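(* There exist a homogeneous $A$-hypergeometric system $H_A(\beta)$ of lattice rank $3$, a generic direction $w$, a fake exponent $v$ of $H_A(\beta)$ in the direction $w$, and an ordered negative support family $\mathcal N^\circ\subseteq\mathcal N_v$ such that the following properties hold. (1) The column matroid of $A$ is three-connected. (2) The affine semigroup $\mathcal C(w)$ is generated by a $\mathbb Z$-basis of $L$. In particular, this affine semigroup is normal and free, and its cone is unimodular. (3) The Stanley–Reisner ring $\mathbb C[\Delta_{\mathcal N^\circ}]$ is a polynomial ring. (4) The intrinsic-perturbation obstruction module satisfies $\operatorname{Hilb}(\mathfrak D_{\mathcal N^\circ}(e);u)=u$. (5) The fake exponent $v$ is binary, i.e. $v_j\in\{-1,0\}$ for every $j$. (6) The direction is nonzero on every nonzero element of $L$, i.e. $w\cdot u\neq0$ for $0\ne u\in L$. The distinguished collection $\mathcal N_v$ is not ordered, but it gives the same two monomial ideals ($M_{\mathcal N_v}=M_{\mathcal N^\circ}$, $P_{\mathcal N_v}(t)=P_{\mathcal N^\circ}(t)$), the same monomial $e$, and hence the same obstruction module as the ordered family $\mathcal N^\circ$. For the ordered family $\mathcal N^\circ$, ambient perturbation supplies a coefficient with the leading logarithmic term $\log x_2-2\log x_3+\log x_6$, and intrinsic perturbation does not supply this coefficient at the fake exponent $v$; that is, the ambient coefficient space at $v$ for $\mathcal N^\circ$ contains an element with this leading term which does not lie in the intrinsic coefficient space at $v$ for $\mathcal N^\circ$.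
   Context: System. $\mathbb N=\{0,1,2,\dots\}$. $A=(a_{ij})\in\mathbb Z^{d\times n}$ has rank $d$ and its columns lie in an affine hyperplane not containing the origin ("homogeneous"). $L=\ker_{\mathbb Z}(A)$; $r=\operatorname{rank}L=n-d$ is the lattice rank. The column matroid of $A$ is the matroid represented over $\mathbb Q$ by its columns (three-connectivity in the standard matroid-theoretic sense). For $u\in L$ write $u=u_+-u_-$ with $u_\pm\in\mathbb N^n$ of disjoint support. $I_A=\langle\partial^{u_+}-\partial^{u_-}\mid u\in L\rangle\subseteq\mathbb C[\partial_1,\dots,\partial_n]$. For $\beta\in\mathbb C^d$, $H_A(\beta)$ is the left ideal of the Weyl algebra in $x_1,\dots,x_n$ generated by $I_A$ and $\sum_j a_{ij}x_j\partial_j-\beta_i$ $(1\le i\le d)$. $\operatorname{in}_w$ takes terms of largest $w$-weight; $\operatorname{in}_{(-w,w)}$ is the initial ideal in the Weyl algebra for weights $-w$ on $x$, $w$ on $\partial$. A direction $w\in\mathbb R^n$ is generic if $\operatorname{in}_w(I_A)$ is a monomial ideal and $w$ lies in the interior of a full-dimensional cone of the small Gröbner fan of $H_A(\beta)$ (so $\operatorname{in}_{(-w',w')}(H_A(\beta))$ is constant for $w'$ in that interior). For $z\in\mathbb C^n$, $p\in\mathbb N^n$: $[z]_p=\prod_j z_j(z_j-1)\cdots(z_j-p_j+1)$. A fake exponent of $H_A(\beta)$ in the direction $w$ is $v\in\mathbb C^n$ with $Av=\beta$ and $[v]_p=0$ for every monomial $\partial^p\in\operatorname{in}_w(I_A)$.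 Semigroup. Let $\{\partial^{g^{(i)}_+}-\partial^{g^{(i)}_-}\}_i$ be the reduced Gröbner basis of $I_A$ in the direction $w$, the first monomial being initial (so $w\cdot g^{(i)}>0$, $g^{(i)}=g^{(i)}_+-g^{(i)}_-$). $\mathcal C(w)=\sum_i\mathbb Ng^{(i)}\subseteq L$; it is normal if it contains every element of the group it generates that lies in the real cone it spans. Negative supports. $\operatorname{nsupp}(z)=\{j\mid z_j\in\mathbb Z_{<0}\}$. For $u\in L$, $I_u=\operatorname{nsupp}(v+u)$; $I_0=\operatorname{nsupp}(v)$; $\mathcal S(v)=\{I_u\mid u\in L\}$. The distinguished collection is $\mathcal N_v=\{I\in\mathcal S(v)\mid w\cdot u\ge0\text{ for every }u\in L\text{ with }I_u=I\}$. A negative support family for $v$ is a set $\mathcal N$ with $I_0\in\mathcal N\subseteq\mathcal N_v$; it is ordered if $I\in\mathcal N$, $J\in\mathcal S(v)$, $J\subseteq I$ imply $J\in\mathcal N$. $K_{\mathcal N}=\bigcap_{I\in\mathcal N}I$. Obstruction module. $\widehat R=\mathbb C[[t_1,\dots,t_n]]$, $t^J=\prod_{j\in J}t_j$, $e=t^{I_0\setminus K_{\mathcal N}}$, $U=\langle At\rangle$, $M_{\mathcal N}=\langle t^{I\setminus K_{\mathcal N}}\mid I\in\mathcal N\rangle$, $P_{\mathcal N}(t)=\langle t^{(I\cup J)\setminus K_{\mathcal N}}\mid I\in\mathcal N,J\in\mathcal S(v)\setminus\mathcal N\rangle$, $\mathfrak D_{\mathcal N}(e)=\dfrac{(U+P_{\mathcal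 N}(t)):e}{(UM_{\mathcal N}+P_{\mathcal N}(t)):e}$. With $R_0=\mathbb C[t_1,\dots,t_n]$ and $M^0_{\mathcal N}\subseteq R_0$ generated by the same squarefree monomials as $M_{\mathcal N}$ (proper), $\Delta_{\mathcal N}$ is the simplicial complex with Stanley–Reisner ideal $M^0_{\mathcal N}$ and $\mathbb C[\Delta_{\mathcal N}]=R_0/M^0_{\mathcal N}$. The two ideals and the Hilbert series. $B$ is an $n\times r$ integer matrix whose columns form a $\mathbb Z$-basis of $L$; $S_0=\mathbb C[s_1,\dots,s_r]$; $\ell_j=(Bs)_j$, $\ell^Y=\prod_{j\in Y}\ell_j$ ($\ell^\varnothing=1$), $E=I_0\setminus K_{\mathcal N}$. Let $\{G_1,\dots,G_g\}$ be the inclusion-minimal members of $\{I\setminus K_{\mathcal N}\mid I\in\mathcal N\}$ and $\{H_1,\dots,H_h\}$ the inclusion-minimal members of $\{(I\cup J)\setminus K_{\mathcal N}\mid I\in\mathcal N,\ J\in\mathcal S(v)\setminus\mathcal N\}$. Each $H_a$ contains some $G_i$; choose such an index $\iota(a)$. $F_{\mathcal N}=\bigoplus_{i}S_0(-|G_i|)\eta_i$, and $Z_{\mathcal N}\subseteq F_{\mathcal N}$ is generated by $\ell^{G_j\setminus G_i}\eta_i-\ell^{G_i\setminus G_j}\eta_j$ $(i<j)$ and $\ell^{H_a\setminus G_{\iota(a)}}\eta_{\iota(a)}$. Choose $i$ with $G_i\subseteq E$ and put $\epsilon_{\mathcal N}=\ell^{E\setminus G_i}\overline{\eta_i}\in F_{\mathcal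 N}/Z_{\mathcal N}$ (independent of the choices). $J_{\mathcal N}^{\mathrm{amb}}=\operatorname{Ann}_{S_0}(\epsilon_{\mathcal N})\subseteq J_{\mathcal N}^{\mathrm{intr}}=\langle\ell^{H_1},\dots,\ell^{H_h}\rangle:\ell^E$, and $\operatorname{Hilb}(\mathfrak D_{\mathcal N}(e);u)=\sum_{q\ge0}\dim_{\mathbb C}(J_{\mathcal N}^{\mathrm{intr}}/J_{\mathcal N}^{\mathrm{amb}})_qu^q$ by definition. Coefficient spaces (for $\mathcal N$ ordered). The ambient coefficient space at $v$ for $\mathcal N$ (the coefficients of $x^v$ obtained by the Okuyama–Saito ambient perturbation) is the full coefficient space: all polynomials $p_0(\log x)$ for which there is a formal series $\sum_{u\in L}x^{v+u}p_u(\log x)$, $p_u\in\mathbb C[y_1,\dots,y_n]$, annihilated by $H_A(\beta)$, with $I_u\in\mathcal N$ whenever $p_u\ne0$. For the intrinsic one, put $a_u(s)=[v+Bs]_{u_-}/[v+Bs+u]_{u_+}$ and $\Psi_{\mathcal N}(x,s)=\ell^E\sum_{u\in L,\,I_u\in\mathcal N}a_u(s)x^{v+Bs+u}$; for a homogeneous ideal $I\subseteq\mathbb C[s]$, $I^\perp=\{q(\partial_s)\mid(q(\partial_s)f)|_{s=0}=0\ \forall f\in I\}$. The intrinsic coefficient space at $v$ for $\mathcal N$ is the space of coefficients of $x^v$ in the series $q(\partial_s)\Psi_{\mathcal N}(x,s)|_{s=0}$, $q\in\langle\ell^{H_1},\dots,\ell^{H_h}\rangle^\perp$. *)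

theory Defs
  imports
    "HOL-Library.Poly_Mapping"
    "HOL-Computational_Algebra.Formal_Power_Series"
    "HOL-Analysis.Function_Topology"
    "HOL-Algebra.Module"
    "HOL-Algebra.QuotRing"
    "HOL-Algebra.Ideal_Product"
begin

text \<open>
  Coordinates are indexed by \<open>{1..n}\<close>, so \<open>x\<^sub>j\<close> is the variable with index \<open>j\<close>.
  Elements of \<open>\<int>\<^sup>n\<close> are functions \<open>nat \<Rightarrow> int\<close> that vanish outside \<open>{1..n}\<close>.  Of the functions
  representing \<open>w\<close>, \<open>v\<close>, \<open>\<beta>\<close> and the entries of \<open>A\<close>, only the values at indices in range matter.
\<close>


section \<open>The lattice and the column matroid\<close>

definition toric_lattice :: "nat \<Rightarrow> nat \<Rightarrow> (nat \<Rightarrow> nat \<Rightarrow> int) \<Rightarrow> (nat \<Rightarrow> int) set" where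
  "toric_lattice n d A =
     {u. (\<forall>j. j \<notin> {1..n} \<longrightarrow> u j = 0) \<and> (\<forall>i\<in>{1..d}. (\<Sum>j=1..n. A i j * u j) = 0)}"

text \<open>Independence refers to the indexed family of columns: equal columns are dependent.\<close>

definition columns_indep :: "nat \<Rightarrow> (nat \<Rightarrow> nat \<Rightarrow> int) \<Rightarrow> nat set \<Rightarrow> bool" where
  "columns_indep d A X \<longleftrightarrow>
     (\<forall>c::nat \<Rightarrow> rat. (\<forall>i\<in>{1..d}. (\<Sum>j\<in>X. c j * of_int (A i j)) = 0) \<longrightarrow> (\<forall>j\<in>X. c j = 0))"

definition column_rank :: "nat \<Rightarrow> (nat \<Rightarrow> nat \<Rightarrow> int) \<Rightarrow> nat set \<Rightarrow> nat" where
  "column_rank d A X = Max {card Y |Y. Y \<subseteq> X \<and> columns_indep d A Y}"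

text \<open>The columns lie in the affine hyperplane \<open>h \<cdot> y = c\<close>, which avoids the origin.\<close>

definition homogeneous_matrix :: "nat \<Rightarrow> nat \<Rightarrow> (nat \<Rightarrow> nat \<Rightarrow> int) \<Rightarrow> bool" where
  "homogeneous_matrix n d A \<longleftrightarrow>
     (\<exists>(h::nat \<Rightarrow> real) c. c \<noteq> 0 \<and> (\<forall>j\<in>{1..n}. (\<Sum>i=1..d. h i * of_int (A i j)) = c))"

text \<open>Tutte's \<open>k\<close>-separations and \<open>k\<close>-connectivity of a matroid on \<open>E\<close> with rank function \<open>rk\<close>.\<close>

definition is_separation :: "'a set \<Rightarrow> ('a set \<Rightarrow> nat) \<Rightarrow> nat \<Rightarrow> 'a set \<Rightarrow> bool" where
  "is_separation E rk k X \<longleftrightarrow>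
     X \<subseteq> E \<and> k \<le> card X \<and> k \<le> card (E - X) \<and> rk X + rk (E - X) < rk E + k"

definition matroid_connected :: "'a set \<Rightarrow> ('a set \<Rightarrow> nat) \<Rightarrow> nat \<Rightarrow> bool" where
  "matroid_connected E rk m \<longleftrightarrow> (\<forall>k X. 1 \<le> k \<longrightarrow> k < m \<longrightarrow> \<not> is_separation E rk k X)"


section \<open>Integer spans, semigroups and cones\<close>

definition int_comb :: "(nat \<Rightarrow> int) set \<Rightarrow> ((nat \<Rightarrow> int) \<Rightarrow> int) \<Rightarrow> nat \<Rightarrow> int" where
  "int_comb F c = (\<lambda>j. \<Sum>g\<in>F. c g * g j)"

definition int_span :: "(nat \<Rightarrow> int) set \<Rightarrow> (nat \<Rightarrow> int) set" where
  "int_span S = {int_comb F c |F c. finite F \<and> F \<subseteq> S}"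

definition nat_span :: "(nat \<Rightarrow> int) set \<Rightarrow> (nat \<Rightarrow> int) set" where
  "nat_span S = {int_comb F c |F c. finite F \<and> F \<subseteq> S \<and> (\<forall>g\<in>F. 0 \<le> c g)}"

definition real_cone :: "(nat \<Rightarrow> int) set \<Rightarrow> (nat \<Rightarrow> real) set" where
  "real_cone S = {(\<lambda>j. \<Sum>g\<in>F. c g * of_int (g j)) |F c.
     finite F \<and> F \<subseteq> S \<and> (\<forall>g\<in>F. 0 \<le> c g)}"

definition is_Z_basis :: "(nat \<Rightarrow> int) set \<Rightarrow> (nat \<Rightarrow> int) set \<Rightarrow> bool" where
  "is_Z_basis L S \<longleftrightarrow> finite S \<and> int_span S = L \<and>
     (\<forall>c. int_comb S c = (\<lambda>_. 0) \<longrightarrow> (\<forall>g\<in>S. c g = 0))"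

definition is_basis_matrix :: "(nat \<Rightarrow> int) set \<Rightarrow> nat \<Rightarrow> (nat \<Rightarrow> nat \<Rightarrow> int) \<Rightarrow> bool" where
  "is_basis_matrix L r B \<longleftrightarrow>
     inj_on (\<lambda>k j. B j k) {1..r} \<and> is_Z_basis L ((\<lambda>k j. B j k) ` {1..r})"

definition normal_semigroup :: "(nat \<Rightarrow> int) set \<Rightarrow> bool" where
  "normal_semigroup C \<longleftrightarrow>
     (\<forall>u\<in>int_span C. (\<lambda>j. real_of_int (u j)) \<in> real_cone C \<longrightarrow> u \<in> C)"

definition free_semigroup :: "(nat \<Rightarrow> int) set \<Rightarrow> bool" where
  "free_semigroup C \<longleftrightarrow> (\<exists>S. finite S \<and> C = nat_span S \<and>
     (\<forall>c c'. (\<forall>g\<in>S. 0 \<le> c g \<and> 0 \<le> c' g) \<longrightarrow> int_comb S c = int_comb S c' \<longrightarrow>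
        (\<forall>g\<in>S. c g = c' g)))"

definition unimodular_cone :: "(nat \<Rightarrow> int) set \<Rightarrow> (nat \<Rightarrow> real) set \<Rightarrow> bool" where
  "unimodular_cone L K \<longleftrightarrow> (\<exists>T S. is_Z_basis L T \<and> S \<subseteq> T \<and> K = real_cone S)"


section \<open>Polynomial rings\<close>

abbreviation "keys \<equiv> Poly_Mapping.keys"
abbreviation "lookup \<equiv> Poly_Mapping.lookup"
abbreviation "single \<equiv> Poly_Mapping.single"

type_synonym mono = "nat \<Rightarrow>\<^sub>0 nat"
type_synonym cpoly = "mono \<Rightarrow>\<^sub>0 complex"

definition monomials :: "nat \<Rightarrow> mono set" where
  "monomials n = {m. keys m \<subseteq> {1..n}}"

definition mono_dvd :: "mono \<Rightarrow> mono \<Rightarrow> bool" where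
  "mono_dvd a b \<longleftrightarrow> (\<forall>j. lookup a j \<le> lookup b j)"

definition mono_deg :: "mono \<Rightarrow> nat" where
  "mono_deg m = (\<Sum>j\<in>keys m. lookup m j)"

definition Const :: "complex \<Rightarrow> cpoly" where
  "Const c = single 0 c"

definition Var :: "nat \<Rightarrow> cpoly" where
  "Var j = single (single j 1) 1"

definition sqfree :: "nat set \<Rightarrow> cpoly" where
  "sqfree J = (\<Prod>j\<in>J. Var j)"

definition polys :: "nat \<Rightarrow> cpoly set" where
  "polys n = {f. keys f \<subseteq> monomials n}"

definition mpoly_ring :: "nat \<Rightarrow> cpoly ring" where
  "mpoly_ring n = \<lparr>carrier = polys n, monoid.mult = (*), one = 1, zero = 0, add = (+)\<rparr>"

definition homogeneous_part :: "cpoly set \<Rightarrow> nat \<Rightarrow> cpoly set" where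
  "homogeneous_part J q = {f \<in> J. \<forall>m\<in>keys f. mono_deg m = q}"

definition pderiv_var :: "nat \<Rightarrow> cpoly \<Rightarrow> cpoly" where
  "pderiv_var j p = (\<Sum>m\<in>keys p.
     single (m - single j 1) (of_nat (lookup m j) * lookup p m))"

definition is_polynomial_ring_quotient :: "nat \<Rightarrow> cpoly set \<Rightarrow> bool" where
  "is_polynomial_ring_quotient n M \<longleftrightarrow>
     (\<exists>k h. h \<in> ring_iso (mpoly_ring k) (mpoly_ring n Quot M) \<and>
        (\<forall>c. h (Const c) = M +>\<^bsub>mpoly_ring n\<^esub> Const c))"

definition falling :: "nat \<Rightarrow> (nat \<Rightarrow> 'a::comm_ring_1) \<Rightarrow> (nat \<Rightarrow> nat) \<Rightarrow> 'a" where
  "falling n z p = (\<Prod>j=1..n. \<Prod>k<p j. z j - of_nat k)"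


section \<open>Initial forms and Groebner bases\<close>

definition init_form :: "('k \<Rightarrow> real) \<Rightarrow> ('k \<Rightarrow>\<^sub>0 complex) \<Rightarrow> ('k \<Rightarrow>\<^sub>0 complex)" where
  "init_form wt f = (\<Sum>m\<in>{m \<in> keys f. \<forall>m'\<in>keys f. wt m' \<le> wt m}.
     single m (lookup f m))"

definition weight :: "(nat \<Rightarrow> real) \<Rightarrow> mono \<Rightarrow> real" where
  "weight w m = (\<Sum>j\<in>keys m. w j * of_nat (lookup m j))"

definition in_ideal :: "nat \<Rightarrow> (nat \<Rightarrow> real) \<Rightarrow> cpoly set \<Rightarrow> cpoly set" where
  "in_ideal n w I = genideal (mpoly_ring n) (init_form (weight w) ` I)"

definition monomial_ideal :: "nat \<Rightarrow> cpoly set \<Rightarrow> bool" where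
  "monomial_ideal n I \<longleftrightarrow>
     (\<exists>S \<subseteq> monomials n. I = genideal (mpoly_ring n) ((\<lambda>m. single m 1) ` S))"

definition pos_part :: "nat \<Rightarrow> (nat \<Rightarrow> int) \<Rightarrow> mono" where
  "pos_part n u = (\<Sum>j=1..n. single j (nat (u j)))"

definition neg_part :: "nat \<Rightarrow> (nat \<Rightarrow> int) \<Rightarrow> mono" where
  "neg_part n u = (\<Sum>j=1..n. single j (nat (- u j)))"

definition binom :: "nat \<Rightarrow> (nat \<Rightarrow> int) \<Rightarrow> cpoly" where
  "binom n u = single (pos_part n u) 1 - single (neg_part n u) 1"

definition toric_ideal :: "nat \<Rightarrow> nat \<Rightarrow> (nat \<Rightarrow> nat \<Rightarrow> int) \<Rightarrow> cpoly set" where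
  "toric_ideal n d A = genideal (mpoly_ring n) (binom n ` toric_lattice n d A)"

text \<open>
  The reduced basis \<open>G\<close> in a direction \<open>w\<close> for which the initial ideal is monomial.  For each
  element, \<open>lead g\<close> below is its initial monomial; no monomial of an element is divisible by the
  initial monomial of another one, and no non-initial monomial by any initial monomial.
\<close>

definition is_reduced_groebner_basis ::
    "nat \<Rightarrow> (nat \<Rightarrow> real) \<Rightarrow> cpoly set \<Rightarrow> cpoly set \<Rightarrow> bool" where
  "is_reduced_groebner_basis n w I G \<longleftrightarrow> G \<subseteq> I \<and>
     in_ideal n w I = genideal (mpoly_ring n) (init_form (weight w) ` G) \<and>
     (\<exists>lead. (\<forall>g\<in>G. init_form (weight w) g = single (lead g) 1) \<and>
        (\<forall>g\<in>G. \<forall>g'\<in>G. \<forall>m\<in>keys g. mono_dvd (lead g') m \<longrightarrow> g' = g \<and> m = lead g))"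

definition groebner_semigroup ::
    "nat \<Rightarrow> (nat \<Rightarrow> int) set \<Rightarrow> cpoly set \<Rightarrow> (nat \<Rightarrow> int) set" where
  "groebner_semigroup n L G = nat_span {g \<in> L. binom n g \<in> G}"


section \<open>The Weyl algebra\<close>

text \<open>Normally ordered: the key \<open>(a, b)\<close> stands for \<open>x\<^sup>a \<partial>\<^sup>b\<close>.\<close>

type_synonym weyl = "(mono \<times> mono) \<Rightarrow>\<^sub>0 complex"

definition weyl_algebra :: "nat \<Rightarrow> weyl set" where
  "weyl_algebra n = {P. keys P \<subseteq> monomials n \<times> monomials n}"

text \<open>Leibniz rule:
  \<open>x\<^sup>a \<partial>\<^sup>b x\<^sup>c \<partial>\<^sup>e = (\<Sum>k. (\<Prod>j. k\<^sub>j! (b\<^sub>j choose k\<^sub>j) (c\<^sub>j choose k\<^sub>j)) x\<^bsup>a+c-k\<^esup> \<partial>\<^bsup>b+e-k\<^esup>)\<close>.\<close>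

definition weyl_mono_mult :: "mono \<times> mono \<Rightarrow> mono \<times> mono \<Rightarrow> weyl" where
  "weyl_mono_mult s t = (case (s, t) of ((a, b), (c, e)) \<Rightarrow>
     (\<Sum>k\<in>{k. mono_dvd k b \<and> mono_dvd k c}.
        single (a + (c - k), (b - k) + e)
          (\<Prod>j\<in>keys k. of_nat (fact (lookup k j) * (lookup b j choose lookup k j)
                                                * (lookup c j choose lookup k j)))))"

definition weyl_scale :: "complex \<Rightarrow> weyl \<Rightarrow> weyl" where
  "weyl_scale c P = (\<Sum>s\<in>keys P. single s (c * lookup P s))"

definition weyl_mult :: "weyl \<Rightarrow> weyl \<Rightarrow> weyl" where
  "weyl_mult P Q =
     (\<Sum>s\<in>keys P. \<Sum>t\<in>keys Q. weyl_scale (lookup P s * lookup Q t) (weyl_mono_mult s t))"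

inductive_set left_ideal :: "nat \<Rightarrow> weyl set \<Rightarrow> weyl set" for n :: nat and G :: "weyl set" where
  zero: "0 \<in> left_ideal n G"
| gen: "P \<in> G \<Longrightarrow> P \<in> left_ideal n G"
| add: "P \<in> left_ideal n G \<Longrightarrow> Q \<in> left_ideal n G \<Longrightarrow> P + Q \<in> left_ideal n G"
| mult: "Q \<in> weyl_algebra n \<Longrightarrow> P \<in> left_ideal n G \<Longrightarrow> weyl_mult Q P \<in> left_ideal n G"

definition diff_op :: "cpoly \<Rightarrow> weyl" where
  "diff_op f = (\<Sum>m\<in>keys f. single (0, m) (lookup f m))"

definition euler_op :: "nat \<Rightarrow> (nat \<Rightarrow> nat \<Rightarrow> int) \<Rightarrow> (nat \<Rightarrow> complex) \<Rightarrow> nat \<Rightarrow> weyl" where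
  "euler_op n A \<beta> i =
     (\<Sum>j=1..n. single (single j 1, single j 1) (of_int (A i j)))
     - single (0, 0) (\<beta> i)"

definition hypergeometric_ideal ::
    "nat \<Rightarrow> nat \<Rightarrow> (nat \<Rightarrow> nat \<Rightarrow> int) \<Rightarrow> (nat \<Rightarrow> complex) \<Rightarrow> weyl set" where
  "hypergeometric_ideal n d A \<beta> =
     left_ideal n (diff_op ` toric_ideal n d A \<union> euler_op n A \<beta> ` {1..d})"

definition weyl_weight :: "(nat \<Rightarrow> real) \<Rightarrow> mono \<times> mono \<Rightarrow> real" where
  "weyl_weight w s = weight w (snd s) - weight w (fst s)"

definition weyl_in_ideal :: "nat \<Rightarrow> (nat \<Rightarrow> real) \<Rightarrow> weyl set \<Rightarrow> weyl set" where
  "weyl_in_ideal n w H = left_ideal n (init_form (weyl_weight w) ` H)"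

text \<open>
  A cell is a class of directions under equality of \<open>in\<^bsub>(-w,w)\<^esub>(H)\<close>; the cones of the small
  Groebner fan are the closures of the cells.  The interior of a full-dimensional cone is the
  interior of its cell, where the initial ideal is constant; the last condition on a generic
  direction records this constancy.  The topology is the product topology on \<open>nat \<Rightarrow> real\<close>: for
  \<open>H\<close> in the \<open>n\<close>-th Weyl algebra only coordinates in \<open>{1..n}\<close> matter, so cells are cylinders over
  subsets of \<open>\<real>\<^sup>n\<close>, and closures and interiors are those of \<open>\<real>\<^sup>n\<close>.
\<close>

definition small_groebner_cell :: "nat \<Rightarrow> weyl set \<Rightarrow> (nat \<Rightarrow> real) \<Rightarrow> (nat \<Rightarrow> real) set" where
  "small_groebner_cell n H w = {w'. weyl_in_ideal n w' H = weyl_in_ideal n w H}"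

definition small_groebner_fan :: "nat \<Rightarrow> weyl set \<Rightarrow> (nat \<Rightarrow> real) set set" where
  "small_groebner_fan n H = {closure (small_groebner_cell n H w) |w. True}"

definition generic_direction ::
    "nat \<Rightarrow> nat \<Rightarrow> (nat \<Rightarrow> nat \<Rightarrow> int) \<Rightarrow> (nat \<Rightarrow> complex) \<Rightarrow> (nat \<Rightarrow> real) \<Rightarrow> bool" where
  "generic_direction n d A \<beta> w \<longleftrightarrow>
     monomial_ideal n (in_ideal n w (toric_ideal n d A)) \<and>
     (\<exists>K \<in> small_groebner_fan n (hypergeometric_ideal n d A \<beta>). w \<in> interior K) \<and>
     w \<in> interior (small_groebner_cell n (hypergeometric_ideal n d A \<beta>) w)"

definition fake_exponent ::
    "nat \<Rightarrow> nat \<Rightarrow> (nat \<Rightarrow> nat \<Rightarrow> int) \<Rightarrow> (nat \<Rightarrow> complex) \<Rightarrow> (nat \<Rightarrow> real) \<Rightarrow> (nat \<Rightarrow> complex) \<Rightarrow> bool" where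
  "fake_exponent n d A \<beta> w v \<longleftrightarrow>
     (\<forall>i\<in>{1..d}. (\<Sum>j=1..n. of_int (A i j) * v j) = \<beta> i) \<and>
     (\<forall>p\<in>monomials n. single p 1 \<in> in_ideal n w (toric_ideal n d A) \<longrightarrow>
        falling n v (lookup p) = 0)"


section \<open>Negative supports\<close>

definition nsupp :: "nat \<Rightarrow> (nat \<Rightarrow> complex) \<Rightarrow> nat set" where
  "nsupp n z = {j\<in>{1..n}. \<exists>k::int. k < 0 \<and> z j = of_int k}"

definition shift :: "(nat \<Rightarrow> complex) \<Rightarrow> (nat \<Rightarrow> int) \<Rightarrow> nat \<Rightarrow> complex" where
  "shift v u = (\<lambda>j. v j + of_int (u j))"

definition nsupps :: "nat \<Rightarrow> (nat \<Rightarrow> int) set \<Rightarrow> (nat \<Rightarrow> complex) \<Rightarrow> nat set set" where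
  "nsupps n L v = {nsupp n (shift v u) |u. u \<in> L}"

definition distinguished_nsupps ::
    "nat \<Rightarrow> (nat \<Rightarrow> int) set \<Rightarrow> (nat \<Rightarrow> real) \<Rightarrow> (nat \<Rightarrow> complex) \<Rightarrow> nat set set" where
  "distinguished_nsupps n L w v = {I \<in> nsupps n L v.
     \<forall>u\<in>L. nsupp n (shift v u) = I \<longrightarrow> 0 \<le> (\<Sum>j=1..n. w j * of_int (u j))}"

definition negative_support_family ::
    "nat \<Rightarrow> (nat \<Rightarrow> int) set \<Rightarrow> (nat \<Rightarrow> real) \<Rightarrow> (nat \<Rightarrow> complex) \<Rightarrow> nat set set \<Rightarrow> bool" where
  "negative_support_family n L w v N \<longleftrightarrow> nsupp n v \<in> N \<and> N \<subseteq> distinguished_nsupps n L w v"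

definition ordered_family ::
    "nat \<Rightarrow> (nat \<Rightarrow> int) set \<Rightarrow> (nat \<Rightarrow> complex) \<Rightarrow> nat set set \<Rightarrow> bool" where
  "ordered_family n L v N \<longleftrightarrow> (\<forall>I\<in>N. \<forall>J\<in>nsupps n L v. J \<subseteq> I \<longrightarrow> J \<in> N)"

text \<open>\<open>K\<^sub>N\<close> is \<open>\<Inter>N\<close>.  Exponent sets of the monomial generators of \<open>M\<^sub>N\<close> and \<open>P\<^sub>N\<close>, and of \<open>e\<close>:\<close>

definition M_sets :: "nat set set \<Rightarrow> nat set set" where
  "M_sets N = {I - \<Inter>N |I. I \<in> N}"

definition P_sets ::
    "nat \<Rightarrow> (nat \<Rightarrow> int) set \<Rightarrow> (nat \<Rightarrow> complex) \<Rightarrow> nat set set \<Rightarrow> nat set set" where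
  "P_sets n L v N = {(I \<union> J) - \<Inter>N |I J. I \<in> N \<and> J \<in> nsupps n L v - N}"

definition e_set :: "nat \<Rightarrow> (nat \<Rightarrow> complex) \<Rightarrow> nat set set \<Rightarrow> nat set" where
  "e_set n v N = nsupp n v - \<Inter>N"

definition sr_ideal :: "nat \<Rightarrow> nat set set \<Rightarrow> cpoly set" where
  "sr_ideal n N = genideal (mpoly_ring n) (sqfree ` M_sets N)"


section \<open>The obstruction module over formal power series\<close>

definition mfps_mult :: "(mono \<Rightarrow> 'a::comm_semiring_1) \<Rightarrow> (mono \<Rightarrow> 'a) \<Rightarrow> mono \<Rightarrow> 'a" where
  "mfps_mult f g = (\<lambda>m. \<Sum>(a, b)\<in>{(a, b). a + b = m}. f a * g b)"

definition mfps_ring :: "nat \<Rightarrow> (mono \<Rightarrow> complex) ring" where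
  "mfps_ring n = \<lparr>carrier = {f. \<forall>m. f m \<noteq> 0 \<longrightarrow> m \<in> monomials n}, monoid.mult = mfps_mult,
     one = (\<lambda>m. if m = 0 then 1 else 0), zero = (\<lambda>_. 0), add = (\<lambda>f g m. f m + g m)\<rparr>"

definition linear_ideal :: "nat \<Rightarrow> nat \<Rightarrow> (nat \<Rightarrow> nat \<Rightarrow> int) \<Rightarrow> (mono \<Rightarrow> complex) set" where
  "linear_ideal n d A = genideal (mfps_ring n)
     ((\<lambda>i. lookup (\<Sum>j=1..n. Const (of_int (A i j)) * Var j)) ` {1..d})"

definition M_ideal :: "nat \<Rightarrow> nat set set \<Rightarrow> (mono \<Rightarrow> complex) set" where
  "M_ideal n N = genideal (mfps_ring n) ((\<lambda>J. lookup (sqfree J)) ` M_sets N)"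

definition P_ideal ::
    "nat \<Rightarrow> (nat \<Rightarrow> int) set \<Rightarrow> (nat \<Rightarrow> complex) \<Rightarrow> nat set set \<Rightarrow> (mono \<Rightarrow> complex) set" where
  "P_ideal n L v N = genideal (mfps_ring n) ((\<lambda>J. lookup (sqfree J)) ` P_sets n L v N)"

definition e_monomial :: "nat \<Rightarrow> (nat \<Rightarrow> complex) \<Rightarrow> nat set set \<Rightarrow> mono \<Rightarrow> complex" where
  "e_monomial n v N = lookup (sqfree (e_set n v N))"

definition colon :: "('a, 'm) ring_scheme \<Rightarrow> 'a set \<Rightarrow> 'a \<Rightarrow> 'a set" where
  "colon R I x = {f \<in> carrier R. f \<otimes>\<^bsub>R\<^esub> x \<in> I}"

text \<open>
  The quotient \<open>Num / Den\<close> of ideals \<open>Den \<subseteq> Num\<close> of \<open>R\<close> as an \<open>R\<close>-module of cosets.  The record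
  type of modules extends that of rings; its fields \<open>mult\<close> and \<open>one\<close> carry no meaning here.
\<close>

definition ideal_quotient_module :: "('a, 'm) ring_scheme \<Rightarrow> 'a set \<Rightarrow> 'a set \<Rightarrow> ('a, 'a set) module" where
  "ideal_quotient_module R Num Den =
     \<lparr>carrier = (\<lambda>f. Den +>\<^bsub>R\<^esub> f) ` Num, monoid.mult = undefined, one = undefined,
      zero = Den, add = (\<lambda>X Y. X <+>\<^bsub>R\<^esub> Y),
      smult = (\<lambda>a X. \<Union>x\<in>X. Den +>\<^bsub>R\<^esub> (a \<otimes>\<^bsub>R\<^esub> x))\<rparr>"

definition obstruction_module ::
    "nat \<Rightarrow> nat \<Rightarrow> (nat \<Rightarrow> nat \<Rightarrow> int) \<Rightarrow> (nat \<Rightarrow> complex) \<Rightarrow> nat set set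
       \<Rightarrow> (mono \<Rightarrow> complex, (mono \<Rightarrow> complex) set) module" where
  "obstruction_module n d A v N =
     (let R = mfps_ring n; U = linear_ideal n d A; M = M_ideal n N;
          P = P_ideal n (toric_lattice n d A) v N; e = e_monomial n v N
      in ideal_quotient_module R (colon R (U <+>\<^bsub>R\<^esub> P) e)
                                 (colon R (ideal_prod R U M <+>\<^bsub>R\<^esub> P) e))"


section \<open>The two ideals and the Hilbert series\<close>

definition minimal_members :: "'a set set \<Rightarrow> 'a set set" where
  "minimal_members F = {X \<in> F. \<forall>Y\<in>F. Y \<subseteq> X \<longrightarrow> Y = X}"

definition ell :: "nat \<Rightarrow> (nat \<Rightarrow> nat \<Rightarrow> int) \<Rightarrow> nat \<Rightarrow> cpoly" where
  "ell r B j = (\<Sum>k=1..r. Const (of_int (B j k)) * Var k)"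

definition ell_prod :: "nat \<Rightarrow> (nat \<Rightarrow> nat \<Rightarrow> int) \<Rightarrow> nat set \<Rightarrow> cpoly" where
  "ell_prod r B Y = (\<Prod>j\<in>Y. ell r B j)"

definition H_ideal ::
    "nat \<Rightarrow> (nat \<Rightarrow> int) set \<Rightarrow> nat \<Rightarrow> (nat \<Rightarrow> nat \<Rightarrow> int) \<Rightarrow> (nat \<Rightarrow> complex) \<Rightarrow> nat set set \<Rightarrow> cpoly set" where
  "H_ideal n L r B v N =
     genideal (mpoly_ring r) (ell_prod r B ` minimal_members (P_sets n L v N))"

definition J_intr ::
    "nat \<Rightarrow> (nat \<Rightarrow> int) set \<Rightarrow> nat \<Rightarrow> (nat \<Rightarrow> nat \<Rightarrow> int) \<Rightarrow> (nat \<Rightarrow> complex) \<Rightarrow> nat set set \<Rightarrow> cpoly set" where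
  "J_intr n L r B v N = colon (mpoly_ring r) (H_ideal n L r B v N) (ell_prod r B (e_set n v N))"

text \<open>
  The free module \<open>F\<^sub>N\<close> has a basis indexed by the minimal sets \<open>G\<^sub>i\<close> themselves; \<open>eta G p\<close> is
  \<open>p \<eta>\<^sub>G\<close>.  The degree shifts of the summands do not affect annihilators.
\<close>

definition eta :: "nat set \<Rightarrow> cpoly \<Rightarrow> nat set \<Rightarrow> cpoly" where
  "eta G p = (\<lambda>X. if X = G then p else 0)"

inductive_set submodule_gen :: "nat \<Rightarrow> (nat set \<Rightarrow> cpoly) set \<Rightarrow> (nat set \<Rightarrow> cpoly) set"
  for r :: nat and S :: "(nat set \<Rightarrow> cpoly) set" where
  zero: "(\<lambda>_. 0) \<in> submodule_gen r S"
| gen: "z \<in> S \<Longrightarrow> z \<in> submodule_gen r S"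
| add: "y \<in> submodule_gen r S \<Longrightarrow> z \<in> submodule_gen r S \<Longrightarrow> (\<lambda>X. y X + z X) \<in> submodule_gen r S"
| smult: "p \<in> polys r \<Longrightarrow> z \<in> submodule_gen r S \<Longrightarrow> (\<lambda>X. p * z X) \<in> submodule_gen r S"

definition Z_module ::
    "nat \<Rightarrow> (nat \<Rightarrow> int) set \<Rightarrow> nat \<Rightarrow> (nat \<Rightarrow> nat \<Rightarrow> int) \<Rightarrow> (nat \<Rightarrow> complex) \<Rightarrow> nat set set
       \<Rightarrow> (nat set \<Rightarrow> cpoly) set" where
  "Z_module n L r B v N =
     (let Gs = minimal_members (M_sets N); Hs = minimal_members (P_sets n L v N);
          \<iota> = (\<lambda>H. SOME G. G \<in> Gs \<and> G \<subseteq> H)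
      in submodule_gen r
           ({\<lambda>X. eta G (ell_prod r B (G' - G)) X - eta G' (ell_prod r B (G - G')) X |G G'.
               G \<in> Gs \<and> G' \<in> Gs \<and> G \<noteq> G'} \<union>
            {eta (\<iota> H) (ell_prod r B (H - \<iota> H)) |H. H \<in> Hs}))"

definition J_amb ::
    "nat \<Rightarrow> (nat \<Rightarrow> int) set \<Rightarrow> nat \<Rightarrow> (nat \<Rightarrow> nat \<Rightarrow> int) \<Rightarrow> (nat \<Rightarrow> complex) \<Rightarrow> nat set set \<Rightarrow> cpoly set" where
  "J_amb n L r B v N =
     (let E = e_set n v N; G = (SOME G. G \<in> minimal_members (M_sets N) \<and> G \<subseteq> E)
      in {f \<in> polys r. (\<lambda>X. f * eta G (ell_prod r B (E - G)) X) \<in> Z_module n L r B v N})"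

text \<open>\<open>S\<close> represents a \<open>\<complex>\<close>-basis of the quotient space \<open>V / W\<close>.\<close>

definition is_quotient_basis :: "cpoly set \<Rightarrow> cpoly set \<Rightarrow> cpoly set \<Rightarrow> bool" where
  "is_quotient_basis V W S \<longleftrightarrow> finite S \<and> S \<subseteq> V \<and>
     (\<forall>c. (\<Sum>s\<in>S. Const (c s) * s) \<in> W \<longrightarrow> (\<forall>s\<in>S. c s = 0)) \<and>
     (\<forall>f\<in>V. \<exists>c. f - (\<Sum>s\<in>S. Const (c s) * s) \<in> W)"

definition quotient_dim :: "cpoly set \<Rightarrow> cpoly set \<Rightarrow> nat" where
  "quotient_dim V W = card (SOME S. is_quotient_basis V W S)"

definition obstruction_hilb ::
    "nat \<Rightarrow> (nat \<Rightarrow> int) set \<Rightarrow> nat \<Rightarrow> (nat \<Rightarrow> nat \<Rightarrow> int) \<Rightarrow> (nat \<Rightarrow> complex) \<Rightarrow> nat set set \<Rightarrow> int fps" where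
  "obstruction_hilb n L r B v N = Abs_fps (\<lambda>q. int (quotient_dim
     (homogeneous_part (J_intr n L r B v N) q) (homogeneous_part (J_amb n L r B v N) q)))"


section \<open>Coefficient spaces\<close>

text \<open>
  A formal series \<open>\<Sum>u\<in>\<int>\<^sup>n. x\<^bsup>v+u\<^esup> f\<^sub>u(log x)\<close> is the function \<open>f\<close>; \<open>Var j\<close> in \<open>f u\<close> stands for
  \<open>log x\<^sub>j\<close>.  Since \<open>\<partial>\<^sub>j (x\<^sup>z p(log x)) = x\<^bsup>z-e\<^sub>j\<^esup> (z\<^sub>j p + \<partial>p/\<partial>y\<^sub>j)(log x)\<close>, the coefficient of
  \<open>x\<^bsup>v+u\<^esup>\<close> after applying \<open>\<partial>\<^sub>j\<close> comes from the index \<open>u + e\<^sub>j\<close>.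
\<close>

definition d_act :: "(nat \<Rightarrow> complex) \<Rightarrow> nat \<Rightarrow> ((nat \<Rightarrow> int) \<Rightarrow> cpoly) \<Rightarrow> (nat \<Rightarrow> int) \<Rightarrow> cpoly" where
  "d_act v j f = (\<lambda>u. let u' = u(j := u j + 1)
     in Const (v j + of_int (u' j)) * f u' + pderiv_var j (f u'))"

definition dmono_act ::
    "nat \<Rightarrow> (nat \<Rightarrow> complex) \<Rightarrow> mono \<Rightarrow> ((nat \<Rightarrow> int) \<Rightarrow> cpoly) \<Rightarrow> (nat \<Rightarrow> int) \<Rightarrow> cpoly" where
  "dmono_act n v b f = foldr (\<lambda>j g. (d_act v j ^^ lookup b j) g) [1..<Suc n] f"

definition weyl_act ::
    "nat \<Rightarrow> (nat \<Rightarrow> complex) \<Rightarrow> weyl \<Rightarrow> ((nat \<Rightarrow> int) \<Rightarrow> cpoly) \<Rightarrow> (nat \<Rightarrow> int) \<Rightarrow> cpoly" where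
  "weyl_act n v P f = (\<lambda>u. \<Sum>(a, b)\<in>keys P.
     Const (lookup P (a, b)) * dmono_act n v b f (\<lambda>j. u j - int (lookup a j)))"

definition ambient_space ::
    "nat \<Rightarrow> nat \<Rightarrow> (nat \<Rightarrow> nat \<Rightarrow> int) \<Rightarrow> (nat \<Rightarrow> complex) \<Rightarrow> (nat \<Rightarrow> complex) \<Rightarrow> nat set set \<Rightarrow> cpoly set" where
  "ambient_space n d A \<beta> v N = {f (\<lambda>_. 0) |f.
     (\<forall>u. f u \<in> polys n) \<and>
     (\<forall>u. f u \<noteq> 0 \<longrightarrow> u \<in> toric_lattice n d A \<and> nsupp n (shift v u) \<in> N) \<and>
     (\<forall>P\<in>hypergeometric_ideal n d A \<beta>. weyl_act n v P f = (\<lambda>_. 0))}"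

text \<open>
  For \<open>nsupp (v + u) \<in> N\<close>, the rational function
  \<open>\<ell>\<^sup>E a\<^sub>u(s) = \<ell>\<^sup>E [v+Bs]\<^bsub>u\<^sub>-\<^esub> / [v+Bs+u]\<^bsub>u\<^sub>+\<^esub>\<close> is regular at \<open>s = 0\<close>; this is its power series there.
\<close>

definition a_series ::
    "nat \<Rightarrow> nat \<Rightarrow> (nat \<Rightarrow> nat \<Rightarrow> int) \<Rightarrow> (nat \<Rightarrow> complex) \<Rightarrow> nat set \<Rightarrow> (nat \<Rightarrow> int) \<Rightarrow> mono \<Rightarrow> complex" where
  "a_series n r B v E u = (THE f. f \<in> carrier (mfps_ring r) \<and>
     mfps_mult f (lookup (falling n (\<lambda>j. Const (shift v u j) + ell r B j) (lookup (pos_part n u)))) =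
     lookup (ell_prod r B E * falling n (\<lambda>j. Const (v j) + ell r B j) (lookup (neg_part n u))))"

text \<open>
  \<open>x\<^bsup>Bs\<^esup> = exp (\<Sum>k. s\<^sub>k (\<Sum>j. B\<^sub>j\<^sub>k log x\<^sub>j))\<close> as a power series in \<open>s\<close> with coefficients in
  \<open>\<complex>[log x]\<close>.
\<close>

definition xBs_series :: "nat \<Rightarrow> nat \<Rightarrow> (nat \<Rightarrow> nat \<Rightarrow> int) \<Rightarrow> mono \<Rightarrow> cpoly" where
  "xBs_series n r B m = (if m \<in> monomials r then
     (\<Prod>k=1..r. Const (1 / fact (lookup m k)) * (\<Sum>j=1..n. Const (of_int (B j k)) * Var j) ^ lookup m k)
     else 0)"

text \<open>\<open>\<partial>\<^sub>s\<^sup>m\<close> followed by \<open>s = 0\<close> multiplies the coefficient of \<open>s\<^sup>m\<close> by \<open>m!\<close>.\<close>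

definition mono_fact :: "mono \<Rightarrow> complex" where
  "mono_fact m = (\<Prod>k\<in>keys m. fact (lookup m k))"

definition perp :: "nat \<Rightarrow> cpoly set \<Rightarrow> cpoly set" where
  "perp r I = {q \<in> polys r. \<forall>f\<in>I. (\<Sum>m\<in>keys q. lookup q m * mono_fact m * lookup f m) = 0}"

text \<open>The series \<open>q(\<partial>\<^sub>s) \<Psi>\<^sub>N(x,s)\<close> at \<open>s = 0\<close>, in the same encoding as above.\<close>

definition intrinsic_series ::
    "nat \<Rightarrow> (nat \<Rightarrow> int) set \<Rightarrow> nat \<Rightarrow> (nat \<Rightarrow> nat \<Rightarrow> int) \<Rightarrow> (nat \<Rightarrow> complex) \<Rightarrow> nat set set \<Rightarrow> cpoly
       \<Rightarrow> (nat \<Rightarrow> int) \<Rightarrow> cpoly" where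
  "intrinsic_series n L r B v N q = (\<lambda>u. if u \<in> L \<and> nsupp n (shift v u) \<in> N then
     (\<Sum>m\<in>keys q. Const (lookup q m * mono_fact m) *
        mfps_mult (\<lambda>k. Const (a_series n r B v (e_set n v N) u k)) (xBs_series n r B) m)
     else 0)"

definition intrinsic_space ::
    "nat \<Rightarrow> (nat \<Rightarrow> int) set \<Rightarrow> nat \<Rightarrow> (nat \<Rightarrow> nat \<Rightarrow> int) \<Rightarrow> (nat \<Rightarrow> complex) \<Rightarrow> nat set set \<Rightarrow> cpoly set" where
  "intrinsic_space n L r B v N =
     {intrinsic_series n L r B v N q (\<lambda>_. 0) |q. q \<in> perp r (H_ideal n L r B v N)}"

text \<open>Total degree in the logarithms; \<open>p\<close> and its leading form differ by terms of lower degree.\<close>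

definition leading_form :: "cpoly \<Rightarrow> cpoly" where
  "leading_form p = init_form (\<lambda>m. real (mono_deg m)) p"

end

theory Submission
  imports Defs
begin

text \<open>
  The columns of the matrix \<open>veronese\<close> are the points \<open>(1, p)\<close>, where \<open>p\<close> runs through the six
  lattice points of the triangle with vertices \<open>(0, 0)\<close>, \<open>(2, 0)\<close>, \<open>(2, 2)\<close>.  Its lattice has the basis
  \<open>g1\<close>, \<open>g2\<close>, \<open>g3\<close>, so that lattice vectors are written \<open>lat a b c\<close>, and the direction has the value
  \<open>a + sqrt 2 * b + sqrt 3 * c\<close> there.  The fake exponent is \<open>v = - e\<^sub>3 - e\<^sub>5\<close>.

  All sets attached to \<open>v\<close> are read off from six linear inequalities in \<open>a\<close>, \<open>b\<close>, \<open>c\<close> (\<open>mem_supp\<close>).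
  For the family \<open>family6\<close>, whose intersection is \<open>{5}\<close>, one gets \<open>M = \<langle>t\<^sub>1, t\<^sub>2, t\<^sub>3\<rangle>\<close>,
  \<open>P = \<langle>t\<^sub>3t\<^sub>4, t\<^sub>2t\<^sub>6, t\<^sub>2t\<^sub>4, t\<^sub>1t\<^sub>6, t\<^sub>1t\<^sub>3\<rangle>\<close> and \<open>e = t\<^sub>3\<close>, and the same for the distinguished
  collection.  The latter is not ordered: it contains \<open>{1, 3, 5}\<close> but not the subset \<open>{1, 3}\<close>.

  The phenomenon lives in degree two.  Let \<open>\<phi>\<close> be the linear functional on quadratic forms in \<open>t\<close> whose
  coefficients are those of \<open>Phi\<close>.  For \<open>i = 1, 2, 3\<close> the vector of the values \<open>\<phi>(t\<^sub>i t\<^sub>j)\<close>, indexed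
  by \<open>j\<close>, is \<open>g2\<close>, \<open>g1\<close>, \<open>g3\<close> respectively.  These are lattice vectors, so \<open>\<phi>\<close> kills \<open>U M\<close>; and it
  kills the generators of \<open>P\<close>, since none of them occurs in it.  But \<open>\<phi>(t\<^sub>3t\<^sub>6) = 1\<close>, although
  \<open>t\<^sub>3t\<^sub>6\<close> lies in \<open>U + P\<close>: the rows of the matrix combine to \<open>t\<^sub>1 + 2t\<^sub>2 + t\<^sub>3\<close>, and
  \<open>t\<^sub>1t\<^sub>6\<close>, \<open>t\<^sub>2t\<^sub>6\<close> lie in \<open>P\<close>.  Hence \<open>\<phi>\<close> detects the difference between the two perturbations.

  \<^item> On the obstruction module: \<open>J_intr\<close> is contained in the maximal ideal, and \<open>\<ell>\<^sub>6\<close> belongs to it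
    (\<open>l6_l3_in_H\<close>).  The ideal \<open>J_amb\<close> contains \<open>\<ell>\<^sub>4\<close>, \<open>\<ell>\<^sub>5\<close> and \<open>\<ell>\<^sub>6\<^sup>2\<close> but, by the functional
    (\<open>Z_functional\<close>), not \<open>\<ell>\<^sub>6\<close>.  So the quotient is spanned by \<open>\<ell>\<^sub>6\<close> and has Hilbert series \<open>u\<close>.
  \<^item> On series: apply \<open>\<phi>\<close> to the terms of degree two in \<open>t\<close> of the Gamma series with exponents
    perturbed by \<open>t\<close>.  The result, \<open>log_solution\<close>, is annihilated by the Euler operators because \<open>\<phi>\<close>
    kills \<open>U M\<close> (\<open>Phi_euler\<close>) and by the toric operators because \<open>\<phi>\<close> kills \<open>P\<close>
    (\<open>Phi_zero_crossing\<close>).  Its coefficient at \<open>x\<^sup>v\<close> is \<open>\<phi>(t\<^sub>3 (\<Sum>\<^sub>j t\<^sub>j log x\<^sub>j))\<close>,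
    that is \<open>log x\<^sub>2 - 2 log x\<^sub>3 + log x\<^sub>6\<close>.
  \<^item> An intrinsic coefficient is obtained from \<open>q\<close> orthogonal to \<open>H = \<langle>\<ell>\<^sup>Y\<rangle>\<close>, and its coefficient of
    \<open>log x\<^sub>6\<close> is the pairing of \<open>q\<close> with \<open>\<ell>\<^sub>3\<ell>\<^sub>6\<close>.  Since \<open>\<ell>\<^sub>3\<ell>\<^sub>6 \<in> H\<close>, it vanishes
    (\<open>log_form_not_intrinsic\<close>).

  Genericity of the direction is a consequence of its injectivity on the lattice
  (\<open>generic_directionI\<close>).  The hypergeometric ideal is graded by \<open>\<int>\<^sup>n / L\<close>, and a weight that separates
  the elements of \<open>L\<close> orders the terms of a graded operator up to terms of equal degree.  By Dickson's
  lemma finitely many strict inequalities on the weight determine all leading terms, so the initial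
  ideal is constant in a neighbourhood (\<open>generic_weight_in_interior_of_cell\<close>).
\<close>

section \<open>Monomials\<close>

lemma lookup_sum_single:
  fixes f :: "'k \<Rightarrow> 'a::comm_monoid_add"
  assumes "finite M"
  shows "lookup (\<Sum>m\<in>M. single m (f m)) k = (if k \<in> M then f k else 0)"
  using assms by (simp add: lookup_sum lookup_single when_def sum.delta)

lemma sum_single_keys: "(\<Sum>m\<in>keys p. single m (lookup p m)) = p"
  by (rule poly_mapping_eqI) (simp add: lookup_sum_single in_keys_iff)

lemma lookup_init_form:
  "lookup (init_form wt f) m =
     (if m \<in> keys f \<and> (\<forall>m'\<in>keys f. wt m' \<le> wt m) then lookup f m else 0)"
  unfolding init_form_def by (subst lookup_sum_single) auto

lemma keys_sum_subset: "finite I \<Longrightarrow> keys (sum f I) \<subseteq> (\<Union>i\<in>I. keys (f i))"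
proof (induction I rule: finite_induct)
  case (insert x F)
  then show ?case using keys_add[of "f x" "sum f F"] by auto
qed simp

lemma mono_dvd_iff: "mono_dvd a b \<longleftrightarrow> (\<exists>c. b = a + c)"
proof
  assume "mono_dvd a b"
  then have "b = a + (b - a)"
    by (intro poly_mapping_eqI) (simp add: mono_dvd_def lookup_add lookup_minus)
  then show "\<exists>c. b = a + c" by blast
qed (auto simp: mono_dvd_def lookup_add)

lemma keys_add_mono: "keys (a + b :: mono) = keys a \<union> keys b"
  by (auto simp: in_keys_iff lookup_add)

lemma monomials_add: "a + b \<in> monomials n \<longleftrightarrow> a \<in> monomials n \<and> b \<in> monomials n"
  by (auto simp: monomials_def keys_add_mono)

lemma monomials_0: "0 \<in> monomials n" by (simp add: monomials_def)

lemma keys_mono_minus: "keys (a - b :: mono) \<subseteq> keys a"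
  by (auto simp: in_keys_iff lookup_minus)

lemma monomials_minus: "a \<in> monomials n \<Longrightarrow> a - b \<in> monomials n"
  using keys_mono_minus[of a b] by (auto simp: monomials_def)

lemma mono_deg_superset:
  "finite S \<Longrightarrow> keys m \<subseteq> S \<Longrightarrow> mono_deg m = (\<Sum>j\<in>S. lookup m j)"
  unfolding mono_deg_def by (rule sum.mono_neutral_left) (auto simp: in_keys_iff)

lemma mono_deg_add: "mono_deg (a + b) = mono_deg a + mono_deg b"
proof -
  let ?S = "keys a \<union> keys b"
  have "mono_deg (a + b) = (\<Sum>j\<in>?S. lookup (a + b) j)"
    by (rule mono_deg_superset) (auto simp: keys_add_mono)
  also have "\<dots> = (\<Sum>j\<in>?S. lookup a j) + (\<Sum>j\<in>?S. lookup b j)"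
    by (simp add: lookup_add sum.distrib)
  also have "\<dots> = mono_deg a + mono_deg b"
    by (subst (1 2) mono_deg_superset[of ?S]) auto
  finally show ?thesis .
qed

lemma mono_deg_0 [simp]: "mono_deg 0 = 0" by (simp add: mono_deg_def)
lemma mono_deg_single [simp]: "mono_deg (single j k) = k" by (simp add: mono_deg_def)
lemma mono_deg_eq_0: "mono_deg m = 0 \<longleftrightarrow> m = 0"
  by (auto simp: mono_deg_def in_keys_iff intro!: poly_mapping_eqI)

lemma lookup_le_mono_deg: "lookup m j \<le> mono_deg m"
proof (cases "j \<in> keys m")
  case True
  then show ?thesis unfolding mono_deg_def by (intro member_le_sum) auto
qed (simp add: in_keys_iff)

lemma finite_mono_dvd: "finite {k :: mono. mono_dvd k b}"
proof -
  have "finite {k :: mono. keys k \<subseteq> keys b \<and> (\<forall>j. lookup k j \<le> mono_deg b)}" (is "finite ?A")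
  proof -
    have "lookup ` ?A \<subseteq> {f. \<forall>j. (j \<in> keys b \<longrightarrow> f j \<in> {..mono_deg b}) \<and> (j \<notin> keys b \<longrightarrow> f j = 0)}"
    proof (rule image_subsetI, rule CollectI, intro allI conjI impI)
      fix k j assume k: "k \<in> ?A"
      then show "lookup k j \<in> {..mono_deg b}" by simp
      assume "j \<notin> keys b"
      then have "j \<notin> keys k" using k by blast
      then show "lookup k j = 0" by (simp add: in_keys_iff)
    qed
    moreover have "finite {f. \<forall>j. (j \<in> keys b \<longrightarrow> f j \<in> {..mono_deg b}) \<and> (j \<notin> keys b \<longrightarrow> f j = (0::nat))}"
      by (rule finite_set_of_finite_funs) auto
    ultimately have "finite (lookup ` ?A)" by (rule finite_subset)
    moreover have "inj_on lookup ?A" by (intro inj_onI poly_mapping_eqI) (simp add: fun_eq_iff)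
    ultimately show ?thesis by (rule finite_imageD)
  qed
  moreover have "{k. mono_dvd k b} \<subseteq> ?A"
  proof
    fix k assume "k \<in> {k. mono_dvd k b}"
    then have k: "\<And>j. lookup k j \<le> lookup b j" by (simp add: mono_dvd_def)
    have "keys k \<subseteq> keys b"
      using k by (metis in_keys_iff le_zero_eq subsetI)
    then show "k \<in> ?A" using k lookup_le_mono_deg order_trans by blast
  qed
  ultimately show ?thesis by (rule finite_subset[rotated])
qed

lemma finite_monomials_deg: "finite {m \<in> monomials n. mono_deg m \<le> k}"
proof -
  let ?A = "{m \<in> monomials n. mono_deg m \<le> k}"
  have "lookup ` ?A \<subseteq> {f. \<forall>j. (j \<in> {1..n} \<longrightarrow> f j \<in> {..k}) \<and> (j \<notin> {1..n} \<longrightarrow> f j = 0)}"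
  proof safe
    fix m j assume "m \<in> monomials n" "mono_deg m \<le> k"
    then show "lookup m j \<le> k" using lookup_le_mono_deg order_trans by blast
  next
    fix m j assume "m \<in> monomials n" "j \<notin> {1..n}"
    then show "lookup m j = 0" by (auto simp: monomials_def in_keys_iff)
  qed
  moreover have "finite {f. \<forall>j. (j \<in> {1..n} \<longrightarrow> f j \<in> {..k}) \<and> (j \<notin> {1..n} \<longrightarrow> f j = (0::nat))}"
    by (rule finite_set_of_finite_funs) auto
  ultimately have "finite (lookup ` ?A)" by (rule finite_subset)
  moreover have "inj_on lookup ?A" by (intro inj_onI poly_mapping_eqI) (simp add: fun_eq_iff)
  ultimately show ?thesis by (rule finite_imageD)
qed

section \<open>The polynomial ring\<close>

lemma polys_0: "0 \<in> polys n" by (simp add: polys_def)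
lemma polys_add: "f \<in> polys n \<Longrightarrow> g \<in> polys n \<Longrightarrow> f + g \<in> polys n"
  using keys_add[of f g] by (auto simp: polys_def)
lemma polys_uminus: "f \<in> polys n \<Longrightarrow> - f \<in> polys n"
  by (auto simp: polys_def in_keys_iff)
lemma polys_diff: "f \<in> polys n \<Longrightarrow> g \<in> polys n \<Longrightarrow> f - g \<in> polys n"
  using polys_add[of f n "- g"] polys_uminus by simp
lemma polys_mult: "f \<in> polys n \<Longrightarrow> g \<in> polys n \<Longrightarrow> f * g \<in> polys n"
  using keys_mult[of f g] by (fastforce simp: polys_def monomials_add)
lemma polys_single: "m \<in> monomials n \<Longrightarrow> single m c \<in> polys n"
  by (simp add: polys_def)
lemma polys_Const: "Const c \<in> polys n"
  by (simp add: Const_def polys_single monomials_0)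
lemma polys_1: "1 \<in> polys n"
  using polys_Const[of 1] by (simp add: Const_def)
lemma polys_Var: "j \<in> {1..n} \<Longrightarrow> Var j \<in> polys n"
  by (simp add: Var_def polys_single monomials_def)
lemma polys_sum: "(\<And>i. i \<in> I \<Longrightarrow> f i \<in> polys n) \<Longrightarrow> sum f I \<in> polys n"
  by (induction I rule: infinite_finite_induct) (auto intro: polys_0 polys_add)
lemma polys_prod: "(\<And>i. i \<in> I \<Longrightarrow> f i \<in> polys n) \<Longrightarrow> prod f I \<in> polys n"
  by (induction I rule: infinite_finite_induct) (auto intro: polys_1 polys_mult)

lemma Const_add: "Const (a + b) = Const a + Const b" by (simp add: Const_def single_add)
lemma Const_mult: "Const (a * b) = Const a * Const b" by (simp add: Const_def mult_single)
lemma Const_0 [simp]: "Const 0 = 0" by (simp add: Const_def)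
lemma Const_1 [simp]: "Const 1 = 1" by (simp add: Const_def)
lemma Const_uminus: "Const (- a) = - Const a" by (simp add: Const_def single_uminus)
lemma Const_numeral: "Const (numeral k) = numeral k" by (simp add: Const_def)

lemma single_mult_poly: "single a c * p = (\<Sum>m\<in>keys p. single (a + m) (c * lookup p m))"
proof -
  have "single a c * p = single a c * (\<Sum>m\<in>keys p. single m (lookup p m))"
    by (simp only: sum_single_keys)
  then show ?thesis by (simp add: sum_distrib_left mult_single)
qed

lemma lookup_single_mult:
  fixes p :: cpoly
  shows "lookup (single a c * p) m = (if mono_dvd a m then c * lookup p (m - a) else 0)"
proof -
  have *: "a + k = m \<longleftrightarrow> mono_dvd a m \<and> k = m - a" for k
    by (auto simp: mono_dvd_iff)
  have "lookup (single a c * p) m = (\<Sum>k\<in>keys p. if a + k = m then c * lookup p k else 0)"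
    by (simp add: single_mult_poly lookup_sum lookup_single when_def)
  also have "\<dots> = (if mono_dvd a m then \<Sum>k\<in>keys p. if k = m - a then c * lookup p k else 0 else 0)"
    by (simp add: *)
  also have "\<dots> = (if mono_dvd a m then c * lookup p (m - a) else 0)"
    by (simp add: in_keys_iff)
  finally show ?thesis .
qed

lemma lookup_Const_mult: "lookup (Const c * p) m = c * lookup p m"
  unfolding Const_def by (simp add: lookup_single_mult mono_dvd_def)

lemma mpoly_ring_simps [simp]:
  "carrier (mpoly_ring n) = polys n" "monoid.mult (mpoly_ring n) = (*)"
  "one (mpoly_ring n) = 1" "zero (mpoly_ring n) = 0" "add (mpoly_ring n) = (+)"
  by (simp_all add: mpoly_ring_def)

lemma mpoly_ring_cring: "cring (mpoly_ring n)"
proof (rule cringI)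
  show "abelian_group (mpoly_ring n)"
  proof (rule abelian_groupI)
    fix x assume "x \<in> carrier (mpoly_ring n)"
    then show "\<exists>y\<in>carrier (mpoly_ring n). y \<oplus>\<^bsub>mpoly_ring n\<^esub> x = \<zero>\<^bsub>mpoly_ring n\<^esub>"
      by (intro bexI[of _ "- x"]) (auto intro: polys_uminus)
  qed (auto intro: polys_add polys_0 simp: ac_simps)
  show "comm_monoid (mpoly_ring n)"
    by unfold_locales (auto intro: polys_mult polys_1 simp: ac_simps)
qed (auto simp: algebra_simps)

lemmas mpoly_ring_ring = cring.axioms(1)[OF mpoly_ring_cring]

lemma mpoly_idealI:
  assumes "T \<subseteq> polys n" "0 \<in> T" "\<And>a b. a \<in> T \<Longrightarrow> b \<in> T \<Longrightarrow> a + b \<in> T"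
    "\<And>a x. a \<in> T \<Longrightarrow> x \<in> polys n \<Longrightarrow> x * a \<in> T"
  shows "ideal T (mpoly_ring n)"
proof -
  interpret R: cring "mpoly_ring n" by (rule mpoly_ring_cring)
  have neg: "- a \<in> T" if "a \<in> T" for a
    using assms(4)[OF that, of "- 1"] polys_uminus[OF polys_1] by simp
  have inv: "\<ominus>\<^bsub>mpoly_ring n\<^esub> a = - a" if "a \<in> polys n" for a
    by (rule R.minus_equality) (auto intro: that polys_uminus)
  show ?thesis
  proof (rule idealI)
    show "subgroup T (add_monoid (mpoly_ring n))"
    proof
      show "T \<subseteq> carrier (add_monoid (mpoly_ring n))" using assms(1) by simp
      show "x \<otimes>\<^bsub>add_monoid (mpoly_ring n)\<^esub> y \<in> T" if "x \<in> T" "y \<in> T" for x y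
        using assms(3)[OF that] by simp
      show "\<one>\<^bsub>add_monoid (mpoly_ring n)\<^esub> \<in> T" using assms(2) by simp
      fix x assume "x \<in> T"
      then show "inv\<^bsub>add_monoid (mpoly_ring n)\<^esub> x \<in> T"
        using inv[of x] neg assms(1) by (auto simp: a_inv_def)
    qed
    show "x \<otimes>\<^bsub>mpoly_ring n\<^esub> a \<in> T" if "a \<in> T" "x \<in> carrier (mpoly_ring n)" for a x
      using assms(4)[OF that(1)] that(2) by simp
    show "a \<otimes>\<^bsub>mpoly_ring n\<^esub> x \<in> T" if "a \<in> T" "x \<in> carrier (mpoly_ring n)" for a x
      using assms(4)[OF that(1), of x] that(2) by (simp add: mult.commute)
  qed (rule R.ring_axioms)
qed

context
  fixes n :: nat and S :: "cpoly set"
  assumes S: "S \<subseteq> polys n"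
begin

lemma genideal_is_ideal: "ideal (genideal (mpoly_ring n) S) (mpoly_ring n)"
  using ring.genideal_ideal[OF mpoly_ring_ring] S by simp

lemma genideal_subset_polys: "genideal (mpoly_ring n) S \<subseteq> polys n"
  using additive_subgroup.a_subset[OF ideal.axioms(1)[OF genideal_is_ideal]] by simp

lemma genideal_gen: "f \<in> S \<Longrightarrow> f \<in> genideal (mpoly_ring n) S"
  using ring.genideal_self[OF mpoly_ring_ring, of S n] S by auto

lemma genideal_0: "0 \<in> genideal (mpoly_ring n) S"
  using additive_subgroup.zero_closed[OF ideal.axioms(1)[OF genideal_is_ideal]] by simp

lemma genideal_add: "f \<in> genideal (mpoly_ring n) S \<Longrightarrow> g \<in> genideal (mpoly_ring n) S \<Longrightarrow>
    f + g \<in> genideal (mpoly_ring n) S"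
  using additive_subgroup.a_closed[OF ideal.axioms(1)[OF genideal_is_ideal], of f g] by simp

lemma genideal_mult: "f \<in> genideal (mpoly_ring n) S \<Longrightarrow> x \<in> polys n \<Longrightarrow>
    x * f \<in> genideal (mpoly_ring n) S"
  using ideal.I_l_closed[OF genideal_is_ideal, of f x] by simp

lemma genideal_uminus: "f \<in> genideal (mpoly_ring n) S \<Longrightarrow> - f \<in> genideal (mpoly_ring n) S"
  using genideal_mult[of f "- 1"] polys_uminus[OF polys_1] by simp

lemma genideal_sum: "(\<And>i. i \<in> I \<Longrightarrow> f i \<in> genideal (mpoly_ring n) S) \<Longrightarrow>
    sum f I \<in> genideal (mpoly_ring n) S"
  by (induction I rule: infinite_finite_induct) (auto intro: genideal_0 genideal_add)

text \<open>The induction principle for membership in a generated ideal.\<close>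

lemma genideal_least:
  assumes "S \<subseteq> T" "T \<subseteq> polys n" "0 \<in> T" "\<And>a b. a \<in> T \<Longrightarrow> b \<in> T \<Longrightarrow> a + b \<in> T"
    "\<And>a x. a \<in> T \<Longrightarrow> x \<in> polys n \<Longrightarrow> x * a \<in> T"
  shows "genideal (mpoly_ring n) S \<subseteq> T"
  using ring.genideal_minimal[OF mpoly_ring_ring mpoly_idealI[OF assms(2-5)] assms(1)] .

end

lemma genideal_cong:
  assumes "S \<subseteq> polys n" "T \<subseteq> polys n" "S \<subseteq> genideal (mpoly_ring n) T" "T \<subseteq> genideal (mpoly_ring n) S"
  shows "genideal (mpoly_ring n) S = genideal (mpoly_ring n) T"
  using ring.genideal_minimal[OF mpoly_ring_ring genideal_is_ideal[OF assms(2)] assms(3)]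
    ring.genideal_minimal[OF mpoly_ring_ring genideal_is_ideal[OF assms(1)] assms(4)] by blast

section \<open>Dickson's lemma\<close>

text \<open>Induction on the index set.  If \<open>B\<close> serves for the coordinates in \<open>J\<close>, then it also serves for every
  element whose new coordinate \<open>i\<close> is at least the maximum of that coordinate on \<open>B\<close>.  Each of the
  finitely many smaller values of the coordinate \<open>i\<close> is handled by the induction hypothesis on its own.\<close>

lemma dickson:
  fixes f :: "'a \<Rightarrow> 'i \<Rightarrow> nat"
  assumes "finite J"
  shows "\<exists>B\<subseteq>S. finite B \<and> (\<forall>t\<in>S. \<exists>b\<in>B. \<forall>j\<in>J. f b j \<le> f t j)"
  using assms
proof (induction J arbitrary: S rule: finite_induct)
  case empty
  show ?case
  proof (cases "S = {}")
    case False
    then obtain s where "s \<in> S" by blast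
    then have "{s} \<subseteq> S \<and> finite {s} \<and> (\<forall>t\<in>S. \<exists>b\<in>{s}. \<forall>j\<in>{}. f b j \<le> f t j)" by simp
    then show ?thesis by (rule exI)
  next
    case True
    then have "{} \<subseteq> S \<and> finite {} \<and> (\<forall>t\<in>S. \<exists>b\<in>{}. \<forall>j\<in>{}. f b j \<le> f t j)" by simp
    then show ?thesis by (rule exI)
  qed
next
  case (insert i J)
  obtain B where B: "B \<subseteq> S" "finite B" "\<forall>t\<in>S. \<exists>b\<in>B. \<forall>j\<in>J. f b j \<le> f t j"
    using insert.IH[of S] by metis
  \<comment> \<open>Elements with \<open>f t i \<ge> m\<close> are covered by \<open>B\<close>; the value 0 is only for empty \<open>B\<close>.\<close>
  define m where "m = Max (insert 0 ((\<lambda>b. f b i) ` B))"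
  have m: "f b i \<le> m" if "b \<in> B" for b
    unfolding m_def using B(2) that by (intro Max_ge) auto
  have "\<forall>k. \<exists>C\<subseteq>{t\<in>S. f t i = k}. finite C \<and>
      (\<forall>t\<in>{t\<in>S. f t i = k}. \<exists>b\<in>C. \<forall>j\<in>J. f b j \<le> f t j)"
    by (intro allI insert.IH)
  then obtain C where C': "\<forall>k. C k \<subseteq> {t\<in>S. f t i = k} \<and> finite (C k) \<and>
      (\<forall>t\<in>{t\<in>S. f t i = k}. \<exists>b\<in>C k. \<forall>j\<in>J. f b j \<le> f t j)"
    unfolding choice_iff by blast
  have C: "\<And>k. C k \<subseteq> {t\<in>S. f t i = k}" "\<And>k. finite (C k)"
    "\<And>k t. t \<in> S \<Longrightarrow> f t i = k \<Longrightarrow> \<exists>b\<in>C k. \<forall>j\<in>J. f b j \<le> f t j"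
    using C' by auto
  show ?case
  proof (intro exI[of _ "B \<union> (\<Union>k<m. C k)"] conjI ballI)
    show "B \<union> (\<Union>k<m. C k) \<subseteq> S" using B(1) C(1) by blast
    show "finite (B \<union> (\<Union>k<m. C k))" using B(2) C(2) by simp
    fix t assume t: "t \<in> S"
    show "\<exists>b\<in>B \<union> (\<Union>k<m. C k). \<forall>j\<in>insert i J. f b j \<le> f t j"
    proof (cases "f t i < m")
      case True
      obtain b where b: "b \<in> C (f t i)" "\<forall>j\<in>J. f b j \<le> f t j" using C(3)[OF t refl] by blast
      then have "f b i = f t i" using C(1) by blast
      then show ?thesis using b True by (intro bexI[of _ b]) auto
    next
      case False
      obtain b where "b \<in> B" "\<forall>j\<in>J. f b j \<le> f t j" using B(3) t by blast
      then show ?thesis using m[of b] False by (intro bexI[of _ b]) auto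
    qed
  qed
qed

section \<open>Products in the Weyl algebra\<close>

text \<open>The degree of \<open>x\<^sup>a \<partial>\<^sup>b\<close> in the grading of the Weyl algebra by \<open>\<int>\<^sup>n\<close> in which \<open>\<partial>\<^sub>j\<close> has degree \<open>e\<^sub>j\<close>
  and \<open>x\<^sub>j\<close> has degree \<open>- e\<^sub>j\<close>.  The weight of a term depends on this degree alone.\<close>

definition shift_of :: "mono \<times> mono \<Rightarrow> nat \<Rightarrow> int" where
  "shift_of s j = int (lookup (snd s) j) - int (lookup (fst s) j)"

text \<open>The total degree, which defines the Bernstein filtration.  It serves to cut the infinite-dimensional
  Weyl algebra into finite-dimensional pieces.\<close>

definition bideg :: "mono \<times> mono \<Rightarrow> nat" where
  "bideg s = mono_deg (fst s) + mono_deg (snd s)"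

definition madd :: "mono \<times> mono \<Rightarrow> mono \<times> mono \<Rightarrow> mono \<times> mono" where
  "madd s t = (fst s + fst t, snd s + snd t)"

lemma shift_of_madd: "shift_of (madd s t) j = shift_of s j + shift_of t j"
  by (simp add: shift_of_def madd_def lookup_add)

lemma bideg_madd: "bideg (madd s t) = bideg s + bideg t"
  by (simp add: bideg_def madd_def mono_deg_add)

lemma monomial_pair_eqI: "shift_of s = shift_of t \<Longrightarrow> fst s = fst t \<Longrightarrow> s = t"
proof (rule prod_eqI)
  assume *: "shift_of s = shift_of t" "fst s = fst t"
  have "lookup (snd s) j = lookup (snd t) j" for j
    using fun_cong[OF *(1), of j] *(2) by (simp add: shift_of_def)
  then show "snd s = snd t" by (intro poly_mapping_eqI)
qed

lemma weyl_weight_shift: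
  assumes "s \<in> monomials n \<times> monomials n"
  shows "weyl_weight w s = (\<Sum>j=1..n. w j * of_int (shift_of s j))"
proof -
  have *: "weight w m = (\<Sum>j=1..n. w j * of_nat (lookup m j))" if "m \<in> monomials n" for m
    unfolding weight_def
    by (rule sum.mono_neutral_left) (use that in \<open>auto simp: monomials_def in_keys_iff\<close>)
  show ?thesis
    using assms by (auto simp: weyl_weight_def * shift_of_def sum_subtractf algebra_simps)
qed

lemma monomials_lookup_outside: "m \<in> monomials n \<Longrightarrow> j \<notin> {1..n} \<Longrightarrow> lookup m j = 0"
  by (metis (no_types, lifting) in_keys_iff mem_Collect_eq monomials_def subsetD)

lemma lookup_weyl_scale: "lookup (weyl_scale c P) r = c * lookup P r"
  by (simp add: weyl_scale_def lookup_sum_single in_keys_iff)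

lemma mono_pos: "k \<noteq> 0 \<Longrightarrow> 0 < (k :: mono)"
proof -
  assume "k \<noteq> 0"
  then have ne: "keys k \<noteq> {}" by simp
  have "0 < lookup k (Min (keys k))" using Min_in[OF _ ne] by (simp add: in_keys_iff)
  moreover have "lookup k j = 0" if "j < Min (keys k)" for j
    using that Min_le[of "keys k" j] by (fastforce simp: in_keys_iff)
  ultimately show "0 < k"
    unfolding less_poly_mapping.rep_eq less_fun_def zero_poly_mapping.rep_eq
    by (intro exI[of _ "Min (keys k)"]) auto
qed

text \<open>The term of the Leibniz rule with index \<open>k\<close> is \<open>x\<^bsup>a+c-k\<^esup> \<partial>\<^bsup>b+e-k\<^esup>\<close>: all terms have the same degree,
  and those with \<open>k \<noteq> 0\<close> have a smaller exponent of \<open>x\<close> in the order on monomials.\<close>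

lemma weyl_mono_mult_keys:
  assumes "r \<in> keys (weyl_mono_mult s t)"
  shows "shift_of r j = shift_of s j + shift_of t j"
    and "bideg r \<le> bideg s + bideg t"
    and "r = madd s t \<or> fst r < fst s + fst t"
    and "s \<in> monomials n \<times> monomials n \<Longrightarrow> t \<in> monomials n \<times> monomials n \<Longrightarrow>
      r \<in> monomials n \<times> monomials n"
proof -
  obtain a b c e where st: "s = (a, b)" "t = (c, e)" by (metis surj_pair)
  let ?K = "{k. mono_dvd k b \<and> mono_dvd k c}"
  have fin: "finite ?K" by (rule finite_subset[OF _ finite_mono_dvd[of b]]) auto
  obtain k where k: "mono_dvd k b" "mono_dvd k c" "r = (a + (c - k), (b - k) + e)"
    using assms keys_sum_subset[OF fin] unfolding weyl_mono_mult_def st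
    by (fastforce split: if_splits)
  obtain b' where b': "b = k + b'" using k(1) mono_dvd_iff by blast
  obtain c' where c': "c = k + c'" using k(2) mono_dvd_iff by blast
  have r: "r = (a + c', b' + e)" using k(3) by (simp add: b' c')
  show "shift_of r j = shift_of s j + shift_of t j"
    by (simp add: r st b' c' shift_of_def lookup_add)
  show "bideg r \<le> bideg s + bideg t"
    by (simp add: r st b' c' bideg_def mono_deg_add)
  show "r = madd s t \<or> fst r < fst s + fst t"
  proof (cases "k = 0")
    case True
    then show ?thesis by (simp add: r st b' c' madd_def)
  next
    case False
    then have "0 < k" by (rule mono_pos)
    then have "c' < k + c'" using add_strict_right_mono[of 0 k c'] by simp
    then have "a + c' < a + (k + c')" by (rule add_strict_left_mono)
    then show ?thesis by (simp add: r st c')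
  qed
  show "r \<in> monomials n \<times> monomials n"
    if "s \<in> monomials n \<times> monomials n" "t \<in> monomials n \<times> monomials n"
    using that by (auto simp: r st b' c' monomials_add)
qed

lemma lookup_weyl_mono_mult_top: "lookup (weyl_mono_mult s t) (madd s t) = 1"
proof -
  obtain a b c e where st: "s = (a, b)" "t = (c, e)" by (metis surj_pair)
  let ?K = "{k. mono_dvd k b \<and> mono_dvd k c}"
  have fin: "finite ?K" by (rule finite_subset[OF _ finite_mono_dvd[of b]]) auto
  have "lookup (single (a + (c - k), (b - k) + e) x) (a + c, b + e) = (if k = 0 then x else 0)"
    if kK: "k \<in> ?K" for k and x :: complex
  proof -
    obtain c' where "c = k + c'" using kK by (auto simp: mono_dvd_iff)
    then have "a + (c - k) = a + c \<longleftrightarrow> k = 0" by simp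
    then show ?thesis by (auto simp: lookup_single when_def)
  qed
  then have "lookup (weyl_mono_mult s t) (madd s t) = (\<Sum>k\<in>?K. if k = 0 then
      (\<Prod>j\<in>keys k. of_nat (fact (lookup k j) * (lookup b j choose lookup k j)
                                                * (lookup c j choose lookup k j))) else 0)"
    unfolding weyl_mono_mult_def st madd_def by (auto simp: lookup_sum intro!: sum.cong)
  also have "\<dots> = 1" using fin by (simp add: mono_dvd_def)
  finally show ?thesis .
qed

lemma lookup_weyl_mult_superset:
  assumes "finite S" "keys P \<subseteq> S" "finite T" "keys Q \<subseteq> T"
  shows "lookup (weyl_mult P Q) r =
    (\<Sum>s\<in>S. \<Sum>t\<in>T. lookup P s * lookup Q t * lookup (weyl_mono_mult s t) r)"
proof -
  have "lookup (weyl_mult P Q) r =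
      (\<Sum>s\<in>keys P. \<Sum>t\<in>keys Q. lookup P s * lookup Q t * lookup (weyl_mono_mult s t) r)"
    by (simp add: weyl_mult_def lookup_sum lookup_weyl_scale)
  also have "\<dots> = (\<Sum>s\<in>keys P. \<Sum>t\<in>T. lookup P s * lookup Q t * lookup (weyl_mono_mult s t) r)"
    by (intro sum.cong refl sum.mono_neutral_left) (use assms in \<open>auto simp: in_keys_iff\<close>)
  also have "\<dots> = (\<Sum>s\<in>S. \<Sum>t\<in>T. lookup P s * lookup Q t * lookup (weyl_mono_mult s t) r)"
    by (intro sum.mono_neutral_left) (use assms in \<open>auto simp: in_keys_iff\<close>)
  finally show ?thesis .
qed

lemma lookup_weyl_mult:
  "lookup (weyl_mult P Q) r =
    (\<Sum>s\<in>keys P. \<Sum>t\<in>keys Q. lookup P s * lookup Q t * lookup (weyl_mono_mult s t) r)"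
  by (rule lookup_weyl_mult_superset) auto

lemma lookup_single_weyl_mult:
  "lookup (weyl_mult (single s c) Q) r =
    (\<Sum>t\<in>keys Q. c * lookup Q t * lookup (weyl_mono_mult s t) r)"
  by (subst lookup_weyl_mult_superset[where S = "{s}" and T = "keys Q"]) auto

lemma lookup_single_weyl_mult_superset:
  assumes "finite T" "keys Q \<subseteq> T"
  shows "lookup (weyl_mult (single s c) Q) r =
    (\<Sum>t\<in>T. c * lookup Q t * lookup (weyl_mono_mult s t) r)"
  by (subst lookup_weyl_mult_superset[where S = "{s}" and T = T]) (use assms in auto)

lemma weyl_mult_keys:
  assumes "r \<in> keys (weyl_mult P Q)"
  obtains s t where "s \<in> keys P" "t \<in> keys Q" "r \<in> keys (weyl_mono_mult s t)"
proof -
  have "(\<Sum>s\<in>keys P. \<Sum>t\<in>keys Q. lookup P s * lookup Q t * lookup (weyl_mono_mult s t) r) \<noteq> 0"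
    using assms by (simp add: in_keys_iff lookup_weyl_mult)
  then obtain s where s: "s \<in> keys P"
    "(\<Sum>t\<in>keys Q. lookup P s * lookup Q t * lookup (weyl_mono_mult s t) r) \<noteq> 0"
    by (meson sum.not_neutral_contains_not_neutral)
  then obtain t where "t \<in> keys Q" "lookup P s * lookup Q t * lookup (weyl_mono_mult s t) r \<noteq> 0"
    by (meson sum.not_neutral_contains_not_neutral)
  then show thesis using that[OF s(1), of t] by (simp add: in_keys_iff)
qed

lemma weyl_mult_single_keys:
  assumes "r \<in> keys (weyl_mult (single s c) Q)"
  obtains t where "t \<in> keys Q" "r \<in> keys (weyl_mono_mult s t)"
proof -
  obtain s' t where "s' \<in> keys (single s c)" "t \<in> keys Q" "r \<in> keys (weyl_mono_mult s' t)"
    by (rule weyl_mult_keys[OF assms])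
  then show thesis using that[of t] by (simp split: if_splits)
qed

lemma weyl_scale_eq_mult: "weyl_mult (single (0, 0) c) P = weyl_scale c P"
proof (rule poly_mapping_eqI)
  fix r
  have *: "weyl_mono_mult (0, 0) t = single t 1" for t
  proof -
    obtain c e where t: "t = (c, e)" by (metis surj_pair)
    have "{k :: mono. mono_dvd k 0 \<and> mono_dvd k c} = {0}"
      by (auto simp: mono_dvd_def intro!: poly_mapping_eqI)
    then show ?thesis by (simp add: weyl_mono_mult_def t)
  qed
  show "lookup (weyl_mult (single (0, 0) c) P) r = lookup (weyl_scale c P) r"
    unfolding lookup_single_weyl_mult lookup_weyl_scale *
    by (simp add: lookup_single when_def in_keys_iff if_distrib sum.delta cong: if_cong)
qed

lemma left_ideal_scale: "P \<in> left_ideal n G \<Longrightarrow> weyl_scale c P \<in> left_ideal n G"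
  unfolding weyl_scale_eq_mult[symmetric]
  by (rule left_ideal.mult) (auto simp: weyl_algebra_def monomials_0)

lemma left_ideal_sum: "(\<And>i. i \<in> I \<Longrightarrow> f i \<in> left_ideal n G) \<Longrightarrow> sum f I \<in> left_ideal n G"
  by (induction I rule: infinite_finite_induct) (auto intro: left_ideal.zero left_ideal.add)

lemma left_ideal_least: "G \<subseteq> left_ideal n G' \<Longrightarrow> left_ideal n G \<subseteq> left_ideal n G'"
proof
  fix P assume G: "G \<subseteq> left_ideal n G'" and "P \<in> left_ideal n G"
  from this(2) show "P \<in> left_ideal n G'"
    by induction (use G in \<open>auto intro: left_ideal.intros\<close>)
qed

lemma left_ideal_subset_weyl: 
  assumes "G \<subseteq> weyl_algebra n"
  shows "left_ideal n G \<subseteq> weyl_algebra n"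
proof
  fix P assume "P \<in> left_ideal n G"
  then show "P \<in> weyl_algebra n"
  proof induction
    case (add P Q)
    then show ?case using keys_add[of P Q] by (auto simp: weyl_algebra_def)
  next
    case (mult Q P)
    show ?case unfolding weyl_algebra_def
    proof (rule CollectI, rule subsetI)
      fix r assume "r \<in> keys (weyl_mult Q P)"
      then obtain s t where "s \<in> keys Q" "t \<in> keys P" "r \<in> keys (weyl_mono_mult s t)"
        by (rule weyl_mult_keys)
      then show "r \<in> monomials n \<times> monomials n"
        using mult weyl_mono_mult_keys(4)[of r s t n] by (auto simp: weyl_algebra_def)
    qed
  qed (use assms in \<open>auto simp: weyl_algebra_def\<close>)
qed

section \<open>Graded left ideals\<close>

text \<open>The component of \<open>P\<close> in the class of \<open>d\<close>, for the grading by \<open>\<int>\<^sup>n / L\<close>.\<close>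

definition graded_part :: "(nat \<Rightarrow> int) set \<Rightarrow> (nat \<Rightarrow> int) \<Rightarrow> weyl \<Rightarrow> weyl" where
  "graded_part L d P =
     (\<Sum>s\<in>{s \<in> keys P. (\<lambda>j. shift_of s j - d j) \<in> L}. single s (lookup P s))"

lemma lookup_graded_part:
  "lookup (graded_part L d P) s = (if (\<lambda>j. shift_of s j - d j) \<in> L then lookup P s else 0)"
  unfolding graded_part_def by (subst lookup_sum_single) (auto simp: in_keys_iff)

text \<open>A left ideal is graded by \<open>\<int>\<^sup>n / L\<close> if the components of its generators lie in it, because
  multiplication by a term shifts the degree by a constant.\<close>

lemma graded_part_in_left_ideal:
  assumes gen: "\<And>g d. g \<in> G \<Longrightarrow> graded_part L d g \<in> left_ideal n G"
    and P: "P \<in> left_ideal n G"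
  shows "graded_part L d P \<in> left_ideal n G"
  using P
proof (induction arbitrary: d)
  case zero
  have "graded_part L d 0 = 0" by (rule poly_mapping_eqI) (simp add: lookup_graded_part)
  then show ?case by (simp add: left_ideal.zero)
next
  case (gen P)
  then show ?case by (rule assms(1))
next
  case (add P Q)
  have "graded_part L d (P + Q) = graded_part L d P + graded_part L d Q"
    by (rule poly_mapping_eqI) (simp add: lookup_graded_part lookup_add)
  then show ?case using add.IH by (simp add: left_ideal.add)
next
  case (mult Q P)
  have "graded_part L d (weyl_mult Q P) =
      (\<Sum>s\<in>keys Q. weyl_mult (single s (lookup Q s)) (graded_part L (\<lambda>j. d j - shift_of s j) P))"
  proof (rule poly_mapping_eqI)
    fix r
    have sub: "keys (graded_part L e P) \<subseteq> keys P" for e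
      by (auto simp: in_keys_iff lookup_graded_part split: if_splits)
    have eq: "lookup Q s * lookup P t * lookup (weyl_mono_mult s t) r *
          (if (\<lambda>j. shift_of r j - d j) \<in> L then 1 else 0) =
        lookup Q s * lookup (graded_part L (\<lambda>j. d j - shift_of s j) P) t
          * lookup (weyl_mono_mult s t) r" for s t
    proof (cases "r \<in> keys (weyl_mono_mult s t)")
      case True
      then have "(\<lambda>j. shift_of r j - d j) = (\<lambda>j. shift_of t j - (d j - shift_of s j))"
        by (auto simp: weyl_mono_mult_keys(1))
      then show ?thesis by (simp add: lookup_graded_part)
    qed (simp add: in_keys_iff)
    have "lookup (graded_part L d (weyl_mult Q P)) r =
        (\<Sum>s\<in>keys Q. \<Sum>t\<in>keys P. lookup Q s * lookup P t * lookup (weyl_mono_mult s t) r *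
          (if (\<lambda>j. shift_of r j - d j) \<in> L then 1 else 0))"
      by (simp add: lookup_graded_part lookup_weyl_mult sum_distrib_right[symmetric])
    also have "\<dots> = (\<Sum>s\<in>keys Q. lookup (weyl_mult (single s (lookup Q s))
        (graded_part L (\<lambda>j. d j - shift_of s j) P)) r)"
      unfolding eq lookup_single_weyl_mult_superset[OF finite_keys sub] ..
    finally show "lookup (graded_part L d (weyl_mult Q P)) r = lookup (\<Sum>s\<in>keys Q.
        weyl_mult (single s (lookup Q s)) (graded_part L (\<lambda>j. d j - shift_of s j) P)) r"
      by (simp add: lookup_sum)
  qed
  also have "\<dots> \<in> left_ideal n G"
    by (intro left_ideal_sum left_ideal.mult mult.IH)
       (use mult.hyps in \<open>auto simp: weyl_algebra_def\<close>)
  finally show ?case .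
qed

section \<open>Initial ideals are locally constant at generic weights\<close>

text \<open>A leading term for the weight, where ties are allowed only between terms of equal degree and are
  broken by the exponent of \<open>x\<close>.\<close>

definition has_leading :: "((mono \<times> mono) \<Rightarrow> real) \<Rightarrow> weyl \<Rightarrow> mono \<times> mono \<Rightarrow> bool" where
  "has_leading wt P x \<longleftrightarrow> x \<in> keys P \<and>
     (\<forall>y\<in>keys P. y \<noteq> x \<longrightarrow> wt y < wt x \<or> (shift_of y = shift_of x \<and> fst y < fst x))"

definition graded :: "(nat \<Rightarrow> int) set \<Rightarrow> weyl \<Rightarrow> bool" where
  "graded L P \<longleftrightarrow> (\<forall>x\<in>keys P. \<forall>y\<in>keys P. (\<lambda>j. shift_of y j - shift_of x j) \<in> L)"

text \<open>The degrees of two terms of a graded operator differ by an element of \<open>L\<close>.  So terms of equal weight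
  have equal degree if the weight vanishes nowhere on \<open>L - {0}\<close>.\<close>

lemma has_leading_exists:
  assumes "P \<noteq> 0" "graded L P" "keys P \<subseteq> monomials n \<times> monomials n"
    and inj: "\<And>u. u \<in> L \<Longrightarrow> u \<noteq> (\<lambda>_. 0) \<Longrightarrow> (\<Sum>j=1..n. w j * of_int (u j)) \<noteq> 0"
  obtains x where "has_leading (weyl_weight w) P x"
proof -
  let ?wt = "weyl_weight w"
  have ne: "keys P \<noteq> {}" using assms(1) by simp
  define \<mu> where "\<mu> = Max (?wt ` keys P)"
  have \<mu>: "?wt y \<le> \<mu>" if "y \<in> keys P" for y
    unfolding \<mu>_def using that by (intro Max_ge) auto
  define T where "T = {y \<in> keys P. ?wt y = \<mu>}"
  have "\<mu> \<in> ?wt ` keys P" unfolding \<mu>_def using ne by (intro Max_in) auto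
  then have T: "T \<noteq> {}" "finite T" unfolding T_def by auto
  define a where "a = Max (fst ` T)"
  have "a \<in> fst ` T" unfolding a_def using T by (intro Max_in) auto
  then obtain x where x: "x \<in> T" "fst x = a" by auto
  have a: "fst y \<le> a" if "y \<in> T" for y
    unfolding a_def using that T by (intro Max_ge) auto
  have "has_leading ?wt P x"
    unfolding has_leading_def
  proof (intro conjI ballI impI)
    show "x \<in> keys P" using x by (simp add: T_def)
    fix y assume y: "y \<in> keys P" "y \<noteq> x"
    show "?wt y < ?wt x \<or> (shift_of y = shift_of x \<and> fst y < fst x)"
    proof (cases "?wt y < ?wt x")
      case False
      then have eq: "?wt y = ?wt x" "y \<in> T" using \<mu>[OF y(1)] x y by (auto simp: T_def)
      have xk: "x \<in> keys P" using x by (simp add: T_def)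
      define u where "u = (\<lambda>j. shift_of y j - shift_of x j)"
      have "u \<in> L" using assms(2) xk y(1) unfolding graded_def u_def by blast
      moreover have "(\<Sum>j=1..n. w j * of_int (u j)) = ?wt y - ?wt x"
        using assms(3) xk y(1)
        by (subst (1 2) weyl_weight_shift[of _ n])
           (auto simp: u_def algebra_simps sum_subtractf)
      ultimately have "u = (\<lambda>_. 0)" using inj eq(1) by fastforce
      then have s: "shift_of y = shift_of x" by (auto simp: u_def fun_eq_iff)
      then have "fst y \<noteq> fst x" using monomial_pair_eqI y(2) by blast
      then show ?thesis using s a[OF eq(2)] x(2) by auto
    qed simp
  qed
  then show thesis by (rule that)
qed

text \<open>The term \<open>x\<close> leads for both weights, and the initial forms for both weights consist of the terms that
  have the same degree as \<open>x\<close>.\<close>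

definition common_leading ::
    "((mono \<times> mono) \<Rightarrow> real) \<Rightarrow> ((mono \<times> mono) \<Rightarrow> real) \<Rightarrow> weyl \<Rightarrow> mono \<times> mono \<Rightarrow> bool" where
  "common_leading wt wt' P x \<longleftrightarrow> x \<in> keys P \<and>
     (\<forall>y\<in>keys P. y \<noteq> x \<longrightarrow>
        (wt y < wt x \<and> wt' y < wt' x) \<or> (shift_of y = shift_of x \<and> fst y < fst x))"

text \<open>In each product of terms the first term of the Leibniz rule has the largest exponent of \<open>x\<close> among terms
  of equal degree, so it remains to compare these first terms with each other.\<close>

lemma common_leading_mult:
  assumes lead: "common_leading (weyl_weight w) (weyl_weight w') P x"
    and s: "s \<in> monomials n \<times> monomials n" and P: "keys P \<subseteq> monomials n \<times> monomials n"
  shows "common_leading (weyl_weight w) (weyl_weight w') (weyl_mult (single s 1) P) (madd s x)"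
    (is "common_leading ?w ?w' ?Q _")
proof -
  have xk: "x \<in> keys P" using lead by (simp add: common_leading_def)
  have wt: "weyl_weight z r = weyl_weight z s + weyl_weight z t"
    if "r \<in> keys (weyl_mono_mult s t)" "t \<in> keys P" for r t z
    using that s P weyl_mono_mult_keys(4)[OF that(1), of n]
    by (subst (1 2 3) weyl_weight_shift[of _ n])
       (auto simp: weyl_mono_mult_keys(1)[OF that(1)] algebra_simps sum.distrib)
  have top: "madd s t \<in> keys (weyl_mono_mult s t)" for t
    by (simp add: in_keys_iff lookup_weyl_mono_mult_top)
  have rel: "r = madd s x \<and> t = x \<or> (?w r < ?w (madd s x) \<and> ?w' r < ?w' (madd s x)) \<or>
      (shift_of r = shift_of (madd s x) \<and> fst r < fst (madd s x))"
    if r: "r \<in> keys (weyl_mono_mult s t)" and t: "t \<in> keys P" for r t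
  proof (cases "t = x")
    case True
    have "shift_of r = shift_of (madd s x)"
      using weyl_mono_mult_keys(1)[OF r] True by (auto simp: shift_of_madd)
    then show ?thesis using weyl_mono_mult_keys(3)[OF r] True by (auto simp: madd_def)
  next
    case False
    then consider "?w t < ?w x" "?w' t < ?w' x" | "shift_of t = shift_of x" "fst t < fst x"
      using lead t by (auto simp: common_leading_def)
    then show ?thesis
    proof cases
      case 1
      then show ?thesis using wt[OF r t] wt[OF top xk] by auto
    next
      case 2
      have "shift_of r = shift_of (madd s x)"
        using weyl_mono_mult_keys(1)[OF r] 2(1) by (auto simp: shift_of_madd)
      moreover have "fst r \<le> fst s + fst t"
        using weyl_mono_mult_keys(3)[OF r] by (auto simp: madd_def)
      then have "fst r < fst (madd s x)"
        using 2(2) by (auto simp: madd_def intro: le_less_trans)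
      ultimately show ?thesis by simp
    qed
  qed
  have irr: "\<not> ((?w r < ?w r \<and> ?w' r < ?w' r) \<or> (shift_of r = shift_of r \<and> fst r < fst r))" for r
    by simp
  have "lookup ?Q (madd s x) = (\<Sum>t\<in>keys P. if t = x then lookup P x else 0)"
    unfolding lookup_single_weyl_mult
  proof (intro sum.cong refl)
    fix t assume t: "t \<in> keys P"
    have "lookup (weyl_mono_mult s t) (madd s x) = 0" if "t \<noteq> x"
      using rel[OF _ t, of "madd s x"] that by (auto simp: in_keys_iff)
    then show "1 * lookup P t * lookup (weyl_mono_mult s t) (madd s x)
        = (if t = x then lookup P x else 0)"
      by (auto simp: lookup_weyl_mono_mult_top)
  qed
  also have "\<dots> = lookup P x" using xk by simp
  finally have "madd s x \<in> keys ?Q" using xk by (simp add: in_keys_iff)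
  moreover have "(?w r < ?w (madd s x) \<and> ?w' r < ?w' (madd s x)) \<or>
      (shift_of r = shift_of (madd s x) \<and> fst r < fst (madd s x))"
    if r: "r \<in> keys ?Q" "r \<noteq> madd s x" for r
  proof -
    obtain t where "t \<in> keys P" "r \<in> keys (weyl_mono_mult s t)"
      by (rule weyl_mult_single_keys[OF r(1)])
    then show ?thesis using rel[of r t] r(2) by auto
  qed
  ultimately show ?thesis unfolding common_leading_def by blast
qed

lemma graded_single_mult:
  assumes "graded L P"
  shows "graded L (weyl_mult (single s 1) P)"
  unfolding graded_def
proof (intro ballI)
  fix x y assume "x \<in> keys (weyl_mult (single s 1) P)" "y \<in> keys (weyl_mult (single s 1) P)"
  then obtain t t' where *: "t \<in> keys P" "x \<in> keys (weyl_mono_mult s t)"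
      "t' \<in> keys P" "y \<in> keys (weyl_mono_mult s t')"
    by (metis weyl_mult_single_keys)
  have "(\<lambda>j. shift_of y j - shift_of x j) = (\<lambda>j. shift_of t' j - shift_of t j)"
    using weyl_mono_mult_keys(1)[OF *(2)] weyl_mono_mult_keys(1)[OF *(4)] by auto
  then show "(\<lambda>j. shift_of y j - shift_of x j) \<in> L"
    using assms * by (auto simp: graded_def)
qed

lemma bideg_single_mult:
  assumes "\<And>y. y \<in> keys P \<Longrightarrow> bideg y \<le> k" "r \<in> keys (weyl_mult (single s 1) P)"
  shows "bideg r \<le> bideg s + k"
proof -
  obtain t where "t \<in> keys P" "r \<in> keys (weyl_mono_mult s t)"
    by (rule weyl_mult_single_keys[OF assms(2)])
  then show ?thesis using weyl_mono_mult_keys(2)[of r s t] assms(1)[of t] by auto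
qed

text \<open>Initial forms of operators with distinct leading terms cannot cancel.  Therefore the initial form of a
  linear combination is the combination of the initial forms of those summands whose weight is maximal.\<close>

lemma init_form_span:
  fixes wt wt' :: "mono \<times> mono \<Rightarrow> real"
  assumes fin: "finite X" and lead: "\<And>x. x \<in> X \<Longrightarrow> common_leading wt wt' (F x) x"
    and same: "\<And>x y. shift_of x = shift_of y \<Longrightarrow> x \<in> Y \<Longrightarrow> y \<in> Y \<Longrightarrow> wt x = wt y"
    and Y: "\<And>x. x \<in> X \<Longrightarrow> keys (F x) \<subseteq> Y"
    and P: "P = (\<Sum>x\<in>X. weyl_scale (c x) (F x))"
  shows "\<exists>T\<subseteq>X. init_form wt P = (\<Sum>x\<in>T. weyl_scale (c x) (init_form wt (F x)))"
proof -
  define X' where "X' = {x\<in>X. c x \<noteq> 0}"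
  have P': "P = (\<Sum>x\<in>X'. weyl_scale (c x) (F x))"
    unfolding P X'_def using fin
    by (intro sum.mono_neutral_right) (auto simp: weyl_scale_def)
  show ?thesis
  proof (cases "X' = {}")
    case True
    then have "init_form wt P = 0" unfolding P' by (simp add: init_form_def)
    then show ?thesis by (intro exI[of _ "{}"]) auto
  next
    case False
    have fin': "finite X'" using fin by (simp add: X'_def)
    define \<mu> where "\<mu> = Max (wt ` X')"
    have \<mu>: "wt x \<le> \<mu>" if "x \<in> X'" for x
      unfolding \<mu>_def using that fin' by (intro Max_ge) auto
    define T where "T = {x\<in>X'. wt x = \<mu>}"
    have "\<mu> \<in> wt ` X'" unfolding \<mu>_def using False fin' by (intro Max_in) auto
    then have T: "T \<noteq> {}" "finite T" unfolding T_def using fin' by auto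
    have F: "wt y \<le> wt x" if "x \<in> X" "y \<in> keys (F x)" for x y
    proof -
      have "x \<in> Y" "y \<in> Y" using lead[OF that(1)] Y[OF that(1)] that(2)
        by (auto simp: common_leading_def)
      then show ?thesis using lead[OF that(1)] that(2) same[of y x]
        by (fastforce simp: common_leading_def)
    qed
    define a where "a = Max (fst ` T)"
    have "a \<in> fst ` T" unfolding a_def using T by (intro Max_in) auto
    then obtain z where z: "z \<in> T" "fst z = a" by auto
    have a: "fst y \<le> a" if "y \<in> T" for y
      unfolding a_def using that T by (intro Max_ge) auto
    have lookP: "lookup P y = (\<Sum>x\<in>X'. c x * lookup (F x) y)" for y
      unfolding P' by (simp add: lookup_sum lookup_weyl_scale)
    have "lookup P z = (\<Sum>x\<in>X'. if x = z then c z * lookup (F z) z else 0)"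
      unfolding lookP
    proof (intro sum.cong refl)
      fix x assume x: "x \<in> X'"
      then have xX: "x \<in> X" by (simp add: X'_def)
      have "lookup (F x) z = 0" if "x \<noteq> z"
      proof (rule ccontr)
        assume "lookup (F x) z \<noteq> 0"
        then have zk: "z \<in> keys (F x)" by (simp add: in_keys_iff)
        have "wt z \<le> wt x" by (rule F[OF xX zk])
        moreover have "wt z = \<mu>" using z by (simp add: T_def)
        ultimately have "x \<in> T" "\<not> wt z < wt x" using \<mu>[OF x] x by (auto simp: T_def)
        then show False using lead[OF xX] zk that a[of x] z(2)
          by (auto simp: common_leading_def)
      qed
      then show "c x * lookup (F x) z = (if x = z then c z * lookup (F z) z else 0)" by auto
    qed
    also have "\<dots> = c z * lookup (F z) z" using z fin' by (simp add: T_def)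
    also have "\<dots> \<noteq> 0" using z lead[of z] by (auto simp: T_def X'_def common_leading_def in_keys_iff)
    finally have zP: "z \<in> keys P" by (simp add: in_keys_iff)
    have le: "wt y \<le> \<mu>" if y: "y \<in> keys P" for y
    proof -
      have "(\<Sum>x\<in>X'. c x * lookup (F x) y) \<noteq> 0" using y lookP by (simp add: in_keys_iff)
      then obtain x where "x \<in> X'" "c x * lookup (F x) y \<noteq> 0"
        by (meson sum.not_neutral_contains_not_neutral)
      then show ?thesis using F[of x y] \<mu>[of x] by (auto simp: in_keys_iff X'_def)
    qed
    have wz: "wt z = \<mu>" using z by (simp add: T_def)
    have iP: "lookup (init_form wt P) y = (if wt y = \<mu> then lookup P y else 0)" for y
    proof (cases "y \<in> keys P")
      case True
      have "(\<forall>m'\<in>keys P. wt m' \<le> wt y) \<longleftrightarrow> wt y = \<mu>"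
        using le[OF True] le zP wz by force
      then show ?thesis using True by (simp add: lookup_init_form)
    qed (simp add: lookup_init_form in_keys_iff)
    have iF: "lookup (init_form wt (F x)) y = (if wt y = wt x then lookup (F x) y else 0)"
      if xX: "x \<in> X" for x y
    proof (cases "y \<in> keys (F x)")
      case True
      have xk: "x \<in> keys (F x)" using lead[OF xX] by (simp add: common_leading_def)
      have "(\<forall>m'\<in>keys (F x). wt m' \<le> wt y) \<longleftrightarrow> wt x \<le> wt y"
        using xk F[OF xX] order_trans by blast
      also have "\<dots> \<longleftrightarrow> wt y = wt x" using F[OF xX True] by auto
      finally show ?thesis using True by (simp add: lookup_init_form)
    qed (simp add: lookup_init_form in_keys_iff)
    have "init_form wt P = (\<Sum>x\<in>T. weyl_scale (c x) (init_form wt (F x)))"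
    proof (rule poly_mapping_eqI)
      fix y
      have "lookup (init_form wt P) y = (\<Sum>x\<in>X'. c x * (if wt y = \<mu> then lookup (F x) y else 0))"
        by (simp add: iP lookP)
      also have "\<dots> = (\<Sum>x\<in>T. c x * (if wt y = \<mu> then lookup (F x) y else 0))"
      proof (rule sum.mono_neutral_right)
        show "\<forall>x\<in>X' - T. c x * (if wt y = \<mu> then lookup (F x) y else 0) = 0"
        proof
          fix x assume x: "x \<in> X' - T"
          then have "wt x < \<mu>" using \<mu>[of x] by (auto simp: T_def)
          then show "c x * (if wt y = \<mu> then lookup (F x) y else 0) = 0"
            using F[of x y] x
            by (cases "lookup (F x) y = 0") (auto simp: X'_def in_keys_iff)
        qed
      qed (auto simp: T_def fin')
      also have "\<dots> = (\<Sum>x\<in>T. c x * lookup (init_form wt (F x)) y)"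
        by (intro sum.cong refl) (auto simp: T_def X'_def iF)
      finally show "lookup (init_form wt P) y =
          lookup (\<Sum>x\<in>T. weyl_scale (c x) (init_form wt (F x))) y"
        by (simp add: lookup_sum lookup_weyl_scale)
    qed
    then show ?thesis by (intro exI[of _ T]) (auto simp: T_def X'_def)
  qed
qed

lemma init_form_common:
  fixes wt wt' :: "mono \<times> mono \<Rightarrow> real"
  assumes lead: "common_leading wt wt' P x"
    and same: "\<And>y. shift_of y = shift_of x \<Longrightarrow> y \<in> keys P \<Longrightarrow> wt y = wt x"
      "\<And>y. shift_of y = shift_of x \<Longrightarrow> y \<in> keys P \<Longrightarrow> wt' y = wt' x"
  shows "init_form wt P = init_form wt' P"
proof (rule poly_mapping_eqI)
  fix y
  have *: "(wt y < wt x \<and> wt' y < wt' x) \<or> (wt y = wt x \<and> wt' y = wt' x)" if "y \<in> keys P" for y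
    using lead same[of y] that unfolding common_leading_def by metis
  have x: "x \<in> keys P" using lead by (simp add: common_leading_def)
  have "(\<forall>m'\<in>keys P. wt m' \<le> wt y) \<longleftrightarrow> (\<forall>m'\<in>keys P. wt' m' \<le> wt' y)" if "y \<in> keys P"
    using *[OF that] * x by (smt (verit))
  then show "lookup (init_form wt P) y = lookup (init_form wt' P) y"
    by (auto simp: lookup_init_form)
qed

lemma has_leading_common:
  "common_leading wt wt' P x \<Longrightarrow> has_leading wt P x"
  by (auto simp: common_leading_def has_leading_def)

lemma common_leading_sym: "common_leading wt wt' P x \<Longrightarrow> common_leading wt' wt P x"
  by (auto simp: common_leading_def)

lemma weyl_scale_add: "weyl_scale (a + b) P = weyl_scale a P + weyl_scale b P"
  by (rule poly_mapping_eqI) (simp add: lookup_weyl_scale lookup_add algebra_simps)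

lemma finite_bideg: "finite {x \<in> monomials n \<times> monomials n. bideg x \<le> k}"
proof (rule finite_subset)
  show "{x \<in> monomials n \<times> monomials n. bideg x \<le> k} \<subseteq>
      {m \<in> monomials n. mono_deg m \<le> k} \<times> {m \<in> monomials n. mono_deg m \<le> k}"
    by (auto simp: bideg_def)
qed (intro finite_cartesian_product finite_monomials_deg)

lemma weyl_weight_cong:
  assumes "shift_of x = shift_of y" "x \<in> monomials n \<times> monomials n" "y \<in> monomials n \<times> monomials n"
  shows "weyl_weight w x = weyl_weight w y"
  using assms(1) by (simp add: weyl_weight_shift[OF assms(2)] weyl_weight_shift[OF assms(3)])

text \<open>Division inside one piece of the filtration.  If \<open>T\<close> contains the leading terms of all graded elements
  of \<open>H\<close> in this piece, then subtracting a multiple of \<open>F x\<close> from such an element with leading term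
  \<open>x\<close> leaves an element with smaller terms, and this ends because the piece is finite.  An arbitrary
  element of \<open>H\<close> is the sum of its graded components.\<close>

lemma span_of_leading_terms:
  fixes w :: "nat \<Rightarrow> real"
  assumes H: "H = left_ideal n G0" "H \<subseteq> weyl_algebra n"
    and graded_part: "\<And>P d. P \<in> H \<Longrightarrow> graded_part L d P \<in> H"
    and L: "(\<lambda>_. 0) \<in> L" "\<And>u v. u \<in> L \<Longrightarrow> v \<in> L \<Longrightarrow> (\<lambda>j. u j - v j) \<in> L"
    and inj: "\<And>u. u \<in> L \<Longrightarrow> u \<noteq> (\<lambda>_. 0) \<Longrightarrow> (\<Sum>j=1..n. w j * of_int (u j)) \<noteq> 0"
    and T: "finite T"
    and F: "\<And>x. x \<in> T \<Longrightarrow> F x \<in> H \<and> graded L (F x) \<and> has_leading (weyl_weight w) (F x) x \<and>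
        (\<forall>y\<in>keys (F x). bideg y \<le> k)"
    and T_leading: "\<And>P x. P \<in> H \<Longrightarrow> graded L P \<Longrightarrow> has_leading (weyl_weight w) P x \<Longrightarrow>
        (\<forall>y\<in>keys P. bideg y \<le> k) \<Longrightarrow> x \<in> T"
    and P: "P \<in> H" "\<forall>y\<in>keys P. bideg y \<le> k"
  shows "\<exists>c. P = (\<Sum>x\<in>T. weyl_scale (c x) (F x))"
proof -
  let ?wt = "weyl_weight w"
  define less where "less = (\<lambda>z y. ?wt z < ?wt y \<or> (shift_of z = shift_of y \<and> fst z < fst y))"
  let ?M = "monomials n \<times> monomials n"
  define X where "X = {x \<in> ?M. bideg x \<le> k}"
  have finX: "finite X" unfolding X_def by (rule finite_bideg)
  have keysX: "y \<in> X" if "P \<in> H" "\<forall>y\<in>keys P. bideg y \<le> k" "y \<in> keys P" for P y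
    using that H(2) by (auto simp: X_def weyl_algebra_def)
  have trans: "less x z" if "less x y" "less y z" "x \<in> X" "y \<in> X" "z \<in> X" for x y z
  proof -
    have "shift_of a = shift_of b \<longrightarrow> ?wt a = ?wt b" if "a \<in> X" "b \<in> X" for a b
      using that weyl_weight_cong[of a b n w] by (simp add: X_def)
    then show ?thesis using that unfolding less_def by (metis order_less_trans)
  qed
  have irrefl: "\<not> less x x" for x by (simp add: less_def)
  \<comment> \<open>The exponents at or below some term of \<open>P\<close>: this set shrinks when the leading term is cancelled.\<close>
  define D where "D = (\<lambda>P :: weyl. {z \<in> X. \<exists>y\<in>keys P. z = y \<or> less z y})"
  have graded_case: "\<exists>c. P = (\<Sum>x\<in>T. weyl_scale (c x) (F x))"
    if "P \<in> H" "graded L P" "\<forall>y\<in>keys P. bideg y \<le> k" for P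
    using that
  proof (induction "card (D P)" arbitrary: P rule: less_induct)
    case less
    note PH = less.prems(1) and Pg = less.prems(2) and Pk = less.prems(3)
    show ?case
    proof (cases "P = 0")
      case True
      have "P = (\<Sum>x\<in>T. weyl_scale 0 (F x))" by (simp add: weyl_scale_def True)
      then show ?thesis by (rule exI[of _ "\<lambda>_. 0"])
    next
      case False
      have "keys P \<subseteq> ?M" using PH H(2) by (auto simp: weyl_algebra_def)
      then obtain x where x: "has_leading ?wt P x"
        using has_leading_exists[OF False Pg _ inj] by blast
      have xT: "x \<in> T" by (rule T_leading[OF PH Pg x Pk])
      have Fx: "F x \<in> H" "graded L (F x)" "has_leading ?wt (F x) x" "\<forall>y\<in>keys (F x). bideg y \<le> k"
        using F[OF xT] by auto
      have xP: "x \<in> keys P" and xF: "x \<in> keys (F x)"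
        using x Fx(3) by (auto simp: has_leading_def)
      define a where "a = lookup P x / lookup (F x) x"
      define Q where "Q = P + weyl_scale (- a) (F x)"
      have lookQ: "lookup Q y = lookup P y - a * lookup (F x) y" for y
        by (simp add: Q_def lookup_add lookup_weyl_scale)
      have QH: "Q \<in> H" using PH Fx(1) left_ideal.add left_ideal_scale unfolding H(1) Q_def by blast
      have Qx: "x \<notin> keys Q" using xF by (simp add: in_keys_iff lookQ a_def)
      have Qkeys: "y \<in> keys P \<or> y \<in> keys (F x)" if "y \<in> keys Q" for y
        using that by (auto simp: in_keys_iff lookQ)
      have Qk: "\<forall>y\<in>keys Q. bideg y \<le> k" using Qkeys Pk Fx(4) by blast
      have Qless: "less y x" if "y \<in> keys Q" for y
        using Qkeys[OF that] Qx that x Fx(3) unfolding has_leading_def less_def by metis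
      have Qg: "graded L Q"
        unfolding graded_def
      proof (intro ballI)
        fix y z assume yz: "y \<in> keys Q" "z \<in> keys Q"
        have *: "(\<lambda>j. shift_of y j - shift_of x j) \<in> L" if "y \<in> keys Q" for y
          using Qkeys[OF that] Pg Fx(2) xP xF by (auto simp: graded_def)
        show "(\<lambda>j. shift_of z j - shift_of y j) \<in> L"
          using L(2)[OF *[OF yz(2)] *[OF yz(1)]] by simp
      qed
      have "D Q \<subset> D P"
      proof
        show "D Q \<subseteq> D P"
        proof
          fix z assume "z \<in> D Q"
          then obtain y where zy: "z \<in> X" "y \<in> keys Q" "z = y \<or> less z y" by (auto simp: D_def)
          have "less z x"
            using zy Qless[OF zy(2)] trans[of z y x] keysX[OF QH Qk] keysX[OF PH Pk xP] by blast
          then show "z \<in> D P" using zy(1) xP by (auto simp: D_def)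
        qed
        have "x \<in> D P" using keysX[OF PH Pk xP] xP by (auto simp: D_def)
        moreover have "x \<notin> D Q"
        proof
          assume "x \<in> D Q"
          then obtain y where y: "y \<in> keys Q" "x = y \<or> less x y" by (auto simp: D_def)
          then have "less x x"
            using Qless[OF y(1)] trans[of x y x] keysX[OF QH Qk y(1)] keysX[OF PH Pk xP] by blast
          then show False using irrefl by blast
        qed
        ultimately show "D Q \<noteq> D P" by blast
      qed
      then have "card (D Q) < card (D P)"
        by (rule psubset_card_mono[rotated]) (simp add: D_def finX)
      from less.hyps[OF this QH Qg Qk] obtain c where c: "Q = (\<Sum>z\<in>T. weyl_scale (c z) (F z))"
        by blast
      have "(\<Sum>z\<in>T. weyl_scale (if z = x then a else 0) (F z)) = weyl_scale a (F x)"
      proof -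
        have "(\<Sum>z\<in>T. weyl_scale (if z = x then a else 0) (F z)) =
            (\<Sum>z\<in>T. if z = x then weyl_scale a (F x) else 0)"
          by (intro sum.cong refl) (simp add: weyl_scale_def)
        then show ?thesis using T xT by simp
      qed
      moreover have "P = Q + weyl_scale a (F x)"
        by (rule poly_mapping_eqI) (simp add: lookQ lookup_add lookup_weyl_scale)
      ultimately have "P = (\<Sum>z\<in>T. weyl_scale (c z + (if z = x then a else 0)) (F z))"
        by (simp add: weyl_scale_add sum.distrib c)
      then show ?thesis by (rule exI[of _ "\<lambda>z. c z + (if z = x then a else 0)"])
    qed
  qed
  show ?thesis using P
  proof (induction "card (keys P)" arbitrary: P rule: less_induct)
    case less
    show ?case
    proof (cases "P = 0")
      case True
      have "P = (\<Sum>x\<in>T. weyl_scale 0 (F x))" by (simp add: weyl_scale_def True)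
      then show ?thesis by (rule exI[of _ "\<lambda>_. 0"])
    next
      case False
      then obtain x where x: "x \<in> keys P" by (metis all_not_in_conv keys_eq_empty)
      define Q where "Q = graded_part L (shift_of x) P"
      define R where "R = P + weyl_scale (-1) Q"
      have QH: "Q \<in> H" unfolding Q_def by (rule graded_part[OF less.prems(1)])
      have lookQ: "lookup Q y = (if (\<lambda>j. shift_of y j - shift_of x j) \<in> L then lookup P y else 0)" for y
        by (simp add: Q_def lookup_graded_part)
      have lookR: "lookup R y = (if (\<lambda>j. shift_of y j - shift_of x j) \<in> L then 0 else lookup P y)" for y
        by (simp add: R_def lookup_add lookup_weyl_scale lookQ)
      have kQ: "keys Q \<subseteq> keys P" by (auto simp: in_keys_iff lookQ split: if_splits)
      have kR: "keys R \<subseteq> keys P" by (auto simp: in_keys_iff lookR split: if_splits)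
      have xR: "x \<notin> keys R" using L(1) by (simp add: in_keys_iff lookR)
      have "card (keys R) < card (keys P)"
        using kR xR x by (intro psubset_card_mono) auto
      moreover have "R \<in> H"
        using less.prems(1) QH left_ideal.add left_ideal_scale unfolding H(1) R_def by blast
      ultimately obtain c where c: "R = (\<Sum>x\<in>T. weyl_scale (c x) (F x))"
        using less.hyps[of R] kR less.prems(2) by blast
      have "graded L Q"
        unfolding graded_def
      proof (intro ballI)
        fix y z assume yz: "y \<in> keys Q" "z \<in> keys Q"
        have "(\<lambda>j. shift_of y j - shift_of x j) \<in> L" "(\<lambda>j. shift_of z j - shift_of x j) \<in> L"
          using yz by (auto simp: in_keys_iff lookQ split: if_splits)
        then show "(\<lambda>j. shift_of z j - shift_of y j) \<in> L"
          using L(2)[of "\<lambda>j. shift_of z j - shift_of x j" "\<lambda>j. shift_of y j - shift_of x j"] by simp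
      qed
      then obtain d where d: "Q = (\<Sum>x\<in>T. weyl_scale (d x) (F x))"
        using graded_case[OF QH] kQ less.prems(2) by blast
      have "P = R + Q" by (rule poly_mapping_eqI) (simp add: lookR lookQ lookup_add)
      then have "P = (\<Sum>x\<in>T. weyl_scale (c x + d x) (F x))"
        by (simp add: c d weyl_scale_add sum.distrib)
      then show ?thesis by (rule exI[of _ "\<lambda>x. c x + d x"])
    qed
  qed
qed

text \<open>The bound \<open>k\<close> on the total degree is part of the data, since division has to respect the filtration:
  the leading term of an operator need not have the largest total degree.\<close>

definition leading_data :: "(nat \<Rightarrow> int) set \<Rightarrow> (nat \<Rightarrow> real) \<Rightarrow> weyl set \<Rightarrow> (weyl \<times> (mono \<times> mono) \<times> nat) set" where
  "leading_data L w H = {(P, x, k). P \<in> H \<and> graded L P \<and> has_leading (weyl_weight w) P x \<and>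
     (\<forall>y\<in>keys P. bideg y \<le> k)}"

text \<open>Dickson's lemma for the exponents of the leading term together with one more coordinate, the slack
  \<open>k - bideg x\<close>.  The slack ensures that the multiple of a basis operator that has the leading term
  \<open>x\<close> stays in the filtered piece of bound \<open>k\<close>.\<close>

lemma leading_data_finite_basis:
  assumes "H \<subseteq> weyl_algebra n"
  obtains B where "finite B" "B \<subseteq> leading_data L w H"
    "\<And>P x k. (P, x, k) \<in> leading_data L w H \<Longrightarrow>
      \<exists>Q s k'. (Q, s, k') \<in> B \<and> (\<exists>t\<in>monomials n \<times> monomials n. x = madd t s \<and> bideg t + k' \<le> k)"
proof -
  define f :: "weyl \<times> (mono \<times> mono) \<times> nat \<Rightarrow> nat \<times> nat \<Rightarrow> nat" where
    "f = (\<lambda>(P, x, k) (i, j). if i = 0 then lookup (fst x) j else if i = 1 then lookup (snd x) j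
        else k - bideg x)"
  let ?J = "{0, 1, 2} \<times> {1..n} \<union> {(2, 0)}"
  have "finite ?J" by simp
  then obtain B where B: "B \<subseteq> leading_data L w H" "finite B"
    "\<forall>t\<in>leading_data L w H. \<exists>b\<in>B. \<forall>j\<in>?J. f b j \<le> f t j"
    using dickson[of ?J "leading_data L w H" f] by metis
  show thesis
  proof (rule that[OF B(2) B(1)])
    fix P x k assume D: "(P, x, k) \<in> leading_data L w H"
    obtain Q y k' where b: "(Q, y, k') \<in> B" "\<forall>j\<in>?J. f (Q, y, k') j \<le> f (P, x, k) j"
      using B(3) D by (metis prod_cases3)
    have mem: "z \<in> monomials n \<times> monomials n \<and> bideg z \<le> l" if "(R, z, l) \<in> leading_data L w H" for R z l
      using that assms by (auto simp: leading_data_def has_leading_def weyl_algebra_def)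
    have xM: "x \<in> monomials n \<times> monomials n" "bideg x \<le> k" using mem[OF D] by auto
    have yM: "y \<in> monomials n \<times> monomials n" "bideg y \<le> k'" using mem[of Q y k'] b(1) B(1) by blast+
    have 1: "mono_dvd (fst y) (fst x)"
      unfolding mono_dvd_def
    proof
      fix j show "lookup (fst y) j \<le> lookup (fst x) j"
      proof (cases "j \<in> {1..n}")
        case True
        then have "(0, j) \<in> ?J" by simp
        from bspec[OF b(2) this] show ?thesis by (simp add: f_def)
      next
        case False
        have "fst y \<in> monomials n" using yM by auto
        then show ?thesis using monomials_lookup_outside[OF _ False] by simp
      qed
    qed
    have 2: "mono_dvd (snd y) (snd x)"
      unfolding mono_dvd_def
    proof
      fix j show "lookup (snd y) j \<le> lookup (snd x) j"
      proof (cases "j \<in> {1..n}")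
        case True
        then have "(1, j) \<in> ?J" by simp
        from bspec[OF b(2) this] show ?thesis by (simp add: f_def)
      next
        case False
        have "snd y \<in> monomials n" using yM by auto
        then show ?thesis using monomials_lookup_outside[OF _ False] by simp
      qed
    qed
    have 3: "k' - bideg y \<le> k - bideg x"
      using bspec[OF b(2), of "(2, 0)"] by (simp add: f_def)
    obtain p where p: "fst x = fst y + p" using 1 mono_dvd_iff by blast
    obtain q where q: "snd x = snd y + q" using 2 mono_dvd_iff by blast
    have xt: "x = madd (p, q) y" by (intro prod_eqI) (simp_all add: madd_def p q add.commute)
    have "fst y + p \<in> monomials n" "snd y + q \<in> monomials n"
      using xM(1) p q by (metis SigmaE fst_conv snd_conv)+
    then have "(p, q) \<in> monomials n \<times> monomials n" by (simp add: monomials_add)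
    moreover have "bideg (p, q) + k' \<le> k"
      using 3 xM(2) yM(2) xt bideg_madd[of "(p, q)" y] by simp
    ultimately show "\<exists>Q s k'. (Q, s, k') \<in> B \<and>
        (\<exists>t\<in>monomials n \<times> monomials n. x = madd t s \<and> bideg t + k' \<le> k)"
      using b(1) xt by blast
  qed
qed

text \<open>Take finitely many operators in the ideal whose leading terms divide all others, within the
  filtration.  The strict inequalities by which these finitely many operators have their leading terms
  hold in a neighbourhood \<open>W\<close> of \<open>w\<close>.  For \<open>w'\<close> in \<open>W\<close>, every leading term for \<open>w\<close> is
  then a common leading term for \<open>w\<close> and \<open>w'\<close> of some element of the ideal.  These elements span
  the ideal, and their initial forms for \<open>w\<close> and \<open>w'\<close> agree; so do the initial ideals.\<close>

theorem generic_weight_in_interior_of_cell: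
  fixes w :: "nat \<Rightarrow> real"
  assumes G0: "G0 \<subseteq> weyl_algebra n"
    and gen: "\<And>g d. g \<in> G0 \<Longrightarrow> graded_part L d g \<in> left_ideal n G0"
    and L: "(\<lambda>_. 0) \<in> L" "\<And>u v. u \<in> L \<Longrightarrow> v \<in> L \<Longrightarrow> (\<lambda>j. u j - v j) \<in> L"
    and inj: "\<And>u. u \<in> L \<Longrightarrow> u \<noteq> (\<lambda>_. 0) \<Longrightarrow> (\<Sum>j=1..n. w j * of_int (u j)) \<noteq> 0"
  shows "w \<in> interior (small_groebner_cell n (left_ideal n G0) w)"
proof -
  define H where "H = left_ideal n G0"
  let ?M = "monomials n \<times> monomials n"
  have HW: "H \<subseteq> weyl_algebra n" unfolding H_def by (rule left_ideal_subset_weyl[OF G0])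
  have gp: "graded_part L d P \<in> H" if "P \<in> H" for P d
    using graded_part_in_left_ideal[OF gen] that unfolding H_def by blast
  obtain B where B: "finite B" "B \<subseteq> leading_data L w H"
    "\<And>P x k. (P, x, k) \<in> leading_data L w H \<Longrightarrow>
      \<exists>Q s k'. (Q, s, k') \<in> B \<and> (\<exists>t\<in>?M. x = madd t s \<and> bideg t + k' \<le> k)"
    using leading_data_finite_basis[OF HW] by metis
  \<comment> \<open>Terms of equal degree have equal weight in every direction, so only the others impose a condition.\<close>
  define W where "W = {w'. \<forall>(P, x, k)\<in>B. \<forall>y\<in>keys P. shift_of y \<noteq> shift_of x \<longrightarrow>
      weyl_weight w' y < weyl_weight w' x}"
  have "open W"
  proof -
    have cont: "continuous_on UNIV (\<lambda>w'. weyl_weight w' x)" for x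
      unfolding weyl_weight_def weight_def
      by (intro continuous_intros continuous_on_product_coordinates)
    have "W = (\<Inter>b\<in>B. \<Inter>y\<in>{y \<in> keys (fst b). shift_of y \<noteq> shift_of (fst (snd b))}.
        {w'. weyl_weight w' y < weyl_weight w' (fst (snd b))})"
      unfolding W_def by fastforce
    also have "open \<dots>"
      by (intro open_INT B(1) ballI open_Collect_less cont) auto
    finally show ?thesis .
  qed
  moreover have "w \<in> W"
    unfolding W_def using B(2) by (auto simp: leading_data_def has_leading_def)
  moreover have "W \<subseteq> small_groebner_cell n H w"
  proof
    fix w' assume w': "w' \<in> W"
    have lead: "\<exists>F. F \<in> H \<and> graded L F \<and> common_leading (weyl_weight w) (weyl_weight w') F x \<and>
        (\<forall>y\<in>keys F. bideg y \<le> k)" if D: "(P, x, k) \<in> leading_data L w H" for P x k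
    proof -
      obtain Q s k' t where Q: "(Q, s, k') \<in> B" "t \<in> ?M" "x = madd t s" "bideg t + k' \<le> k"
        using B(3)[OF D] by blast
      have QD: "Q \<in> H" "graded L Q" "has_leading (weyl_weight w) Q s" "\<forall>y\<in>keys Q. bideg y \<le> k'"
        using B(2) Q(1) by (auto simp: leading_data_def)
      have "weyl_weight w' y < weyl_weight w' s" if "y \<in> keys Q" "shift_of y \<noteq> shift_of s" for y
        using w' Q(1) that unfolding W_def by blast
      then have c: "common_leading (weyl_weight w) (weyl_weight w') Q s"
        unfolding common_leading_def
      proof (intro conjI ballI impI)
        show "s \<in> keys Q" using QD(3) by (simp add: has_leading_def)
        fix y assume y: "y \<in> keys Q" "y \<noteq> s"
        have "s \<in> ?M" "y \<in> ?M"
          using QD(1) HW y(1) \<open>s \<in> keys Q\<close> by (auto simp: weyl_algebra_def)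
        then have "weyl_weight w y = weyl_weight w s" if "shift_of y = shift_of s"
          using weyl_weight_cong that by blast
        moreover have "weyl_weight w y < weyl_weight w s \<or> shift_of y = shift_of s \<and> fst y < fst s"
          using QD(3) y by (simp add: has_leading_def)
        ultimately show "weyl_weight w y < weyl_weight w s \<and> weyl_weight w' y < weyl_weight w' s \<or>
            shift_of y = shift_of s \<and> fst y < fst s"
          using \<open>\<And>y. y \<in> keys Q \<Longrightarrow> shift_of y \<noteq> shift_of s \<Longrightarrow> weyl_weight w' y < weyl_weight w' s\<close> y(1)
          by (cases "shift_of y = shift_of s") auto
      qed
      show ?thesis
      proof (intro exI[of _ "weyl_mult (single t 1) Q"] conjI ballI)
        show "weyl_mult (single t 1) Q \<in> H"
          using QD(1) Q(2) unfolding H_def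
          by (intro left_ideal.mult) (simp_all add: weyl_algebra_def)
        show "graded L (weyl_mult (single t 1) Q)" by (rule graded_single_mult[OF QD(2)])
        show "common_leading (weyl_weight w) (weyl_weight w') (weyl_mult (single t 1) Q) x"
          unfolding Q(3) using QD(1) HW weyl_algebra_def
          by (intro common_leading_mult[OF c Q(2)]) blast
        fix y assume "y \<in> keys (weyl_mult (single t 1) Q)"
        then show "bideg y \<le> k"
          using bideg_single_mult[of Q k' y t] QD(4) Q(4) by force
      qed
    qed
    have span: "\<exists>T F c. finite T \<and> P = (\<Sum>x\<in>T. weyl_scale (c x) (F x)) \<and>
        (\<forall>x\<in>T. F x \<in> H \<and> common_leading (weyl_weight w) (weyl_weight w') (F x) x)"
      if P: "P \<in> H" for P
    proof -
      define k where "k = Max (insert 0 (bideg ` keys P))"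
      have k: "\<forall>y\<in>keys P. bideg y \<le> k" unfolding k_def by auto
      define T where "T = {x. \<exists>P. (P, x, k) \<in> leading_data L w H}"
      have "T \<subseteq> {x \<in> ?M. bideg x \<le> k}"
        using HW unfolding T_def leading_data_def has_leading_def weyl_algebra_def by blast
      then have T: "finite T" by (rule finite_subset[OF _ finite_bideg])
      have "\<forall>x\<in>T. \<exists>F. F \<in> H \<and> graded L F \<and> common_leading (weyl_weight w) (weyl_weight w') F x \<and>
          (\<forall>y\<in>keys F. bideg y \<le> k)"
        unfolding T_def using lead by blast
      then obtain F where F: "\<And>x. x \<in> T \<Longrightarrow> F x \<in> H \<and> graded L (F x) \<and>
          common_leading (weyl_weight w) (weyl_weight w') (F x) x \<and> (\<forall>y\<in>keys (F x). bideg y \<le> k)"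
        by metis
      have F': "F x \<in> H \<and> graded L (F x) \<and> has_leading (weyl_weight w) (F x) x \<and>
          (\<forall>y\<in>keys (F x). bideg y \<le> k)" if "x \<in> T" for x
        using F[OF that] has_leading_common by blast
      have "\<exists>c. P = (\<Sum>x\<in>T. weyl_scale (c x) (F x))"
        by (rule span_of_leading_terms[OF H_def HW gp L inj T F' _ P k])
           (auto simp: T_def leading_data_def)
      then show ?thesis using T F by blast
    qed
    have same: "weyl_weight v x = weyl_weight v y"
      if "shift_of x = shift_of y" "x \<in> ?M" "y \<in> ?M" for v x y
      using weyl_weight_cong that by blast
    \<comment> \<open>The roles of the two directions are symmetric, so both inclusions are proved at once.\<close>
    have init: "init_form (weyl_weight v) P \<in> left_ideal n (init_form (weyl_weight v') ` H)"
      if P: "P \<in> H" and v: "v = w \<and> v' = w' \<or> v = w' \<and> v' = w" for P v v'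
    proof -
      obtain T F c where T: "finite T" "P = (\<Sum>x\<in>T. weyl_scale (c x) (F x))"
        "\<And>x. x \<in> T \<Longrightarrow> F x \<in> H"
        "\<And>x. x \<in> T \<Longrightarrow> common_leading (weyl_weight w) (weyl_weight w') (F x) x"
        using span[OF P] by blast
      have FM: "keys (F x) \<subseteq> ?M" if "x \<in> T" for x
        using T(3)[OF that] HW by (auto simp: weyl_algebra_def)
      have cl: "common_leading (weyl_weight v) (weyl_weight v') (F x) x" if "x \<in> T" for x
        using T(4)[OF that] v common_leading_sym by blast
      obtain T' where T': "T' \<subseteq> T"
        "init_form (weyl_weight v) P = (\<Sum>x\<in>T'. weyl_scale (c x) (init_form (weyl_weight v) (F x)))"
        using init_form_span[OF T(1) cl same FM T(2)] by blast
      have "init_form (weyl_weight v) (F x) = init_form (weyl_weight v') (F x)" if x: "x \<in> T" for x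
      proof (rule init_form_common[OF cl[OF x]])
        have xM: "x \<in> ?M" using cl[OF x] FM[OF x] by (auto simp: common_leading_def)
        show "weyl_weight v y = weyl_weight v x" if "shift_of y = shift_of x" "y \<in> keys (F x)" for y
          using same[OF that(1)] FM[OF x] that(2) xM by blast
        show "weyl_weight v' y = weyl_weight v' x" if "shift_of y = shift_of x" "y \<in> keys (F x)" for y
          using same[OF that(1)] FM[OF x] that(2) xM by blast
      qed
      then show ?thesis
        unfolding T'(2) using T' T(3)
        by (intro left_ideal_sum left_ideal_scale left_ideal.gen) auto
    qed
    have "weyl_in_ideal n w' H = weyl_in_ideal n w H"
      unfolding weyl_in_ideal_def
      by (intro equalityI left_ideal_least subsetI) (auto intro: init)
    then show "w' \<in> small_groebner_cell n H w" by (simp add: small_groebner_cell_def)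
  qed
  ultimately show ?thesis unfolding H_def by (rule interiorI)
qed

section \<open>Grading of the hypergeometric ideal\<close>

lemma lookup_pos_part: "lookup (pos_part n u) j = (if j \<in> {1..n} then nat (u j) else 0)"
  unfolding pos_part_def by (simp add: lookup_sum lookup_single when_def sum.delta)

lemma lookup_neg_part: "lookup (neg_part n u) j = (if j \<in> {1..n} then nat (- u j) else 0)"
  unfolding neg_part_def by (simp add: lookup_sum lookup_single when_def sum.delta)

lemma pos_part_monomials: "pos_part n u \<in> monomials n"
  by (auto simp: monomials_def in_keys_iff lookup_pos_part split: if_splits)

lemma neg_part_monomials: "neg_part n u \<in> monomials n"
  by (auto simp: monomials_def in_keys_iff lookup_neg_part split: if_splits)

lemma binom_polys: "binom n u \<in> polys n"
  unfolding binom_def by (intro polys_diff polys_single pos_part_monomials neg_part_monomials)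

lemma toric_gens_polys: "binom n ` toric_lattice n d A \<subseteq> polys n"
  using binom_polys by blast

lemma toric_lattice_0: "(\<lambda>_. 0) \<in> toric_lattice n d A"
  by (simp add: toric_lattice_def)

lemma toric_lattice_diff:
  "u \<in> toric_lattice n d A \<Longrightarrow> v \<in> toric_lattice n d A \<Longrightarrow> (\<lambda>j. u j - v j) \<in> toric_lattice n d A"
  by (auto simp: toric_lattice_def algebra_simps sum_subtractf)

text \<open>The component of \<open>f\<close> in the class of \<open>d\<close>, for the grading by \<open>\<int>\<^sup>n / L\<close>.\<close>

definition poly_part :: "(nat \<Rightarrow> int) set \<Rightarrow> (nat \<Rightarrow> int) \<Rightarrow> cpoly \<Rightarrow> cpoly" where
  "poly_part L d f =
     (\<Sum>m\<in>{m \<in> keys f. (\<lambda>j. int (lookup m j) - d j) \<in> L}. single m (lookup f m))"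

lemma lookup_poly_part:
  "lookup (poly_part L d f) m = (if (\<lambda>j. int (lookup m j) - d j) \<in> L then lookup f m else 0)"
  unfolding poly_part_def by (subst lookup_sum_single) (auto simp: in_keys_iff)

lemma poly_part_add: "poly_part L d (f + g) = poly_part L d f + poly_part L d g"
  by (rule poly_mapping_eqI) (simp add: lookup_poly_part lookup_add)

lemma poly_part_sum: "poly_part L d (sum f I) = (\<Sum>i\<in>I. poly_part L d (f i))"
  by (rule poly_mapping_eqI) (simp add: lookup_poly_part lookup_sum)

lemma poly_part_single_mult:
  "poly_part L d (single m c * f) = single m c * poly_part L (\<lambda>j. d j - int (lookup m j)) f"
proof (rule poly_mapping_eqI)
  fix k
  show "lookup (poly_part L d (single m c * f)) k =
      lookup (single m c * poly_part L (\<lambda>j. d j - int (lookup m j)) f) k"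
  proof (cases "mono_dvd m k")
    case True
    then obtain k' where "k = m + k'" using mono_dvd_iff by blast
    then have "(\<lambda>j. int (lookup (k - m) j) - (d j - int (lookup m j))) =
        (\<lambda>j. int (lookup k j) - d j)"
      by (simp add: lookup_add fun_eq_iff)
    then show ?thesis using True by (simp add: lookup_poly_part lookup_single_mult)
  qed (simp add: lookup_poly_part lookup_single_mult)
qed

lemma poly_expand_mult: "x * f = (\<Sum>m\<in>keys x. single m (lookup x m) * f)"
  for x f :: cpoly
  by (simp add: sum_distrib_right[symmetric] sum_single_keys)

lemma poly_part_binom:
  assumes u: "u \<in> toric_lattice n d A"
  shows "poly_part (toric_lattice n d A) e (binom n u) =
    (if (\<lambda>j. int (lookup (pos_part n u) j) - e j) \<in> toric_lattice n d A then binom n u else 0)"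
proof -
  let ?L = "toric_lattice n d A"
  have eq: "(\<lambda>j. int (lookup (pos_part n u) j) - e j) = 
      (\<lambda>j. (int (lookup (neg_part n u) j) - e j) - (0 - u j))"
    using u by (auto simp: fun_eq_iff lookup_pos_part lookup_neg_part toric_lattice_def)
  have eq': "(\<lambda>j. int (lookup (neg_part n u) j) - e j) = 
      (\<lambda>j. (int (lookup (pos_part n u) j) - e j) - u j)"
    using u by (auto simp: fun_eq_iff lookup_pos_part lookup_neg_part toric_lattice_def)
  have mu: "(\<lambda>j. 0 - u j) \<in> ?L" using toric_lattice_diff[OF toric_lattice_0 u] .
  have iff: "(\<lambda>j. int (lookup (pos_part n u) j) - e j) \<in> ?L \<longleftrightarrow>
      (\<lambda>j. int (lookup (neg_part n u) j) - e j) \<in> ?L"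
  proof
    assume "(\<lambda>j. int (lookup (pos_part n u) j) - e j) \<in> ?L"
    then show "(\<lambda>j. int (lookup (neg_part n u) j) - e j) \<in> ?L"
      by (subst eq') (rule toric_lattice_diff[OF _ u])
  next
    assume "(\<lambda>j. int (lookup (neg_part n u) j) - e j) \<in> ?L"
    then show "(\<lambda>j. int (lookup (pos_part n u) j) - e j) \<in> ?L"
      by (subst eq) (rule toric_lattice_diff[OF _ mu])
  qed
  show ?thesis
    by (rule poly_mapping_eqI)
       (auto simp: lookup_poly_part binom_def lookup_minus lookup_single when_def iff)
qed

lemma toric_ideal_graded:
  assumes "f \<in> toric_ideal n d A"
  shows "poly_part (toric_lattice n d A) e f \<in> toric_ideal n d A"
proof -
  let ?L = "toric_lattice n d A"
  let ?I = "toric_ideal n d A"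
  note gens = toric_gens_polys[of n d A]
  have I: "?I \<subseteq> polys n" unfolding toric_ideal_def by (rule genideal_subset_polys[OF gens])
  have "?I \<subseteq> {f \<in> polys n. \<forall>e. poly_part ?L e f \<in> ?I}" (is "_ \<subseteq> ?T")
    unfolding toric_ideal_def[of n d A]
  proof (rule genideal_least[OF gens], fold toric_ideal_def)
    show "binom n ` ?L \<subseteq> ?T"
    proof safe
      fix u e assume u: "u \<in> ?L"
      show "binom n u \<in> polys n" by (rule binom_polys)
      note poly_part_binom[OF u, of e]
      moreover have "binom n u \<in> ?I" "0 \<in> ?I"
        unfolding toric_ideal_def using genideal_gen[OF gens] genideal_0[OF gens] u by auto
      ultimately show "poly_part ?L e (binom n u) \<in> ?I" by simp
    qed
    have "0 \<in> ?I" unfolding toric_ideal_def by (rule genideal_0[OF gens])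
    moreover have "poly_part ?L e 0 = 0" for e by (simp add: poly_part_def)
    ultimately show "0 \<in> ?T" by (simp add: polys_0)
    show "a + b \<in> ?T" if "a \<in> ?T" "b \<in> ?T" for a b
      using that genideal_add[OF gens] by (auto simp: poly_part_add polys_add toric_ideal_def)
    show "x * a \<in> ?T" if a: "a \<in> ?T" and x: "x \<in> polys n" for a x
    proof (rule CollectI, intro conjI allI)
      show "x * a \<in> polys n" using that by (simp add: polys_mult)
      fix e
      have "poly_part ?L e (x * a) =
          (\<Sum>m\<in>keys x. single m (lookup x m) * poly_part ?L (\<lambda>j. e j - int (lookup m j)) a)"
        by (subst poly_expand_mult) (simp add: poly_part_sum poly_part_single_mult)
      also have "\<dots> \<in> ?I"
        unfolding toric_ideal_def
      proof (intro genideal_sum[OF gens] genideal_mult[OF gens])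
        fix m assume "m \<in> keys x"
        then show "single m (lookup x m) \<in> polys n" using x by (auto simp: polys_def)
        show "poly_part ?L (\<lambda>j. e j - int (lookup m j)) a \<in> genideal (mpoly_ring n) (binom n ` ?L)"
          using a by (simp add: toric_ideal_def)
      qed
      finally show "poly_part ?L e (x * a) \<in> ?I" .
    qed
  qed auto
  then show ?thesis using assms by blast
qed

lemma lookup_diff_op: "lookup (diff_op f) (a, b) = (if a = 0 then lookup f b else 0)"
proof -
  have "lookup (diff_op f) (a, b) = (\<Sum>m\<in>keys f. if m = b then (if a = 0 then lookup f b else 0) else 0)"
    unfolding diff_op_def lookup_sum by (intro sum.cong refl) (auto simp: lookup_single when_def)
  then show ?thesis by (simp add: in_keys_iff)
qed

lemma graded_part_diff_op: "graded_part L d (diff_op f) = diff_op (poly_part L d f)"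
proof (rule poly_mapping_eqI)
  fix s :: "mono \<times> mono"
  obtain a b where s: "s = (a, b)" by (metis surj_pair)
  show "lookup (graded_part L d (diff_op f)) s = lookup (diff_op (poly_part L d f)) s"
    by (simp add: s lookup_graded_part lookup_diff_op lookup_poly_part shift_of_def)
qed

lemma keys_diff_op: "keys (diff_op f) \<subseteq> (\<lambda>m. (0, m)) ` keys f"
proof
  fix s assume "s \<in> keys (diff_op f)"
  then show "s \<in> (\<lambda>m. (0, m)) ` keys f"
    by (cases s) (auto simp: in_keys_iff lookup_diff_op split: if_splits)
qed

lemma keys_euler_op:
  assumes "s \<in> keys (euler_op n A \<beta> i)"
  shows "s = (0, 0) \<or> (\<exists>j\<in>{1..n}. s = (single j 1, single j 1))"
proof (rule ccontr)
  assume *: "\<not> ?thesis"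
  have "lookup (euler_op n A \<beta> i) s = 0"
    using * unfolding euler_op_def lookup_minus lookup_sum lookup_single when_def
    by (auto intro!: sum.neutral)
  then show False using assms by (simp add: in_keys_iff)
qed

lemma hypergeometric_gens_weyl:
  "diff_op ` toric_ideal n d A \<union> euler_op n A \<beta> ` {1..d} \<subseteq> weyl_algebra n"
proof (intro Un_least image_subsetI)
  fix f assume "f \<in> toric_ideal n d A"
  then have "f \<in> polys n"
    unfolding toric_ideal_def using genideal_subset_polys[OF toric_gens_polys] by blast
  then have "keys f \<subseteq> monomials n" by (simp add: polys_def)
  then show "diff_op f \<in> weyl_algebra n"
    using keys_diff_op[of f] monomials_0[of n] unfolding weyl_algebra_def by blast
next
  fix i
  have "(single j 1, single j 1) \<in> monomials n \<times> monomials n" if "j \<in> {1..n}" for j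
    using that by (simp add: monomials_def)
  then show "euler_op n A \<beta> i \<in> weyl_algebra n"
    using keys_euler_op[of _ n A \<beta> i] monomials_0[of n] unfolding weyl_algebra_def by blast
qed

lemma hypergeometric_gens_graded:
  assumes "g \<in> diff_op ` toric_ideal n d A \<union> euler_op n A \<beta> ` {1..d}"
  shows "graded_part (toric_lattice n d A) e g \<in> hypergeometric_ideal n d A \<beta>"
  using assms
proof
  assume "g \<in> diff_op ` toric_ideal n d A"
  then obtain f where "f \<in> toric_ideal n d A" "g = diff_op f" by blast
  then show ?thesis
    unfolding hypergeometric_ideal_def
    by (auto simp: graded_part_diff_op intro!: left_ideal.gen toric_ideal_graded)
next
  let ?L = "toric_lattice n d A"
  assume g: "g \<in> euler_op n A \<beta> ` {1..d}"
  then obtain i where i: "g = euler_op n A \<beta> i" by blast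
  have s0: "shift_of s = (\<lambda>_. 0)" if "s \<in> keys g" for s
    using keys_euler_op[OF that[unfolded i]] by (auto simp: shift_of_def fun_eq_iff)
  have "graded_part ?L e g = (if (\<lambda>j. 0 - e j) \<in> ?L then g else 0)"
  proof (rule poly_mapping_eqI)
    fix s show "lookup (graded_part ?L e g) s = lookup (if (\<lambda>j. 0 - e j) \<in> ?L then g else 0) s"
      by (cases "s \<in> keys g") (auto simp: lookup_graded_part s0 in_keys_iff)
  qed
  moreover have "g \<in> hypergeometric_ideal n d A \<beta>"
    unfolding hypergeometric_ideal_def using g by (intro left_ideal.gen) auto
  moreover have "0 \<in> hypergeometric_ideal n d A \<beta>"
    unfolding hypergeometric_ideal_def by (rule left_ideal.zero)
  ultimately show ?thesis by simp
qed

text \<open>The hypergeometric ideal is graded by \<open>\<int>\<^sup>n / L\<close>: the two monomials of a toric binomial differ by an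
  element of \<open>L\<close>, and Euler operators have degree zero.\<close>

theorem generic_directionI:
  assumes "monomial_ideal n (in_ideal n w (toric_ideal n d A))"
    and inj: "\<And>u. u \<in> toric_lattice n d A \<Longrightarrow> u \<noteq> (\<lambda>_. 0) \<Longrightarrow> (\<Sum>j=1..n. w j * of_int (u j)) \<noteq> 0"
  shows "generic_direction n d A \<beta> w"
proof -
  let ?C = "small_groebner_cell n (hypergeometric_ideal n d A \<beta>) w"
  have int: "w \<in> interior ?C"
    unfolding hypergeometric_ideal_def
    by (rule generic_weight_in_interior_of_cell[OF hypergeometric_gens_weyl
        hypergeometric_gens_graded[unfolded hypergeometric_ideal_def]
        toric_lattice_0 toric_lattice_diff inj])
  then have "w \<in> interior (closure ?C)" using interior_mono[OF closure_subset] by blast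
  then show ?thesis
    unfolding generic_direction_def small_groebner_fan_def using assms(1) int by blast
qed

section \<open>The action of the Weyl algebra on logarithmic series\<close>

lemma lookup_pderiv_var:
  "lookup (pderiv_var j p) m = of_nat (Suc (lookup m j)) * lookup p (m + single j 1)"
proof -
  have *: "lookup (single (k - single j 1) (of_nat (lookup k j) * lookup p k)) m =
      (if k = m + single j 1 then of_nat (Suc (lookup m j)) * lookup p k else 0)" for k
  proof (cases "lookup k j = 0")
    case True
    then have "k \<noteq> m + single j 1" by (auto simp: lookup_add)
    then show ?thesis using True by simp
  next
    case False
    have "k - single j 1 = m \<longleftrightarrow> k = m + single j 1"
    proof
      assume "k - single j 1 = m"
      then show "k = m + single j 1"
        using False by (intro poly_mapping_eqI)
          (auto simp: lookup_add lookup_minus lookup_single when_def)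
    qed simp
    then show ?thesis by (auto simp: lookup_single when_def lookup_add)
  qed
  show ?thesis
    unfolding pderiv_var_def lookup_sum * by (simp add: in_keys_iff)
qed

lemma pderiv_var_add: "pderiv_var j (p + q) = pderiv_var j p + pderiv_var j q"
  by (rule poly_mapping_eqI) (simp add: lookup_pderiv_var lookup_add algebra_simps)

lemma pderiv_var_0 [simp]: "pderiv_var j 0 = 0"
  by (simp add: pderiv_var_def)

lemma pderiv_var_Const_mult: "pderiv_var j (Const c * p) = Const c * pderiv_var j p"
  by (rule poly_mapping_eqI) (simp add: lookup_pderiv_var lookup_Const_mult)

lemma pderiv_var_commute: "pderiv_var i (pderiv_var j p) = pderiv_var j (pderiv_var i p)"
  by (rule poly_mapping_eqI)
     (cases "i = j"; simp add: lookup_pderiv_var lookup_add lookup_single_not_eq algebra_simps)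

type_synonym log_series = "(nat \<Rightarrow> int) \<Rightarrow> cpoly"

definition x_act :: "mono \<Rightarrow> log_series \<Rightarrow> log_series" where
  "x_act a f = (\<lambda>u. f (\<lambda>j. u j - int (lookup a j)))"

lemma d_act_apply: "d_act v j f u =
    Const (v j + of_int (u j + 1)) * f (u(j := u j + 1)) + pderiv_var j (f (u(j := u j + 1)))"
  by (simp add: d_act_def Let_def)

lemma d_act_add: "d_act v j (\<lambda>u. f u + g u) = (\<lambda>u. d_act v j f u + d_act v j g u)"
  by (rule ext) (simp add: d_act_apply pderiv_var_add algebra_simps)

lemma d_act_0: "d_act v j (\<lambda>_. 0) = (\<lambda>_. 0)"
  by (rule ext) (simp add: d_act_apply)

lemma d_act_Const: "d_act v j (\<lambda>u. Const c * f u) = (\<lambda>u. Const c * d_act v j f u)"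
  by (rule ext) (simp add: d_act_apply pderiv_var_Const_mult algebra_simps)

lemma d_act_sum: "d_act v j (\<lambda>u. \<Sum>i\<in>I. f i u) = (\<lambda>u. \<Sum>i\<in>I. d_act v j (f i) u)"
  by (induction I rule: infinite_finite_induct) (simp_all add: d_act_0 d_act_add)

lemma d_act_commute: "d_act v i (d_act v j f) = d_act v j (d_act v i f)"
proof (cases "i = j")
  case False
  show ?thesis
    by (rule ext)
       (use False in \<open>simp add: d_act_apply fun_upd_twist pderiv_var_add pderiv_var_Const_mult
          pderiv_var_commute algebra_simps\<close>)
qed simp

lemma funpow_d_act_commute: "(d_act v i ^^ k) (d_act v j f) = d_act v j ((d_act v i ^^ k) f)"
  by (induction k) (simp_all add: d_act_commute)

lemma foldr_d_act_Suc:
  assumes "distinct xs" "j \<in> set xs"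
  shows "foldr (\<lambda>i g. (d_act v i ^^ lookup (b + single j 1) i) g) xs f =
    d_act v j (foldr (\<lambda>i g. (d_act v i ^^ lookup b i) g) xs f)"
  using assms
proof (induction xs)
  case (Cons i xs)
  show ?case
  proof (cases "i = j")
    case True
    then have "j \<notin> set xs" using Cons.prems by simp
    then have "foldr (\<lambda>i g. (d_act v i ^^ lookup (b + single j 1) i) g) xs f =
        foldr (\<lambda>i g. (d_act v i ^^ lookup b i) g) xs f"
      by (intro foldr_cong refl) (auto simp: lookup_add lookup_single when_def)
    then show ?thesis by (simp add: True lookup_add)
  next
    case False
    then show ?thesis
      using Cons by (simp add: lookup_add lookup_single_not_eq funpow_d_act_commute)
  qed
qed simp

lemma dmono_act_Suc:
  assumes "j \<in> {1..n}"
  shows "dmono_act n v (b + single j 1) f = d_act v j (dmono_act n v b f)"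
  unfolding dmono_act_def by (rule foldr_d_act_Suc) (use assms in auto)

lemma dmono_act_zero: "dmono_act n v 0 f = f"
proof -
  have "foldr (\<lambda>j g. (d_act v j ^^ lookup 0 j) g) xs f = f" for xs
    by (induction xs) auto
  then show ?thesis by (simp add: dmono_act_def)
qed

lemma monomial_induct [consumes 1, case_names zero step]:
  assumes "b \<in> monomials n" "P 0"
    and "\<And>b j. b \<in> monomials n \<Longrightarrow> j \<in> {1..n} \<Longrightarrow> P b \<Longrightarrow> P (b + single j 1)"
  shows "P b"
  using assms(1)
proof (induction "mono_deg b" arbitrary: b)
  case 0
  then show ?case using assms(2) mono_deg_eq_0 by metis
next
  case (Suc k)
  then have "b \<noteq> 0" by auto
  then obtain j where j: "j \<in> keys b" by (metis all_not_in_conv keys_eq_empty)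
  define c where "c = b - single j 1"
  have bc: "b = c + single j 1"
    unfolding c_def using j
    by (intro poly_mapping_eqI) (auto simp: lookup_add lookup_minus lookup_single when_def in_keys_iff)
  then have "mono_deg b = mono_deg c + 1" by (simp add: mono_deg_add)
  then have "P c" using Suc bc monomials_add by (metis Suc_eq_plus1 add_right_cancel)
  moreover have "j \<in> {1..n}" using j Suc.prems by (auto simp: monomials_def)
  moreover have "c \<in> monomials n" using Suc.prems bc monomials_add by metis
  ultimately show ?case using assms(3) bc by blast
qed

lemma dmono_act_add_mono:
  assumes "b \<in> monomials n"
  shows "dmono_act n v (b + c) f = dmono_act n v b (dmono_act n v c f)"
  using assms
proof (induction b rule: monomial_induct)
  case (step b j)
  have "b + single j 1 + c = (b + c) + single j 1" by (simp add: ac_simps)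
  then show ?case using step by (simp only: dmono_act_Suc)
qed (simp add: dmono_act_zero)

lemma dmono_act_0:
  assumes "b \<in> monomials n" shows "dmono_act n v b (\<lambda>_. 0) = (\<lambda>_. 0)"
  using assms by (induction rule: monomial_induct) (simp_all del: One_nat_def add: dmono_act_zero dmono_act_Suc d_act_0)

lemma dmono_act_sum:
  assumes "b \<in> monomials n"
  shows "dmono_act n v b (\<lambda>u. \<Sum>i\<in>I. f i u) = (\<lambda>u. \<Sum>i\<in>I. dmono_act n v b (f i) u)"
  using assms by (induction rule: monomial_induct) (simp_all del: One_nat_def add: dmono_act_zero dmono_act_Suc d_act_sum)

lemma dmono_act_Const:
  assumes "b \<in> monomials n"
  shows "dmono_act n v b (\<lambda>u. Const c * f u) = (\<lambda>u. Const c * dmono_act n v b f u)"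
  using assms by (induction rule: monomial_induct) (simp_all del: One_nat_def add: dmono_act_zero dmono_act_Suc d_act_Const)

text \<open>The relation \<open>\<partial>\<^sub>j x\<^sup>p = x\<^sup>p \<partial>\<^sub>j + p\<^sub>j x\<^bsup>p-e\<^sub>j\<^esup>\<close>.\<close>

lemma d_act_x_act:
  "d_act v j (x_act p h) u =
     x_act p (d_act v j h) u + Const (of_nat (lookup p j)) * x_act (p - single j 1) h u"
proof -
  let ?u = "\<lambda>i. u i - int (lookup p i)"
  have up: "(\<lambda>i. (u(j := u j + 1)) i - int (lookup p i)) = ?u(j := ?u j + 1)"
    by (auto simp: fun_eq_iff)
  have low: "(\<lambda>i. u i - int (lookup (p - single j 1) i)) = ?u(j := ?u j + 1)" if "lookup p j \<noteq> 0"
    using that by (auto simp: fun_eq_iff lookup_minus lookup_single when_def)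
  have c: "Const (v j + of_int (u j + 1)) =
      Const (v j + of_int (?u j + 1)) + Const (of_nat (lookup p j))"
    by (simp add: Const_add[symmetric])
  show ?thesis
  proof (cases "lookup p j = 0")
    case True
    then show ?thesis unfolding d_act_apply x_act_def up by simp
  next
    case False
    show ?thesis unfolding d_act_apply x_act_def up low[OF False] c by (simp add: algebra_simps)
  qed
qed

text \<open>The coefficients in the definition of the Weyl product.  They vanish unless \<open>k\<close> divides \<open>b\<close>, so sums
  over \<open>k\<close> may run over the divisors of \<open>c\<close> alone.\<close>

definition leibniz_coeff :: "mono \<Rightarrow> mono \<Rightarrow> mono \<Rightarrow> complex" where
  "leibniz_coeff b c k = (\<Prod>j\<in>keys k. of_nat (fact (lookup k j) * (lookup b j choose lookup k j)
                                                * (lookup c j choose lookup k j)))"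

lemma leibniz_coeff_superset:
  assumes "finite S" "keys k \<subseteq> S"
  shows "leibniz_coeff b c k = (\<Prod>j\<in>S. of_nat (fact (lookup k j) * (lookup b j choose lookup k j)
                                                * (lookup c j choose lookup k j)))"
  unfolding leibniz_coeff_def
  by (rule prod.mono_neutral_left) (use assms in \<open>auto simp: in_keys_iff\<close>)

lemma leibniz_coeff_eq_0:
  assumes "\<not> mono_dvd k b"
  shows "leibniz_coeff b c k = 0"
proof -
  obtain j where j: "lookup b j < lookup k j" using assms by (auto simp: mono_dvd_def not_le)
  then have "j \<in> keys k" by (auto simp: in_keys_iff)
  then show ?thesis unfolding leibniz_coeff_def using j by (intro prod_zero) (auto intro!: bexI[of _ j])
qed

lemma leibniz_binomial_rec:
  assumes "Suc k \<le> c"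
  shows "fact (Suc k) * (Suc b choose Suc k) * (c choose Suc k) =
    fact (Suc k) * (b choose Suc k) * (c choose Suc k) + (c - k) * (fact k * (b choose k) * (c choose k))"
proof -
  obtain e where e: "c = Suc (k + e)" using assms by (metis add_Suc le_Suc_ex)
  have "Suc k * (c choose Suc k) = (c - k) * (c choose k)"
    using Suc_times_binomial_add[of k e] by (simp add: e)
  moreover have "fact (Suc k) * (b choose k) * (c choose Suc k) =
      fact k * (b choose k) * (Suc k * (c choose Suc k))"
    by (simp only: fact_Suc of_nat_id mult_ac)
  ultimately have "fact (Suc k) * (b choose k) * (c choose Suc k) =
      (c - k) * (fact k * (b choose k) * (c choose k))"
    by (simp only: mult_ac)
  then show ?thesis by (simp only: binomial_Suc_Suc add_mult_distrib add_mult_distrib2 add.commute)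
qed

text \<open>The recursion that corresponds to \<open>\<partial>\<^bsup>b+e\<^sub>j\<^esup> = \<partial>\<^sub>j \<partial>\<^sup>b\<close>: the new factor either passes through the power
  of \<open>x\<close> or lowers it.\<close>

lemma leibniz_coeff_rec:
  assumes "mono_dvd k c"
  shows "leibniz_coeff (b + single j 1) c k = leibniz_coeff b c k +
    (if lookup k j = 0 then 0
     else of_nat (lookup (c - (k - single j 1)) j) * leibniz_coeff b c (k - single j 1))"
proof -
  let ?S = "insert j (keys k)"
  let ?f = "\<lambda>b k i. of_nat (fact (lookup k i) * (lookup b i choose lookup k i)
      * (lookup c i choose lookup k i)) :: complex"
  have split: "leibniz_coeff b c k' = ?f b k' j * (\<Prod>i\<in>keys k - {j}. ?f b k' i)"
    if "keys k' \<subseteq> ?S" for b k'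
  proof -
    have "leibniz_coeff b c k' = (\<Prod>i\<in>?S. ?f b k' i)"
      by (rule leibniz_coeff_superset) (use that in auto)
    also have "\<dots> = ?f b k' j * (\<Prod>i\<in>?S - {j}. ?f b k' i)"
      by (rule prod.remove) auto
    finally show ?thesis by simp
  qed
  have rest: "(\<Prod>i\<in>keys k - {j}. ?f (b + single j 1) k i) = (\<Prod>i\<in>keys k - {j}. ?f b k i)"
    by (intro prod.cong refl) (auto simp: lookup_add lookup_single when_def)
  have rest': "(\<Prod>i\<in>keys k - {j}. ?f b (k - single j 1) i) = (\<Prod>i\<in>keys k - {j}. ?f b k i)"
    by (intro prod.cong refl) (auto simp: lookup_minus lookup_single when_def)
  have sub: "keys (k - single j 1) \<subseteq> ?S" using keys_mono_minus[of k "single j 1"] by auto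
  show ?thesis
  proof (cases "lookup k j")
    case 0
    then have "?f (b + single j 1) k j = 1" "?f b k j = 1" by auto
    moreover have sk: "keys k \<subseteq> ?S" by auto
    ultimately show ?thesis using 0 unfolding split[OF sk] rest by simp
  next
    case (Suc q)
    have le: "Suc q \<le> lookup c j" using assms Suc by (metis mono_dvd_def)
    have q: "lookup (k - single j 1) j = q" using Suc by (simp add: lookup_minus)
    have bj: "lookup (b + single j 1) j = Suc (lookup b j)" by (simp add: lookup_add)
    let ?N = "lookup (c - (k - single j 1)) j"
    have N: "?N = lookup c j - q" using q by (simp only: lookup_minus[of c])
    have sk: "keys k \<subseteq> ?S" by auto
    have top: "?f (b + single j 1) k j = ?f b k j + of_nat ?N * ?f b (k - single j 1) j"
      unfolding Suc q bj N leibniz_binomial_rec[OF le] by simp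
    have "leibniz_coeff (b + single j 1) c k =
        (?f b k j + of_nat ?N * ?f b (k - single j 1) j) * (\<Prod>i\<in>keys k - {j}. ?f b k i)"
      unfolding split[OF sk] rest top ..
    also have "\<dots> = ?f b k j * (\<Prod>i\<in>keys k - {j}. ?f b k i) +
        of_nat ?N * (?f b (k - single j 1) j * (\<Prod>i\<in>keys k - {j}. ?f b k i))"
      by (simp only: distrib_right mult.assoc)
    also have "\<dots> = leibniz_coeff b c k + of_nat ?N * leibniz_coeff b c (k - single j 1)"
      unfolding split[OF sk] split[OF sub] rest' ..
    finally show ?thesis using Suc by simp
  qed
qed

text \<open>The Leibniz rule as an identity of operators on series, by induction on \<open>b\<close>.\<close>

lemma dmono_act_x_act:
  assumes "b \<in> monomials n"
  shows "dmono_act n v b (x_act c g) u =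
    (\<Sum>k\<in>{k. mono_dvd k c}. Const (leibniz_coeff b c k) * x_act (c - k) (dmono_act n v (b - k) g) u)"
  using assms
proof (induction b arbitrary: u rule: monomial_induct)
  case zero
  have "leibniz_coeff 0 c k = (if k = 0 then 1 else 0)" for k
  proof (cases "k = 0")
    case False
    then have "\<not> mono_dvd k 0" by (auto simp: mono_dvd_def intro!: poly_mapping_eqI)
    then show ?thesis using False leibniz_coeff_eq_0 by simp
  qed (simp add: leibniz_coeff_def)
  then have "(\<Sum>k\<in>{k. mono_dvd k c}. Const (leibniz_coeff 0 c k) * x_act (c - k) (dmono_act n v (0 - k) g) u)
      = (\<Sum>k\<in>{k. mono_dvd k c}. if k = 0 then x_act c g u else 0)"
    by (intro sum.cong refl) (auto simp: dmono_act_zero)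
  also have "\<dots> = x_act c g u"
  proof -
    have "mono_dvd 0 c" by (simp add: mono_dvd_def)
    then show ?thesis by (simp add: finite_mono_dvd)
  qed
  finally show ?case by (simp add: dmono_act_zero)
next
  case (step b j)
  let ?K = "{k. mono_dvd k c}"
  let ?e = "single j (1::nat)"
  let ?X = "\<lambda>k. x_act (c - k) (dmono_act n v (b + ?e - k) g) u"
  have fin: "finite ?K" by (rule finite_mono_dvd)
  have IH: "dmono_act n v b (x_act c g) = (\<lambda>u. \<Sum>k\<in>?K. Const (leibniz_coeff b c k) *
      x_act (c - k) (dmono_act n v (b - k) g) u)"
    by (rule ext) (rule step.IH)
  have t1: "Const (leibniz_coeff b c k) * x_act (c - k) (d_act v j (dmono_act n v (b - k) g)) u =
      Const (leibniz_coeff b c k) * ?X k" for k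
  proof (cases "mono_dvd k b")
    case True
    then obtain b' where b': "b = k + b'" using mono_dvd_iff by blast
    have "b + ?e - k = (b - k) + ?e" by (simp add: b' add.assoc)
    then show ?thesis using step.hyps by (simp only: dmono_act_Suc)
  qed (simp add: leibniz_coeff_eq_0)
  have t2: "(\<Sum>k\<in>?K. Const (leibniz_coeff b c k) * (Const (of_nat (lookup (c - k) j)) *
        x_act (c - k - ?e) (dmono_act n v (b - k) g) u)) =
      (\<Sum>k\<in>?K. Const (if lookup k j = 0 then 0
        else of_nat (lookup (c - (k - ?e)) j) * leibniz_coeff b c (k - ?e)) * ?X k)"
    (is "sum ?g ?K = sum ?h ?K")
  proof -
    have "sum ?g ?K = sum ?g {k\<in>?K. lookup (c - k) j \<noteq> 0}"
      by (rule sum.mono_neutral_right) (use fin in auto)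
    also have "\<dots> = sum ?h {k\<in>?K. lookup k j \<noteq> 0}"
    proof (rule sum.reindex_bij_witness[of _ "\<lambda>k. k - ?e" "\<lambda>k. k + ?e"])
      fix k assume k: "k \<in> {k\<in>?K. lookup (c - k) j \<noteq> 0}"
      show "k + ?e - ?e = k" by simp
      show "k + ?e \<in> {k\<in>?K. lookup k j \<noteq> 0}"
      proof -
        have "lookup (k + ?e) i \<le> lookup c i" for i
          using k by (cases "i = j") (auto simp: mono_dvd_def lookup_add lookup_minus lookup_single_not_eq)
        then show ?thesis by (simp add: mono_dvd_def lookup_add)
      qed
      have 1: "c - (k + ?e) = c - k - ?e" by (simp add: diff_diff_add)
      have 2: "b + ?e - (k + ?e) = b - k"
        by (rule poly_mapping_eqI) (simp add: lookup_add lookup_minus)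
      have 3: "lookup (k + ?e) j \<noteq> 0" by (simp add: lookup_add)
      show "?h (k + ?e) = ?g k"
        using 3 by (simp add: 1 2 Const_mult mult_ac del: One_nat_def)
    next
      fix k assume k: "k \<in> {k\<in>?K. lookup k j \<noteq> 0}"
      show "k - ?e + ?e = k"
        using k by (intro poly_mapping_eqI) (auto simp: lookup_add lookup_minus lookup_single when_def)
      have "lookup (k - ?e) i \<le> lookup c i" for i
        using k by (auto simp: mono_dvd_def lookup_minus intro: le_trans[OF diff_le_self])
      moreover have "lookup (c - (k - ?e)) j \<noteq> 0"
      proof -
        have "lookup k j \<le> lookup c j" using k by (simp add: mono_dvd_def)
        then show ?thesis using k by (simp add: lookup_minus)
      qed
      ultimately show "k - ?e \<in> {k\<in>?K. lookup (c - k) j \<noteq> 0}" by (simp add: mono_dvd_def)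
    qed
    also have "\<dots> = sum ?h ?K"
      by (rule sum.mono_neutral_left) (use fin in auto)
    finally show ?thesis .
  qed
  have "dmono_act n v (b + ?e) (x_act c g) u = (\<Sum>k\<in>?K. Const (leibniz_coeff b c k) *
      d_act v j (x_act (c - k) (dmono_act n v (b - k) g)) u)"
    by (simp only: dmono_act_Suc[OF step.hyps(2)] IH d_act_sum d_act_Const)
  also have "\<dots> = (\<Sum>k\<in>?K. Const (leibniz_coeff b c k) * ?X k) + sum (\<lambda>k. Const (leibniz_coeff b c k) *
      (Const (of_nat (lookup (c - k) j)) * x_act (c - k - ?e) (dmono_act n v (b - k) g) u)) ?K"
    unfolding d_act_x_act distrib_left sum.distrib t1 ..
  also have "\<dots> = (\<Sum>k\<in>?K. Const (leibniz_coeff (b + ?e) c k) * ?X k)"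
    unfolding t2 sum.distrib[symmetric]
    by (intro sum.cong refl) (subst leibniz_coeff_rec, simp, simp add: Const_add distrib_right)
  finally show ?case .
qed

lemma weyl_act_superset:
  assumes "finite S" "keys P \<subseteq> S"
  shows "weyl_act n v P f u =
    (\<Sum>s\<in>S. Const (lookup P s) * x_act (fst s) (dmono_act n v (snd s) f) u)"
proof -
  have "weyl_act n v P f u = (\<Sum>s\<in>keys P. Const (lookup P s) * x_act (fst s) (dmono_act n v (snd s) f) u)"
    unfolding weyl_act_def x_act_def by (intro sum.cong refl) auto
  also have "\<dots> = (\<Sum>s\<in>S. Const (lookup P s) * x_act (fst s) (dmono_act n v (snd s) f) u)"
    by (rule sum.mono_neutral_left) (use assms in \<open>auto simp: in_keys_iff\<close>)
  finally show ?thesis .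
qed

lemma weyl_act_single:
  "weyl_act n v (single s c) f u = Const c * x_act (fst s) (dmono_act n v (snd s) f) u"
  by (subst weyl_act_superset[of "{s}"]) auto

lemma weyl_act_add: "weyl_act n v (P + Q) f u = weyl_act n v P f u + weyl_act n v Q f u"
proof -
  let ?S = "keys P \<union> keys Q"
  have "weyl_act n v (P + Q) f u = (\<Sum>s\<in>?S. Const (lookup (P + Q) s) * x_act (fst s) (dmono_act n v (snd s) f) u)"
    by (rule weyl_act_superset) (use keys_add[of P Q] in auto)
  also have "\<dots> = weyl_act n v P f u + weyl_act n v Q f u"
    by (subst (1 2) weyl_act_superset[of ?S]) (auto simp: lookup_add Const_add distrib_right sum.distrib)
  finally show ?thesis .
qed

lemma weyl_act_0: "weyl_act n v 0 f u = 0"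
  by (simp add: weyl_act_def)

lemma weyl_act_sum: "weyl_act n v (sum P I) f u = (\<Sum>i\<in>I. weyl_act n v (P i) f u)"
  by (induction I rule: infinite_finite_induct) (simp_all add: weyl_act_0 weyl_act_add)

lemma weyl_act_scale: "weyl_act n v (weyl_scale c P) f u = Const c * weyl_act n v P f u"
  unfolding weyl_scale_def weyl_act_sum weyl_act_single
  by (simp add: weyl_act_superset[of "keys P" P] sum_distrib_left Const_mult mult.assoc)

lemma x_act_add_mono: "x_act a (x_act c f) = x_act (a + c) f"
  by (rule ext) (simp add: x_act_def lookup_add algebra_simps)

lemma weyl_act_mono_mult:
  assumes "snd s \<in> monomials n"
  shows "weyl_act n v (weyl_mono_mult s t) f u =
    x_act (fst s) (dmono_act n v (snd s) (x_act (fst t) (dmono_act n v (snd t) f))) u"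
proof -
  obtain a b c e where st: "s = (a, b)" "t = (c, e)" by (metis surj_pair)
  let ?K = "{k. mono_dvd k b \<and> mono_dvd k c}"
  have b: "b \<in> monomials n" using assms by (simp add: st)
  have "weyl_act n v (weyl_mono_mult s t) f u =
      (\<Sum>k\<in>?K. Const (leibniz_coeff b c k) * x_act (a + (c - k)) (dmono_act n v (b - k + e) f) u)"
    unfolding weyl_mono_mult_def st by (simp add: weyl_act_sum weyl_act_single leibniz_coeff_def)
  also have "\<dots> = (\<Sum>k\<in>{k. mono_dvd k c}. Const (leibniz_coeff b c k) *
      x_act (a + (c - k)) (dmono_act n v (b - k + e) f) u)"
  proof (rule sum.mono_neutral_left)
    show "\<forall>k\<in>{k. mono_dvd k c} - ?K. Const (leibniz_coeff b c k) *
      x_act (a + (c - k)) (dmono_act n v (b - k + e) f) u = 0"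
    proof
      fix k assume "k \<in> {k. mono_dvd k c} - ?K"
      then have "\<not> mono_dvd k b" by auto
      then show "Const (leibniz_coeff b c k) * x_act (a + (c - k)) (dmono_act n v (b - k + e) f) u = 0"
        by (simp add: leibniz_coeff_eq_0)
    qed
  qed (auto simp: finite_mono_dvd)
  also have "\<dots> = (\<Sum>k\<in>{k. mono_dvd k c}. Const (leibniz_coeff b c k) *
      x_act (a + (c - k)) (dmono_act n v (b - k) (dmono_act n v e f)) u)"
    by (simp add: dmono_act_add_mono[OF monomials_minus[OF b]])
  also have "\<dots> = x_act a (dmono_act n v b (x_act c (dmono_act n v e f))) u"
    unfolding x_act_add_mono[symmetric] x_act_def[of a] dmono_act_x_act[OF b] ..
  finally show ?thesis by (simp add: st)
qed

text \<open>The Weyl product is composition of operators.  In consequence a series annihilated by generators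
  is annihilated by their left ideal.\<close>

lemma weyl_act_mult:
  assumes "Q \<in> weyl_algebra n"
  shows "weyl_act n v (weyl_mult Q P) f = weyl_act n v Q (weyl_act n v P f)"
proof
  fix u
  have mon: "snd s \<in> monomials n" if "s \<in> keys Q" for s
    using assms that by (auto simp: weyl_algebra_def)
  have P: "weyl_act n v P f = (\<lambda>u. \<Sum>t\<in>keys P. Const (lookup P t) * x_act (fst t) (dmono_act n v (snd t) f) u)"
    by (rule ext) (rule weyl_act_superset, auto)
  have "weyl_act n v (weyl_mult Q P) f u = (\<Sum>s\<in>keys Q. \<Sum>t\<in>keys P. Const (lookup Q s * lookup P t) *
      x_act (fst s) (dmono_act n v (snd s) (x_act (fst t) (dmono_act n v (snd t) f))) u)"
    unfolding weyl_mult_def by (simp add: weyl_act_sum weyl_act_scale weyl_act_mono_mult mon)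
  also have "\<dots> = (\<Sum>s\<in>keys Q. Const (lookup Q s) * x_act (fst s) (dmono_act n v (snd s) (weyl_act n v P f)) u)"
  proof (intro sum.cong refl)
    fix s assume s: "s \<in> keys Q"
    show "(\<Sum>t\<in>keys P. Const (lookup Q s * lookup P t) *
        x_act (fst s) (dmono_act n v (snd s) (x_act (fst t) (dmono_act n v (snd t) f))) u) =
      Const (lookup Q s) * x_act (fst s) (dmono_act n v (snd s) (weyl_act n v P f)) u"
      unfolding P dmono_act_sum[OF mon[OF s]] dmono_act_Const[OF mon[OF s]]
      by (simp add: x_act_def[of "fst s"] sum_distrib_left Const_mult mult.assoc)
  qed
  also have "\<dots> = weyl_act n v Q (weyl_act n v P f) u"
    by (rule weyl_act_superset[symmetric]) auto
  finally show "weyl_act n v (weyl_mult Q P) f u = weyl_act n v Q (weyl_act n v P f) u" .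
qed

lemma left_ideal_annihilates:
  assumes G: "\<And>g. g \<in> G \<Longrightarrow> weyl_act n v g f = (\<lambda>_. 0)" and P: "P \<in> left_ideal n G"
  shows "weyl_act n v P f = (\<lambda>_. 0)"
  using P
proof induction
  case zero
  then show ?case by (rule ext) (rule weyl_act_0)
next
  case (add P Q)
  then show ?case by (simp add: fun_eq_iff weyl_act_add)
next
  case (mult Q P)
  have "weyl_act n v Q (\<lambda>_. 0) u = 0" for u
  proof -
    have "dmono_act n v (snd s) (\<lambda>_. 0) = (\<lambda>_. 0)" if "s \<in> keys Q" for s
      by (rule dmono_act_0) (use mult.hyps(1) that in \<open>auto simp: weyl_algebra_def\<close>)
    then show ?thesis by (subst weyl_act_superset[of "keys Q"]) (simp_all add: x_act_def)
  qed
  then have "weyl_act n v Q (\<lambda>_. 0) = (\<lambda>_. 0)" by (rule ext)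
  then show ?case by (simp only: weyl_act_mult[OF mult.hyps(1)] mult.IH)
qed (rule G)

section \<open>The lattice of the six points of a doubled triangle\<close>

text \<open>The points of the triangle in the order \<open>(1, 0)\<close>, \<open>(0, 0)\<close>, \<open>(1, 1)\<close>, \<open>(2, 0)\<close>, \<open>(2, 1)\<close>, \<open>(2, 2)\<close>.
  The vertices are 2, 4 and 6, and the midpoints of the sides \<open>24\<close>, \<open>26\<close>, \<open>46\<close> are 1, 3 and 5.\<close>

definition veronese :: "nat \<Rightarrow> nat \<Rightarrow> int" where
  "veronese i j = (if i = 1 then 1
     else if i = 2 then (if j = 2 then 0 else if j = 1 \<or> j = 3 then 1 else 2)
     else (if j = 6 then 2 else if j = 3 \<or> j = 5 then 1 else 0))"

text \<open>The coordinates are chosen so that \<open>a\<close>, \<open>b\<close>, \<open>c\<close> are the entries \<open>- u\<^sub>5\<close>, \<open>u\<^sub>4\<close>, \<open>u\<^sub>6\<close> of a lattice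
  vector \<open>u\<close>.\<close>

definition lat :: "int \<Rightarrow> int \<Rightarrow> int \<Rightarrow> nat \<Rightarrow> int" where
  "lat a b c j = (if j = 1 then a - 2 * b else if j = 2 then b + c - a
     else if j = 3 then a - 2 * c else if j = 4 then b else if j = 5 then - a
     else if j = 6 then c else 0)"

abbreviation "lattice6 \<equiv> toric_lattice 6 3 veronese"

lemma atLeastAtMost_6: "{1..6::nat} = {1, 2, 3, 4, 5, 6}" by auto
lemma atLeastAtMost_3: "{1..3::nat} = {1, 2, 3}" by auto

lemma sum_6: "(\<Sum>j=1..6. f j) = f 1 + f 2 + f 3 + f 4 + f 5 + f (6::nat)"
  for f :: "nat \<Rightarrow> 'a::comm_monoid_add"
  unfolding atLeastAtMost_6 by (simp add: add.assoc)

lemma veronese_values: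
  "veronese 1 j = 1" "veronese (Suc 0) j = 1"
  "veronese 2 1 = 1" "veronese 2 (Suc 0) = 1" "veronese 2 2 = 0" "veronese 2 3 = 1"
  "veronese 2 4 = 2" "veronese 2 5 = 2" "veronese 2 6 = 2"
  "veronese 3 1 = 0" "veronese 3 (Suc 0) = 0" "veronese 3 2 = 0" "veronese 3 3 = 1"
  "veronese 3 4 = 0" "veronese 3 5 = 1" "veronese 3 6 = 2"
  by (simp_all add: veronese_def)

lemma lat_values [simp]:
  "lat a b c 1 = a - 2 * b" "lat a b c (Suc 0) = a - 2 * b" "lat a b c 2 = b + c - a"
  "lat a b c 3 = a - 2 * c" "lat a b c 4 = b" "lat a b c 5 = - a" "lat a b c 6 = c"
  by (simp_all add: lat_def)

lemmas sum_6s = sum_6 sum_6[simplified]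

lemma lattice6_eq: "lattice6 = {lat a b c |a b c. True}"
proof (intro equalityI subsetI)
  fix u assume u: "u \<in> lattice6"
  then have eqs: "(\<Sum>j=1..6. veronese i j * u j) = 0" if "i \<in> {1, 2, 3}" for i
    using that by (auto simp: toric_lattice_def)
  have out: "u j = 0" if "j \<notin> {1..6}" for j using u that by (auto simp: toric_lattice_def)
  have "u 1 + u 2 + u 3 + u 4 + u 5 + u 6 = 0" "u 1 + u 3 + 2 * u 4 + 2 * u 5 + 2 * u 6 = 0"
    "u 3 + u 5 + 2 * u 6 = 0"
    using eqs[of 1] eqs[of 2] eqs[of 3] by (simp_all add: sum_6s veronese_def)
  then have on: "u j = lat (- u 5) (u 4) (u 6) j" if "j \<in> {1, 2, 3, 4, 5, 6}" for j
    using that by (elim insertE emptyE) simp_all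
  have "u j = lat (- u 5) (u 4) (u 6) j" for j
  proof (cases "j \<in> {1..6}")
    case True
    then show ?thesis using on[of j] unfolding atLeastAtMost_6 by blast
  next
    case False
    then show ?thesis using out[OF False] by (auto simp: lat_def)
  qed
  then have "u = lat (- u 5) (u 4) (u 6)" by (rule ext)
  then show "u \<in> {lat a b c |a b c. True}" by blast
next
  fix u assume "u \<in> {lat a b c |a b c. True}"
  then obtain a b c where u: "u = lat a b c" by blast
  have "(\<Sum>j=1..6. veronese i j * u j) = 0" if "i \<in> {1, 2, 3}" for i
    using that by (elim insertE emptyE) (simp_all add: sum_6s u veronese_values)
  moreover have "u j = 0" if "j \<notin> {1..6}" for j
    using that by (auto simp: u lat_def)
  ultimately show "u \<in> lattice6"
    unfolding toric_lattice_def atLeastAtMost_3 by blast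
qed

lemma lat_in_lattice6: "lat a b c \<in> lattice6"
  by (auto simp: lattice6_eq)

lemma lat_inject: "lat a b c = lat a' b' c' \<longleftrightarrow> a = a' \<and> b = b' \<and> c = c'"
proof
  assume eq: "lat a b c = lat a' b' c'"
  show "a = a' \<and> b = b' \<and> c = c'"
    using fun_cong[OF eq, of 4] fun_cong[OF eq, of 5] fun_cong[OF eq, of 6] by (simp add: lat_def)
qed simp

lemma lat_0: "lat 0 0 0 = (\<lambda>_. 0)"
  by (rule ext) (simp add: lat_def)

lemma lattice6_coords: "u \<in> lattice6 \<Longrightarrow> u = lat (- u 5) (u 4) (u 6)"
  by (auto simp: lattice6_eq lat_def)

section \<open>The column matroid\<close>

lemma card_le_column_rank:
  assumes "finite X" "Y \<subseteq> X" "columns_indep d A Y"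
  shows "card Y \<le> column_rank d A X"
  unfolding column_rank_def
proof (rule Max_ge)
  have "{card Y |Y. Y \<subseteq> X \<and> columns_indep d A Y} \<subseteq> card ` Pow X" by auto
  then show "finite {card Y |Y. Y \<subseteq> X \<and> columns_indep d A Y}"
    by (rule finite_subset) (simp add: assms(1))
qed (use assms in auto)

text \<open>Twice the signed area of the triangle with the vertices \<open>i\<close>, \<open>j\<close>, \<open>k\<close>.\<close>

definition triple_det :: "nat \<Rightarrow> nat \<Rightarrow> nat \<Rightarrow> int" where
  "triple_det i j k = (veronese 2 j - veronese 2 i) * (veronese 3 k - veronese 3 i)
     - (veronese 3 j - veronese 3 i) * (veronese 2 k - veronese 2 i)"

lemma indep_triple:
  assumes "distinct [i, j, k]" "triple_det i j k \<noteq> 0"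
  shows "columns_indep 3 veronese {i, j, k}"
  unfolding columns_indep_def
proof (intro allI impI)
  fix c :: "nat \<Rightarrow> rat"
  assume c: "\<forall>r\<in>{1..3}. (\<Sum>l\<in>{i, j, k}. c l * of_int (veronese r l)) = 0"
  define x where "x = (\<lambda>l. rat_of_int (veronese 2 l))"
  define y where "y = (\<lambda>l. rat_of_int (veronese 3 l))"
  have r: "(\<Sum>l\<in>{i, j, k}. c l * of_int (veronese r l)) =
      c i * of_int (veronese r i) + c j * of_int (veronese r j) + c k * of_int (veronese r k)" for r
    using assms(1) by (simp add: add.assoc)
  have eqs: "c i + c j + c k = 0" "c i * x i + c j * x j + c k * x k = 0"
    "c i * y i + c j * y j + c k * y k = 0"
    using c[rule_format, of 1] c[rule_format, of 2] c[rule_format, of 3] unfolding r x_def y_def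
    by (simp_all add: veronese_def[of "Suc 0"])
  define D where "D = (x j - x i) * (y k - y i) - (y j - y i) * (x k - x i)"
  have D: "D \<noteq> 0"
  proof -
    have "D = of_int (triple_det i j k)" by (simp add: D_def x_def y_def triple_det_def)
    then show ?thesis using assms(2) by simp
  qed
  have ci: "c i = - c j - c k" using eqs(1) by (simp add: algebra_simps add_eq_0_iff)
  have e2: "c j * (x j - x i) + c k * (x k - x i) = 0" using eqs(2) ci by (simp add: algebra_simps)
  have e3: "c j * (y j - y i) + c k * (y k - y i) = 0" using eqs(3) ci by (simp add: algebra_simps)
  have "c j * D = (c j * (x j - x i) + c k * (x k - x i)) * (y k - y i)
      - (c j * (y j - y i) + c k * (y k - y i)) * (x k - x i)"
    by (simp add: D_def algebra_simps)
  then have "c j = 0" using D by (simp add: e2 e3)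
  moreover have "c k * D = (c j * (y j - y i) + c k * (y k - y i)) * (x j - x i)
      - (c j * (x j - x i) + c k * (x k - x i)) * (y j - y i)"
    by (simp add: D_def algebra_simps)
  then have "c k = 0" using D by (simp add: e2 e3)
  ultimately show "\<forall>l\<in>{i, j, k}. c l = 0" using ci by simp
qed

lemma rank_ge_3:
  assumes "X \<subseteq> {1..6}" "{i, j, k} \<subseteq> X" "distinct [i, j, k]" "triple_det i j k \<noteq> 0"
  shows "3 \<le> column_rank 3 veronese X"
proof -
  have "card {i, j, k} = 3" using assms(3) by simp
  then show ?thesis
    using card_le_column_rank[OF finite_subset[OF assms(1)] assms(2) indep_triple[OF assms(3,4)]] by simp
qed

lemma rank_ge_3_avoiding_two:
  assumes "X \<subseteq> {1..6}" "{1..6} \<subseteq> X \<union> {p, q}" "p \<in> {1..6}" "q \<in> {1..6}"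
  shows "3 \<le> column_rank 3 veronese X"
proof -
  have pq: "p \<in> {1, 2, 3, 4, 5, 6}" "q \<in> {1, 2, 3, 4, 5, 6}"
    using assms(3,4) by (auto simp: atLeastAtMost_6)
  \<comment> \<open>Triangles such that every pair of points is disjoint from one of them.\<close>
  let ?F = "{(1, 2, 3), (1, 2, 5), (1, 4, 6), (2, 4, 6), (3, 4, 5), (3, 5, 6)}"
  have "\<exists>(i, j, k)\<in>?F. p \<notin> {i, j, k} \<and> q \<notin> {i, j, k}"
    using pq by (elim insertE emptyE; simp)
  then obtain i j k where ijk: "(i, j, k) \<in> ?F" "p \<notin> {i, j, k}" "q \<notin> {i, j, k}" by blast
  have "{i, j, k} \<subseteq> {1..6} \<and> distinct [i, j, k] \<and> triple_det i j k \<noteq> 0"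
    using ijk(1) by (elim insertE emptyE; simp add: triple_det_def veronese_values)
  moreover from this have "{i, j, k} \<subseteq> X" using ijk assms(2) by blast
  ultimately show ?thesis using rank_ge_3[OF assms(1)] by blast
qed

lemma rank_pair:
  assumes "X \<subseteq> {1..6}" "i \<in> X" "j \<in> X" "i \<noteq> j"
  shows "2 \<le> column_rank 3 veronese X"
proof -
  have "i \<in> {1, 2, 3, 4, 5, 6}" "j \<in> {1, 2, 3, 4, 5, 6}" using assms by (auto simp: atLeastAtMost_6)
  then have diff: "veronese 2 i \<noteq> veronese 2 j \<or> veronese 3 i \<noteq> veronese 3 j"
    using assms(4) by (elim insertE emptyE; simp add: veronese_values)
  have "columns_indep 3 veronese {i, j}"
    unfolding columns_indep_def
  proof (intro allI impI)
    fix c :: "nat \<Rightarrow> rat"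
    assume c: "\<forall>r\<in>{1..3}. (\<Sum>l\<in>{i, j}. c l * of_int (veronese r l)) = 0"
    have r: "(\<Sum>l\<in>{i, j}. c l * of_int (veronese r l)) =
        c i * of_int (veronese r i) + c j * of_int (veronese r j)" for r
      using assms(4) by simp
    have eqs: "c i + c j = 0" "c i * of_int (veronese 2 i) + c j * of_int (veronese 2 j) = 0"
      "c i * of_int (veronese 3 i) + c j * of_int (veronese 3 j) = 0"
      using c[rule_format, of 1] c[rule_format, of 2] c[rule_format, of 3] unfolding r
      by (simp_all add: veronese_values)
    have ci: "c i = - c j" using eqs(1) by (simp add: add_eq_0_iff2)
    have "c j * (of_int (veronese 2 j) - of_int (veronese 2 i)) = 0"
      "c j * (of_int (veronese 3 j) - of_int (veronese 3 i)) = 0"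
      using eqs(2,3) ci by (simp_all add: algebra_simps)
    then have "c j = 0" using diff by auto
    then show "\<forall>l\<in>{i, j}. c l = 0" using ci by simp
  qed
  then have "card {i, j} \<le> column_rank 3 veronese X"
    using assms by (intro card_le_column_rank finite_subset[OF assms(1)]) auto
  then show ?thesis using assms(4) by simp
qed

lemma rank_point:
  assumes "X \<subseteq> {1..6}" "i \<in> X"
  shows "1 \<le> column_rank 3 veronese X"
proof -
  have "columns_indep 3 veronese {i}"
    unfolding columns_indep_def by (auto dest!: bspec[of _ _ 1] simp: veronese_def)
  then have "card {i} \<le> column_rank 3 veronese X"
    using assms by (intro card_le_column_rank finite_subset[OF assms(1)]) auto
  then show ?thesis by simp
qed

text \<open>The only collinear triples are the sides of the big triangle.\<close>

lemma collinear_triples: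
  assumes "i \<in> {1..6}" "j \<in> {1..6}" "k \<in> {1..6}" "distinct [i, j, k]" "triple_det i j k = 0"
  shows "{i, j, k} \<subseteq> {1, 2, 4} \<or> {i, j, k} \<subseteq> {2, 3, 6} \<or> {i, j, k} \<subseteq> {4, 5, 6}"
proof -
  have "i \<in> {1, 2, 3, 4, 5, 6}" "j \<in> {1, 2, 3, 4, 5, 6}" "k \<in> {1, 2, 3, 4, 5, 6}"
    using assms by (auto simp: atLeastAtMost_6)
  then show ?thesis
    using assms(4,5)
    by (elim insertE emptyE; simp add: triple_det_def veronese_values)
qed

text \<open>Removing at most two points leaves a set of full rank.  For three points the same holds for one of the
  two parts: either the triple spans, or it is a side, and then the other three points span.\<close>

lemma veronese_rank_sum:
  assumes X: "X \<subseteq> {1..6}"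
  shows "card X = 1 \<Longrightarrow> 4 \<le> column_rank 3 veronese X + column_rank 3 veronese ({1..6} - X)"
    and "card X = 2 \<or> card X = 3 \<Longrightarrow> 5 \<le> column_rank 3 veronese X + column_rank 3 veronese ({1..6} - X)"
proof -
  let ?Y = "{1..6} - X"
  have Y: "?Y \<subseteq> {1..6}" by auto
  show "4 \<le> column_rank 3 veronese X + column_rank 3 veronese ?Y" if X1: "card X = 1"
  proof -
    obtain p where p: "X = {p}" using X1 by (rule card_1_singletonE)
    have "3 \<le> column_rank 3 veronese ?Y" by (rule rank_ge_3_avoiding_two[OF Y, of p p]) (use p X in auto)
    moreover have "1 \<le> column_rank 3 veronese X" by (rule rank_point[OF X, of p]) (use p in auto)
    ultimately show ?thesis by simp
  qed
  show "5 \<le> column_rank 3 veronese X + column_rank 3 veronese ?Y" if "card X = 2 \<or> card X = 3"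
    using that
  proof
    assume "card X = 2"
    then obtain p q where pq: "X = {p, q}" "p \<noteq> q" by (auto simp: card_2_iff)
    have "3 \<le> column_rank 3 veronese ?Y" by (rule rank_ge_3_avoiding_two[OF Y, of p q]) (use pq X in auto)
    moreover have "2 \<le> column_rank 3 veronese X" by (rule rank_pair[OF X, of p q]) (use pq in auto)
    ultimately show ?thesis by simp
  next
    assume "card X = 3"
    then obtain i j k where ijk: "X = {i, j, k}" "distinct [i, j, k]" by (auto simp: card_3_iff)
    show ?thesis
    proof (cases "triple_det i j k = 0")
      case False
      have "3 \<le> column_rank 3 veronese X"
        by (rule rank_ge_3[OF X _ ijk(2) False]) (use ijk in auto)
      moreover have "\<exists>p\<in>?Y. \<exists>q\<in>?Y. p \<noteq> q"
      proof -
        have "card ?Y = 3" using X \<open>card X = 3\<close> by (simp add: card_Diff_subset finite_subset)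
        then show ?thesis by (auto simp: card_3_iff)
      qed
      then obtain p q where "p \<in> ?Y" "q \<in> ?Y" "p \<noteq> q" by blast
      then have "2 \<le> column_rank 3 veronese ?Y" by (rule rank_pair[OF Y])
      ultimately show ?thesis by simp
    next
      case True
      have "X \<subseteq> {1, 2, 4} \<or> X \<subseteq> {2, 3, 6} \<or> X \<subseteq> {4, 5, 6}"
        using collinear_triples[OF _ _ _ ijk(2) True] X ijk(1) by simp
      then have "{3, 5, 6} \<subseteq> ?Y \<or> {1, 4, 5} \<subseteq> ?Y \<or> {1, 2, 3} \<subseteq> ?Y" by auto
      then have "3 \<le> column_rank 3 veronese ?Y"
        using rank_ge_3[OF Y, of 3 5 6] rank_ge_3[OF Y, of 1 4 5] rank_ge_3[OF Y, of 1 2 3]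
        by (auto simp: triple_det_def veronese_values)
      moreover have "2 \<le> column_rank 3 veronese X"
        by (rule rank_pair[OF X, of i j]) (use ijk in auto)
      ultimately show ?thesis by simp
    qed
  qed
qed

text \<open>The lattice has rank three, so two linear conditions leave a nonzero vector.  It is a linear relation
  between the other four columns.\<close>

lemma lattice_vector_vanishing_at_two:
  assumes "p \<in> {1..6}" "q \<in> {1..6}"
  shows "\<exists>a b c. (a, b, c) \<noteq> (0, 0, 0) \<and> lat a b c p = 0 \<and> lat a b c q = 0"
proof -
  have "p \<in> {1, 2, 3, 4, 5, 6}" "q \<in> {1, 2, 3, 4, 5, 6}"
    using assms by (auto simp: atLeastAtMost_6)
  then have "\<exists>(a, b, c)\<in>{(-2, -1, -1), (0, 0, 1), (-2, -1, 0), (-1, 0, -1), (0, -1, 1), (1, 1, 0), (2, 0, 1), (0, 1, 0), (1, 0, 0)}. lat a b c p = 0 \<and> lat a b c q = 0"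
    by (elim insertE emptyE; simp)
  then obtain a b c where "(a, b, c) \<in> {(-2, -1, -1), (0, 0, 1), (-2, -1, 0), (-1, 0, -1), (0, -1, 1), (1, 1, 0), (2, 0, 1), (0, 1, 0), (1, 0, 0)}" "lat a b c p = 0" "lat a b c q = 0" by blast
  then show ?thesis by (intro exI[of _ a] exI[of _ b] exI[of _ c]) auto
qed

lemma veronese_rank: "column_rank 3 veronese {1..6} = 3"
proof (rule antisym)
  show "3 \<le> column_rank 3 veronese {1..6}"
    by (rule rank_ge_3_avoiding_two[of _ 1 1]) auto
  have "card Y \<le> 3" if Y: "Y \<subseteq> {1..6}" "columns_indep 3 veronese Y" for Y
  proof (rule ccontr)
    assume "\<not> card Y \<le> 3"
    moreover have fY: "finite Y" using Y(1) finite_subset by auto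
    ultimately have "card ({1..6} - Y) \<le> 2"
      using Y(1) by (simp add: card_Diff_subset)
    then obtain p q where pq: "p \<in> {1..6}" "q \<in> {1..6}" "{1..6} - Y \<subseteq> {p, q}"
    proof -
      assume *: "\<And>p q. p \<in> {1..6} \<Longrightarrow> q \<in> {1..6} \<Longrightarrow> {1..6} - Y \<subseteq> {p, q} \<Longrightarrow> thesis"
      consider "card ({1..6} - Y) = 0" | "card ({1..6} - Y) = 1" | "card ({1..6} - Y) = 2"
        using \<open>card ({1..6} - Y) \<le> 2\<close> by linarith
      then show thesis
      proof cases
        case 1
        then have "{1..6} - Y = {}" by simp
        then show thesis by (intro *[of 1 1]) auto
      next
        case 2
        then obtain p where "{1..6} - Y = {p}" by (rule card_1_singletonE)
        then show thesis by (intro *[of p p]) auto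
      next
        case 3
        then obtain p q where "{1..6} - Y = {p, q}" by (auto simp: card_2_iff)
        then show thesis by (intro *[of p q]) auto
      qed
    qed
    obtain a b c where abc: "(a, b, c) \<noteq> (0, 0, 0)" "lat a b c p = 0" "lat a b c q = 0"
      using lattice_vector_vanishing_at_two[OF pq(1,2)] by blast
    have zero: "lat a b c j = 0" if "j \<notin> Y" for j
    proof (cases "j \<in> {1..6}")
      case True
      then show ?thesis using that pq(3) abc by auto
    qed (auto simp: lat_def)
    have "(\<Sum>j\<in>Y. rat_of_int (lat a b c j) * of_int (veronese i j)) = 0" if i: "i \<in> {1..3}" for i
    proof -
      have "(\<Sum>j\<in>Y. rat_of_int (lat a b c j) * of_int (veronese i j)) =
          (\<Sum>j=1..6. rat_of_int (lat a b c j) * of_int (veronese i j))"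
        using Y(1) zero by (intro sum.mono_neutral_left) auto
      also have "\<dots> = of_int (\<Sum>j=1..6. veronese i j * lat a b c j)"
        by (simp add: mult.commute)
      also have "\<dots> = 0"
        using lat_in_lattice6[of a b c] i by (simp add: toric_lattice_def)
      finally show ?thesis .
    qed
    moreover have "(\<forall>i\<in>{1..3}. (\<Sum>j\<in>Y. rat_of_int (lat a b c j) * of_int (veronese i j)) = 0) \<longrightarrow>
        (\<forall>j\<in>Y. rat_of_int (lat a b c j) = 0)"
      using Y(2) unfolding columns_indep_def by (rule spec)
    ultimately have "\<forall>j\<in>Y. rat_of_int (lat a b c j) = 0" by blast
    then have "lat a b c = lat 0 0 0" using zero unfolding lat_0 by (intro ext) auto
    then show False using abc(1) by (simp add: lat_inject)
  qed
  moreover have "{card Y |Y. Y \<subseteq> {1..6} \<and> columns_indep 3 veronese Y} \<noteq> {}"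
    using indep_triple[of 1 2 3] by (auto simp: triple_det_def veronese_values intro!: exI[of _ "{1,2,3}"])
  moreover have "finite {card Y |Y. Y \<subseteq> {1..6} \<and> columns_indep 3 veronese Y}"
    by (rule finite_subset[of _ "card ` Pow {1..6}"]) (blast, simp)
  ultimately show "column_rank 3 veronese {1..6} \<le> 3"
    unfolding column_rank_def by (subst Max_le_iff) auto
qed

lemma veronese_three_connected: "matroid_connected {1..6} (column_rank 3 veronese) 3"
  unfolding matroid_connected_def is_separation_def
proof (intro allI impI notI)
  fix k :: nat and X assume k: "1 \<le> k" "k < 3"
    and sep: "X \<subseteq> {1..6} \<and> k \<le> card X \<and> k \<le> card ({1..6} - X) \<and>
      column_rank 3 veronese X + column_rank 3 veronese ({1..6} - X) < column_rank 3 veronese {1..6} + k"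
  have *: False if Z: "Z \<subseteq> {1..6}" "k \<le> card Z" "card Z \<le> 3"
      "column_rank 3 veronese Z + column_rank 3 veronese ({1..6} - Z) < 3 + k" for Z
  proof -
    have "card Z = 1 \<or> card Z = 2 \<or> card Z = 3" using Z(2,3) k(1) by linarith
    then show False using veronese_rank_sum[OF Z(1)] Z k by linarith
  qed
  have "X \<subseteq> {1..6}" using sep by blast
  then have c: "card ({1..6} - X) = 6 - card X"
    using card_Diff_subset[of X "{1..6}"] finite_subset[of X "{1..6}"] by simp
  show False
  proof (cases "card X \<le> 3")
    case True
    then show False using *[of X] sep unfolding veronese_rank by blast
  next
    case False
    have "{1..6} - ({1..6} - X) = X" using sep by auto
    moreover have "column_rank 3 veronese X + column_rank 3 veronese ({1..6} - X) < 3 + k"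
      using sep unfolding veronese_rank by blast
    moreover have "card ({1..6} - X) \<le> 3" using False c by linarith
    ultimately show False
      using *[of "{1..6} - X"] sep by (simp only: add.commute) blast
  qed
qed

section \<open>A direction that separates lattice vectors\<close>

text \<open>On \<open>L\<close> the values are \<open>a + sqrt 2 * b + sqrt 3 * c\<close>: positive on the basis vectors and, as
  \<open>1\<close>, \<open>sqrt 2\<close>, \<open>sqrt 3\<close> are independent over the rationals, nonzero away from the origin.\<close>

definition weight6 :: "nat \<Rightarrow> real" where
  "weight6 j = (if j = 4 then sqrt 2 else if j = 5 then -1 else if j = 6 then sqrt 3 else 0)"

lemma weight6_lat: "(\<Sum>j=1..6. weight6 j * of_int (lat a b c j)) = a + sqrt 2 * b + sqrt 3 * c"
  by (simp add: sum_6s weight6_def)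

lemma sqrt_bounds: "1.41 < sqrt 2" "sqrt 2 < 1.42" "1.73 < sqrt 3" "sqrt 3 < 1.74"
  by (rule real_less_rsqrt real_less_lsqrt; simp add: power2_eq_square)+

text \<open>The multiplicity of \<open>p\<close> is even on the left and odd on the right.\<close>

lemma square_eq_prime_times:
  fixes k m p s :: int
  assumes "k\<^sup>2 = p * s * m\<^sup>2" "prime p" "\<not> p dvd s"
  shows "m = 0"
proof (rule ccontr)
  assume m: "m \<noteq> 0"
  have s: "s \<noteq> 0" "p \<noteq> 0" using assms by auto
  have pe: "prime_elem p" using assms(2) by auto
  have k: "k \<noteq> 0" using assms(1) m s by auto
  have "multiplicity p (k\<^sup>2) = 2 * multiplicity p k"
    by (rule prime_elem_multiplicity_power_distrib) (use pe k in auto)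
  moreover have "multiplicity p (p * s * m\<^sup>2) = multiplicity p p + multiplicity p s + 2 * multiplicity p m"
  proof -
    have "multiplicity p (p * s * m\<^sup>2) = multiplicity p (p * s) + multiplicity p (m\<^sup>2)"
      by (rule prime_elem_multiplicity_mult_distrib[OF pe]) (use s m in auto)
    also have "multiplicity p (p * s) = multiplicity p p + multiplicity p s"
      by (rule prime_elem_multiplicity_mult_distrib[OF pe]) (use s in auto)
    also have "multiplicity p (m\<^sup>2) = 2 * multiplicity p m"
      by (rule prime_elem_multiplicity_power_distrib[OF pe]) (use m in auto)
    finally show ?thesis .
  qed
  moreover have "multiplicity p p = 1"
    by (rule multiplicity_self) (use s(2) pe in \<open>auto simp only: prime_elem_def\<close>)
  moreover have "multiplicity p s = 0" using assms(3) by (rule not_dvd_imp_multiplicity_0)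
  ultimately have "2 * multiplicity p k = 1 + 2 * multiplicity p m" using assms(1) by simp
  then show False by presburger
qed

text \<open>Squaring \<open>a = - (sqrt 2 * b + sqrt 3 * c)\<close> leaves \<open>sqrt 6 * b * c\<close> as the only irrational term, and
  squaring once more makes \<open>24 * (b * c)\<^sup>2\<close> a perfect square.  So \<open>b * c = 0\<close>, and what remains is the
  irrationality of \<open>sqrt 2\<close> and \<open>sqrt 3\<close>.\<close>

lemma weight6_injective:
  fixes a b c :: int
  assumes "a + sqrt 2 * b + sqrt 3 * c = 0"
  shows "a = 0 \<and> b = 0 \<and> c = 0"
proof -
  have sq: "(sqrt 2 * b + sqrt 3 * c)\<^sup>2 = 2 * b\<^sup>2 + 3 * c\<^sup>2 + 2 * (sqrt 2 * sqrt 3) * (b * c)"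
    by (simp add: power2_eq_square algebra_simps)
  have "real_of_int a = - (sqrt 2 * b + sqrt 3 * c)" using assms by simp
  then have "(real_of_int a)\<^sup>2 = (sqrt 2 * b + sqrt 3 * c)\<^sup>2" by (simp only: power2_minus)
  then have "real_of_int a ^ 2 - 2 * real_of_int b ^ 2 - 3 * real_of_int c ^ 2 = 2 * (sqrt 2 * sqrt 3) * (b * c)"
    unfolding sq by simp
  then have "(real_of_int a ^ 2 - 2 * real_of_int b ^ 2 - 3 * real_of_int c ^ 2)\<^sup>2 =
      (2 * (sqrt 2 * sqrt 3) * (b * c))\<^sup>2" by simp
  also have "\<dots> = 24 * (real_of_int b * real_of_int c)\<^sup>2"
    by (simp add: power_mult_distrib)
  finally have "real_of_int ((a\<^sup>2 - 2 * b\<^sup>2 - 3 * c\<^sup>2)\<^sup>2) = real_of_int (3 * 8 * (b * c)\<^sup>2)" by simp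
  then have "(a\<^sup>2 - 2 * b\<^sup>2 - 3 * c\<^sup>2)\<^sup>2 = 3 * 8 * (b * c)\<^sup>2" by linarith
  then have bc: "b * c = 0" by (rule square_eq_prime_times) auto
  show ?thesis
  proof (cases "b = 0")
    case True
    then have "real_of_int a = - (sqrt 3 * c)" using assms by simp
    then have "(real_of_int a)\<^sup>2 = 3 * (real_of_int c)\<^sup>2" by (simp add: power_mult_distrib)
    then have "real_of_int (a\<^sup>2) = real_of_int (3 * 1 * c\<^sup>2)" by simp
    then have "a\<^sup>2 = 3 * 1 * c\<^sup>2" by linarith
    then have "c = 0" by (rule square_eq_prime_times) auto
    then show ?thesis using True assms by simp
  next
    case False
    then have c: "c = 0" using bc by simp
    then have "real_of_int a = - (sqrt 2 * b)" using assms by simp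
    then have "(real_of_int a)\<^sup>2 = 2 * (real_of_int b)\<^sup>2" by (simp add: power_mult_distrib)
    then have "real_of_int (a\<^sup>2) = real_of_int (2 * 1 * b\<^sup>2)" by simp
    then have "a\<^sup>2 = 2 * 1 * b\<^sup>2" by linarith
    then have "b = 0" by (rule square_eq_prime_times) auto
    then show ?thesis using False by simp
  qed
qed

lemma weight6_nonzero:
  assumes "u \<in> lattice6" "u \<noteq> (\<lambda>_. 0)"
  shows "(\<Sum>j=1..6. weight6 j * of_int (u j)) \<noteq> 0"
proof
  assume z: "(\<Sum>j=1..6. weight6 j * of_int (u j)) = 0"
  obtain a b c where u: "u = lat a b c" using assms(1) by (auto simp: lattice6_eq)
  have "a = 0 \<and> b = 0 \<and> c = 0" by (rule weight6_injective) (use z in \<open>simp only: u weight6_lat\<close>)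
  then show False using assms(2) lat_0 u by simp
qed

section \<open>The orthant semigroup\<close>

abbreviation "g1 \<equiv> lat 1 0 0"
abbreviation "g2 \<equiv> lat 0 1 0"
abbreviation "g3 \<equiv> lat 0 0 1"

text \<open>This turns out to be the semigroup of the reduced Groebner basis.\<close>

definition orthant :: "(nat \<Rightarrow> int) set" where
  "orthant = {lat a b c |a b c. 0 \<le> a \<and> 0 \<le> b \<and> 0 \<le> c}"

lemma basis_distinct: "g1 \<noteq> g2" "g1 \<noteq> g3" "g2 \<noteq> g3"
  by (simp_all add: lat_inject)

lemma int_comb_basis: "int_comb {g1, g2, g3} k = lat (k g1) (k g2) (k g3)"
proof
  fix j
  have "int_comb {g1, g2, g3} k j = k g1 * g1 j + k g2 * g2 j + k g3 * g3 j"
    using basis_distinct by (simp add: int_comb_def add.assoc)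
  also have "\<dots> = lat (k g1) (k g2) (k g3) j"
    by (simp add: lat_def)
  finally show "int_comb {g1, g2, g3} k j = lat (k g1) (k g2) (k g3) j" .
qed

lemma int_comb_lattice6:
  assumes "finite F" "F \<subseteq> lattice6"
  shows "int_comb F k = lat (\<Sum>g\<in>F. k g * - g 5) (\<Sum>g\<in>F. k g * g 4) (\<Sum>g\<in>F. k g * g 6)"
  using assms
proof (induction F rule: finite_induct)
  case empty
  then show ?case by (simp add: int_comb_def lat_0)
next
  case (insert g F)
  have "g = lat (- g 5) (g 4) (g 6)" using insert.prems by (intro lattice6_coords) auto
  then have g: "g j = lat (- g 5) (g 4) (g 6) j" for j by (rule fun_cong)
  show ?case
  proof
    fix j
    have "int_comb (insert g F) k j = k g * g j + int_comb F k j"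
      using insert.hyps by (simp add: int_comb_def)
    also have "\<dots> = k g * lat (- g 5) (g 4) (g 6) j +
        lat (\<Sum>g\<in>F. k g * - g 5) (\<Sum>g\<in>F. k g * g 4) (\<Sum>g\<in>F. k g * g 6) j"
      using insert.IH insert.prems g[of j] by simp
    also have "\<dots> = lat (\<Sum>g\<in>insert g F. k g * - g 5) (\<Sum>g\<in>insert g F. k g * g 4)
        (\<Sum>g\<in>insert g F. k g * g 6) j"
      using insert.hyps by (simp add: lat_def algebra_simps)
    finally show "int_comb (insert g F) k j = \<dots>" .
  qed
qed

lemma lattice6_basis: "is_Z_basis lattice6 {g1, g2, g3}"
  unfolding is_Z_basis_def
proof (intro conjI allI impI ballI)
  show "int_span {g1, g2, g3} = lattice6"
  proof (intro equalityI subsetI)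
    fix u assume "u \<in> int_span {g1, g2, g3}"
    then obtain F k where F: "finite F" "F \<subseteq> {g1, g2, g3}" "u = int_comb F k"
      by (auto simp: int_span_def)
    then have "F \<subseteq> lattice6" using lat_in_lattice6 by blast
    then show "u \<in> lattice6" unfolding F(3) int_comb_lattice6[OF F(1)] by (simp add: lat_in_lattice6 int_comb_lattice6[OF F(1)])
  next
    fix u assume "u \<in> lattice6"
    then have u: "u = lat (- u 5) (u 4) (u 6)" by (rule lattice6_coords)
    define k where "k = (\<lambda>g. if g = g1 then - u 5 else if g = g2 then u 4 else u 6)"
    have "u = int_comb {g1, g2, g3} k"
      unfolding int_comb_basis using u basis_distinct by (simp add: k_def)
    then show "u \<in> int_span {g1, g2, g3}" by (auto simp: int_span_def)
  qed
  fix k g assume "int_comb {g1, g2, g3} k = (\<lambda>_. 0)" and g: "g \<in> {g1, g2, g3}"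
  then have "lat (k g1) (k g2) (k g3) = lat 0 0 0" by (simp only: int_comb_basis lat_0)
  then show "k g = 0" using g by (auto simp: lat_inject)
qed simp

lemma orthant_subset: "orthant \<subseteq> lattice6"
  using lat_in_lattice6 by (auto simp: orthant_def)

lemma orthant_iff: "u \<in> orthant \<longleftrightarrow> u \<in> lattice6 \<and> u 5 \<le> 0 \<and> 0 \<le> u 4 \<and> 0 \<le> u 6"
proof
  assume "u \<in> lattice6 \<and> u 5 \<le> 0 \<and> 0 \<le> u 4 \<and> 0 \<le> u 6"
  then show "u \<in> orthant"
    unfolding orthant_def using lattice6_coords[of u] by (intro CollectI exI[of _ "- u 5"] exI[of _ "u 4"] exI[of _ "u 6"]) auto
qed (auto simp: orthant_def lat_in_lattice6)

lemma nat_span_subset_orthant: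
  assumes "S \<subseteq> orthant"
  shows "nat_span S \<subseteq> orthant"
proof
  fix u assume "u \<in> nat_span S"
  then obtain F k where F: "finite F" "F \<subseteq> S" "\<forall>g\<in>F. 0 \<le> k g" "u = int_comb F k"
    by (auto simp: nat_span_def)
  have Fo: "F \<subseteq> orthant" using F(2) assms by blast
  have "u = lat (\<Sum>g\<in>F. k g * - g 5) (\<Sum>g\<in>F. k g * g 4) (\<Sum>g\<in>F. k g * g 6)"
    unfolding F(4) by (rule int_comb_lattice6[OF F(1)]) (use Fo orthant_subset in blast)
  moreover have "0 \<le> (\<Sum>g\<in>F. k g * - g 5)" "0 \<le> (\<Sum>g\<in>F. k g * g 4)" "0 \<le> (\<Sum>g\<in>F. k g * g 6)"
    by (intro sum_nonneg mult_nonneg_nonneg; use F(3) Fo in \<open>auto simp: orthant_iff\<close>)+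
  ultimately show "u \<in> orthant" unfolding orthant_def by blast
qed

lemma nat_span_mono: "S \<subseteq> T \<Longrightarrow> nat_span S \<subseteq> nat_span T"
  unfolding nat_span_def by blast

lemma nat_span_basis: "nat_span {g1, g2, g3} = orthant"
proof
  show "nat_span {g1, g2, g3} \<subseteq> orthant"
    by (rule nat_span_subset_orthant) (auto simp: orthant_iff lat_in_lattice6)
  show "orthant \<subseteq> nat_span {g1, g2, g3}"
  proof
    fix u assume "u \<in> orthant"
    then obtain a b c where u: "u = lat a b c" "0 \<le> a" "0 \<le> b" "0 \<le> c" by (auto simp: orthant_def)
    define k where "k = (\<lambda>g. if g = g1 then a else if g = g2 then b else c)"
    have "u = int_comb {g1, g2, g3} k"
      unfolding int_comb_basis using u basis_distinct by (simp add: k_def)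
    moreover have "\<forall>g\<in>{g1, g2, g3}. 0 \<le> k g" using u by (auto simp: k_def)
    ultimately show "u \<in> nat_span {g1, g2, g3}" unfolding nat_span_def by blast
  qed
qed

lemma orthant_free: "free_semigroup orthant"
  unfolding free_semigroup_def
proof (intro exI[of _ "{g1, g2, g3}"] conjI allI impI ballI)
  fix k k' g assume "int_comb {g1, g2, g3} k = int_comb {g1, g2, g3} k'" and "g \<in> {g1, g2, g3}"
  then show "k g = k' g" unfolding int_comb_basis lat_inject by auto
qed (simp_all add: nat_span_basis)

lemma real_cone_orthant:
  assumes "x \<in> real_cone orthant"
  shows "x 5 \<le> 0" "0 \<le> x 4" "0 \<le> x 6"
    and "x = (\<lambda>j. - x 5 * of_int (g1 j) + x 4 * of_int (g2 j) + x 6 * of_int (g3 j))"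
proof -
  obtain F k where F: "finite F" "F \<subseteq> orthant" "\<forall>g\<in>F. 0 \<le> k g"
    "x = (\<lambda>j. \<Sum>g\<in>F. k g * real_of_int (g j))"
    using assms by (auto simp: real_cone_def)
  have g: "g 5 \<le> 0" "0 \<le> g 4" "0 \<le> g 6" "g = lat (- g 5) (g 4) (g 6)" if "g \<in> F" for g
    using that F(2) lattice6_coords[of g] by (auto simp: orthant_iff)
  have "0 \<le> (\<Sum>g\<in>F. k g * - real_of_int (g 5))"
    using F(3) g by (intro sum_nonneg mult_nonneg_nonneg) auto
  then show "x 5 \<le> 0" unfolding F(4) by (simp add: sum_negf)
  show "0 \<le> x 4" "0 \<le> x 6"
    unfolding F(4) using F(3) g by (auto intro!: sum_nonneg mult_nonneg_nonneg)
  show "x = (\<lambda>j. - x 5 * of_int (g1 j) + x 4 * of_int (g2 j) + x 6 * of_int (g3 j))"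
  proof
    fix j
    have "x j = (\<Sum>g\<in>F. k g * real_of_int (lat (- g 5) (g 4) (g 6) j))"
      unfolding F(4) by (intro sum.cong refl) (use g(4) in metis)
    also have "\<dots> = (\<Sum>g\<in>F. k g * (- real_of_int (g 5) * of_int (g1 j) + of_int (g 4) * of_int (g2 j) + of_int (g 6) * of_int (g3 j)))"
      by (intro sum.cong refl) (simp add: lat_def)
    also have "\<dots> = - x 5 * of_int (g1 j) + x 4 * of_int (g2 j) + x 6 * of_int (g3 j)"
      unfolding F(4) by (simp add: sum_distrib_left sum_distrib_right sum.distrib sum_negf sum_subtractf algebra_simps)
    finally show "x j = - x 5 * of_int (g1 j) + x 4 * of_int (g2 j) + x 6 * of_int (g3 j)" .
  qed
qed

lemma orthant_normal: "normal_semigroup orthant"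
  unfolding normal_semigroup_def
proof (intro ballI impI)
  fix u assume u: "u \<in> int_span orthant" and x: "(\<lambda>j. real_of_int (u j)) \<in> real_cone orthant"
  obtain F k where "finite F" "F \<subseteq> orthant" "u = int_comb F k" using u by (auto simp: int_span_def)
  then have "u = lat (\<Sum>g\<in>F. k g * - g 5) (\<Sum>g\<in>F. k g * g 4) (\<Sum>g\<in>F. k g * g 6)"
    using int_comb_lattice6[of F k] orthant_subset by simp
  then have "u \<in> lattice6" using lat_in_lattice6 by simp
  then show "u \<in> orthant" using real_cone_orthant(1-3)[OF x] by (simp add: orthant_iff)
qed

lemma orthant_unimodular: "unimodular_cone lattice6 (real_cone orthant)"
  unfolding unimodular_cone_def
proof (intro exI conjI)
  show "is_Z_basis lattice6 {g1, g2, g3}" by (rule lattice6_basis)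
  show "{g1, g2, g3} \<subseteq> {g1, g2, g3}" ..
  show "real_cone orthant = real_cone {g1, g2, g3}"
  proof
    show "real_cone orthant \<subseteq> real_cone {g1, g2, g3}"
    proof
      fix x assume x: "x \<in> real_cone orthant"
      define k where "k = (\<lambda>g. if g = g1 then - x 5 else if g = g2 then x 4 else x 6)"
      have "x j = (\<Sum>g\<in>{g1, g2, g3}. k g * of_int (g j))" for j
        using fun_cong[OF real_cone_orthant(4)[OF x], of j] basis_distinct
        by (simp add: k_def add.assoc)
      then have "x = (\<lambda>j. \<Sum>g\<in>{g1, g2, g3}. k g * of_int (g j))" by (rule ext)
      moreover have "\<forall>g\<in>{g1, g2, g3}. 0 \<le> k g"
        using real_cone_orthant(1-3)[OF x] by (auto simp: k_def)
      ultimately show "x \<in> real_cone {g1, g2, g3}" unfolding real_cone_def by blast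
    qed
    have "{g1, g2, g3} \<subseteq> orthant" by (auto simp: orthant_iff lat_in_lattice6)
    then show "real_cone {g1, g2, g3} \<subseteq> real_cone orthant" unfolding real_cone_def by blast
  qed
qed

section \<open>Negative supports\<close>

definition exponent6 :: "nat \<Rightarrow> complex" where
  "exponent6 j = (if j = 3 \<or> j = 5 then -1 else 0)"

abbreviation supp :: "int \<Rightarrow> int \<Rightarrow> int \<Rightarrow> nat set" where
  "supp a b c \<equiv> nsupp 6 (shift exponent6 (lat a b c))"

lemma nsupp_of_int: "nsupp n (\<lambda>j. of_int (z j)) = {j\<in>{1..n}. z j < 0}"
  unfolding nsupp_def by (auto simp: of_int_eq_iff) 

lemma shift_exponent6:
  "shift exponent6 u = (\<lambda>j. of_int (u j + (if j = 3 \<or> j = 5 then -1 else 0)))"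
  by (rule ext) (simp add: shift_def exponent6_def)

lemma mem_nsupp_shift:
  "j \<in> nsupp 6 (shift exponent6 u) \<longleftrightarrow> j \<in> {1..6} \<and> (if j = 3 \<or> j = 5 then u j \<le> 0 else u j < 0)"
  unfolding shift_exponent6 nsupp_of_int by auto

text \<open>The six inequalities that govern the example.  Coordinates 3 and 5 of the exponent are \<open>-1\<close>, which
  makes their inequalities weak.\<close>

lemma mem_supp:
  "j \<in> supp a b c \<longleftrightarrow> j = 1 \<and> a < 2 * b \<or> j = 2 \<and> b + c < a \<or> j = 3 \<and> a \<le> 2 * c \<or>
     j = 4 \<and> b < 0 \<or> j = 5 \<and> 0 \<le> a \<or> j = 6 \<and> c < 0"
  unfolding mem_nsupp_shift atLeastAtMost_6 by (auto simp: lat_def)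

lemma nsupps_eq: "nsupps 6 lattice6 exponent6 = {supp a b c |a b c. True}"
  unfolding nsupps_def lattice6_eq by blast

lemma supp_0: "nsupp 6 exponent6 = {3, 5}"
proof -
  have "shift exponent6 (lat 0 0 0) = exponent6" by (rule ext) (simp add: shift_def lat_0)
  then have "nsupp 6 exponent6 = supp 0 0 0" by simp
  also have "\<dots> = {3, 5}" by (rule Set.set_eqI) (auto simp: mem_supp)
  finally show ?thesis .
qed

lemma supp_eqI:
  assumes "a < 2 * b \<longleftrightarrow> a' < 2 * b'" "b + c < a \<longleftrightarrow> b' + c' < a'" "a \<le> 2 * c \<longleftrightarrow> a' \<le> 2 * c'"
    "b < 0 \<longleftrightarrow> b' < 0" "0 \<le> a \<longleftrightarrow> 0 \<le> a'" "c < 0 \<longleftrightarrow> c' < 0"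
  shows "supp a b c = supp a' b' c'"
  by (rule Set.set_eqI) (simp only: mem_supp assms)

text \<open>The supports of the lattice vectors with \<open>a, b, c \<ge> 0\<close> that do not contain both 1 and 3.
  Without this exclusion the family would not be closed under passing to smaller supports.\<close>

definition family6 :: "nat set set" where
  "family6 = {{1, 5}, {2, 5}, {3, 5}, {1, 2, 5}, {2, 3, 5}}"

abbreviation "distinguished6 \<equiv> distinguished_nsupps 6 lattice6 weight6 exponent6"

lemma supp_in_family6_iff:
  "supp a b c \<in> family6 \<longleftrightarrow> 0 \<le> a \<and> 0 \<le> b \<and> 0 \<le> c \<and> \<not> (a < 2 * b \<and> a \<le> 2 * c)"
proof
  assume "supp a b c \<in> family6"
  then have "4 \<notin> supp a b c \<and> 6 \<notin> supp a b c \<and> 5 \<in> supp a b c \<and> \<not> (1 \<in> supp a b c \<and> 3 \<in> supp a b c)"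
    unfolding family6_def by (elim insertE emptyE) simp_all
  then show "0 \<le> a \<and> 0 \<le> b \<and> 0 \<le> c \<and> \<not> (a < 2 * b \<and> a \<le> 2 * c)"
    unfolding mem_supp by auto
next
  assume h: "0 \<le> a \<and> 0 \<le> b \<and> 0 \<le> c \<and> \<not> (a < 2 * b \<and> a \<le> 2 * c)"
  have e: "supp a b c = (if a < 2 * b then {1} else {}) \<union> (if b + c < a then {2} else {}) \<union>
      (if a \<le> 2 * c then {3} else {}) \<union> {5}"
    by (rule Set.set_eqI) (use h in \<open>auto simp: mem_supp\<close>)
  have "a < 2 * b \<or> b + c < a \<or> a \<le> 2 * c" using h by linarith
  then show "supp a b c \<in> family6"
    unfolding e family6_def using h by (auto simp: insert_commute)
qed

lemma distinguished6_weight: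
  assumes "supp a b c \<in> distinguished6"
  shows "0 \<le> a + sqrt 2 * b + sqrt 3 * c"
  using assms lat_in_lattice6[of a b c] weight6_lat[of a b c]
  unfolding distinguished_nsupps_def by force

text \<open>The weight is nonnegative where all three coordinates are.\<close>

lemma distinguished6I:
  assumes "\<And>a' b' c'. supp a' b' c' = supp a b c \<Longrightarrow> 0 \<le> a' \<and> 0 \<le> b' \<and> 0 \<le> c'"
  shows "supp a b c \<in> distinguished6"
  unfolding distinguished_nsupps_def
proof (intro CollectI conjI ballI impI)
  show "supp a b c \<in> nsupps 6 lattice6 exponent6" by (auto simp: nsupps_eq)
  fix u assume "u \<in> lattice6" and eq: "nsupp 6 (shift exponent6 u) = supp a b c"
  then obtain a' b' c' where u: "u = lat a' b' c'" by (auto simp: lattice6_eq)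
  have "0 \<le> a' \<and> 0 \<le> b' \<and> 0 \<le> c'" using assms eq u by blast
  then show "0 \<le> (\<Sum>j=1..6. weight6 j * of_int (u j))"
    unfolding u weight6_lat by simp
qed

lemma supp_signs:
  "supp a b c = supp a' b' c' \<Longrightarrow> (a < 2 * b \<longleftrightarrow> a' < 2 * b') \<and> (b + c < a \<longleftrightarrow> b' + c' < a') \<and>
    (a \<le> 2 * c \<longleftrightarrow> a' \<le> 2 * c') \<and> (b < 0 \<longleftrightarrow> b' < 0) \<and> (0 \<le> a \<longleftrightarrow> 0 \<le> a') \<and> (c < 0 \<longleftrightarrow> c' < 0)"
proof -
  assume "supp a b c = supp a' b' c'"
  then have eq: "j \<in> supp a b c \<longleftrightarrow> j \<in> supp a' b' c'" for j by simp
  show ?thesis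
    using eq[of 1] eq[of 2] eq[of 3] eq[of 4] eq[of 5] eq[of 6] unfolding mem_supp by simp
qed

lemma family6_mem_supp: "I \<in> family6 \<Longrightarrow> \<exists>a b c. I = supp a b c"
proof -
  have "supp 1 1 0 = {1, 5}" "supp 1 0 0 = {2, 5}" "supp 0 0 0 = {3, 5}"
    "supp 3 2 0 = {1, 2, 5}" "supp 2 0 1 = {2, 3, 5}"
    by (rule Set.set_eqI, auto simp: mem_supp)+
  then show "I \<in> family6 \<Longrightarrow> \<exists>a b c. I = supp a b c"
    unfolding family6_def by (elim insertE emptyE) metis+
qed

lemma family6_subset_distinguished: "family6 \<subseteq> distinguished6"
proof
  fix I assume I: "I \<in> family6"
  then obtain a b c where abc: "I = supp a b c" using family6_mem_supp by blast
  show "I \<in> distinguished6"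
    unfolding abc
  proof (rule distinguished6I)
    fix a' b' c' assume "supp a' b' c' = supp a b c"
    then have "supp a' b' c' \<in> family6" using I abc by simp
    then show "0 \<le> a' \<and> 0 \<le> b' \<and> 0 \<le> c'" by (simp add: supp_in_family6_iff)
  qed
qed

text \<open>A support is not distinguished as soon as one lattice vector with this support has negative weight.
  The list in the proof gives such a vector for each realizable pattern of inequalities that violates
  the claim.\<close>

lemma distinguished6_signs:
  assumes "supp a b c \<in> distinguished6"
  shows "0 \<le> a \<and> 0 \<le> c \<and> (0 \<le> b \<or> a \<le> 2 * c)"
proof -
  have no: "\<not> ((a < 2 * b \<longleftrightarrow> a' < 2 * b') \<and> (b + c < a \<longleftrightarrow> b' + c' < a') \<and>
    (a \<le> 2 * c \<longleftrightarrow> a' \<le> 2 * c') \<and> (b < 0 \<longleftrightarrow> b' < 0) \<and> (0 \<le> a \<longleftrightarrow> 0 \<le> a') \<and> (c < 0 \<longleftrightarrow> c' < 0))"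
    if neg: "a' + sqrt 2 * b' + sqrt 3 * c' < 0" for a' b' c' :: int
  proof
    assume "(a < 2 * b \<longleftrightarrow> a' < 2 * b') \<and> (b + c < a \<longleftrightarrow> b' + c' < a') \<and>
      (a \<le> 2 * c \<longleftrightarrow> a' \<le> 2 * c') \<and> (b < 0 \<longleftrightarrow> b' < 0) \<and> (0 \<le> a \<longleftrightarrow> 0 \<le> a') \<and> (c < 0 \<longleftrightarrow> c' < 0)"
    then have "supp a b c = supp a' b' c'" by (intro supp_eqI) auto
    then have "supp a' b' c' \<in> distinguished6" using assms by simp
    then show False using distinguished6_weight neg by fastforce
  qed
  note bounds = sqrt_bounds
  have n0: "\<not> ( a < 2 * b \<and>  b + c < a \<and> \<not> a \<le> 2 * c \<and>  b < 0 \<and> \<not> 0 \<le> a \<and>  c < 0)"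
    using no[of "-3" "-1" "-3"] bounds by simp
  have n1: "\<not> ( a < 2 * b \<and>  b + c < a \<and> \<not> a \<le> 2 * c \<and> \<not> b < 0 \<and>  0 \<le> a \<and>  c < 0)"
    using no[of "0" "1" "-2"] bounds by simp
  have n2: "\<not> ( a < 2 * b \<and>  b + c < a \<and> \<not> a \<le> 2 * c \<and> \<not> b < 0 \<and> \<not> 0 \<le> a \<and>  c < 0)"
    using no[of "-1" "0" "-2"] bounds by simp
  have n3: "\<not> ( a < 2 * b \<and> \<not> b + c < a \<and>  a \<le> 2 * c \<and> \<not> b < 0 \<and> \<not> 0 \<le> a \<and> \<not> c < 0)"
    using no[of "-1" "0" "0"] bounds by simp
  have n4: "\<not> ( a < 2 * b \<and> \<not> b + c < a \<and>  a \<le> 2 * c \<and>  b < 0 \<and> \<not> 0 \<le> a \<and> \<not> c < 0)"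
    using no[of "-3" "-1" "0"] bounds by simp
  have n5: "\<not> ( a < 2 * b \<and> \<not> b + c < a \<and>  a \<le> 2 * c \<and>  b < 0 \<and> \<not> 0 \<le> a \<and>  c < 0)"
    using no[of "-3" "-1" "-1"] bounds by simp
  have n6: "\<not> ( a < 2 * b \<and> \<not> b + c < a \<and>  a \<le> 2 * c \<and> \<not> b < 0 \<and> \<not> 0 \<le> a \<and>  c < 0)"
    using no[of "-2" "0" "-1"] bounds by simp
  have n7: "\<not> ( a < 2 * b \<and> \<not> b + c < a \<and> \<not> a \<le> 2 * c \<and>  b < 0 \<and> \<not> 0 \<le> a \<and>  c < 0)"
    using no[of "-3" "-1" "-2"] bounds by simp
  have n8: "\<not> ( a < 2 * b \<and> \<not> b + c < a \<and> \<not> a \<le> 2 * c \<and> \<not> b < 0 \<and>  0 \<le> a \<and>  c < 0)"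
    using no[of "0" "1" "-1"] bounds by simp
  have n9: "\<not> ( a < 2 * b \<and> \<not> b + c < a \<and> \<not> a \<le> 2 * c \<and> \<not> b < 0 \<and> \<not> 0 \<le> a \<and>  c < 0)"
    using no[of "-1" "0" "-1"] bounds by simp
  have n10: "\<not> (\<not> a < 2 * b \<and>  b + c < a \<and>  a \<le> 2 * c \<and>  b < 0 \<and> \<not> 0 \<le> a \<and> \<not> c < 0)"
    using no[of "-1" "-2" "0"] bounds by simp
  have n11: "\<not> (\<not> a < 2 * b \<and>  b + c < a \<and>  a \<le> 2 * c \<and>  b < 0 \<and>  0 \<le> a \<and> \<not> c < 0)"
    using no[of "0" "-1" "0"] bounds by simp
  have n12: "\<not> (\<not> a < 2 * b \<and>  b + c < a \<and>  a \<le> 2 * c \<and>  b < 0 \<and> \<not> 0 \<le> a \<and>  c < 0)"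
    using no[of "-2" "-2" "-1"] bounds by simp
  have n13: "\<not> (\<not> a < 2 * b \<and>  b + c < a \<and> \<not> a \<le> 2 * c \<and>  b < 0 \<and>  0 \<le> a \<and> \<not> c < 0)"
    using no[of "1" "-1" "0"] bounds by simp
  have n14: "\<not> (\<not> a < 2 * b \<and>  b + c < a \<and> \<not> a \<le> 2 * c \<and>  b < 0 \<and>  0 \<le> a \<and>  c < 0)"
    using no[of "0" "-1" "-1"] bounds by simp
  have n15: "\<not> (\<not> a < 2 * b \<and>  b + c < a \<and> \<not> a \<le> 2 * c \<and>  b < 0 \<and> \<not> 0 \<le> a \<and>  c < 0)"
    using no[of "-1" "-1" "-1"] bounds by simp
  have n16: "\<not> (\<not> a < 2 * b \<and>  b + c < a \<and> \<not> a \<le> 2 * c \<and> \<not> b < 0 \<and>  0 \<le> a \<and>  c < 0)"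
    using no[of "0" "0" "-1"] bounds by simp
  have n17: "\<not> (\<not> a < 2 * b \<and> \<not> b + c < a \<and>  a \<le> 2 * c \<and>  b < 0 \<and> \<not> 0 \<le> a \<and> \<not> c < 0)"
    using no[of "-1" "-1" "0"] bounds by simp
  have n18: "\<not> (\<not> a < 2 * b \<and> \<not> b + c < a \<and>  a \<le> 2 * c \<and>  b < 0 \<and> \<not> 0 \<le> a \<and>  c < 0)"
    using no[of "-2" "-1" "-1"] bounds by simp
  show ?thesis
    using n0 n1 n2 n3 n4 n5 n6 n7 n8 n9 n10 n11 n12 n13 n14 n15 n16 n17 n18 by smt
qed

lemma family6_ordered: "ordered_family 6 lattice6 exponent6 family6"
  unfolding ordered_family_def
proof (intro ballI impI)
  fix I J assume I: "I \<in> family6" and J: "J \<in> nsupps 6 lattice6 exponent6" "J \<subseteq> I"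
  obtain a b c where abc: "J = supp a b c" using J(1) by (auto simp: nsupps_eq)
  have "4 \<notin> I \<and> 6 \<notin> I \<and> \<not> (1 \<in> I \<and> 3 \<in> I)"
    using I unfolding family6_def by (elim insertE emptyE) simp_all
  then have "4 \<notin> J" "6 \<notin> J" "\<not> (1 \<in> J \<and> 3 \<in> J)" using J(2) by auto
  then have "0 \<le> b" "0 \<le> c" "\<not> (a < 2 * b \<and> a \<le> 2 * c)" unfolding abc mem_supp by auto
  then show "J \<in> family6" unfolding abc supp_in_family6_iff by auto
qed

lemma supp_135: "supp 1 1 1 = {1, 3, 5}"
  by (rule Set.set_eqI) (auto simp: mem_supp)

lemma supp_13: "supp (-1) 0 0 = {1, 3}"
  by (rule Set.set_eqI) (auto simp: mem_supp)

lemma supp_not_distinguished: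
  "a + sqrt 2 * b + sqrt 3 * c < 0 \<Longrightarrow> supp a b c \<notin> distinguished6" for a b c :: int
  using distinguished6_weight[of a b c] by auto

lemma distinguished6_not_ordered: "\<not> ordered_family 6 lattice6 exponent6 distinguished6"
proof
  assume ord: "ordered_family 6 lattice6 exponent6 distinguished6"
  have "supp 1 1 1 \<in> distinguished6"
  proof (rule distinguished6I)
    fix a b c assume "supp a b c = supp 1 1 1"
    from supp_signs[OF this] show "0 \<le> a \<and> 0 \<le> b \<and> 0 \<le> c" by simp
  qed
  moreover have "supp (-1) 0 0 \<in> nsupps 6 lattice6 exponent6" unfolding nsupps_eq by blast
  moreover have "supp (-1) 0 0 \<subseteq> supp 1 1 1" unfolding supp_135 supp_13 by simp
  ultimately have "supp (-1) 0 0 \<in> distinguished6"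
    using ord[unfolded ordered_family_def, rule_format, of "supp 1 1 1" "supp (-1) 0 0"] by simp
  then show False using supp_not_distinguished[of "-1" 0 0] by simp
qed

lemma family6_negative_support: "negative_support_family 6 lattice6 weight6 exponent6 family6"
  unfolding negative_support_family_def using family6_subset_distinguished
  by (simp add: supp_0 family6_def)

section \<open>The two monomial ideals\<close>

text \<open>These turn out to be the exponent sets of the minimal generators of the two monomial ideals, for
  \<open>family6\<close> and for the distinguished collection.  As all families in between can be treated at
  once, the lemmas below concern an arbitrary such family.\<close>

definition min_M :: "nat set set" where "min_M = {{1}, {2}, {3}}"
definition min_P :: "nat set set" where "min_P = {{3, 4}, {2, 6}, {2, 4}, {1, 6}, {1, 3}}"

context
  fixes N :: "nat set set"
  assumes lower: "family6 \<subseteq> N" and upper: "N \<subseteq> distinguished6"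
begin

lemma member_supp: "I \<in> N \<Longrightarrow> \<exists>a b c. I = supp a b c \<and> 0 \<le> a \<and> 0 \<le> c \<and> (0 \<le> b \<or> a \<le> 2 * c)"
proof -
  assume I: "I \<in> N"
  then have "I \<in> nsupps 6 lattice6 exponent6" using upper by (auto simp: distinguished_nsupps_def)
  then obtain a b c where "I = supp a b c" by (auto simp: nsupps_eq)
  then show ?thesis using distinguished6_signs[of a b c] I upper by blast
qed

lemma Inter_N: "\<Inter>N = {5}"
proof
  have "{1, 5} \<in> N" "{2, 5} \<in> N" using lower by (auto simp: family6_def)
  then have "\<Inter>N \<subseteq> {1, 5} \<inter> {2, 5}" by blast
  also have "{1, 5} \<inter> {2, 5} = {5::nat}" by auto
  finally show "\<Inter>N \<subseteq> {5}" .
  have "5 \<in> I" if "I \<in> N" for I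
    using member_supp[OF that] unfolding mem_supp[of 5] by (auto simp: mem_supp)
  then show "{5} \<subseteq> \<Inter>N" by blast
qed

lemma min_M_subset: "min_M \<subseteq> M_sets N"
proof -
  have "{1, 5} - {5} \<in> M_sets N" "{2, 5} - {5} \<in> M_sets N" "{3, 5} - {5} \<in> M_sets N"
    using lower unfolding M_sets_def Inter_N family6_def by blast+
  then show ?thesis by (auto simp: min_M_def insert_Diff_if)
qed

lemma M_sets_above: "X \<in> M_sets N \<Longrightarrow> \<exists>Y\<in>min_M. Y \<subseteq> X"
proof -
  assume "X \<in> M_sets N"
  then obtain I where I: "I \<in> N" "X = I - {5}" unfolding M_sets_def Inter_N by blast
  obtain a b c where abc: "I = supp a b c" using member_supp[OF I(1)] by blast
  have "a < 2 * b \<or> b + c < a \<or> a \<le> 2 * c" by linarith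
  then have "1 \<in> I \<or> 2 \<in> I \<or> 3 \<in> I" unfolding abc mem_supp by auto
  then show ?thesis unfolding I(2) min_M_def by auto
qed

lemma min_P_subset: "min_P \<subseteq> P_sets 6 lattice6 exponent6 N"
proof -
  \<comment> \<open>Supports outside the family, each attained at a lattice vector of negative weight.\<close>
  have s: "supp (-1) (-1) 0 = {3, 4}" "supp 0 0 (-1) = {2, 5, 6}" "supp 1 (-1) 0 = {2, 4, 5}"
    "supp (-1) 0 (-1) = {1, 6}" "supp (-1) 0 0 = {1, 3}"
    by (rule Set.set_eqI, auto simp: mem_supp)+
  have "supp (-1) (-1) 0 \<notin> N" "supp 0 0 (-1) \<notin> N" "supp 1 (-1) 0 \<notin> N"
    "supp (-1) 0 (-1) \<notin> N" "supp (-1) 0 0 \<notin> N"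
    using upper sqrt_bounds
    by (auto dest!: subsetD simp: supp_not_distinguished)
  then have S: "J \<in> nsupps 6 lattice6 exponent6 - N" if "J \<in> {{3, 4}, {2, 5, 6}, {2, 4, 5}, {1, 6}, {1, 3}}" for J
    using that unfolding s[symmetric] nsupps_eq by (elim insertE emptyE) blast+
  have P: "(I \<union> J) - {5} \<in> P_sets 6 lattice6 exponent6 N"
    if "I \<in> family6" "J \<in> {{3, 4}, {2, 5, 6}, {2, 4, 5}, {1, 6}, {1, 3}}" for I J
    unfolding P_sets_def Inter_N using that(1) lower S[OF that(2)] by blast
  have "({3, 5} \<union> {3, 4}) - {5} \<in> P_sets 6 lattice6 exponent6 N"
    "({2, 5} \<union> {2, 5, 6}) - {5} \<in> P_sets 6 lattice6 exponent6 N"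
    "({2, 5} \<union> {2, 4, 5}) - {5} \<in> P_sets 6 lattice6 exponent6 N"
    "({1, 5} \<union> {1, 6}) - {5} \<in> P_sets 6 lattice6 exponent6 N"
    "({1, 5} \<union> {1, 3}) - {5} \<in> P_sets 6 lattice6 exponent6 N"
    by (rule P; simp add: family6_def)+
  moreover have "({3, 5} \<union> {3, 4}) - {5} = {3, 4::nat}" "({2, 5} \<union> {2, 5, 6}) - {5} = {2, 6::nat}"
    "({2, 5} \<union> {2, 4, 5}) - {5} = {2, 4::nat}" "({1, 5} \<union> {1, 6}) - {5} = {1, 6::nat}"
    "({1, 5} \<union> {1, 3}) - {5} = {1, 3::nat}"
    by auto
  ultimately show ?thesis unfolding min_P_def by simp
qed

text \<open>A pure matter of inequalities: each of the ways in which \<open>J\<close> can fail to be a member of \<open>family6\<close>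
  forces one of the five pairs into \<open>I \<union> J\<close>.\<close>

lemma P_sets_above: "X \<in> P_sets 6 lattice6 exponent6 N \<Longrightarrow> \<exists>Y\<in>min_P. Y \<subseteq> X"
proof -
  assume "X \<in> P_sets 6 lattice6 exponent6 N"
  then obtain I J where IJ: "I \<in> N" "J \<in> nsupps 6 lattice6 exponent6" "J \<notin> N" "X = (I \<union> J) - {5}"
    unfolding P_sets_def Inter_N by blast
  obtain a b c where I: "I = supp a b c" "0 \<le> a" "0 \<le> c" "0 \<le> b \<or> a \<le> 2 * c"
    using member_supp[OF IJ(1)] by blast
  obtain a' b' c' where J: "J = supp a' b' c'" using IJ(2) by (auto simp: nsupps_eq)
  have "J \<notin> family6" using IJ(3) lower by blast
  then have J': "\<not> (0 \<le> a' \<and> 0 \<le> b' \<and> 0 \<le> c' \<and> \<not> (a' < 2 * b' \<and> a' \<le> 2 * c'))"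
    unfolding J supp_in_family6_iff .
  have "((a \<le> 2 * c \<or> a' \<le> 2 * c') \<and> (b < 0 \<or> b' < 0)) \<or> ((b + c < a \<or> b' + c' < a') \<and> (c < 0 \<or> c' < 0)) \<or>
    ((b + c < a \<or> b' + c' < a') \<and> (b < 0 \<or> b' < 0)) \<or> ((a < 2 * b \<or> a' < 2 * b') \<and> (c < 0 \<or> c' < 0)) \<or>
    ((a < 2 * b \<or> a' < 2 * b') \<and> (a \<le> 2 * c \<or> a' \<le> 2 * c'))"
    using I(2-4) J' by smt
  then have "(3 \<in> X \<and> 4 \<in> X) \<or> (2 \<in> X \<and> 6 \<in> X) \<or> (2 \<in> X \<and> 4 \<in> X) \<or> (1 \<in> X \<and> 6 \<in> X) \<or> (1 \<in> X \<and> 3 \<in> X)"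
    unfolding IJ(4) I(1) J by (simp add: mem_supp)
  then show ?thesis unfolding min_P_def by auto
qed

lemma M_sets_range: "X \<in> M_sets N \<Longrightarrow> X \<subseteq> {1..6}"
  using upper unfolding M_sets_def distinguished_nsupps_def nsupps_def nsupp_def by blast

lemma P_sets_range: "X \<in> P_sets 6 lattice6 exponent6 N \<Longrightarrow> X \<subseteq> {1..6}"
  using upper unfolding P_sets_def distinguished_nsupps_def nsupps_def nsupp_def by blast

end

lemma minimal_membersI:
  assumes "A \<subseteq> F" "\<And>X. X \<in> F \<Longrightarrow> \<exists>Y\<in>A. Y \<subseteq> X"
    and "\<And>X Y. X \<in> A \<Longrightarrow> Y \<in> A \<Longrightarrow> X \<subseteq> Y \<Longrightarrow> X = Y"
  shows "minimal_members F = A"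
proof (intro equalityI subsetI)
  fix X assume "X \<in> minimal_members F"
  then have X: "X \<in> F" "\<And>Y. Y \<in> F \<Longrightarrow> Y \<subseteq> X \<Longrightarrow> Y = X" by (auto simp: minimal_members_def)
  obtain Y where Y: "Y \<in> A" "Y \<subseteq> X" using assms(2)[OF X(1)] by blast
  then have "Y = X" using X(2) assms(1) by blast
  then show "X \<in> A" using Y by simp
next
  fix X assume X: "X \<in> A"
  have "Y = X" if Y: "Y \<in> F" "Y \<subseteq> X" for Y
  proof -
    obtain Z where Z: "Z \<in> A" "Z \<subseteq> Y" using assms(2)[OF Y(1)] by blast
    then have "Z = X" using assms(3)[OF Z(1) X] Y(2) by blast
    then show ?thesis using Z(2) Y(2) by blast
  qed
  then show "X \<in> minimal_members F" using X assms(1) by (auto simp: minimal_members_def)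
qed

lemma min_M_antichain: "X \<in> min_M \<Longrightarrow> Y \<in> min_M \<Longrightarrow> X \<subseteq> Y \<Longrightarrow> X = Y"
  unfolding min_M_def by (elim insertE emptyE) simp_all

lemma min_P_antichain: "X \<in> min_P \<Longrightarrow> Y \<in> min_P \<Longrightarrow> X \<subseteq> Y \<Longrightarrow> X = Y"
  unfolding min_P_def by (elim insertE emptyE) simp_all

lemma minimal_M: "minimal_members (M_sets family6) = min_M"
  by (rule minimal_membersI[OF min_M_subset M_sets_above min_M_antichain])
     (use family6_subset_distinguished in simp_all)

lemma minimal_P: "minimal_members (P_sets 6 lattice6 exponent6 family6) = min_P"
  by (rule minimal_membersI[OF min_P_subset P_sets_above min_P_antichain])
     (use family6_subset_distinguished in simp_all)

section \<open>The Groebner basis\<close>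

lemma weight_monomials: "m \<in> monomials n \<Longrightarrow> weight w m = (\<Sum>j=1..n. w j * of_nat (lookup m j))"
  unfolding weight_def
  by (rule sum.mono_neutral_left) (auto simp: monomials_def in_keys_iff)

lemma weight_diff:
  assumes "m \<in> monomials n" "m' \<in> monomials n"
  shows "weight w m - weight w m' = (\<Sum>j=1..n. w j * of_int (int (lookup m j) - int (lookup m' j)))"
  by (simp add: weight_monomials[OF assms(1)] weight_monomials[OF assms(2)] sum_subtractf[symmetric]
      algebra_simps)

lemma pos_neg_part: "j \<in> {1..n} \<Longrightarrow> int (lookup (pos_part n u) j) - int (lookup (neg_part n u) j) = u j"
  by (simp add: lookup_pos_part lookup_neg_part)

lemma weight_binom:
  "weight w (pos_part n u) - weight w (neg_part n u) = (\<Sum>j=1..n. w j * of_int (u j))"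
  by (subst weight_diff[OF pos_part_monomials neg_part_monomials])
     (intro sum.cong refl, simp only: pos_neg_part)

lemma init_form_binom:
  assumes "0 < (\<Sum>j=1..n. w j * of_int (u j))"
  shows "init_form (weight w) (binom n u) = single (pos_part n u) 1"
proof (rule poly_mapping_eqI)
  fix m
  have less: "weight w (neg_part n u) < weight w (pos_part n u)"
    using assms weight_binom[of w n u] by simp
  then have ne: "pos_part n u \<noteq> neg_part n u" by auto
  then have k: "keys (binom n u) = {pos_part n u, neg_part n u}"
    by (auto simp: binom_def in_keys_iff lookup_minus lookup_single when_def split: if_splits)
  show "lookup (init_form (weight w) (binom n u)) m = lookup (single (pos_part n u) 1) m"
    unfolding lookup_init_form k
    using less ne by (auto simp: binom_def lookup_minus lookup_single when_def)
qed

lemma binom_inject: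
  assumes "u \<in> toric_lattice n d A" "u' \<in> toric_lattice n d A" "u' \<noteq> (\<lambda>_. 0)" "binom n u = binom n u'"
  shows "u = u'"
proof -
  have "pos_part n u' \<noteq> neg_part n u'"
  proof
    assume eq: "pos_part n u' = neg_part n u'"
    have "u' j = 0" for j
      using pos_neg_part[of j n u'] eq assms(2) by (cases "j \<in> {1..n}") (auto simp: toric_lattice_def)
    then show False using assms(3) by auto
  qed
  then have "lookup (binom n u) (pos_part n u') = 1" "lookup (binom n u) (neg_part n u') = -1"
    unfolding assms(4) by (simp_all add: binom_def lookup_minus lookup_single when_def)
  then have eq: "pos_part n u = pos_part n u'" "neg_part n u = neg_part n u'"
    by (auto simp: binom_def lookup_minus lookup_single when_def split: if_splits)
  have "u j = u' j" for j
    using pos_neg_part[of j n u'] pos_neg_part[of j n u] assms(1,2) unfolding eq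
    by (cases "j \<in> {1..n}") (auto simp: toric_lattice_def)
  then show ?thesis by (rule ext)
qed

definition coeff_sum :: "cpoly \<Rightarrow> complex" where
  "coeff_sum f = (\<Sum>m\<in>keys f. lookup f m)"

lemma coeff_sum_superset: "finite S \<Longrightarrow> keys f \<subseteq> S \<Longrightarrow> coeff_sum f = (\<Sum>m\<in>S. lookup f m)"
  unfolding coeff_sum_def by (rule sum.mono_neutral_left) (auto simp: in_keys_iff)

lemma coeff_sum_add: "coeff_sum (f + g) = coeff_sum f + coeff_sum g"
proof -
  let ?S = "keys f \<union> keys g"
  have "coeff_sum (f + g) = (\<Sum>m\<in>?S. lookup (f + g) m)"
    by (rule coeff_sum_superset) (use keys_add[of f g] in auto)
  then show ?thesis
    by (simp add: lookup_add sum.distrib coeff_sum_superset[of ?S f] coeff_sum_superset[of ?S g])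
qed

lemma coeff_sum_0: "coeff_sum 0 = 0" by (simp add: coeff_sum_def)

lemma coeff_sum_sum: "coeff_sum (sum f I) = (\<Sum>i\<in>I. coeff_sum (f i))"
  by (induction I rule: infinite_finite_induct) (simp_all add: coeff_sum_add coeff_sum_0)

lemma coeff_sum_single: "coeff_sum (single m c) = c"
  by (simp add: coeff_sum_def)

lemma coeff_sum_single_mult: "coeff_sum (single m c * f) = c * coeff_sum f"
  unfolding single_mult_poly coeff_sum_sum coeff_sum_single
  by (simp add: coeff_sum_def sum_distrib_left)

text \<open>Setting all variables to 1 kills binomials, and it kills each graded component of an element of the
  toric ideal because such a component lies in the ideal again.\<close>

lemma toric_ideal_coeff_sum:
  assumes "f \<in> toric_ideal n d A"
  shows "coeff_sum (poly_part (toric_lattice n d A) e f) = 0"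
proof -
  let ?L = "toric_lattice n d A"
  have "toric_ideal n d A \<subseteq> {f \<in> polys n. \<forall>e. coeff_sum (poly_part ?L e f) = 0}" (is "_ \<subseteq> ?T")
    unfolding toric_ideal_def
  proof (rule genideal_least[OF toric_gens_polys])
    have "coeff_sum (binom n u) = 0" for u
      using coeff_sum_add[of "binom n u" "single (neg_part n u) 1"]
      by (simp add: binom_def coeff_sum_single)
    then show "binom n ` ?L \<subseteq> ?T" by (auto simp: binom_polys poly_part_binom coeff_sum_0)
    show "0 \<in> ?T" by (simp add: polys_0 poly_part_def coeff_sum_0)
    show "a + b \<in> ?T" if "a \<in> ?T" "b \<in> ?T" for a b
      using that by (simp add: polys_add poly_part_add coeff_sum_add)
    show "x * a \<in> ?T" if "a \<in> ?T" "x \<in> polys n" for a x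
    proof (rule CollectI, intro conjI allI)
      show "x * a \<in> polys n" using that by (simp add: polys_mult)
      fix e show "coeff_sum (poly_part ?L e (x * a)) = 0"
        by (subst poly_expand_mult)
           (use that in \<open>simp add: poly_part_sum poly_part_single_mult coeff_sum_sum coeff_sum_single_mult\<close>)
    qed
  qed auto
  then show ?thesis using assms by blast
qed

text \<open>The leading monomials of the three basis vectors do not generate the initial ideal; three sums
  of basis vectors have to be added.\<close>

definition gb_vectors :: "(nat \<Rightarrow> int) set" where
  "gb_vectors = {lat 1 0 0, lat 0 1 0, lat 0 0 1, lat 1 1 0, lat 1 0 1, lat 2 1 1}"

lemma gb_vectors_orthant: "gb_vectors \<subseteq> orthant"
  by (auto simp: gb_vectors_def orthant_iff lat_in_lattice6)

lemma gb_vectors_weight: "u \<in> gb_vectors \<Longrightarrow> 0 < (\<Sum>j=1..6. weight6 j * of_int (u j))"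
  unfolding gb_vectors_def
  by (elim insertE emptyE; simp only: weight6_lat; simp add: add_pos_pos)

text \<open>If one of the coordinates is positive, then the positive part is divisible by one of the six leading
  monomials \<open>\<partial>\<^sub>1\<partial>\<^sub>3\<close>, \<open>\<partial>\<^sub>2\<partial>\<^sub>4\<close>, \<open>\<partial>\<^sub>2\<partial>\<^sub>6\<close>, \<open>\<partial>\<^sub>3\<partial>\<^sub>4\<close>, \<open>\<partial>\<^sub>1\<partial>\<^sub>6\<close>, \<open>\<partial>\<^sub>4\<partial>\<^sub>6\<close>; the six
  cases of the proof have them in this order.\<close>

lemma gb_divides:
  assumes "0 < a \<or> 0 < b \<or> 0 < c"
  shows "\<exists>g\<in>gb_vectors. mono_dvd (pos_part 6 g) (pos_part 6 (lat a b c))"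
proof -
  let ?u = "lat a b c"
  have dvd: "mono_dvd (pos_part 6 g) (pos_part 6 ?u)"
    if g: "\<forall>j\<in>{1, 2, 3, 4, 5, 6}. g j \<le> 0 \<or> g j \<le> ?u j" for g
    unfolding mono_dvd_def lookup_pos_part atLeastAtMost_6
  proof
    fix j
    have "nat (g j) \<le> nat (?u j)" if "j \<in> {1, 2, 3, 4, 5, 6}"
      using bspec[OF g that] by linarith
    then show "(if j \<in> {1, 2, 3, 4, 5, 6} then nat (g j) else 0) \<le>
        (if j \<in> {1, 2, 3, 4, 5, 6} then nat (?u j) else 0)" by simp
  qed
  have "(0 < a - 2 * b \<and> 0 < a - 2 * c) \<or> (0 < b + c - a \<and> 0 < b) \<or> (0 < b + c - a \<and> 0 < c) \<or>
      (0 < a - 2 * c \<and> 0 < b) \<or> (0 < a - 2 * b \<and> 0 < c) \<or> (0 < b \<and> 0 < c)"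
    using assms by linarith
  then show ?thesis
  proof (elim disjE)
    assume "0 < a - 2 * b \<and> 0 < a - 2 * c"
    then show ?thesis by (intro bexI[of _ "lat 1 0 0"] dvd) (auto simp: gb_vectors_def)
  next
    assume "0 < b + c - a \<and> 0 < b"
    then show ?thesis by (intro bexI[of _ "lat 0 1 0"] dvd) (auto simp: gb_vectors_def)
  next
    assume "0 < b + c - a \<and> 0 < c"
    then show ?thesis by (intro bexI[of _ "lat 0 0 1"] dvd) (auto simp: gb_vectors_def)
  next
    assume "0 < a - 2 * c \<and> 0 < b"
    then show ?thesis by (intro bexI[of _ "lat 1 1 0"] dvd) (auto simp: gb_vectors_def)
  next
    assume "0 < a - 2 * b \<and> 0 < c"
    then show ?thesis by (intro bexI[of _ "lat 1 0 1"] dvd) (auto simp: gb_vectors_def)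
  next
    assume "0 < b \<and> 0 < c"
    then show ?thesis by (intro bexI[of _ "lat 2 1 1"] dvd) (auto simp: gb_vectors_def)
  qed
qed

definition gb6 :: "cpoly set" where "gb6 = binom 6 ` gb_vectors"
definition leads :: "mono set" where "leads = pos_part 6 ` gb_vectors"
definition lead_ideal :: "cpoly set" where
  "lead_ideal = genideal (mpoly_ring 6) ((\<lambda>m. single m 1) ` leads)"

lemma leads_polys: "(\<lambda>m. single m 1) ` leads \<subseteq> polys 6"
  unfolding leads_def by (auto intro!: polys_single pos_part_monomials)

lemma gb6_subset: "gb6 \<subseteq> toric_ideal 6 3 veronese"
proof
  fix f assume "f \<in> gb6"
  then have "f \<in> binom 6 ` lattice6"
    using gb_vectors_orthant orthant_subset unfolding gb6_def by blast
  then show "f \<in> toric_ideal 6 3 veronese"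
    unfolding toric_ideal_def by (rule genideal_gen[OF toric_gens_polys])
qed

lemma init_form_gb6: "init_form (weight weight6) ` gb6 = (\<lambda>m. single m 1) ` leads"
  unfolding gb6_def leads_def image_image
  by (intro image_cong refl init_form_binom gb_vectors_weight)

lemma toric_ideal_polys: "toric_ideal n d A \<subseteq> polys n"
  unfolding toric_ideal_def by (rule genideal_subset_polys[OF toric_gens_polys])

lemma keys_init_form: "keys (init_form wt f) \<subseteq> keys f"
  by (auto simp: in_keys_iff lookup_init_form split: if_splits)

lemma init_form_polys: "f \<in> polys n \<Longrightarrow> init_form wt f \<in> polys n"
  using keys_init_form[of wt f] by (auto simp: polys_def)

text \<open>The coefficients of \<open>f\<close> sum to zero in each class modulo \<open>L\<close>, so the class of a top monomial
  \<open>m\<close> contains a second monomial \<open>m'\<close> of \<open>f\<close>.  Then \<open>m - m'\<close> is a lattice vector of positive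
  weight, and its positive part divides \<open>m\<close>.\<close>

lemma init_form_key_divisible:
  assumes f: "f \<in> toric_ideal 6 3 veronese" and m: "m \<in> keys (init_form (weight weight6) f)"
  shows "\<exists>l\<in>leads. mono_dvd l m"
proof -
  have mf: "m \<in> keys f" by (rule subsetD[OF keys_init_form m])
  have max: "weight weight6 m' \<le> weight weight6 m" if "m' \<in> keys f" for m'
    using m that by (auto simp: in_keys_iff lookup_init_form split: if_splits)
  have f6: "keys f \<subseteq> monomials 6" using subsetD[OF toric_ideal_polys f] by (simp add: polys_def)
  let ?e = "\<lambda>j. int (lookup m j)"
  let ?p = "poly_part lattice6 ?e f"
  have mp: "m \<in> keys ?p"
    using mf toric_lattice_0[of 6 3 veronese] by (simp add: in_keys_iff lookup_poly_part)
  have "\<exists>m'\<in>keys ?p. m' \<noteq> m"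
  proof (rule ccontr)
    assume "\<not> ?thesis"
    then have "keys ?p = {m}" using mp by blast
    then have "coeff_sum ?p = lookup ?p m" by (simp add: coeff_sum_def)
    then show False using toric_ideal_coeff_sum[OF f, of ?e] mp by (simp add: in_keys_iff)
  qed
  then obtain m' where m': "m' \<in> keys ?p" "m' \<noteq> m" by blast
  have m'f: "m' \<in> keys f" and inL: "(\<lambda>j. int (lookup m' j) - ?e j) \<in> lattice6"
    using m'(1) by (auto simp: in_keys_iff lookup_poly_part split: if_splits)
  define u where "u = (\<lambda>j. int (lookup m j) - int (lookup m' j))"
  have "u \<in> lattice6"
    using toric_lattice_diff[OF toric_lattice_0 inL] by (simp add: u_def)
  then obtain a b c where abc: "u = lat a b c" by (auto simp: lattice6_eq)
  have "u \<noteq> (\<lambda>_. 0)"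
  proof
    assume u0: "u = (\<lambda>_. 0)"
    have "lookup m j = lookup m' j" for j using fun_cong[OF u0, of j] by (simp add: u_def)
    then show False using m'(2) poly_mapping_eqI by metis
  qed
  moreover have w: "weight weight6 m - weight weight6 m' = (\<Sum>j=1..6. weight6 j * of_int (u j))"
    unfolding u_def by (rule weight_diff) (use f6 mf m'f in auto)
  ultimately have "0 < (\<Sum>j=1..6. weight6 j * of_int (u j))"
    using max[OF m'f] weight6_nonzero[OF \<open>u \<in> lattice6\<close>] by linarith
  then have pos: "0 < a + sqrt 2 * b + sqrt 3 * c" unfolding abc weight6_lat .
  have "0 < a \<or> 0 < b \<or> 0 < c"
  proof (rule ccontr)
    assume "\<not> ?thesis"
    then have "real_of_int a \<le> 0" "sqrt 2 * real_of_int b \<le> 0" "sqrt 3 * real_of_int c \<le> 0"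
      by (auto intro: mult_nonneg_nonpos)
    then show False using pos by linarith
  qed
  then obtain g where g: "g \<in> gb_vectors" "mono_dvd (pos_part 6 g) (pos_part 6 u)"
    unfolding abc using gb_divides by blast
  have "mono_dvd (pos_part 6 u) m"
    unfolding mono_dvd_def lookup_pos_part u_def by auto
  then have "mono_dvd (pos_part 6 g) m" using g(2) unfolding mono_dvd_def by (meson le_trans)
  then show ?thesis using g(1) by (auto simp: leads_def)
qed

lemma in_lead_idealI:
  assumes "f \<in> polys 6" "\<And>m. m \<in> keys f \<Longrightarrow> \<exists>l\<in>leads. mono_dvd l m"
  shows "f \<in> lead_ideal"
proof -
  have "single m (lookup f m) \<in> lead_ideal" if m: "m \<in> keys f" for m
  proof -
    obtain l q where l: "l \<in> leads" "m = l + q" using assms(2)[OF m] mono_dvd_iff by blast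
    have "q \<in> monomials 6" using assms(1) m l(2) by (auto simp: polys_def monomials_add)
    moreover have "single m (lookup f m) = single q (lookup f m) * single l 1"
      by (simp add: l(2) mult_single add.commute)
    ultimately show ?thesis
      unfolding lead_ideal_def using l(1)
      by (simp only:) (intro genideal_mult[OF leads_polys] genideal_gen[OF leads_polys] polys_single imageI)
  qed
  then have "(\<Sum>m\<in>keys f. single m (lookup f m)) \<in> lead_ideal"
    unfolding lead_ideal_def by (intro genideal_sum[OF leads_polys]) (auto simp: lead_ideal_def)
  then show ?thesis by (simp only: sum_single_keys)
qed

lemma lead_ideal_keys:
  assumes "f \<in> lead_ideal" "m \<in> keys f"
  shows "\<exists>l\<in>leads. mono_dvd l m"
proof -
  have "lead_ideal \<subseteq> {f \<in> polys 6. \<forall>m\<in>keys f. \<exists>l\<in>leads. mono_dvd l m}" (is "_ \<subseteq> ?T")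
    unfolding lead_ideal_def
  proof (rule genideal_least[OF leads_polys])
    show "(\<lambda>m. single m 1) ` leads \<subseteq> ?T" using leads_polys by (auto simp: mono_dvd_def)
    show "a + b \<in> ?T" if "a \<in> ?T" "b \<in> ?T" for a b
      using that keys_add[of a b] by (auto simp: polys_add)
    show "x * a \<in> ?T" if a: "a \<in> ?T" and x: "x \<in> polys 6" for a x
    proof (rule CollectI, intro conjI ballI)
      show "x * a \<in> polys 6" using a x by (simp add: polys_mult)
      fix m assume "m \<in> keys (x * a)"
      then obtain p q where pq: "m = p + q" "q \<in> keys a" using keys_mult[of x a] by blast
      then obtain l where "l \<in> leads" "mono_dvd l q" using a by blast
      then show "\<exists>l\<in>leads. mono_dvd l m"
        by (intro bexI[of _ l]) (auto simp: pq(1) mono_dvd_def lookup_add intro: le_trans)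
    qed
  qed (auto simp: polys_0)
  then show ?thesis using assms by blast
qed

lemma in_ideal_eq: "in_ideal 6 weight6 (toric_ideal 6 3 veronese) = lead_ideal"
proof -
  let ?I = "toric_ideal 6 3 veronese"
  have i: "init_form (weight weight6) ` ?I \<subseteq> polys 6"
    using toric_ideal_polys init_form_polys by blast
  have "init_form (weight weight6) f \<in> lead_ideal" if "f \<in> ?I" for f
    using that i by (intro in_lead_idealI init_form_key_divisible[OF that]) auto
  moreover have "(\<lambda>m. single m 1) ` leads \<subseteq> init_form (weight weight6) ` ?I"
    unfolding init_form_gb6[symmetric] using gb6_subset by blast
  ultimately show ?thesis
    unfolding in_ideal_def lead_ideal_def
    by (intro genideal_cong[OF i leads_polys] image_subsetI)
       (simp_all only: lead_ideal_def, blast intro: genideal_gen[OF i])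
qed

lemma gb6_reduced: "is_reduced_groebner_basis 6 weight6 (toric_ideal 6 3 veronese) gb6"
  unfolding is_reduced_groebner_basis_def
proof (intro conjI)
  show "gb6 \<subseteq> toric_ideal 6 3 veronese" by (rule gb6_subset)
  show "in_ideal 6 weight6 (toric_ideal 6 3 veronese) =
      genideal (mpoly_ring 6) (init_form (weight weight6) ` gb6)"
    unfolding in_ideal_eq init_form_gb6 lead_ideal_def ..
  define lead where "lead = (\<lambda>g. THE m. init_form (weight weight6) g = single m (1::complex))"
  have lead: "lead (binom 6 u) = pos_part 6 u" if "u \<in> gb_vectors" for u
    unfolding lead_def init_form_binom[OF gb_vectors_weight[OF that]]
    by (rule the_equality) (auto dest: arg_cong[where f = keys])
  have div: "u' = u \<and> m = pos_part 6 u"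
    if u: "u \<in> gb_vectors" "u' \<in> gb_vectors" and m: "m = pos_part 6 u \<or> m = neg_part 6 u"
      and d: "mono_dvd (pos_part 6 u') m" for u u' m
  proof -
    have dj: "nat (u' j) \<le> lookup m j" if "j \<in> {1, 2, 3, 4, 5, 6}" for j
    proof -
      have "j \<in> {1..6}" using that unfolding atLeastAtMost_6 .
      moreover have "lookup (pos_part 6 u') j \<le> lookup m j" using d by (simp add: mono_dvd_def)
      ultimately show ?thesis by (simp add: lookup_pos_part)
    qed
    have "\<forall>j\<in>{1, 2, 3, 4, 5, 6}. nat (u' j) \<le> nat (u j)" if "m = pos_part 6 u"
      using dj unfolding that lookup_pos_part atLeastAtMost_6 by simp
    moreover have "\<forall>j\<in>{1, 2, 3, 4, 5, 6}. nat (u' j) \<le> nat (- u j)" if "m = neg_part 6 u"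
      using dj unfolding that lookup_neg_part atLeastAtMost_6 by simp
    moreover have "u' = u" if "\<forall>j\<in>{1, 2, 3, 4, 5, 6}. nat (u' j) \<le> nat (u j)"
      using u that unfolding gb_vectors_def by (elim insertE emptyE; simp)
    moreover have False if "\<forall>j\<in>{1, 2, 3, 4, 5, 6}. nat (u' j) \<le> nat (- u j)"
      using u that unfolding gb_vectors_def by (elim insertE emptyE; simp)
    ultimately show ?thesis using m by blast
  qed
  have keys: "m = pos_part 6 u \<or> m = neg_part 6 u" if "m \<in> keys (binom 6 u)" for m u
    using that by (auto simp: binom_def in_keys_iff lookup_minus lookup_single when_def split: if_splits)
  show "\<exists>lead. (\<forall>g\<in>gb6. init_form (weight weight6) g = single (lead g) 1) \<and>
      (\<forall>g\<in>gb6. \<forall>g'\<in>gb6. \<forall>m\<in>keys g. mono_dvd (lead g') m \<longrightarrow> g' = g \<and> m = lead g)"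
  proof (intro exI[of _ lead] conjI ballI impI)
    fix g assume "g \<in> gb6"
    then obtain u where u: "u \<in> gb_vectors" "g = binom 6 u" by (auto simp: gb6_def)
    show "init_form (weight weight6) g = single (lead g) 1"
      unfolding u(2) lead[OF u(1)] by (rule init_form_binom[OF gb_vectors_weight[OF u(1)]])
    fix g' m assume "g' \<in> gb6" and m: "m \<in> keys g" and d: "mono_dvd (lead g') m"
    then obtain u' where u': "u' \<in> gb_vectors" "g' = binom 6 u'" by (auto simp: gb6_def)
    have "u' = u \<and> m = pos_part 6 u"
      using div[OF u(1) u'(1) keys] m d unfolding u(2) u'(2) lead[OF u'(1)] by blast
    then show "g' = g" "m = lead g" using u u' lead by auto
  qed
qed

lemma groebner_semigroup6: "groebner_semigroup 6 lattice6 gb6 = orthant"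
proof -
  have "{g \<in> lattice6. binom 6 g \<in> gb6} = gb_vectors"
  proof (intro equalityI subsetI)
    fix g assume "g \<in> {g \<in> lattice6. binom 6 g \<in> gb6}"
    then obtain u where u: "g \<in> lattice6" "u \<in> gb_vectors" "binom 6 g = binom 6 u" by (auto simp: gb6_def)
    have "u \<in> lattice6" using u(2) gb_vectors_orthant orthant_subset by blast
    moreover have "u \<noteq> (\<lambda>_. 0)" using gb_vectors_weight[OF u(2)] by auto
    ultimately show "g \<in> gb_vectors" using binom_inject[OF u(1) _ _ u(3)] u(2) by simp
  next
    fix g assume "g \<in> gb_vectors"
    then show "g \<in> {g \<in> lattice6. binom 6 g \<in> gb6}"
      using gb_vectors_orthant orthant_subset by (auto simp: gb6_def)
  qed
  moreover have "nat_span gb_vectors = orthant"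
  proof
    show "nat_span gb_vectors \<subseteq> orthant" by (rule nat_span_subset_orthant[OF gb_vectors_orthant])
    show "orthant \<subseteq> nat_span gb_vectors"
      unfolding nat_span_basis[symmetric] by (rule nat_span_mono) (auto simp: gb_vectors_def)
  qed
  ultimately show ?thesis unfolding groebner_semigroup_def by simp
qed

text \<open>The exponent vanishes at 1, 2, 4 and 6, which makes it a fake exponent.\<close>

lemma leads_support: "l \<in> leads \<Longrightarrow> \<exists>j\<in>{1, 2, 4, 6}. 0 < lookup l j"
  unfolding leads_def gb_vectors_def by (auto simp: lookup_pos_part)

definition beta6 :: "nat \<Rightarrow> complex" where
  "beta6 i = (\<Sum>j=1..6. of_int (veronese i j) * exponent6 j)"

lemma fake_exponent6: "fake_exponent 6 3 veronese beta6 weight6 exponent6"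
  unfolding fake_exponent_def in_ideal_eq
proof (intro conjI ballI impI)
  fix i show "(\<Sum>j=1..6. of_int (veronese i j) * exponent6 j) = beta6 i" by (simp add: beta6_def)
next
  fix p assume "p \<in> monomials 6" "single p 1 \<in> lead_ideal"
  then obtain l where l: "l \<in> leads" "mono_dvd l p" using lead_ideal_keys[of "single p 1" p] by auto
  obtain j where j: "j \<in> {1, 2, 4, 6}" "0 < lookup l j" using leads_support[OF l(1)] by blast
  have "lookup l j \<le> lookup p j" using l(2) by (simp add: mono_dvd_def)
  then have "0 < lookup p j" using j(2) by simp
  moreover have "exponent6 j = 0" using j(1) by (auto simp: exponent6_def)
  ultimately have "(\<Prod>k<lookup p j. exponent6 j - of_nat k) = 0"
    by (intro prod_zero bexI[of _ 0]) simp_all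
  moreover have "j \<in> {1..6}" using j(1) by auto
  ultimately have "\<exists>i\<in>{1..6}. (\<Prod>k<lookup p i. exponent6 i - of_nat k) = 0" by (rule bexI)
  then show "falling 6 exponent6 (lookup p) = 0"
    unfolding falling_def by (intro prod_zero) auto
qed

lemma in_ideal_monomial: "monomial_ideal 6 (in_ideal 6 weight6 (toric_ideal 6 3 veronese))"
  unfolding monomial_ideal_def in_ideal_eq lead_ideal_def
  by (intro exI[of _ leads] conjI refl) (auto simp: leads_def pos_part_monomials)

lemma generic_direction6: "generic_direction 6 3 veronese beta6 weight6"
  by (rule generic_directionI[OF in_ideal_monomial weight6_nonzero])

lemma homogeneous_veronese: "homogeneous_matrix 6 3 veronese"
  unfolding homogeneous_matrix_def
proof (intro exI[of _ "\<lambda>i. if i = 1 then 1 else 0"] exI[of _ 1] conjI ballI)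
  fix j show "(\<Sum>i=1..3. (if i = 1 then 1 else 0) * real_of_int (veronese i j)) = 1"
    unfolding atLeastAtMost_3 by (simp add: veronese_values)
qed simp

section \<open>Ideals generated by squarefree monomials\<close>

lemma mfps_mult_lookup: "mfps_mult (lookup p) (lookup q) = lookup (p * q)" for p q :: cpoly
proof
  fix m :: mono
  have fin: "finite {(a, b). a + b = m}"
  proof (rule finite_subset)
    show "{(a, b). a + b = m} \<subseteq> {k. mono_dvd k m} \<times> {k. mono_dvd k m}"
      by (auto simp: mono_dvd_def lookup_add)
  qed (simp add: finite_mono_dvd)
  have "p * q = (\<Sum>a\<in>keys p. \<Sum>b\<in>keys q. single (a + b) (lookup p a * lookup q b))"
    by (subst poly_expand_mult) (simp add: single_mult_poly)
  then have "lookup (p * q) m =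
      (\<Sum>a\<in>keys p. \<Sum>b\<in>keys q. if a + b = m then lookup p a * lookup q b else 0)"
    by (simp add: lookup_sum lookup_single when_def)
  also have "\<dots> = (\<Sum>(a, b)\<in>keys p \<times> keys q. if a + b = m then lookup p a * lookup q b else 0)"
    by (rule sum.cartesian_product)
  also have "\<dots> = (\<Sum>(a, b)\<in>{(a, b). a + b = m}. lookup p a * lookup q b)"
    by (rule sum.mono_neutral_cong) (auto simp: fin in_keys_iff)
  finally show "mfps_mult (lookup p) (lookup q) m = lookup (p * q) m"
    by (simp add: mfps_mult_def)
qed

lemma lookup_polys_carrier: "p \<in> polys n \<Longrightarrow> lookup p \<in> carrier (mfps_ring n)"
  by (auto simp: mfps_ring_def polys_def in_keys_iff subset_iff)

lemma sqfree_polys: "X \<subseteq> {1..n} \<Longrightarrow> sqfree X \<in> polys n"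
  unfolding sqfree_def by (intro polys_prod polys_Var) auto

lemma sqfree_split: "Y \<subseteq> X \<Longrightarrow> finite X \<Longrightarrow> sqfree X = sqfree (X - Y) * sqfree Y"
  unfolding sqfree_def by (rule prod.subset_diff)

lemma mfps_sqfree_ideal_mono:
  assumes "\<And>X. X \<in> F \<Longrightarrow> X \<subseteq> {1..n} \<and> (\<exists>Y\<in>F'. Y \<subseteq> X)"
  shows "genideal (mfps_ring n) ((\<lambda>J. lookup (sqfree J)) ` F) \<subseteq>
    genideal (mfps_ring n) ((\<lambda>J. lookup (sqfree J)) ` F')"
  unfolding genideal_def
proof (rule Inter_anti_mono, rule Collect_mono, intro impI conjI)
  fix I assume I: "ideal I (mfps_ring n) \<and> (\<lambda>J. lookup (sqfree J)) ` F' \<subseteq> I"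
  then show "ideal I (mfps_ring n)" by simp
  show "(\<lambda>J. lookup (sqfree J)) ` F \<subseteq> I"
  proof (rule image_subsetI)
    fix X assume X: "X \<in> F"
    then obtain Y where Y: "Y \<in> F'" "Y \<subseteq> X" and Xn: "X \<subseteq> {1..n}" using assms by blast
    have "lookup (sqfree (X - Y)) \<otimes>\<^bsub>mfps_ring n\<^esub> lookup (sqfree Y) \<in> I"
      by (rule ideal.I_l_closed)
         (use I Y Xn in \<open>auto intro!: lookup_polys_carrier sqfree_polys\<close>)
    then have "mfps_mult (lookup (sqfree (X - Y))) (lookup (sqfree Y)) \<in> I"
      by (simp add: mfps_ring_def)
    then show "lookup (sqfree X) \<in> I"
      using sqfree_split[OF Y(2) finite_subset[OF Xn]] by (simp add: mfps_mult_lookup)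
  qed
qed

lemma ideals_distinguished6:
  "M_ideal 6 distinguished6 = M_ideal 6 family6"
  "P_ideal 6 lattice6 exponent6 distinguished6 = P_ideal 6 lattice6 exponent6 family6"
proof -
  note f = family6_subset_distinguished
  have M: "M_ideal 6 N \<subseteq> M_ideal 6 N'"
    if "family6 \<subseteq> N" "N \<subseteq> distinguished6" "family6 \<subseteq> N'" "N' \<subseteq> distinguished6" for N N'
    unfolding M_ideal_def
  proof (rule mfps_sqfree_ideal_mono)
    fix X assume X: "X \<in> M_sets N"
    show "X \<subseteq> {1..6} \<and> (\<exists>Y\<in>M_sets N'. Y \<subseteq> X)"
      using M_sets_range[OF that(1,2) X] M_sets_above[OF that(1,2) X] min_M_subset[OF that(3,4)] by blast
  qed
  then show "M_ideal 6 distinguished6 = M_ideal 6 family6" using f by blast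
  have P: "P_ideal 6 lattice6 exponent6 N \<subseteq> P_ideal 6 lattice6 exponent6 N'"
    if "family6 \<subseteq> N" "N \<subseteq> distinguished6" "family6 \<subseteq> N'" "N' \<subseteq> distinguished6" for N N'
    unfolding P_ideal_def
  proof (rule mfps_sqfree_ideal_mono)
    fix X assume X: "X \<in> P_sets 6 lattice6 exponent6 N"
    show "X \<subseteq> {1..6} \<and> (\<exists>Y\<in>P_sets 6 lattice6 exponent6 N'. Y \<subseteq> X)"
      using P_sets_range[OF that(1,2) X] P_sets_above[OF that(1,2) X] min_P_subset[OF that(3,4)] by blast
  qed
  then show "P_ideal 6 lattice6 exponent6 distinguished6 = P_ideal 6 lattice6 exponent6 family6"
    using f by blast
qed

lemma e_monomial_distinguished6: "e_monomial 6 exponent6 distinguished6 = e_monomial 6 exponent6 family6"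
  unfolding e_monomial_def e_set_def
  using Inter_N[OF family6_subset_distinguished] Inter_N[OF _ family6_subset_distinguished] by simp

lemma obstruction_module_distinguished6:
  "obstruction_module 6 3 veronese exponent6 distinguished6 = obstruction_module 6 3 veronese exponent6 family6"
  unfolding obstruction_module_def ideals_distinguished6 e_monomial_distinguished6 ..

section \<open>The Stanley-Reisner ring\<close>

text \<open>Renaming of variable \<open>j\<close> to \<open>j + k\<close>, which makes room for the first \<open>k\<close> variables.\<close>

definition shift_mono :: "nat \<Rightarrow> mono \<Rightarrow> mono" where
  "shift_mono k m = (\<Sum>j\<in>keys m. single (j + k) (lookup m j))"

lemma lookup_shift_mono: "lookup (shift_mono k m) j = (if k \<le> j then lookup m (j - k) else 0)"
proof -
  have "lookup (shift_mono k m) j = (\<Sum>i\<in>keys m. if i = j - k \<and> k \<le> j then lookup m i else 0)"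
    unfolding shift_mono_def lookup_sum lookup_single when_def by (intro sum.cong refl) auto
  then show ?thesis by (cases "k \<le> j") (simp_all add: in_keys_iff)
qed

lemma shift_mono_add: "shift_mono k (a + b) = shift_mono k a + shift_mono k b"
  by (rule poly_mapping_eqI) (simp add: lookup_shift_mono lookup_add)

lemma shift_mono_inject: "shift_mono k a = shift_mono k b \<longleftrightarrow> a = b"
proof
  assume eq: "shift_mono k a = shift_mono k b"
  have "lookup a j = lookup b j" for j
    using arg_cong[OF eq, of "\<lambda>m. lookup m (j + k)"] by (simp add: lookup_shift_mono)
  then show "a = b" by (rule poly_mapping_eqI)
qed simp

lemma shift_mono_monomials: "m \<in> monomials n \<Longrightarrow> shift_mono k m \<in> monomials (n + k)"
proof -
  assume m: "m \<in> monomials n"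
  have "j \<in> {1..n + k}" if "j \<in> keys (shift_mono k m)" for j
  proof -
    have "k \<le> j" "j - k \<in> keys m"
      using that by (auto simp: in_keys_iff lookup_shift_mono split: if_splits)
    moreover from this have "j - k \<in> {1..n}" using m by (auto simp: monomials_def)
    ultimately show ?thesis by auto
  qed
  then show ?thesis by (auto simp: monomials_def)
qed

definition shift_poly :: "nat \<Rightarrow> cpoly \<Rightarrow> cpoly" where
  "shift_poly k p = (\<Sum>m\<in>keys p. single (shift_mono k m) (lookup p m))"

lemma lookup_shift_poly:
  "lookup (shift_poly k p) (shift_mono k m) = lookup p m"
  unfolding shift_poly_def lookup_sum lookup_single when_def
  by (simp add: shift_mono_inject in_keys_iff)

lemma keys_shift_poly: "keys (shift_poly k p) \<subseteq> shift_mono k ` keys p"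
proof -
  have "keys (shift_poly k p) \<subseteq> (\<Union>m\<in>keys p. keys (single (shift_mono k m) (lookup p m)))"
    unfolding shift_poly_def by (rule keys_sum_subset) simp
  then show ?thesis by (auto split: if_splits)
qed

lemma shift_poly_superset:
  "finite S \<Longrightarrow> keys p \<subseteq> S \<Longrightarrow> shift_poly k p = (\<Sum>m\<in>S. single (shift_mono k m) (lookup p m))"
  unfolding shift_poly_def by (rule sum.mono_neutral_left) (auto simp: in_keys_iff)

lemma shift_poly_add: "shift_poly k (p + q) = shift_poly k p + shift_poly k q"
proof -
  let ?S = "keys p \<union> keys q"
  have "shift_poly k (p + q) = (\<Sum>m\<in>?S. single (shift_mono k m) (lookup (p + q) m))"
    by (rule shift_poly_superset) (use keys_add[of p q] in auto)
  then show ?thesis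
    by (simp add: lookup_add single_add sum.distrib shift_poly_superset[of ?S p] shift_poly_superset[of ?S q])
qed

lemma shift_poly_0: "shift_poly k 0 = 0" by (simp add: shift_poly_def)

lemma shift_poly_sum: "shift_poly k (sum f I) = (\<Sum>i\<in>I. shift_poly k (f i))"
  by (induction I rule: infinite_finite_induct) (simp_all add: shift_poly_add shift_poly_0)

lemma shift_poly_single: "shift_poly k (single m c) = single (shift_mono k m) c"
  by (subst shift_poly_superset[of "{m}"]) auto

lemma shift_poly_mult: "shift_poly k (p * q) = shift_poly k p * shift_poly k q"
proof -
  have "shift_poly k (p * q) =
      (\<Sum>a\<in>keys p. \<Sum>b\<in>keys q. single (shift_mono k (a + b)) (lookup p a * lookup q b))"
    by (subst poly_expand_mult) (simp add: single_mult_poly shift_poly_sum shift_poly_single)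
  also have "\<dots> = shift_poly k p * shift_poly k q"
    unfolding shift_poly_def[of k p] shift_poly_def[of k q]
    by (simp add: sum_product shift_mono_add mult_single)
  finally show ?thesis .
qed

lemma shift_poly_Const: "shift_poly k (Const c) = Const c"
proof -
  have "shift_mono k 0 = 0" by (simp add: shift_mono_def)
  then show ?thesis by (simp add: Const_def shift_poly_single)
qed

lemma shift_poly_polys: "p \<in> polys n \<Longrightarrow> shift_poly k p \<in> polys (n + k)"
  using keys_shift_poly[of k p] shift_mono_monomials unfolding polys_def by blast

lemma mpoly_ring_uminus: "a \<in> polys n \<Longrightarrow> \<ominus>\<^bsub>mpoly_ring n\<^esub> a = - a"
proof -
  interpret R: cring "mpoly_ring n" by (rule mpoly_ring_cring)
  show "a \<in> polys n \<Longrightarrow> \<ominus>\<^bsub>mpoly_ring n\<^esub> a = - a"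
    by (rule R.minus_equality) (auto intro: polys_uminus)
qed

definition var_ideal :: "nat \<Rightarrow> nat \<Rightarrow> cpoly set" where
  "var_ideal n k = genideal (mpoly_ring n) (Var ` {1..k})"

lemma var_ideal_iff:
  assumes "k \<le> n"
  shows "f \<in> var_ideal n k \<longleftrightarrow> f \<in> polys n \<and> (\<forall>m\<in>keys f. \<exists>j\<in>{1..k}. 0 < lookup m j)"
proof
  have g: "Var ` {1..k} \<subseteq> polys n" using assms polys_Var by auto
  have "var_ideal n k \<subseteq> {f \<in> polys n. \<forall>m\<in>keys f. \<exists>j\<in>{1..k}. 0 < lookup m j}" (is "_ \<subseteq> ?T")
    unfolding var_ideal_def
  proof (rule genideal_least[OF g])
    show "Var ` {1..k} \<subseteq> ?T"
    proof (rule image_subsetI)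
      fix j assume j: "j \<in> {1..k}"
      then have "Var j \<in> polys n" using g by blast
      then show "Var j \<in> ?T" using j by (auto simp: Var_def intro!: bexI[of _ j])
    qed
    show "a + b \<in> ?T" if "a \<in> ?T" "b \<in> ?T" for a b
      using that keys_add[of a b] polys_add by blast
    show "x * a \<in> ?T" if a: "a \<in> ?T" and x: "x \<in> polys n" for a x
    proof (rule CollectI, intro conjI ballI)
      show "x * a \<in> polys n" using a x by (simp add: polys_mult)
      fix m assume "m \<in> keys (x * a)"
      then obtain p q where pq: "m = p + q" "q \<in> keys a" using keys_mult[of x a] by blast
      then obtain j where "j \<in> {1..k}" "0 < lookup q j" using a by blast
      then show "\<exists>j\<in>{1..k}. 0 < lookup m j" by (intro bexI[of _ j]) (auto simp: pq(1) lookup_add)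
    qed
  qed (auto simp: polys_0)
  then show "f \<in> var_ideal n k \<Longrightarrow> f \<in> polys n \<and> (\<forall>m\<in>keys f. \<exists>j\<in>{1..k}. 0 < lookup m j)"
    by blast
  assume f: "f \<in> polys n \<and> (\<forall>m\<in>keys f. \<exists>j\<in>{1..k}. 0 < lookup m j)"
  have "single m (lookup f m) \<in> var_ideal n k" if m: "m \<in> keys f" for m
  proof -
    obtain j where j: "j \<in> {1..k}" "0 < lookup m j" using f m by blast
    have "mono_dvd (single j 1) m" using j(2) by (auto simp: mono_dvd_def lookup_single when_def)
    then obtain q where q: "m = single j 1 + q" using mono_dvd_iff by blast
    have "m \<in> monomials n" using f m by (auto simp: polys_def)
    then have "q \<in> monomials n" unfolding q monomials_add by simp
    moreover have "single m (lookup f m) = single q (lookup f m) * Var j"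
      by (simp add: Var_def mult_single q add.commute)
    ultimately show ?thesis
      unfolding var_ideal_def using j(1)
      by (simp only:) (intro genideal_mult[OF g] genideal_gen[OF g] polys_single imageI)
  qed
  then have "(\<Sum>m\<in>keys f. single m (lookup f m)) \<in> var_ideal n k"
    unfolding var_ideal_def by (intro genideal_sum[OF g]) (simp add: var_ideal_def)
  then show "f \<in> var_ideal n k" by (simp only: sum_single_keys)
qed

text \<open>Modulo the first \<open>k\<close> variables every polynomial has exactly one representative in the other
  variables.\<close>

lemma var_ideal_quotient: "is_polynomial_ring_quotient (n + k) (var_ideal (n + k) k)"
proof -
  let ?R = "mpoly_ring (n + k)" and ?S = "mpoly_ring n" and ?M = "var_ideal (n + k) k"
  interpret R: cring ?R by (rule mpoly_ring_cring)
  have g: "Var ` {1..k} \<subseteq> polys (n + k)" using polys_Var by auto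
  interpret M: ideal ?M ?R unfolding var_ideal_def by (rule genideal_is_ideal[OF g])
  define h where "h = (\<lambda>p. ?M +>\<^bsub>?R\<^esub> shift_poly k p)"
  have coset: "?M +>\<^bsub>?R\<^esub> a = ?M +>\<^bsub>?R\<^esub> b \<longleftrightarrow> a - b \<in> ?M" if "a \<in> polys (n + k)" "b \<in> polys (n + k)" for a b
    using R.quotient_eq_iff_same_a_r_cos[OF M.ideal_axioms, of a b] that
    by (simp add: a_minus_def mpoly_ring_uminus)
  have sp: "shift_poly k p \<in> polys (n + k)" if "p \<in> polys n" for p
    by (rule shift_poly_polys[OF that])
  have "h \<in> ring_iso ?S (?R Quot ?M)"
  proof (rule ring_iso_memI)
    fix p assume p: "p \<in> carrier ?S"
    then show "h p \<in> carrier (?R Quot ?M)"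
      using sp[of p] M.rcos_ring_hom unfolding h_def ring_hom_def by auto
    fix q assume q: "q \<in> carrier ?S"
    show "h (p \<otimes>\<^bsub>?S\<^esub> q) = h p \<otimes>\<^bsub>?R Quot ?M\<^esub> h q"
      using ring_hom_mult[OF M.rcos_ring_hom, of "shift_poly k p" "shift_poly k q"] sp p q
      by (simp add: h_def shift_poly_mult)
    show "h (p \<oplus>\<^bsub>?S\<^esub> q) = h p \<oplus>\<^bsub>?R Quot ?M\<^esub> h q"
      using ring_hom_add[OF M.rcos_ring_hom, of "shift_poly k p" "shift_poly k q"] sp p q
      by (simp add: h_def shift_poly_add)
  next
    have "shift_poly k 1 = 1" using shift_poly_Const[of k 1] by simp
    then show "h \<one>\<^bsub>?S\<^esub> = \<one>\<^bsub>?R Quot ?M\<^esub>"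
      using ring_hom_one[OF M.rcos_ring_hom] by (simp add: h_def)
    show "bij_betw h (carrier ?S) (carrier (?R Quot ?M))"
      unfolding bij_betw_def
    proof
      show "inj_on h (carrier ?S)"
      proof (rule inj_onI)
        fix p q assume pq: "p \<in> carrier ?S" "q \<in> carrier ?S" "h p = h q"
        then have "shift_poly k p - shift_poly k q \<in> ?M" using coset sp by (simp add: h_def)
        moreover have "shift_poly k p - shift_poly k q = shift_poly k (p - q)"
          using shift_poly_add[of k "p - q" q] by (simp add: algebra_simps)
        ultimately have M: "shift_poly k (p - q) \<in> ?M" by simp
        have "lookup (p - q) m = 0" for m
        proof (rule ccontr)
          assume ne: "lookup (p - q) m \<noteq> 0"
          then have "m \<in> keys (p - q)" by (simp add: in_keys_iff)
          moreover have "p - q \<in> polys n" using pq(1,2) polys_diff by simp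
          ultimately have mn: "m \<in> monomials n" by (auto simp: polys_def)
          have "shift_mono k m \<in> keys (shift_poly k (p - q))"
            using ne by (simp add: in_keys_iff lookup_shift_poly)
          then obtain j where j: "j \<in> {1..k}" "0 < lookup (shift_mono k m) j"
            using M var_ideal_iff[of k "n + k"] by auto
          then have "j = k" "0 < lookup m 0" by (auto simp: lookup_shift_mono split: if_splits)
          then show False using monomials_lookup_outside[OF mn, of 0] by simp
        qed
        then have "p - q = 0" by (intro poly_mapping_eqI) simp
        then show "p = q" by simp
      qed
      show "h ` carrier ?S = carrier (?R Quot ?M)"
      proof
        show "h ` carrier ?S \<subseteq> carrier (?R Quot ?M)"
          using sp M.rcos_ring_hom unfolding h_def ring_hom_def by auto
        show "carrier (?R Quot ?M) \<subseteq> h ` carrier ?S"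
        proof
          fix X assume "X \<in> carrier (?R Quot ?M)"
          then obtain f where f: "f \<in> polys (n + k)" "X = ?M +>\<^bsub>?R\<^esub> f"
            by (auto simp: FactRing_def A_RCOSETS_def')
          define K where "K = {m \<in> keys f. \<forall>j\<in>{1..k}. lookup m j = 0}"
          \<comment> \<open>The inverse of \<open>shift_mono k\<close> on the monomials that avoid the first \<open>k\<close> variables.\<close>
          define down where "down = (\<lambda>m::mono. \<Sum>j\<in>keys m. single (j - k) (lookup m j))"
          have down: "shift_mono k (down m) = m \<and> down m \<in> monomials n" if m: "m \<in> K" for m
          proof -
            have mn: "m \<in> monomials (n + k)" using m f(1) by (auto simp: K_def polys_def)
            have z: "lookup m j = 0" if "j \<le> k" for j
              using m that monomials_lookup_outside[OF mn, of 0] by (cases "j = 0") (auto simp: K_def)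
            have ld: "lookup (down m) i = (if i = 0 then 0 else lookup m (i + k))" for i
            proof -
              have "lookup (down m) i = (\<Sum>j\<in>keys m. if j = i + k \<and> i \<noteq> 0 then lookup m j else 0)"
                unfolding down_def lookup_sum lookup_single when_def
              proof (intro sum.cong refl)
                fix j assume "j \<in> keys m"
                then have "k < j" using z by (metis in_keys_iff not_le)
                then show "(if j - k = i then lookup m j else 0) =
                    (if j = i + k \<and> i \<noteq> 0 then lookup m j else 0)" by auto
              qed
              then show ?thesis by (cases "i = 0") (simp_all add: in_keys_iff)
            qed
            have "lookup (shift_mono k (down m)) j = lookup m j" for j
              using z[of j] by (auto simp: lookup_shift_mono ld)
            moreover have "down m \<in> monomials n"
            proof -
              have "i \<in> {1..n}" if "i \<in> keys (down m)" for i
              proof -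
                have "lookup m (i + k) \<noteq> 0" "i \<noteq> 0" using that by (auto simp: in_keys_iff ld split: if_splits)
                then have "i + k \<in> {1..n + k}" by (metis monomials_lookup_outside[OF mn])
                then show ?thesis using \<open>i \<noteq> 0\<close> by auto
              qed
              then show ?thesis by (auto simp: monomials_def)
            qed
            ultimately show ?thesis using poly_mapping_eqI by blast
          qed
          \<comment> \<open>The representative: drop the monomials of \<open>f\<close> divisible by one of the first \<open>k\<close> variables.\<close>
          define p where "p = (\<Sum>m\<in>K. single (down m) (lookup f m))"
          have p: "p \<in> polys n" unfolding p_def using down by (intro polys_sum polys_single) auto
          have finK: "finite K" by (simp add: K_def)
          have sh: "shift_poly k p = (\<Sum>m\<in>K. single m (lookup f m))"
            unfolding p_def shift_poly_sum shift_poly_single using down by (intro sum.cong refl) auto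
          have "f - shift_poly k p \<in> ?M"
          proof -
            have "f - shift_poly k p \<in> polys (n + k)" using f(1) sp[OF p] by (rule polys_diff)
            moreover have "\<exists>j\<in>{1..k}. 0 < lookup m j" if "m \<in> keys (f - shift_poly k p)" for m
            proof (rule ccontr)
              assume no: "\<not> ?thesis"
              have "lookup (f - shift_poly k p) m = 0"
                unfolding lookup_minus sh lookup_sum_single[OF finK]
                using no by (auto simp: K_def in_keys_iff)
              then show False using that by (simp add: in_keys_iff)
            qed
            ultimately show ?thesis using var_ideal_iff[of k "n + k"] by simp
          qed
          then have "X = h p" using coset[OF f(1) sp[OF p]] by (simp add: f(2) h_def)
          then show "X \<in> h ` carrier ?S" using p by simp
        qed
      qed
    qed
  qed
  moreover have "h (Const c) = ?M +>\<^bsub>?R\<^esub> Const c" for c by (simp add: h_def shift_poly_Const)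
  ultimately show ?thesis unfolding is_polynomial_ring_quotient_def by blast
qed

lemma sr_ideal6: "sr_ideal 6 family6 = var_ideal 6 3"
proof -
  note f = order_refl[of family6] family6_subset_distinguished
  have sv: "sqfree {j} = Var j" for j by (simp add: sqfree_def)
  have g1: "sqfree ` M_sets family6 \<subseteq> polys 6" using M_sets_range[OF f] sqfree_polys by blast
  have g2: "Var ` {1..3} \<subseteq> polys 6" by (auto intro: polys_Var)
  have mm: "sqfree ` min_M = Var ` {1..3}"
    unfolding min_M_def atLeastAtMost_3 by (simp add: sv)
  have "sqfree X \<in> genideal (mpoly_ring 6) (Var ` {1..3})" if X: "X \<in> M_sets family6" for X
  proof -
    obtain Y where Y: "Y \<in> min_M" "Y \<subseteq> X" using M_sets_above[OF f X] by blast
    have Xr: "X \<subseteq> {1..6}" by (rule M_sets_range[OF f X])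
    have "sqfree X = sqfree (X - Y) * sqfree Y" by (rule sqfree_split[OF Y(2) finite_subset[OF Xr]]) simp
    moreover have "sqfree Y \<in> Var ` {1..3}" using Y(1) mm by blast
    moreover have "sqfree (X - Y) \<in> polys 6" by (rule sqfree_polys) (use Xr in blast)
    ultimately show ?thesis using genideal_mult[OF g2 genideal_gen[OF g2]] by simp
  qed
  moreover have "Var ` {1..3} \<subseteq> sqfree ` M_sets family6"
    unfolding mm[symmetric] using min_M_subset[OF f] by blast
  ultimately show ?thesis
    unfolding sr_ideal_def var_ideal_def
    by (intro genideal_cong[OF g1 g2]) (blast, blast intro: genideal_gen[OF g1])
qed

lemma sr_ring6: "is_polynomial_ring_quotient 6 (sr_ideal 6 family6)"
  using var_ideal_quotient[of 3 3] by (simp add: sr_ideal6)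

section \<open>Linear forms attached to a basis of the lattice\<close>

lemma e_set6: "e_set 6 exponent6 family6 = {3}"
  unfolding e_set_def supp_0 Inter_N[OF order_refl family6_subset_distinguished] by auto

lemma numeral_polys: "numeral k \<in> polys n"
  using polys_Const[of "numeral k" n] by (simp add: Const_numeral)

lemma monomial_split:
  assumes "m \<in> monomials n" "m \<noteq> 0"
  obtains k q where "k \<in> {1..n}" "q \<in> monomials n" "m = single k 1 + q"
proof -
  obtain k where k: "k \<in> keys m" using assms(2) by (metis all_not_in_conv keys_eq_empty)
  then have "mono_dvd (single k 1) m" by (auto simp: mono_dvd_def lookup_single when_def in_keys_iff)
  then obtain q where q: "m = single k 1 + q" using mono_dvd_iff by blast
  have "single k 1 + q \<in> monomials n" using assms(1) q by simp
  then have "single k 1 \<in> monomials n" "q \<in> monomials n" by (simp_all only: monomials_add)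
  then have "k \<in> {1..n}" by (simp add: monomials_def)
  then show thesis using that \<open>q \<in> monomials n\<close> q by blast
qed

text \<open>Two basis matrices differ by a linear change of the variables \<open>s\<close>.  The computation for an arbitrary
  one uses nothing but the linear relations between the forms \<open>\<ell>\<^sub>j\<close>.\<close>

locale basis_matrix6 =
  fixes B :: "nat \<Rightarrow> nat \<Rightarrow> int"
  assumes B: "is_basis_matrix lattice6 3 B"
begin

declare One_nat_def [simp del]

definition l :: "nat \<Rightarrow> cpoly" where "l j = ell 3 B j"

lemma inj_B: "inj_on (\<lambda>k j. B j k) {1..3}"
  using B by (simp add: is_basis_matrix_def)

lemma basis_B: "is_Z_basis lattice6 ((\<lambda>k j. B j k) ` {1..3})"
  using B by (simp add: is_basis_matrix_def)

lemma column_lat: "k \<in> {1..3} \<Longrightarrow> (\<lambda>j. B j k) = lat (- B 5 k) (B 4 k) (B 6 k)"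
proof -
  assume k: "k \<in> {1..3}"
  let ?c = "\<lambda>k j. B j k"
  have "int_comb {?c k} (\<lambda>_. 1) = ?c k" by (simp add: int_comb_def)
  then have "?c k \<in> int_span (?c ` {1..3})"
    unfolding int_span_def using k
    by (intro CollectI exI[of _ "{?c k}"] exI[of _ "\<lambda>_. 1"]) auto
  then have "?c k \<in> lattice6" using basis_B by (simp add: is_Z_basis_def)
  then show "?c k = lat (- B 5 k) (B 4 k) (B 6 k)" by (rule lattice6_coords)
qed

lemma B_rows: "k \<in> {1..3} \<Longrightarrow> B j k = lat (- B 5 k) (B 4 k) (B 6 k) j"
  using column_lat[of k] by (rule fun_cong)

lemma lattice_combination:
  assumes "u \<in> lattice6"
  shows "\<exists>c. \<forall>j. u j = (\<Sum>k=1..3. c k * B j k)"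
proof -
  let ?c = "\<lambda>k j. B j k"
  have "u \<in> int_span (?c ` {1..3})" using basis_B assms by (simp add: is_Z_basis_def)
  then obtain F d where F: "finite F" "F \<subseteq> ?c ` {1..3}" "u = int_comb F d" by (auto simp: int_span_def)
  define c where "c k = (if ?c k \<in> F then d (?c k) else 0)" for k
  have "u j = (\<Sum>k=1..3. c k * B j k)" for j
  proof -
    have "u j = (\<Sum>g\<in>?c ` {1..3}. (if g \<in> F then d g else 0) * g j)"
      unfolding F(3) int_comb_def using F(1,2) by (intro sum.mono_neutral_cong_left) auto
    also have "\<dots> = (\<Sum>k=1..3. c k * B j k)"
      by (subst sum.reindex[OF inj_B]) (simp add: c_def)
    finally show ?thesis .
  qed
  then show ?thesis by blast
qed

lemma columns_independent:
  assumes "\<And>j. (\<Sum>k=1..3. c k * B j k) = 0" "k \<in> {1..3}"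
  shows "c k = 0"
proof -
  let ?c = "\<lambda>k j. B j k"
  define d where "d g = c (the_inv_into {1..3} ?c g)" for g
  have d: "d (?c k) = c k" if "k \<in> {1..3}" for k
    unfolding d_def using the_inv_into_f_f[OF inj_B that] by simp
  have "int_comb (?c ` {1..3}) d = (\<lambda>_. 0)"
  proof
    fix j
    have "int_comb (?c ` {1..3}) d j = (\<Sum>k=1..3. d (?c k) * B j k)"
      unfolding int_comb_def by (subst sum.reindex[OF inj_B]) simp
    also have "\<dots> = (\<Sum>k=1..3. c k * B j k)" using d by (intro sum.cong refl) simp
    finally show "int_comb (?c ` {1..3}) d j = 0" using assms(1) by simp
  qed
  then have "d (?c k) = 0" using basis_B assms(2) by (simp add: is_Z_basis_def)
  then show ?thesis using d assms(2) by simp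
qed

text \<open>The coordinates of \<open>g1\<close>, \<open>g2\<close>, \<open>g3\<close> in the basis formed by the columns of \<open>B\<close>.\<close>

definition lattice_coords :: "nat \<Rightarrow> nat \<Rightarrow> int" where
  "lattice_coords i = (SOME c. \<forall>j. (if i = 1 then g1 else if i = 2 then g2 else g3) j = (\<Sum>k=1..3. c k * B j k))"

lemma lattice_coords:
  "g1 j = (\<Sum>k=1..3. lattice_coords 1 k * B j k)" "g2 j = (\<Sum>k=1..3. lattice_coords 2 k * B j k)"
  "g3 j = (\<Sum>k=1..3. lattice_coords 3 k * B j k)"
proof -
  have *: "\<forall>j. (if i = 1 then g1 else if i = 2 then g2 else g3) j = (\<Sum>k=1..3. lattice_coords i k * B j k)" for i :: nat
  proof -
    have "\<exists>c. \<forall>j. (if i = 1 then g1 else if i = 2 then g2 else g3) j = (\<Sum>k=1..3. c k * B j k)"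
      by (rule lattice_combination) (simp add: lat_in_lattice6)
    from someI_ex[OF this] show ?thesis unfolding lattice_coords_def .
  qed
  show "g1 j = (\<Sum>k=1..3. lattice_coords 1 k * B j k)" using *[of 1] by simp
  show "g2 j = (\<Sum>k=1..3. lattice_coords 2 k * B j k)" using *[of 2] by simp
  show "g3 j = (\<Sum>k=1..3. lattice_coords 3 k * B j k)" using *[of 3] by simp
qed

lemma lattice_coords_inverse:
  assumes k: "k \<in> {1..3}" and k': "k' \<in> {1..3}"
  shows "- B 5 k' * lattice_coords 1 k + B 4 k' * lattice_coords 2 k + B 6 k' * lattice_coords 3 k = (if k = k' then 1 else 0)"
proof -
  define c where "c k = - B 5 k' * lattice_coords 1 k + B 4 k' * lattice_coords 2 k + B 6 k' * lattice_coords 3 k - (if k = k' then 1 else 0)" for k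
  have "(\<Sum>k=1..3. c k * B j k) = 0" for j
  proof -
    have "(\<Sum>k=1..3. c k * B j k) = - B 5 k' * g1 j + B 4 k' * g2 j + B 6 k' * g3 j
        - (\<Sum>k=1..3. (if k = k' then 1 else 0) * B j k)"
      unfolding lattice_coords c_def by (simp add: algebra_simps sum.distrib sum_subtractf sum_distrib_left sum_negf)
    also have "(\<Sum>k=1..3. (if k = k' then 1 else 0) * B j k) = (\<Sum>k=1..3. if k = k' then B j k' else 0)"
      by (intro sum.cong refl) auto
    also have "\<dots> = B j k'" using k' by simp
    also have "- B 5 k' * g1 j + B 4 k' * g2 j + B 6 k' * g3 j - B j k' = 0"
      unfolding B_rows[OF k', of j] by (simp add: lat_def)
    finally show ?thesis .
  qed
  then have "c k = 0" using columns_independent k by blast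
  then show ?thesis by (simp add: c_def)
qed

lemma l_polys: "l j \<in> polys 3"
  unfolding l_def ell_def by (intro polys_sum polys_mult polys_Const polys_Var)

lemma lookup_Var: "lookup (Var k) m = (if m = single k 1 then 1 else 0)"
  by (simp add: Var_def lookup_single when_def eq_commute)

lemma lookup_l: "lookup (l j) m = (\<Sum>k=1..3. of_int (B j k) * (if m = single k 1 then 1 else 0))"
  by (simp add: l_def ell_def lookup_sum lookup_Const_mult lookup_Var)

lemma l_deg: "m \<in> keys (l j) \<Longrightarrow> mono_deg m = 1"
proof -
  assume "m \<in> keys (l j)"
  then have "(\<Sum>k=1..3. of_int (B j k) * (if m = single k 1 then 1 else 0)) \<noteq> (0::complex)"
    by (simp add: in_keys_iff lookup_l)
  then obtain k where "of_int (B j k) * (if m = single k (1::nat) then 1 else 0) \<noteq> (0::complex)"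
    by (rule sum.not_neutral_contains_not_neutral)
  then have "m = single k 1" by (simp split: if_splits)
  then show ?thesis by simp
qed

lemma lookup_l_0: "lookup (l j) 0 = 0"
  using l_deg[of 0 j] by (auto simp: in_keys_iff)

lemma lookup_l_single: "k \<in> {1..3} \<Longrightarrow> lookup (l j) (single k 1) = of_int (B j k)"
proof -
  assume k: "k \<in> {1..3}"
  have "(single k (1::nat) = single k' 1) = (k' = k)" for k'
  proof
    assume "single k (1::nat) = single k' 1"
    then have "lookup (single k (1::nat)) k = lookup (single k' 1) k" by simp
    then show "k' = k" by (simp add: lookup_single when_def split: if_splits)
  qed simp
  then have "lookup (l j) (single k 1) = (\<Sum>k'=1..3. of_int (B j k') * (if k' = k then 1 else 0))"
    by (simp only: lookup_l)
  also have "\<dots> = (\<Sum>k'=1..3. if k' = k then of_int (B j k) else 0)"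
    by (rule sum.cong[OF refl]) simp
  finally show ?thesis using k by simp
qed

lemma l_combination:
  assumes "\<And>k. k \<in> {1..3} \<Longrightarrow> B j k = x * B 5 k + y * B 4 k + z * B 6 k"
  shows "l j = Const (of_int x) * l 5 + Const (of_int y) * l 4 + Const (of_int z) * l 6"
proof (rule poly_mapping_eqI)
  fix m
  show "lookup (l j) m = lookup (Const (of_int x) * l 5 + Const (of_int y) * l 4 + Const (of_int z) * l 6) m"
    unfolding lookup_l lookup_add lookup_Const_mult sum_distrib_left sum.distrib[symmetric]
    by (intro sum.cong refl) (simp add: assms algebra_simps)
qed

lemma l_relations: "l 1 = - l 5 - 2 * l 4" "l 2 = l 5 + l 4 + l 6" "l 3 = - l 5 - 2 * l 6"
proof -
  have "l 1 = Const (of_int (-1)) * l 5 + Const (of_int (-2)) * l 4 + Const (of_int 0) * l 6"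
    by (rule l_combination) (subst B_rows, simp, simp)
  then show "l 1 = - l 5 - 2 * l 4" by (simp add: Const_uminus Const_numeral)
  have "l 2 = Const (of_int 1) * l 5 + Const (of_int 1) * l 4 + Const (of_int 1) * l 6"
    by (rule l_combination) (subst B_rows, simp, simp)
  then show "l 2 = l 5 + l 4 + l 6" by simp
  have "l 3 = Const (of_int (-1)) * l 5 + Const (of_int 0) * l 4 + Const (of_int (-2)) * l 6"
    by (rule l_combination) (subst B_rows, simp, simp)
  then show "l 3 = - l 5 - 2 * l 6" by (simp add: Const_uminus Const_numeral)
qed

lemma Var_combination:
  assumes k: "k \<in> {1..3}"
  shows "Var k = Const (of_int (- lattice_coords 1 k)) * l 5 + Const (of_int (lattice_coords 2 k)) * l 4 + Const (of_int (lattice_coords 3 k)) * l 6"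
proof (rule poly_mapping_eqI)
  fix m :: mono
  let ?i = "\<lambda>k'. if m = single k' (1::nat) then 1 else (0::complex)"
  have "lookup (Const (of_int (- lattice_coords 1 k)) * l 5 + Const (of_int (lattice_coords 2 k)) * l 4 + Const (of_int (lattice_coords 3 k)) * l 6) m
      = (\<Sum>k'=1..3. of_int (- B 5 k' * lattice_coords 1 k + B 4 k' * lattice_coords 2 k + B 6 k' * lattice_coords 3 k) * ?i k')"
    unfolding lookup_l lookup_add lookup_Const_mult sum_distrib_left sum.distrib[symmetric]
    by (intro sum.cong refl) (simp add: algebra_simps)
  also have "\<dots> = (\<Sum>k'=1..3. if k' = k then ?i k else 0)"
    by (intro sum.cong refl, subst lattice_coords_inverse[OF k]) auto
  also have "\<dots> = ?i k" using k by simp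
  finally show "lookup (Var k) m = lookup (Const (of_int (- lattice_coords 1 k)) * l 5 + Const (of_int (lattice_coords 2 k)) * l 4
      + Const (of_int (lattice_coords 3 k)) * l 6) m"
    unfolding lookup_Var by (rule sym)
qed

section \<open>The intrinsic ideal\<close>

abbreviation "H \<equiv> H_ideal 6 lattice6 3 B exponent6 family6"

lemma ell_prod_polys: "ell_prod 3 B Y \<in> polys 3"
  unfolding ell_prod_def by (intro polys_prod) (simp add: l_polys[unfolded l_def])

lemma H_gens: "ell_prod 3 B ` min_P \<subseteq> polys 3"
  using ell_prod_polys by blast

lemma H_eq: "H = genideal (mpoly_ring 3) (ell_prod 3 B ` min_P)"
  unfolding H_ideal_def minimal_P ..

lemma ell_prod_pair: "i \<noteq> j \<Longrightarrow> ell_prod 3 B {i, j} = l i * l j"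
  by (simp add: ell_prod_def l_def)

lemma ell_prod_single: "ell_prod 3 B {i} = l i"
  by (simp add: ell_prod_def l_def)

lemma H_members: "l 3 * l 4 \<in> H" "l 2 * l 6 \<in> H" "l 2 * l 4 \<in> H" "l 1 * l 6 \<in> H" "l 1 * l 3 \<in> H"
proof -
  have "ell_prod 3 B Y \<in> H" if "Y \<in> min_P" for Y
    unfolding H_eq by (rule genideal_gen[OF H_gens]) (use that in blast)
  from this[of "{3, 4}"] this[of "{2, 6}"] this[of "{2, 4}"] this[of "{1, 6}"] this[of "{1, 3}"]
  show "l 3 * l 4 \<in> H" "l 2 * l 6 \<in> H" "l 2 * l 4 \<in> H" "l 1 * l 6 \<in> H" "l 1 * l 3 \<in> H"
    by (simp_all add: min_P_def ell_prod_pair)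
qed

lemma H_mult: "f \<in> H \<Longrightarrow> x \<in> polys 3 \<Longrightarrow> x * f \<in> H"
  unfolding H_eq by (rule genideal_mult[OF H_gens])
lemma H_add: "f \<in> H \<Longrightarrow> g \<in> H \<Longrightarrow> f + g \<in> H"
  unfolding H_eq by (rule genideal_add[OF H_gens])
lemma H_uminus: "f \<in> H \<Longrightarrow> - f \<in> H"
  unfolding H_eq by (rule genideal_uminus[OF H_gens])

text \<open>By the linear relation \<open>\<ell>\<^sub>1 + 2 \<ell>\<^sub>2 + \<ell>\<^sub>3 = 0\<close>, the product \<open>\<ell>\<^sub>3\<ell>\<^sub>6\<close> is a
  combination of the generators \<open>\<ell>\<^sub>1\<ell>\<^sub>6\<close> and \<open>\<ell>\<^sub>2\<ell>\<^sub>6\<close>.\<close>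

lemma l6_l3_in_H: "l 6 * l 3 \<in> H"
proof -
  have "l 6 * l 3 = - (l 1 * l 6) + (- 2) * (l 2 * l 6)"
    by (simp add: l_relations algebra_simps)
  then show ?thesis
    by (simp only:) (intro H_add H_uminus H_mult H_members polys_uminus numeral_polys)
qed

lemma H_degree: "f \<in> H \<Longrightarrow> m \<in> keys f \<Longrightarrow> 2 \<le> mono_deg m"
proof -
  have "H \<subseteq> {f \<in> polys 3. \<forall>m\<in>keys f. 2 \<le> mono_deg m}" (is "_ \<subseteq> ?T")
    unfolding H_eq
  proof (rule genideal_least[OF H_gens])
    have "2 \<le> mono_deg m" if mk: "m \<in> keys (l i * l j)" for m i j
    proof -
      obtain p q where pq: "m = p + q" "p \<in> keys (l i)" "q \<in> keys (l j)"
        using keys_mult[of "l i" "l j"] mk by blast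
      show ?thesis unfolding pq(1) mono_deg_add l_deg[OF pq(2)] l_deg[OF pq(3)] by simp
    qed
    then have "l i * l j \<in> ?T" for i j using polys_mult[OF l_polys l_polys] by blast
    then show "ell_prod 3 B ` min_P \<subseteq> ?T" by (simp add: min_P_def ell_prod_pair)
    show "a + b \<in> ?T" if "a \<in> ?T" "b \<in> ?T" for a b
      using that keys_add[of a b] polys_add by blast
    show "x * a \<in> ?T" if a: "a \<in> ?T" and x: "x \<in> polys 3" for a x
    proof (rule CollectI, intro conjI ballI)
      show "x * a \<in> polys 3" using a x by (simp add: polys_mult)
      fix m assume "m \<in> keys (x * a)"
      then obtain p q where pq: "m = p + q" "q \<in> keys a" using keys_mult[of x a] by blast
      then have "2 \<le> mono_deg q" using a by blast
      then show "2 \<le> mono_deg m" by (simp add: pq(1) mono_deg_add)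
    qed
  qed (auto simp: polys_0)
  then show "f \<in> H \<Longrightarrow> m \<in> keys f \<Longrightarrow> 2 \<le> mono_deg m" by blast
qed

abbreviation "Jintr \<equiv> J_intr 6 lattice6 3 B exponent6 family6"

lemma Jintr_iff: "f \<in> Jintr \<longleftrightarrow> f \<in> polys 3 \<and> f * l 3 \<in> H"
  unfolding J_intr_def colon_def e_set6 ell_prod_single by simp

lemma lookup_mult_single:
  fixes p f :: cpoly
  shows "lookup (p * f) (single k 1) = lookup p 0 * lookup f (single k 1) + lookup p (single k 1) * lookup f 0"
proof -
  have split: "a + b = single k (1::nat) \<longleftrightarrow> a = 0 \<and> b = single k 1 \<or> a = single k 1 \<and> b = 0" for a b :: mono
  proof
    assume eq: "a + b = single k 1"
    then have "mono_deg a + mono_deg b = 1" using mono_deg_add[of a b] by simp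
    then have "mono_deg a = 0 \<or> mono_deg b = 0" by linarith
    then show "a = 0 \<and> b = single k 1 \<or> a = single k 1 \<and> b = 0"
      using eq by (auto simp: mono_deg_eq_0)
  qed auto
  have ne: "(0::mono) \<noteq> single k 1"
  proof
    assume "(0::mono) = single k 1"
    then have "mono_deg 0 = mono_deg (single k 1)" by (rule arg_cong)
    then show False by simp
  qed
  have one: "single k 1 - single k (1::nat) = 0" by simp
  have "lookup (p * f) (single k 1) = (\<Sum>a\<in>keys p. lookup (single a (lookup p a) * f) (single k 1))"
    by (subst poly_expand_mult) (simp add: lookup_sum)
  also have "\<dots> = (\<Sum>a\<in>keys p. (if a = 0 then lookup p 0 * lookup f (single k 1) else 0) +
      (if a = single k 1 then lookup p (single k 1) * lookup f 0 else 0))"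
  proof (intro sum.cong refl)
    fix a assume "a \<in> keys p"
    have "mono_dvd a (single k 1) \<longleftrightarrow> a = 0 \<or> a = single k 1"
      unfolding mono_dvd_iff using split by (metis)
    then show "lookup (single a (lookup p a) * f) (single k 1) =
        (if a = 0 then lookup p 0 * lookup f (single k 1) else 0) +
        (if a = single k 1 then lookup p (single k 1) * lookup f 0 else 0)"
      using ne by (auto simp: lookup_single_mult)
  qed
  also have "\<dots> = lookup p 0 * lookup f (single k 1) + lookup p (single k 1) * lookup f 0"
    by (simp add: sum.distrib in_keys_iff)
  finally show ?thesis .
qed

text \<open>The derivative of \<open>f\<close> at the origin in the direction in which \<open>Bs\<close> moves along \<open>g1\<close>, \<open>g2\<close> or \<open>g3\<close>.\<close>

definition linear_coeff :: "nat \<Rightarrow> cpoly \<Rightarrow> complex" where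
  "linear_coeff i f = (\<Sum>k=1..3. of_int (lattice_coords i k) * lookup f (single k 1))"

lemma linear_coeff_l: "linear_coeff 1 (l j) = of_int (g1 j)" "linear_coeff 2 (l j) = of_int (g2 j)" "linear_coeff 3 (l j) = of_int (g3 j)"
proof -
  have "linear_coeff i (l j) = (\<Sum>k=1..3. of_int (lattice_coords i k) * of_int (B j k))" for i
    unfolding linear_coeff_def by (intro sum.cong refl) (simp only: lookup_l_single)
  then have "linear_coeff i (l j) = of_int (\<Sum>k=1..3. lattice_coords i k * B j k)" for i by simp
  then show "linear_coeff 1 (l j) = of_int (g1 j)" "linear_coeff 2 (l j) = of_int (g2 j)" "linear_coeff 3 (l j) = of_int (g3 j)"
    by (simp_all only: lattice_coords)
qed

lemma linear_coeff_add: "linear_coeff i (f + g) = linear_coeff i f + linear_coeff i g"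
  by (simp add: linear_coeff_def lookup_add algebra_simps sum.distrib)

lemma linear_coeff_mult: "linear_coeff i (p * f) = lookup p 0 * linear_coeff i f + linear_coeff i p * lookup f 0"
  by (simp add: linear_coeff_def lookup_mult_single algebra_simps sum.distrib sum_distrib_left sum_distrib_right
      del: One_nat_def)

lemma linear_coeff_0: "linear_coeff i 0 = 0" by (simp add: linear_coeff_def)

lemma linear_coeff_uminus: "linear_coeff i (- f) = - linear_coeff i f"
  using linear_coeff_add[of i f "- f"] linear_coeff_0[of i] by (simp add: add_eq_0_iff2)

text \<open>An element with a constant term would put a linear form \<open>\<ell>\<^sub>3 + \<dots>\<close> into \<open>H\<close>, which lives in degrees
  at least two.\<close>

lemma Jintr_const: "f \<in> Jintr \<Longrightarrow> lookup f 0 = 0"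
proof -
  assume "f \<in> Jintr"
  then have fH: "f * l 3 \<in> H" by (simp add: Jintr_iff)
  have "lookup (f * l 3) (single k 1) = 0" for k
    using H_degree[OF fH, of "single k 1"] by (auto simp: in_keys_iff)
  then have "linear_coeff 3 (f * l 3) = 0" by (simp add: linear_coeff_def del: One_nat_def)
  then show "lookup f 0 = 0" by (simp add: linear_coeff_mult lookup_l_0 linear_coeff_l)
qed

section \<open>The ambient ideal\<close>

text \<open>The element \<open>a \<eta>\<^sub>1 + b \<eta>\<^sub>2 + c \<eta>\<^sub>3\<close> of the free module on the sets \<open>{1}\<close>, \<open>{2}\<close>, \<open>{3}\<close>.\<close>

definition vec3 :: "cpoly \<Rightarrow> cpoly \<Rightarrow> cpoly \<Rightarrow> nat set \<Rightarrow> cpoly" where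
  "vec3 a b c X = (if X = {1} then a else if X = {2} then b else if X = {3} then c else 0)"

lemma eta_vec3: "eta {1} p = vec3 p 0 0" "eta {2} p = vec3 0 p 0" "eta {3} p = vec3 0 0 p"
  by (rule ext, simp add: eta_def vec3_def)+

abbreviation "Z \<equiv> Z_module 6 lattice6 3 B exponent6 family6"

definition \<iota> :: "nat set \<Rightarrow> nat set" where "\<iota> Y = (SOME G. G \<in> min_M \<and> G \<subseteq> Y)"

text \<open>The generators of \<open>Z\<close>, with the minimal sets of the example inserted.\<close>

definition Z_gens :: "(nat set \<Rightarrow> cpoly) set" where
  "Z_gens = {\<lambda>X. eta G (ell_prod 3 B (G' - G)) X - eta G' (ell_prod 3 B (G - G')) X |G G'.
               G \<in> min_M \<and> G' \<in> min_M \<and> G \<noteq> G'} \<union>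
            {eta (\<iota> Y) (ell_prod 3 B (Y - \<iota> Y)) |Y. Y \<in> min_P}"

lemma Z_eq: "Z = submodule_gen 3 Z_gens"
  unfolding Z_module_def Let_def minimal_M minimal_P Z_gens_def \<iota>_def ..

lemma Z_add: "vec3 a b c \<in> Z \<Longrightarrow> vec3 a' b' c' \<in> Z \<Longrightarrow> vec3 (a + a') (b + b') (c + c') \<in> Z"
proof -
  assume "vec3 a b c \<in> Z" "vec3 a' b' c' \<in> Z"
  then have "(\<lambda>X. vec3 a b c X + vec3 a' b' c' X) \<in> Z" unfolding Z_eq by (rule submodule_gen.add)
  moreover have "(\<lambda>X. vec3 a b c X + vec3 a' b' c' X) = vec3 (a + a') (b + b') (c + c')"
    by (rule ext) (simp add: vec3_def)
  ultimately show ?thesis by simp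
qed

lemma Z_smult: "vec3 a b c \<in> Z \<Longrightarrow> p \<in> polys 3 \<Longrightarrow> vec3 (p * a) (p * b) (p * c) \<in> Z"
proof -
  assume "vec3 a b c \<in> Z" "p \<in> polys 3"
  then have "(\<lambda>X. p * vec3 a b c X) \<in> Z" unfolding Z_eq by (intro submodule_gen.smult)
  moreover have "(\<lambda>X. p * vec3 a b c X) = vec3 (p * a) (p * b) (p * c)"
    by (rule ext) (simp add: vec3_def)
  ultimately show ?thesis by simp
qed

lemma koszul_diff: "i \<noteq> j \<Longrightarrow> ell_prod 3 B ({j} - {i}) = l j"
proof -
  assume "i \<noteq> j"
  then have "{j} - {i} = {j}" by auto
  then show ?thesis by (simp add: ell_prod_single)
qed

lemma Z_koszul: "vec3 (l 3) 0 (- l 1) \<in> Z" "vec3 0 (l 3) (- l 2) \<in> Z"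
proof -
  have k: "(\<lambda>X. eta {i} (l j) X - eta {j} (l i) X) \<in> Z" if "{i} \<in> min_M" "{j} \<in> min_M" "i \<noteq> j" for i j
  proof -
    have "(\<lambda>X. eta {i} (ell_prod 3 B ({j} - {i})) X - eta {j} (ell_prod 3 B ({i} - {j})) X) \<in> Z_gens"
      unfolding Z_gens_def using that by blast
    then show ?thesis
      unfolding Z_eq koszul_diff[OF that(3)] koszul_diff[OF that(3)[symmetric]] by (rule submodule_gen.gen)
  qed
  have "(\<lambda>X. eta {1} (l 3) X - eta {3} (l 1) X) \<in> Z" "(\<lambda>X. eta {2} (l 3) X - eta {3} (l 2) X) \<in> Z"
    by (rule k; simp add: min_M_def)+
  moreover have "(\<lambda>X. eta {1} (l 3) X - eta {3} (l 1) X) = vec3 (l 3) 0 (- l 1)"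
    "(\<lambda>X. eta {2} (l 3) X - eta {3} (l 2) X) = vec3 0 (l 3) (- l 2)"
    unfolding eta_vec3 by (rule ext, simp add: vec3_def)+
  ultimately show "vec3 (l 3) 0 (- l 1) \<in> Z" "vec3 0 (l 3) (- l 2) \<in> Z" by simp_all
qed

lemma \<iota>_values: "\<iota> {3, 4} = {3}" "\<iota> {2, 6} = {2}" "\<iota> {2, 4} = {2}" "\<iota> {1, 6} = {1}"
  "\<iota> {1, 3} = {1} \<or> \<iota> {1, 3} = {3}"
proof -
  have *: "\<iota> Y \<in> min_M \<and> \<iota> Y \<subseteq> Y" if "\<exists>G. G \<in> min_M \<and> G \<subseteq> Y" for Y
    unfolding \<iota>_def by (rule someI_ex) (rule that)
  have "\<iota> {3, 4} \<in> min_M \<and> \<iota> {3, 4} \<subseteq> {3, 4}" "\<iota> {2, 6} \<in> min_M \<and> \<iota> {2, 6} \<subseteq> {2, 6}"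
    "\<iota> {2, 4} \<in> min_M \<and> \<iota> {2, 4} \<subseteq> {2, 4}" "\<iota> {1, 6} \<in> min_M \<and> \<iota> {1, 6} \<subseteq> {1, 6}"
    "\<iota> {1, 3} \<in> min_M \<and> \<iota> {1, 3} \<subseteq> {1, 3}"
    by (rule *; simp add: min_M_def; blast)+
  note h = this
  show "\<iota> {3, 4} = {3}" using h(1) unfolding min_M_def by (elim conjE insertE emptyE; simp)
  show "\<iota> {2, 6} = {2}" using h(2) unfolding min_M_def by (elim conjE insertE emptyE; simp)
  show "\<iota> {2, 4} = {2}" using h(3) unfolding min_M_def by (elim conjE insertE emptyE; simp)
  show "\<iota> {1, 6} = {1}" using h(4) unfolding min_M_def by (elim conjE insertE emptyE; simp)
  show "\<iota> {1, 3} = {1} \<or> \<iota> {1, 3} = {3}"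
    using h(5) unfolding min_M_def by (elim conjE insertE emptyE; simp)
qed

lemma Z_H_gen: "Y \<in> min_P \<Longrightarrow> eta (\<iota> Y) (ell_prod 3 B (Y - \<iota> Y)) \<in> Z"
  unfolding Z_eq Z_gens_def by (intro submodule_gen.gen) blast

lemma pair_diff: "{3, 4} - {3} = {4::nat}" "{2, 6} - {2} = {6::nat}" "{2, 4} - {2} = {4::nat}"
  "{1, 6} - {1} = {6::nat}" "{1, 3} - {1} = {3::nat}" "{1, 3} - {3} = {1::nat}"
  by auto

text \<open>The set \<open>{1, 3}\<close> contains two minimal sets, and \<open>\<iota>\<close> may choose either; the Koszul relation
  between \<open>\<eta>\<^sub>1\<close> and \<open>\<eta>\<^sub>3\<close> turns one choice into the other.\<close>

lemma Z_members: "vec3 0 0 (l 4) \<in> Z" "vec3 0 (l 6) 0 \<in> Z" "vec3 0 0 (l 1) \<in> Z"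
proof -
  show "vec3 0 0 (l 4) \<in> Z"
    using Z_H_gen[of "{3, 4}"] unfolding \<iota>_values pair_diff ell_prod_single eta_vec3 by (simp add: min_P_def)
  show "vec3 0 (l 6) 0 \<in> Z"
    using Z_H_gen[of "{2, 6}"] unfolding \<iota>_values pair_diff ell_prod_single eta_vec3 by (simp add: min_P_def)
  have g: "eta (\<iota> {1, 3}) (ell_prod 3 B ({1, 3} - \<iota> {1, 3})) \<in> Z"
    by (rule Z_H_gen) (simp add: min_P_def)
  show "vec3 0 0 (l 1) \<in> Z"
    using \<iota>_values(5)
  proof
    assume i: "\<iota> {1, 3} = {1}"
    have "vec3 (l 3) 0 0 \<in> Z" using g unfolding i pair_diff ell_prod_single eta_vec3 .
    from Z_add[OF this Z_smult[OF Z_koszul(1) polys_uminus[OF polys_1]]] show ?thesis by simp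
  next
    assume i: "\<iota> {1, 3} = {3}"
    show ?thesis using g unfolding i pair_diff ell_prod_single eta_vec3 .
  qed
qed

abbreviation "Jamb \<equiv> J_amb 6 lattice6 3 B exponent6 family6"

lemma Jamb_iff: "f \<in> Jamb \<longleftrightarrow> f \<in> polys 3 \<and> vec3 0 0 f \<in> Z"
proof -
  have G: "(SOME G. G \<in> min_M \<and> G \<subseteq> {3}) = {3}"
    by (rule some_equality) (auto simp: min_M_def)
  have "(\<lambda>X. f * eta {3} 1 X) = vec3 0 0 f"
    unfolding eta_vec3 by (rule ext) (simp add: vec3_def)
  then show ?thesis
    unfolding J_amb_def Let_def e_set6 minimal_M G by (simp add: ell_prod_def)
qed

lemma Jamb_add: "f \<in> Jamb \<Longrightarrow> g \<in> Jamb \<Longrightarrow> f + g \<in> Jamb"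
  using Z_add[of 0 0 f 0 0 g] by (simp add: Jamb_iff polys_add)

lemma Jamb_mult: "f \<in> Jamb \<Longrightarrow> p \<in> polys 3 \<Longrightarrow> p * f \<in> Jamb"
  using Z_smult[of 0 0 f p] by (simp add: Jamb_iff polys_mult)

lemma Jamb_uminus: "f \<in> Jamb \<Longrightarrow> - f \<in> Jamb"
  using Jamb_mult[of f "- 1"] polys_uminus[OF polys_1] by simp

lemma Jamb_diff: "f \<in> Jamb \<Longrightarrow> g \<in> Jamb \<Longrightarrow> f - g \<in> Jamb"
  using Jamb_add[of f "- g"] Jamb_uminus by simp

lemma Jamb_0: "0 \<in> Jamb"
  using Jamb_mult[of "l 4" 0] Z_members(1) by (simp add: Jamb_iff l_polys polys_0)

lemma Jamb_sum: "(\<And>i. i \<in> I \<Longrightarrow> f i \<in> Jamb) \<Longrightarrow> sum f I \<in> Jamb"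
  by (induction I rule: infinite_finite_induct) (auto intro: Jamb_0 Jamb_add)

lemma Jamb_members: "l 4 \<in> Jamb" "l 5 \<in> Jamb" "l 6 * l 6 \<in> Jamb"
proof -
  show l4: "l 4 \<in> Jamb" using Z_members(1) by (simp add: Jamb_iff l_polys)
  have l1: "l 1 \<in> Jamb" using Z_members(3) by (simp add: Jamb_iff l_polys)
  have "l 5 = - l 1 + (- 2) * l 4" by (simp add: l_relations)
  then show l5: "l 5 \<in> Jamb"
    by (simp only:) (intro Jamb_add Jamb_uminus Jamb_mult l1 l4 polys_uminus numeral_polys)
  have "vec3 0 0 (l 6 * l 2) \<in> Z"
    using Z_add[OF Z_smult[OF Z_koszul(2) polys_uminus[OF l_polys[of 6]]] Z_smult[OF Z_members(2) l_polys[of 3]]]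
    by (simp add: mult.commute)
  then have "l 6 * l 2 \<in> Jamb" by (simp add: Jamb_iff l_polys polys_mult)
  moreover have "l 6 * l 6 = l 6 * l 2 - (l 6 * l 5 + l 6 * l 4)" by (simp add: l_relations algebra_simps)
  moreover have "l 6 * l 5 + l 6 * l 4 \<in> Jamb" by (intro Jamb_add Jamb_mult l4 l5 l_polys)
  ultimately show "l 6 * l 6 \<in> Jamb" by (simp only: Jamb_diff)
qed

text \<open>The functional of degree one that sends \<open>\<ell>\<^sub>j \<eta>\<^sub>i\<close> to the \<open>j\<close>-th entry of \<open>g2\<close>, \<open>g1\<close>, \<open>g3\<close> for
  \<open>i = 1, 2, 3\<close>.  It is well defined on \<open>F\<close>, as these are lattice vectors, and it respects the Koszul
  relations because the \<open>3 \<times> 3\<close> matrix of their first three entries is symmetric.  The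
  other generators correspond to entries that are zero.  The vanishing of
  constant terms is carried along to make the induction over multiples work.\<close>

lemma Z_functional:
  assumes "z \<in> Z"
  shows "(\<forall>i\<in>{1, 2, 3}. lookup (z {i}) 0 = 0) \<and> linear_coeff 2 (z {1}) + linear_coeff 1 (z {2}) + linear_coeff 3 (z {3}) = 0"
  using assms unfolding Z_eq
proof induction
  case zero
  then show ?case by (simp add: linear_coeff_0)
next
  case (gen z)
  from gen consider G G' where "G \<in> min_M" "G' \<in> min_M" "G \<noteq> G'"
      "z = (\<lambda>X. eta G (ell_prod 3 B (G' - G)) X - eta G' (ell_prod 3 B (G - G')) X)"
    | Y where "Y \<in> min_P" "z = eta (\<iota> Y) (ell_prod 3 B (Y - \<iota> Y))"
    unfolding Z_gens_def by blast
  then show ?case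
  proof cases
    case 1
    then obtain i j where ij: "G = {i}" "G' = {j}" "i \<in> {1, 2, 3}" "j \<in> {1, 2, 3}" "i \<noteq> j"
      unfolding min_M_def by (elim insertE emptyE) auto
    have z: "z = (\<lambda>X. eta {i} (l j) X - eta {j} (l i) X)"
      using 1(4) koszul_diff[OF ij(5)] koszul_diff[OF ij(5)[symmetric]] unfolding ij(1,2) by simp
    show ?thesis
      unfolding z using ij(3-5)
      by (elim insertE emptyE)
         (simp_all add: eta_def lookup_minus lookup_l_0 linear_coeff_0 linear_coeff_uminus linear_coeff_l)
  next
    case 2
    have "Y = {3, 4} \<or> Y = {2, 6} \<or> Y = {2, 4} \<or> Y = {1, 6} \<or> Y = {1, 3}"
      using 2(1) by (simp add: min_P_def)
    then have "z = vec3 0 0 (l 4) \<or> z = vec3 0 (l 6) 0 \<or> z = vec3 0 (l 4) 0 \<or> z = vec3 (l 6) 0 0 \<or>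
        z = vec3 (l 3) 0 0 \<or> z = vec3 0 0 (l 1)"
      using 2(2) \<iota>_values(5)
      by (elim disjE) (simp_all add: \<iota>_values(1-4) pair_diff ell_prod_single eta_vec3)
    then show ?thesis
      by (elim disjE) (simp_all add: vec3_def lookup_l_0 linear_coeff_0 linear_coeff_l)
  qed
next
  case (add y z)
  have "linear_coeff 2 (y {1} + z {1}) + linear_coeff 1 (y {2} + z {2}) + linear_coeff 3 (y {3} + z {3}) =
      (linear_coeff 2 (y {1}) + linear_coeff 1 (y {2}) + linear_coeff 3 (y {3})) + (linear_coeff 2 (z {1}) + linear_coeff 1 (z {2}) + linear_coeff 3 (z {3}))"
    by (simp add: linear_coeff_add)
  also have "\<dots> = 0" using add.IH by simp
  finally show ?case using add.IH by (simp add: lookup_add)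
next
  case (smult p z)
  have m0: "lookup (p * f) 0 = 0" if "lookup f 0 = 0" for f :: cpoly
  proof -
    have "lookup (p * f) 0 = (\<Sum>a\<in>keys p. lookup (single a (lookup p a) * f) 0)"
      by (subst poly_expand_mult) (simp add: lookup_sum)
    also have "\<dots> = 0"
    proof (intro sum.neutral ballI)
      fix a assume "a \<in> keys p"
      have "0 - a = (0::mono)" by (rule poly_mapping_eqI) (simp add: lookup_minus)
      then show "lookup (single a (lookup p a) * f) 0 = 0" by (simp add: lookup_single_mult that)
    qed
    finally show ?thesis .
  qed
  have z0: "lookup (z {1}) 0 = 0" "lookup (z {2}) 0 = 0" "lookup (z {3}) 0 = 0"
    using smult.IH by simp_all
  have "linear_coeff 2 (p * z {1}) + linear_coeff 1 (p * z {2}) + linear_coeff 3 (p * z {3}) =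
      lookup p 0 * (linear_coeff 2 (z {1}) + linear_coeff 1 (z {2}) + linear_coeff 3 (z {3}))"
    by (simp add: linear_coeff_mult z0 distrib_left)
  also have "linear_coeff 2 (z {1}) + linear_coeff 1 (z {2}) + linear_coeff 3 (z {3}) = 0" using smult.IH by blast
  finally show ?case using m0 smult.IH by simp
qed

lemma l6_notin_Jamb: "l 6 \<notin> Jamb"
proof
  assume "l 6 \<in> Jamb"
  then have "vec3 0 0 (l 6) \<in> Z" by (simp add: Jamb_iff)
  from Z_functional[OF this] show False by (simp add: vec3_def linear_coeff_0 linear_coeff_l)
qed

section \<open>The Hilbert series\<close>

lemma Var_mod_Jamb: "k \<in> {1..3} \<Longrightarrow> \<exists>c. Var k - Const c * l 6 \<in> Jamb"
proof -
  assume k: "k \<in> {1..3}"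
  have "Var k - Const (of_int (lattice_coords 3 k)) * l 6 =
      Const (of_int (- lattice_coords 1 k)) * l 5 + Const (of_int (lattice_coords 2 k)) * l 4"
    unfolding Var_combination[OF k] by (simp add: algebra_simps)
  moreover have "\<dots> \<in> Jamb" by (intro Jamb_add Jamb_mult Jamb_members polys_Const)
  ultimately have "Var k - Const (of_int (lattice_coords 3 k)) * l 6 \<in> Jamb" by simp
  then show ?thesis by blast
qed

text \<open>Modulo \<open>\<ell>\<^sub>4\<close> and \<open>\<ell>\<^sub>5\<close> every variable is a multiple of \<open>\<ell>\<^sub>6\<close>, and \<open>\<ell>\<^sub>6\<^sup>2\<close> lies in the ideal.\<close>

lemma degree_ge_2_in_Jamb:
  assumes "f \<in> polys 3" "\<And>m. m \<in> keys f \<Longrightarrow> 2 \<le> mono_deg m"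
  shows "f \<in> Jamb"
proof -
  have "single m (lookup f m) \<in> Jamb" if m: "m \<in> keys f" for m
  proof -
    have m3: "m \<in> monomials 3" using assms(1) m by (auto simp: polys_def)
    have "m \<noteq> 0" using assms(2)[OF m] by auto
    then obtain k q where k: "k \<in> {1..3}" "q \<in> monomials 3" "m = single k 1 + q"
      using monomial_split[OF m3] by blast
    have "q \<noteq> 0" using assms(2)[OF m] k(3) by (auto simp: mono_deg_add)
    then obtain k' q' where k': "k' \<in> {1..3}" "q' \<in> monomials 3" "q = single k' 1 + q'"
      using monomial_split[OF k(2)] by blast
    obtain c where c: "Var k - Const c * l 6 \<in> Jamb" using Var_mod_Jamb[OF k(1)] by blast
    obtain c' where c': "Var k' - Const c' * l 6 \<in> Jamb" using Var_mod_Jamb[OF k'(1)] by blast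
    have "Var k * Var k' = Var k' * (Var k - Const c * l 6) + Const c * l 6 * (Var k' - Const c' * l 6)
        + (Const c * Const c') * (l 6 * l 6)"
      by (simp add: algebra_simps)
    moreover have "\<dots> \<in> Jamb"
      by (intro Jamb_add Jamb_mult c c' Jamb_members polys_mult polys_Const l_polys polys_Var k'(1))
    ultimately have vv: "Var k * Var k' \<in> Jamb" by simp
    have "single m (lookup f m) = single q' (lookup f m) * (Var k * Var k')"
      by (simp add: Var_def mult_single k(3) k'(3) ac_simps)
    then show ?thesis using Jamb_mult[OF vv polys_single[OF k'(2)]] by simp
  qed
  then have "(\<Sum>m\<in>keys f. single m (lookup f m)) \<in> Jamb" by (rule Jamb_sum)
  then show ?thesis by (simp only: sum_single_keys)
qed

lemma degree_1_mod_Jamb: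
  assumes "f \<in> polys 3" "\<And>m. m \<in> keys f \<Longrightarrow> mono_deg m = 1"
  shows "\<exists>c. f - Const c * l 6 \<in> Jamb"
proof -
  have "\<exists>c. single m (lookup f m) - Const c * l 6 \<in> Jamb" if m: "m \<in> keys f" for m
  proof -
    have m3: "m \<in> monomials 3" using assms(1) m by (auto simp: polys_def)
    have "m \<noteq> 0" using assms(2)[OF m] by auto
    then obtain k q where k: "k \<in> {1..3}" "q \<in> monomials 3" "m = single k 1 + q"
      using monomial_split[OF m3] by blast
    then have "q = 0" using assms(2)[OF m] by (simp add: mono_deg_add mono_deg_eq_0)
    then have e: "single m (lookup f m) = Const (lookup f m) * Var k"
      by (simp add: Const_def Var_def mult_single k(3))
    obtain c where c: "Var k - Const c * l 6 \<in> Jamb" using Var_mod_Jamb[OF k(1)] by blast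
    have "Const (lookup f m) * (Var k - Const c * l 6) \<in> Jamb" by (rule Jamb_mult[OF c polys_Const])
    then have "single m (lookup f m) - Const (lookup f m * c) * l 6 \<in> Jamb"
      by (simp add: e Const_mult algebra_simps)
    then show ?thesis by blast
  qed
  then obtain c where c: "\<And>m. m \<in> keys f \<Longrightarrow> single m (lookup f m) - Const (c m) * l 6 \<in> Jamb" by metis
  have "(\<Sum>m\<in>keys f. single m (lookup f m) - Const (c m) * l 6) \<in> Jamb" by (rule Jamb_sum) (rule c)
  moreover have "(\<Sum>m\<in>keys f. single m (lookup f m) - Const (c m) * l 6) = f - Const (\<Sum>m\<in>keys f. c m) * l 6"
  proof -
    have "Const (\<Sum>m\<in>S. c m) = (\<Sum>m\<in>S. Const (c m))" for S
      by (induction S rule: infinite_finite_induct) (simp_all add: Const_add)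
    then show ?thesis by (simp add: sum_subtractf sum_single_keys sum_distrib_right)
  qed
  ultimately show ?thesis by (intro exI) simp
qed

lemma Jamb_subset_Jintr_degree: 
  "homogeneous_part Jintr q \<subseteq> homogeneous_part Jamb q" if "q \<noteq> 1"
proof
  fix f assume f: "f \<in> homogeneous_part Jintr q"
  then have fJ: "f \<in> Jintr" and d: "\<And>m. m \<in> keys f \<Longrightarrow> mono_deg m = q"
    by (auto simp: homogeneous_part_def)
  have f3: "f \<in> polys 3" using fJ by (simp add: Jintr_iff)
  have "2 \<le> mono_deg m" if m: "m \<in> keys f" for m
  proof (rule ccontr)
    assume "\<not> ?thesis"
    then have "mono_deg m = 0" using d[OF m] \<open>q \<noteq> 1\<close> by linarith
    then have "m = 0" by (simp add: mono_deg_eq_0)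
    then show False using m Jintr_const[OF fJ] by (simp add: in_keys_iff)
  qed
  then have "f \<in> Jamb" by (rule degree_ge_2_in_Jamb[OF f3])
  then show "f \<in> homogeneous_part Jamb q" using d by (simp add: homogeneous_part_def)
qed

end

lemma quotient_dim_0:
  assumes "V \<subseteq> W"
  shows "quotient_dim V W = 0"
proof -
  have "is_quotient_basis V W S \<longleftrightarrow> S = {}" for S
  proof
    assume S: "is_quotient_basis V W S"
    show "S = {}"
    proof (rule ccontr)
      assume "S \<noteq> {}"
      then obtain s where s: "s \<in> S" by blast
      define c where "c t = (if t = s then 1 else 0 :: complex)" for t
      have "(\<Sum>t\<in>S. Const (c t) * t) = (\<Sum>t\<in>S. if t = s then s else 0)"
        by (intro sum.cong refl) (simp add: c_def)
      also have "\<dots> = s" using S s by (simp add: is_quotient_basis_def)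
      also have "s \<in> W" using S s assms by (auto simp: is_quotient_basis_def)
      finally have "c s = 0" using S s by (simp add: is_quotient_basis_def)
      then show False by (simp add: c_def)
    qed
  qed (use assms in \<open>auto simp: is_quotient_basis_def\<close>)
  then show ?thesis by (simp add: quotient_dim_def)
qed

text \<open>As \<open>quotient_dim\<close> selects some basis of the quotient, all of them have to be shown to have one element.\<close>

lemma quotient_dim_1:
  assumes x: "x \<in> V" "x \<notin> W" and V: "\<And>f. f \<in> V \<Longrightarrow> \<exists>c. f - Const c * x \<in> W"
    and W: "\<And>f g. f \<in> W \<Longrightarrow> g \<in> W \<Longrightarrow> f + g \<in> W" "\<And>c f. f \<in> W \<Longrightarrow> Const c * f \<in> W"
  shows "quotient_dim V W = 1"
proof -
  have "is_quotient_basis V W {x}"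
    unfolding is_quotient_basis_def
  proof (intro conjI allI impI ballI)
    fix c s assume c: "(\<Sum>s\<in>{x}. Const (c s) * s) \<in> W" and s: "s \<in> {x}"
    show "c s = 0"
    proof (rule ccontr)
      assume ne: "c s \<noteq> 0"
      have "Const (1 / c x) * (Const (c x) * x) \<in> W" by (rule W(2)) (use c in simp)
      moreover have "Const (1 / c x) * (Const (c x) * x) = x"
        using ne s by (simp add: mult.assoc[symmetric] Const_mult[symmetric])
      ultimately show False using x(2) by simp
    qed
  next
    fix f assume "f \<in> V"
    then obtain c where "f - Const c * x \<in> W" using V by blast
    then show "\<exists>c. f - (\<Sum>s\<in>{x}. Const (c s) * s) \<in> W" by (intro exI[of _ "\<lambda>_. c"]) simp
  qed (use x in auto)
  moreover have "card S = 1" if S: "is_quotient_basis V W S" for S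
  proof -
    have fin: "finite S" and SV: "S \<subseteq> V"
      and ind: "\<And>c. (\<Sum>s\<in>S. Const (c s) * s) \<in> W \<Longrightarrow> \<forall>s\<in>S. c s = 0"
      using S by (auto simp: is_quotient_basis_def)
    have ne: "S \<noteq> {}"
    proof
      assume "S = {}"
      then show False using S x by (auto simp: is_quotient_basis_def)
    qed
    have same: "s = t" if st: "s \<in> S" "t \<in> S" for s t
    proof (rule ccontr)
      assume d: "s \<noteq> t"
      obtain a where a: "s - Const a * x \<in> W" using V SV st by blast
      obtain b where b: "t - Const b * x \<in> W" using V SV st by blast
      have comb: "(\<Sum>r\<in>S. Const (if r = s then p else if r = t then q else 0) * r) = Const p * s + Const q * t" for p q
      proof -
        have "(\<Sum>r\<in>S. Const (if r = s then p else if r = t then q else 0) * r) =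
            (\<Sum>r\<in>{s, t}. Const (if r = s then p else if r = t then q else 0) * r)"
          using st fin by (intro sum.mono_neutral_right) auto
        then show ?thesis using d by simp
      qed
      have "Const b * (s - Const a * x) + Const (- a) * (t - Const b * x) \<in> W"
        by (intro W a b)
      then have "Const b * s + Const (- a) * t \<in> W"
        by (simp add: algebra_simps Const_uminus)
      then have "b = 0" using ind[of "\<lambda>r. if r = s then b else if r = t then - a else 0"] st d
        unfolding comb by auto
      then have "t \<in> W" using b by simp
      then have "Const 0 * s + Const 1 * t \<in> W" by simp
      then show False using ind[of "\<lambda>r. if r = s then 0 else if r = t then 1 else 0"] st d
        unfolding comb by auto
    qed
    obtain s where "s \<in> S" using ne by blast
    then have "S = {s}" using same by blast
    then show ?thesis by simp
  qed
  ultimately show ?thesis unfolding quotient_dim_def by (metis someI_ex)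
qed

context basis_matrix6
begin

declare One_nat_def [simp del]

lemma obstruction_hilb6: "obstruction_hilb 6 lattice6 3 B exponent6 family6 = fps_X"
proof (rule fps_ext)
  fix q
  have "quotient_dim (homogeneous_part Jintr q) (homogeneous_part Jamb q) = (if q = 1 then 1 else 0)"
  proof (cases "q = 1")
    case True
    have "quotient_dim (homogeneous_part Jintr 1) (homogeneous_part Jamb 1) = 1"
    proof (rule quotient_dim_1)
      show "l 6 \<in> homogeneous_part Jintr 1"
        using l6_l3_in_H l_deg by (simp add: homogeneous_part_def Jintr_iff l_polys)
      show "l 6 \<notin> homogeneous_part Jamb 1" using l6_notin_Jamb by (simp add: homogeneous_part_def)
      have cdeg: "mono_deg m = 1" if "m \<in> keys (Const c * f)" "\<And>m. m \<in> keys f \<Longrightarrow> mono_deg m = 1" for c f m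
        using that by (auto simp: in_keys_iff lookup_Const_mult)
      show "\<exists>c. f - Const c * l 6 \<in> homogeneous_part Jamb 1" if f: "f \<in> homogeneous_part Jintr 1" for f
      proof -
        have fd: "f \<in> polys 3" "\<And>m. m \<in> keys f \<Longrightarrow> mono_deg m = 1"
          using f by (auto simp: homogeneous_part_def Jintr_iff)
        obtain c where c: "f - Const c * l 6 \<in> Jamb" using degree_1_mod_Jamb[OF fd] by blast
        have "mono_deg m = 1" if "m \<in> keys (f - Const c * l 6)" for m
          using that keys_diff[of f "Const c * l 6"] fd(2) cdeg[of _ c "l 6"] l_deg by blast
        then show ?thesis using c by (auto simp: homogeneous_part_def)
      qed
      show "f + g \<in> homogeneous_part Jamb 1"
        if "f \<in> homogeneous_part Jamb 1" "g \<in> homogeneous_part Jamb 1" for f g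
        using that keys_add[of f g] Jamb_add unfolding homogeneous_part_def by blast
      show "Const c * f \<in> homogeneous_part Jamb 1" if "f \<in> homogeneous_part Jamb 1" for c f
        using that Jamb_mult[OF _ polys_Const] cdeg unfolding homogeneous_part_def by blast
    qed
    then show ?thesis using True by simp
  next
    case False
    then show ?thesis using quotient_dim_0[OF Jamb_subset_Jintr_degree] by simp
  qed
  then show "fps_nth (obstruction_hilb 6 lattice6 3 B exponent6 family6) q = fps_nth fps_X q"
    unfolding obstruction_hilb_def by (simp add: fps_X_nth)
qed

end

section \<open>A linear functional applied to the Gamma series\<close>

\<comment> \<open>Orders, indices and exponents are compared with the numeral 1 throughout the following parts.\<close>
declare One_nat_def [simp del]

text \<open>The expansions at \<open>t = 0\<close> of \<open>1 / ((1 + t) \<dots> (k + t))\<close> and of \<open>(t - a) (t - a - 1) \<dots> (t - a - k + 1)\<close>.\<close>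

fun rising_inverse :: "nat \<Rightarrow> complex fps" where
  "rising_inverse 0 = 1"
| "rising_inverse (Suc k) = rising_inverse k * inverse (fps_const (of_nat (Suc k)) + fps_X)"

fun falling_fps :: "complex \<Rightarrow> nat \<Rightarrow> complex fps" where
  "falling_fps a 0 = 1"
| "falling_fps a (Suc k) = (fps_X - fps_const (a + of_nat k)) * falling_fps a k"

text \<open>The expansion of \<open>\<Gamma>(1 + t) / \<Gamma>(1 + z + t)\<close> at \<open>t = 0\<close>.\<close>

definition gamma_fps :: "int \<Rightarrow> complex fps" where
  "gamma_fps z = (if 0 \<le> z then rising_inverse (nat z) else falling_fps 0 (nat (- z)))"

text \<open>For \<open>z < 0\<close>, the series \<open>gamma_fps z\<close> divided by its factor \<open>t\<close>.\<close>

definition gamma_reduced :: "int \<Rightarrow> complex fps" where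
  "gamma_reduced z = falling_fps 1 (nat (- z - 1))"

lemma gamma_fps_rec: "(fps_const (of_int z) + fps_X) * gamma_fps z = gamma_fps (z - 1)"
proof (cases "0 < z")
  case True
  then obtain k where k: "z = int (Suc k)" by (metis gr0_implies_Suc pos_int_cases)
  let ?p = "fps_const (of_nat (Suc k)) + fps_X :: complex fps"
  have "fps_nth ?p 0 \<noteq> 0" by (simp del: of_nat_Suc)
  then have "?p * inverse ?p = 1" by (metis inverse_mult_eq_1 mult.commute)
  then have "?p * (rising_inverse k * inverse ?p) = rising_inverse k"
    by (simp only: mult.left_commute[of ?p] mult_1_right)
  moreover have "gamma_fps z = rising_inverse (Suc k)" "gamma_fps (z - 1) = rising_inverse k"
  proof -
    have "nat z = Suc k" unfolding k by (rule nat_int)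
    moreover have "nat (z - 1) = k" unfolding k by simp
    moreover have "0 \<le> z" "0 \<le> z - 1" unfolding k by simp_all
    ultimately show "gamma_fps z = rising_inverse (Suc k)" "gamma_fps (z - 1) = rising_inverse k"
      by (simp_all only: gamma_fps_def if_True)
  qed
  moreover have "of_int z = (of_nat (Suc k) :: complex)" by (simp add: k)
  ultimately show ?thesis by (simp only: rising_inverse.simps)
next
  case False
  define k where "k = nat (- z)"
  have z: "z = - int k" using False by (simp add: k_def)
  have n: "nat (1 + int k) = Suc k" by simp
  have "gamma_fps z = falling_fps 0 k" by (cases "k = 0") (simp_all add: gamma_fps_def z)
  moreover have "gamma_fps (z - 1) = falling_fps 0 (Suc k)" by (simp add: gamma_fps_def z n)
  ultimately show ?thesis by (simp add: z fps_const_neg[symmetric] add.commute del: fps_const_neg)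
qed

lemma gamma_reduced_rec: "z < 0 \<Longrightarrow> (fps_const (of_int z) + fps_X) * gamma_reduced z = gamma_reduced (z - 1)"
proof -
  assume "z < 0"
  define k where "k = nat (- z - 1)"
  have z: "z = - int k - 1" using \<open>z < 0\<close> by (simp add: k_def)
  have n: "nat (1 + int k) = Suc k" by simp
  have c: "fps_const (of_int z) + fps_X = fps_X - fps_const (1 + of_nat k :: complex)"
  proof -
    have "of_int z = - (1 + of_nat k :: complex)" by (simp add: z)
    then have "fps_const (of_int z) = - fps_const (1 + of_nat k :: complex)" by (simp only: fps_const_neg)
    then show ?thesis by simp
  qed
  have "gamma_reduced z = falling_fps 1 k" by (simp add: gamma_reduced_def z)
  moreover have "gamma_reduced (z - 1) = falling_fps 1 (Suc k)" by (simp add: gamma_reduced_def z n)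
  ultimately show ?thesis unfolding c by simp
qed

lemma gamma_fps_negative: "z < 0 \<Longrightarrow> fps_nth (gamma_fps z) 0 = 0"
proof -
  have "fps_nth (falling_fps 0 (Suc k)) 0 = 0" for k
    by (induction k) simp_all
  moreover assume "z < 0"
  then obtain k where "nat (- z) = Suc k" by (metis gr0_implies_Suc neg_0_less_iff_less zero_less_nat_eq)
  ultimately show ?thesis using \<open>z < 0\<close> by (simp add: gamma_fps_def)
qed

text \<open>Coordinate 5 lies in all members of the family, so its exponents are always negative and all terms of
  the Gamma series share the factor \<open>t\<^sub>5\<close>, which is removed.\<close>

definition gamma_coord :: "nat \<Rightarrow> int \<Rightarrow> complex fps" where
  "gamma_coord k z = (if k = 5 then gamma_reduced z else gamma_fps z)"

lemma gamma_coord_rec: "k \<noteq> 5 \<or> z < 0 \<Longrightarrow> (fps_const (of_int z) + fps_X) * gamma_coord k z = gamma_coord k (z - 1)"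
  by (simp add: gamma_coord_def gamma_fps_rec gamma_reduced_rec)

lemma gamma_coord_nth_rec:
  assumes "k \<noteq> 5 \<or> z < 0"
  shows "fps_nth (gamma_coord k (z - 1)) 0 = of_int z * fps_nth (gamma_coord k z) 0"
    and "fps_nth (gamma_coord k (z - 1)) (Suc q) = of_int z * fps_nth (gamma_coord k z) (Suc q) + fps_nth (gamma_coord k z) q"
  unfolding gamma_coord_rec[OF assms, symmetric] by (simp_all add: distrib_right)

text \<open>For \<open>q \<le> 2\<close>, the coefficient of \<open>t\<^sup>q\<close> in \<open>gamma_coord k z * exp (t y\<^sub>k)\<close>, where \<open>y\<^sub>k = log x\<^sub>k\<close>.\<close>

definition log_coeff :: "nat \<Rightarrow> int \<Rightarrow> nat \<Rightarrow> cpoly" where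
  "log_coeff k z q = (if q = 0 then Const (fps_nth (gamma_coord k z) 0)
     else if q = 1 then Const (fps_nth (gamma_coord k z) 0) * Var k + Const (fps_nth (gamma_coord k z) 1)
     else Const (fps_nth (gamma_coord k z) 0) * (Const (1 / 2) * (Var k * Var k))
       + Const (fps_nth (gamma_coord k z) 1) * Var k + Const (fps_nth (gamma_coord k z) 2))"

lemma pderiv_var_mult: "pderiv_var j (p * q) = pderiv_var j p * q + p * pderiv_var j q"
proof -
  have s: "pderiv_var j (single a c) = single (a - single j 1) (of_nat (lookup a j) * c)" for a c
    unfolding pderiv_var_def by simp
  have one: "pderiv_var j (single a c * single b d) =
      pderiv_var j (single a c) * single b d + single a c * pderiv_var j (single b d)" for a b c d
  proof -
    have 1: "a - single j 1 + b = a + b - single j 1" if "lookup a j \<noteq> 0"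
      using that by (intro poly_mapping_eqI) (auto simp: lookup_add lookup_minus lookup_single when_def)
    have 2: "a + (b - single j 1) = a + b - single j 1" if "lookup b j \<noteq> 0"
      using that by (intro poly_mapping_eqI) (auto simp: lookup_add lookup_minus lookup_single when_def)
    have "single (a - single j 1 + b) (of_nat (lookup a j) * c * d) =
        single (a + b - single j 1) (of_nat (lookup a j) * c * d)"
      by (cases "lookup a j = 0") (simp, simp add: 1)
    moreover have "single (a + (b - single j 1)) (c * (of_nat (lookup b j) * d)) =
        single (a + b - single j 1) (c * (of_nat (lookup b j) * d))"
      by (cases "lookup b j = 0") (simp, simp add: 2)
    ultimately show ?thesis
      unfolding s mult_single by (simp add: lookup_add single_add[symmetric] algebra_simps)
  qed
  have sum: "pderiv_var j (sum f I) = (\<Sum>i\<in>I. pderiv_var j (f i))" for f and I :: "mono set"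
    by (induction I rule: infinite_finite_induct) (simp_all add: pderiv_var_add)
  have one': "pderiv_var j (single a c * q) = pderiv_var j (single a c) * q + single a c * pderiv_var j q" for a c
  proof -
    have "pderiv_var j (single a c * q) = (\<Sum>b\<in>keys q. pderiv_var j (single a c * single b (lookup q b)))"
      by (subst sum_single_keys[of q, symmetric]) (simp only: sum_distrib_left sum)
    also have "\<dots> = pderiv_var j (single a c) * (\<Sum>b\<in>keys q. single b (lookup q b)) +
        single a c * pderiv_var j (\<Sum>b\<in>keys q. single b (lookup q b))"
      by (simp only: one sum sum.distrib sum_distrib_left)
    finally show ?thesis by (simp only: sum_single_keys)
  qed
  have "pderiv_var j (p * q) = (\<Sum>a\<in>keys p. pderiv_var j (single a (lookup p a) * q))"
    by (subst poly_expand_mult) (simp only: sum)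
  also have "\<dots> = pderiv_var j (\<Sum>a\<in>keys p. single a (lookup p a)) * q +
      (\<Sum>a\<in>keys p. single a (lookup p a)) * pderiv_var j q"
    by (simp only: one' sum sum.distrib sum_distrib_right)
  finally show ?thesis by (simp only: sum_single_keys)
qed

lemma pderiv_var_Const: "pderiv_var j (Const c) = 0"
  unfolding pderiv_var_def Const_def by simp

lemma pderiv_var_Var: "pderiv_var j (Var k) = (if j = k then 1 else 0)"
  unfolding pderiv_var_def Var_def by (simp add: lookup_single when_def)

lemma pderiv_log_coeff_other: "j \<noteq> k \<Longrightarrow> pderiv_var j (log_coeff k z q) = 0"
  unfolding log_coeff_def by (simp add: pderiv_var_Const pderiv_var_Const_mult pderiv_var_add pderiv_var_mult pderiv_var_Var)

lemma pderiv_log_coeff_same: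
  "pderiv_var k (log_coeff k z q) = (if q = 0 then 0 else if q = 1 then log_coeff k z 0 else log_coeff k z 1)"
proof -
  have "Const (1 / 2) * (Var k + Var k) = Var k"
  proof -
    have "Const (1 / 2) * (Var k + Var k) = (Const (1 / 2) + Const (1 / 2)) * Var k"
      by (simp add: algebra_simps)
    also have "Const (1 / 2) + Const (1 / 2) = 1" unfolding Const_add[symmetric] by simp
    finally show ?thesis by simp
  qed
  then show ?thesis
    unfolding log_coeff_def
    by (simp add: pderiv_var_Const pderiv_var_Const_mult pderiv_var_add pderiv_var_mult pderiv_var_Var)
qed

lemma log_coeff_rec:
  assumes "k \<noteq> 5 \<or> z < 0" "q \<le> 2"
  shows "Const (of_int z) * log_coeff k z q + pderiv_var k (log_coeff k z q) = log_coeff k (z - 1) q"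
proof -
  note r = gamma_coord_nth_rec[OF assms(1)]
  have r1: "fps_nth (gamma_coord k (z - 1)) 1 = of_int z * fps_nth (gamma_coord k z) 1 + fps_nth (gamma_coord k z) 0"
    using r(2)[of 0] by (simp add: One_nat_def)
  have r2: "fps_nth (gamma_coord k (z - 1)) 2 = of_int z * fps_nth (gamma_coord k z) 2 + fps_nth (gamma_coord k z) 1"
    using r(2)[of 1] by (simp add: numeral_2_eq_2 One_nat_def)
  consider "q = 0" | "q = 1" | "q = 2" using assms(2) by linarith
  then show ?thesis
  proof cases
    case 1
    then show ?thesis unfolding pderiv_log_coeff_same by (simp add: log_coeff_def r(1) Const_mult)
  next
    case 2
    then show ?thesis
      unfolding pderiv_log_coeff_same by (simp add: log_coeff_def r(1) r1 Const_mult Const_add algebra_simps del: One_nat_def)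
  next
    case 3
    then show ?thesis
      unfolding pderiv_log_coeff_same by (simp add: log_coeff_def r(1) r1 r2 Const_mult Const_add algebra_simps del: One_nat_def)
  qed
qed

text \<open>The coefficient of \<open>t\<^sup>e\<close> in the perturbed Gamma series at \<open>x\<^sup>z\<close>, for \<open>e\<close> with entries at most 2.\<close>

definition log_term :: "(nat \<Rightarrow> nat) \<Rightarrow> (nat \<Rightarrow> int) \<Rightarrow> cpoly" where
  "log_term e z = (\<Prod>k\<in>{1..6}. log_coeff k (z k) (e k))"

lemma log_term_rec:
  assumes j: "j \<in> {1..6}" and z: "j \<noteq> 5 \<or> z j < 0" and e: "e j \<le> 2"
  shows "Const (of_int (z j)) * log_term e z + pderiv_var j (log_term e z) = log_term e (z(j := z j - 1))"
proof -
  let ?R = "\<Prod>k\<in>{1..6} - {j}. log_coeff k (z k) (e k)"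
  have split: "log_term e y = log_coeff j (y j) (e j) * (\<Prod>k\<in>{1..6} - {j}. log_coeff k (y k) (e k))" for y
    unfolding log_term_def by (rule prod.remove[OF _ j]) simp
  have rest: "(\<Prod>k\<in>{1..6} - {j}. log_coeff k ((z(j := z j - 1)) k) (e k)) = ?R"
    by (rule prod.cong) auto
  have "pderiv_var j (\<Prod>k\<in>S. log_coeff k (z k) (e k)) = 0" if "finite S" "j \<notin> S" for S
    using that by (induction S rule: finite_induct) (auto simp: pderiv_var_mult pderiv_log_coeff_other
      pderiv_var_Const[of j 1, simplified])
  then have d: "pderiv_var j ?R = 0" by simp
  have "Const (of_int (z j)) * log_term e z + pderiv_var j (log_term e z) =
      (Const (of_int (z j)) * log_coeff j (z j) (e j) + pderiv_var j (log_coeff j (z j) (e j))) * ?R"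
    unfolding split[of z] by (simp add: pderiv_var_mult d algebra_simps)
  also have "\<dots> = log_coeff j (z j - 1) (e j) * ?R" unfolding log_coeff_rec[OF z e] ..
  also have "\<dots> = log_term e (z(j := z j - 1))"
    unfolding split[of "z(j := z j - 1)"] rest by simp
  finally show ?thesis .
qed

text \<open>The exponent of \<open>t\<^sub>i t\<^sub>j\<close>.\<close>

definition pair_exp :: "nat \<Rightarrow> nat \<Rightarrow> nat \<Rightarrow> nat" where
  "pair_exp i j k = (if k = i then 1 else 0) + (if k = j then 1 else 0)"

text \<open>The functional \<open>\<phi>\<close> applied to the perturbed Gamma series at \<open>x\<^sup>z\<close>.  Its values on the products
  \<open>t\<^sub>i t\<^sub>j\<close> with \<open>i \<le> 3\<close> are the entries of \<open>g2\<close>, \<open>g1\<close> and \<open>g3\<close>; on the others they vanish.\<close>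

definition Phi :: "(nat \<Rightarrow> int) \<Rightarrow> cpoly" where
  "Phi z = - 2 * log_term (pair_exp 1 1) z - log_term (pair_exp 2 2) z - 2 * log_term (pair_exp 3 3) z + log_term (pair_exp 1 2) z
     + log_term (pair_exp 1 4) z + log_term (pair_exp 2 3) z - log_term (pair_exp 2 5) z + log_term (pair_exp 3 6) z"

lemma Phi_rec:
  assumes j: "j \<in> {1..6}" and z: "j \<noteq> 5 \<or> z j < 0"
  shows "Const (of_int (z j)) * Phi z + pderiv_var j (Phi z) = Phi (z(j := z j - 1))"
proof -
  have t: "log_term (pair_exp i i') (z(j := z j - 1)) =
      Const (of_int (z j)) * log_term (pair_exp i i') z + pderiv_var j (log_term (pair_exp i i') z)" for i i'
    by (rule log_term_rec[of j z "pair_exp i i'", OF j z, symmetric]) (simp add: pair_exp_def)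
  have neg: "pderiv_var j (- p) = - pderiv_var j p" for p
    using pderiv_var_Const_mult[of j "-1" p] by (simp add: Const_uminus)
  have sub: "pderiv_var j (p - q) = pderiv_var j p - pderiv_var j q" for p q
    using pderiv_var_add[of j p "- q"] by (simp add: neg)
  have two: "pderiv_var j (2 * p) = 2 * pderiv_var j p" for p
    using pderiv_var_Const_mult[of j 2 p] by (simp add: Const_numeral)
  show ?thesis
    unfolding Phi_def t by (simp add: sub neg two pderiv_var_add algebra_simps)
qed

lemma log_coeff_negative: "k \<noteq> 5 \<Longrightarrow> z < 0 \<Longrightarrow> log_coeff k z 0 = 0"
  by (simp add: log_coeff_def gamma_coord_def gamma_fps_negative)

lemma log_term_zero:
  assumes "k \<in> {1..6}" "k \<noteq> 5" "z k < 0" "k \<noteq> i" "k \<noteq> j"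
  shows "log_term (pair_exp i j) z = 0"
  unfolding log_term_def
  by (rule prod_zero) (use assms log_coeff_negative[of k "z k"] in \<open>auto simp: pair_exp_def intro!: bexI[of _ k]\<close>)

text \<open>If two exponents are negative, then the Gamma series is divisible by the corresponding product
  \<open>t\<^sub>i t\<^sub>j\<close>, so this product alone can contribute in degree two.  The five products listed here do not
  occur in \<open>\<phi>\<close>.\<close>

lemma Phi_zero:
  assumes "z 3 < 0 \<and> z 4 < 0 \<or> z 2 < 0 \<and> z 6 < 0 \<or> z 2 < 0 \<and> z 4 < 0 \<or> z 1 < 0 \<and> z 6 < 0 \<or> z 1 < 0 \<and> z 3 < 0"
  shows "Phi z = 0"
proof -
  have t: "log_term (pair_exp i j) z = 0" if "k \<in> {1, 2, 3, 4, 6}" "z k < 0" "k \<noteq> i" "k \<noteq> j" for i j k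
    by (rule log_term_zero[of k]) (use that in auto)
  show ?thesis
    using assms
    by (elim disjE conjE) (simp_all add: Phi_def t[of 3] t[of 4] t[of 2] t[of 6] t[of 1])
qed

section \<open>The series is a solution\<close>

lemma weyl_act_diff_op_superset:
  assumes "finite S" "keys f \<subseteq> S"
  shows "weyl_act n v (diff_op f) g u = (\<Sum>m\<in>S. Const (lookup f m) * dmono_act n v m g u)"
proof -
  have "weyl_act n v (diff_op f) g u = (\<Sum>m\<in>keys f. Const (lookup f m) * dmono_act n v m g u)"
    unfolding diff_op_def weyl_act_sum weyl_act_single by (simp add: x_act_def)
  also have "\<dots> = (\<Sum>m\<in>S. Const (lookup f m) * dmono_act n v m g u)"
    by (rule sum.mono_neutral_left) (use assms in \<open>auto simp: in_keys_iff\<close>)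
  finally show ?thesis .
qed

lemma weyl_act_diff_op_add:
  "weyl_act n v (diff_op (f + h)) g u = weyl_act n v (diff_op f) g u + weyl_act n v (diff_op h) g u"
proof -
  let ?S = "keys f \<union> keys h"
  have "weyl_act n v (diff_op (f + h)) g u = (\<Sum>m\<in>?S. Const (lookup (f + h) m) * dmono_act n v m g u)"
    by (rule weyl_act_diff_op_superset) (use keys_add[of f h] in auto)
  then show ?thesis
    by (simp add: lookup_add Const_add distrib_right sum.distrib
        weyl_act_diff_op_superset[of ?S f] weyl_act_diff_op_superset[of ?S h])
qed

lemma weyl_act_diff_op_sum:
  "weyl_act n v (diff_op (sum f I)) g u = (\<Sum>i\<in>I. weyl_act n v (diff_op (f i)) g u)"
proof -
  have "weyl_act n v (diff_op 0) g u = 0" by (subst weyl_act_diff_op_superset[of "{}"]) auto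
  then show ?thesis
    by (induction I rule: infinite_finite_induct) (simp_all add: weyl_act_diff_op_add)
qed

lemma weyl_act_diff_op_single: "weyl_act n v (diff_op (single m c)) g u = Const c * dmono_act n v m g u"
  by (subst weyl_act_diff_op_superset[of "{m}"]) auto

lemma weyl_act_diff_op_mult:
  assumes "x \<in> polys n" "weyl_act n v (diff_op a) g = (\<lambda>_. 0)"
  shows "weyl_act n v (diff_op (x * a)) g = (\<lambda>_. 0)"
proof
  fix u
  have a: "weyl_act n v (diff_op a) g = (\<lambda>u. \<Sum>k\<in>keys a. Const (lookup a k) * dmono_act n v k g u)"
    by (rule ext) (rule weyl_act_diff_op_superset, auto)
  have "weyl_act n v (diff_op (single m c * a)) g u = 0" if m: "m \<in> monomials n" for m c
  proof -
    have "weyl_act n v (diff_op (single m c * a)) g u =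
        (\<Sum>k\<in>keys a. Const c * (Const (lookup a k) * dmono_act n v m (dmono_act n v k g) u))"
      unfolding single_mult_poly weyl_act_diff_op_sum weyl_act_diff_op_single
      by (simp add: Const_mult mult.assoc dmono_act_add_mono[OF m])
    also have "\<dots> = Const c * dmono_act n v m (weyl_act n v (diff_op a) g) u"
      unfolding a dmono_act_sum[OF m] dmono_act_Const[OF m] by (simp add: sum_distrib_left)
    also have "\<dots> = 0" unfolding assms(2) dmono_act_0[OF m] by simp
    finally show ?thesis .
  qed
  then show "weyl_act n v (diff_op (x * a)) g u = 0"
    by (subst poly_expand_mult)
       (use assms(1) in \<open>auto simp: weyl_act_diff_op_sum polys_def intro!: sum.neutral\<close>)
qed

text \<open>The exponent \<open>v + u\<close>, whose entries are integers.\<close>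

definition int_exponent :: "(nat \<Rightarrow> int) \<Rightarrow> nat \<Rightarrow> int" where
  "int_exponent u j = u j + (if j = 3 \<or> j = 5 then -1 else 0)"

lemma exponent6_int_exponent: "exponent6 j + of_int (u j) = of_int (int_exponent u j)"
  by (simp add: exponent6_def int_exponent_def)

lemma mem_nsupp_int_exponent: "j \<in> nsupp 6 (shift exponent6 u) \<longleftrightarrow> j \<in> {1..6} \<and> int_exponent u j < 0"
  unfolding mem_nsupp_shift int_exponent_def by auto

text \<open>The truncation to the index set \<open>T\<close>.  Keeping \<open>T\<close> variable lets iterated derivatives be computed: they
  translate \<open>T\<close> and leave the coefficients alone.\<close>

definition Phi_series :: "((nat \<Rightarrow> int) \<Rightarrow> bool) \<Rightarrow> log_series" where
  "Phi_series T u = (if T u then Phi (int_exponent u) else 0)"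

lemma d_act_Phi_series:
  assumes j: "j \<in> {1..6}" and T: "\<And>u. T u \<Longrightarrow> j \<noteq> 5 \<or> int_exponent u j < 0"
  shows "d_act exponent6 j (Phi_series T) = Phi_series (\<lambda>u. T (u(j := u j + 1)))"
proof
  fix u :: "nat \<Rightarrow> int"
  let ?u = "u(j := u j + 1)"
  show "d_act exponent6 j (Phi_series T) u = Phi_series (\<lambda>u. T (u(j := u j + 1))) u"
  proof (cases "T ?u")
    case True
    have z: "(int_exponent ?u)(j := int_exponent ?u j - 1) = int_exponent u"
      by (rule ext) (simp add: int_exponent_def)
    have "Const (of_int (int_exponent ?u j)) * Phi (int_exponent ?u) + pderiv_var j (Phi (int_exponent ?u)) = Phi (int_exponent u)"
      using Phi_rec[of j "int_exponent ?u"] j T[OF True] unfolding z by blast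
    moreover have "exponent6 j + of_int (u j + 1) = of_int (int_exponent ?u j)"
      using exponent6_int_exponent[of j ?u] by simp
    ultimately show ?thesis using True by (simp only: d_act_apply Phi_series_def if_True)
  qed (simp add: d_act_apply Phi_series_def)
qed

lemma dmono_act_Phi_series:
  assumes b: "b \<in> monomials 6" and T: "\<And>u. T u \<Longrightarrow> u 5 \<le> 0"
  shows "dmono_act 6 exponent6 b (Phi_series T) = Phi_series (\<lambda>u. T (\<lambda>j. u j + int (lookup b j)))"
  using b
proof (induction b rule: monomial_induct)
  case zero
  then show ?case by (simp add: dmono_act_zero)
next
  case (step b j)
  let ?T = "\<lambda>u. T (\<lambda>j. u j + int (lookup b j))"
  have "dmono_act 6 exponent6 (b + single j 1) (Phi_series T) = d_act exponent6 j (Phi_series ?T)"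
    by (simp only: dmono_act_Suc[OF step.hyps(2)] step.IH)
  also have "\<dots> = Phi_series (\<lambda>u. ?T (u(j := u j + 1)))"
  proof (rule d_act_Phi_series[OF step.hyps(2)])
    fix u assume "?T u"
    then have "u 5 + int (lookup b 5) \<le> 0" by (rule T)
    then show "j \<noteq> 5 \<or> int_exponent u j < 0" by (auto simp: int_exponent_def)
  qed
  also have "\<dots> = Phi_series (\<lambda>u. T (\<lambda>i. u i + int (lookup (b + single j 1) i)))"
  proof -
    have "(\<lambda>i. (u(j := u j + 1)) i + int (lookup b i)) = (\<lambda>i. u i + int (lookup (b + single j 1) i))" for u
      by (rule ext) (simp add: lookup_add lookup_single when_def)
    then show ?thesis by simp
  qed
  finally show ?case .
qed

definition in_family :: "(nat \<Rightarrow> int) \<Rightarrow> bool" where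
  "in_family u \<longleftrightarrow> u \<in> lattice6 \<and> nsupp 6 (shift exponent6 u) \<in> family6"

definition log_solution :: log_series where "log_solution = Phi_series in_family"

lemma in_family_5: "in_family u \<Longrightarrow> u 5 \<le> 0"
proof -
  assume "in_family u"
  then have "nsupp 6 (shift exponent6 u) \<in> family6" by (simp add: in_family_def)
  then have "5 \<in> nsupp 6 (shift exponent6 u)" unfolding family6_def by (elim insertE emptyE) simp_all
  then show "u 5 \<le> 0" by (simp add: mem_nsupp_int_exponent int_exponent_def)
qed

text \<open>Between a member of the family and a lattice point outside, the coefficient at a common lower bound of
  the exponents vanishes, because both negative supports, and thus a generator of \<open>P\<close>, are contained in
  its negative support.\<close>

lemma Phi_zero_crossing:
  assumes u: "in_family u" and u': "u' \<in> lattice6" "\<not> in_family u'"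
    and le: "\<And>j. z j \<le> int_exponent u j" "\<And>j. z j \<le> int_exponent u' j"
  shows "Phi z = 0"
proof -
  let ?I = "nsupp 6 (shift exponent6 u)" and ?J = "nsupp 6 (shift exponent6 u')"
  have "?I \<in> family6" "?J \<in> nsupps 6 lattice6 exponent6" "?J \<notin> family6"
    using u u' by (auto simp: in_family_def nsupps_def)
  then have "(?I \<union> ?J) - \<Inter>family6 \<in> P_sets 6 lattice6 exponent6 family6"
    unfolding P_sets_def by blast
  then obtain Y where Y: "Y \<in> min_P" "Y \<subseteq> (?I \<union> ?J) - \<Inter>family6"
    using P_sets_above[OF order_refl family6_subset_distinguished] by blast
  have neg: "z j < 0" if "j \<in> Y" for j
  proof -
    have "int_exponent u j < 0 \<or> int_exponent u' j < 0" using that Y(2) mem_nsupp_int_exponent by blast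
    then show ?thesis using le[of j] by linarith
  qed
  have "Y = {3, 4} \<or> Y = {2, 6} \<or> Y = {2, 4} \<or> Y = {1, 6} \<or> Y = {1, 3}"
    using Y(1) by (simp add: min_P_def)
  then show ?thesis
    using neg by (intro Phi_zero) auto
qed

text \<open>If both of the shifted exponents lie in the family, then both monomials of the binomial give the same
  coefficient, \<open>Phi\<close> at the lower exponent.  If exactly one does, then this coefficient vanishes.\<close>

lemma binom_annihilates:
  assumes m: "m \<in> lattice6"
  shows "weyl_act 6 exponent6 (diff_op (binom 6 m)) log_solution = (\<lambda>_. 0)"
proof
  fix u
  let ?p = "pos_part 6 m" and ?n = "neg_part 6 m"
  let ?up = "\<lambda>j. u j + int (lookup ?p j)" and ?un = "\<lambda>j. u j + int (lookup ?n j)"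
  have act: "dmono_act 6 exponent6 ?p log_solution u = Phi_series (\<lambda>u. in_family (\<lambda>j. u j + int (lookup ?p j))) u"
    "dmono_act 6 exponent6 ?n log_solution u = Phi_series (\<lambda>u. in_family (\<lambda>j. u j + int (lookup ?n j))) u"
    unfolding log_solution_def
    by (simp_all only: dmono_act_Phi_series[of "pos_part 6 m" in_family, OF pos_part_monomials]
        dmono_act_Phi_series[of "neg_part 6 m" in_family, OF neg_part_monomials] in_family_5)
  have d: "?up = (\<lambda>j. ?un j - (0 - m j))" "?un = (\<lambda>j. ?up j - m j)"
    using m by (auto simp: fun_eq_iff lookup_pos_part lookup_neg_part toric_lattice_def)
  have mm: "(\<lambda>j. 0 - m j) \<in> lattice6" by (rule toric_lattice_diff[OF toric_lattice_0 m])
  have lat: "?un \<in> lattice6" if "?up \<in> lattice6" by (subst d(2)) (rule toric_lattice_diff[OF that m])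
  have lat': "?up \<in> lattice6" if "?un \<in> lattice6" by (subst d(1)) (rule toric_lattice_diff[OF that mm])
  have le: "int_exponent u j \<le> int_exponent ?up j" "int_exponent u j \<le> int_exponent ?un j" for j
    by (simp_all add: int_exponent_def)
  have "Phi (int_exponent u) = 0" if "in_family ?up \<noteq> in_family ?un"
  proof (cases "in_family ?up")
    case True
    then have "?un \<in> lattice6" using lat by (simp add: in_family_def)
    then show ?thesis using Phi_zero_crossing[OF True _ _ le] that True by simp
  next
    case False
    then have t: "in_family ?un" using that by simp
    then have "?up \<in> lattice6" using lat' by (simp add: in_family_def)
    then show ?thesis using Phi_zero_crossing[OF t _ False le(2,1)] by simp
  qed
  then have "dmono_act 6 exponent6 ?p log_solution u = dmono_act 6 exponent6 ?n log_solution u"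
    unfolding act Phi_series_def by auto
  moreover have "binom 6 m = single ?p 1 + single ?n (- 1)"
    by (simp add: binom_def single_uminus)
  ultimately show "weyl_act 6 exponent6 (diff_op (binom 6 m)) log_solution u = 0"
    by (simp add: weyl_act_diff_op_add weyl_act_diff_op_single Const_uminus)
qed

lemma toric_annihilates:
  assumes "f \<in> toric_ideal 6 3 veronese"
  shows "weyl_act 6 exponent6 (diff_op f) log_solution = (\<lambda>_. 0)"
proof -
  have "toric_ideal 6 3 veronese \<subseteq> {f \<in> polys 6. weyl_act 6 exponent6 (diff_op f) log_solution = (\<lambda>_. 0)}"
    (is "_ \<subseteq> ?T")
    unfolding toric_ideal_def
  proof (rule genideal_least[OF toric_gens_polys])
    show "binom 6 ` lattice6 \<subseteq> ?T" by (auto simp: binom_polys binom_annihilates)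
    show "0 \<in> ?T"
      by (simp add: polys_0 fun_eq_iff weyl_act_diff_op_superset[of "{}" 0])
    show "a + b \<in> ?T" if "a \<in> ?T" "b \<in> ?T" for a b
      using that by (simp add: polys_add fun_eq_iff weyl_act_diff_op_add)
    show "x * a \<in> ?T" if "a \<in> ?T" "x \<in> polys 6" for a x
      using that by (simp add: polys_mult weyl_act_diff_op_mult)
  qed auto
  then show ?thesis using assms by blast
qed

lemma pderiv_log_term:
  assumes j: "j \<in> {1..6}" and e: "e j \<le> 2"
  shows "pderiv_var j (log_term e z) = (if e j = 0 then 0 else log_term (e(j := e j - 1)) z)"
proof -
  let ?R = "\<Prod>k\<in>{1..6} - {j}. log_coeff k (z k) (e k)"
  have split: "log_term e z = log_coeff j (z j) (e j) * (\<Prod>k\<in>{1..6} - {j}. log_coeff k (z k) (e k))" for e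
    unfolding log_term_def by (rule prod.remove[OF _ j]) simp
  have rest: "(\<Prod>k\<in>{1..6} - {j}. log_coeff k (z k) ((e(j := e j - 1)) k)) = ?R"
    by (rule prod.cong) auto
  have "pderiv_var j (\<Prod>k\<in>S. log_coeff k (z k) (e k)) = 0" if "finite S" "j \<notin> S" for S
    using that by (induction S rule: finite_induct) (auto simp: pderiv_var_mult pderiv_log_coeff_other
      pderiv_var_Const[of j 1, simplified])
  then have "pderiv_var j ?R = 0" by simp
  then have "pderiv_var j (log_term e z) = pderiv_var j (log_coeff j (z j) (e j)) * ?R"
    by (simp add: split[of e] pderiv_var_mult)
  moreover have "log_term (e(j := e j - 1)) z = log_coeff j (z j) (e j - 1) * ?R"
    unfolding split[of "e(j := e j - 1)"] rest by simp
  moreover have "e j = 0 \<or> e j = 1 \<or> e j = 2" using e by linarith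
  ultimately show ?thesis by (elim disjE) (simp_all add: pderiv_log_coeff_same numeral_2_eq_2 One_nat_def)
qed

text \<open>The exponent of \<open>t\<^sub>i\<close>.\<close>

definition unit_exp :: "nat \<Rightarrow> nat \<Rightarrow> nat" where "unit_exp i k = (if k = i then 1 else 0)"

lemma pderiv_log_term_pair:
  assumes j: "j \<in> {1..6}"
  shows "pderiv_var j (log_term (pair_exp i i') z) =
    (if j = i then log_term (unit_exp i') z else if j = i' then log_term (unit_exp i) z else 0)"
proof -
  have "(pair_exp i i')(j := pair_exp i i' j - 1) = unit_exp i'" if "j = i"
    using that by (auto simp: fun_eq_iff pair_exp_def unit_exp_def)
  moreover have "(pair_exp i i')(j := pair_exp i i' j - 1) = unit_exp i" if "j = i'" "j \<noteq> i"
    using that by (auto simp: fun_eq_iff pair_exp_def unit_exp_def)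
  ultimately show ?thesis
    using pderiv_log_term[OF j, of "pair_exp i i'" z] by (auto simp: pair_exp_def)
qed

text \<open>Differentiation by \<open>y\<^sub>j\<close> multiplies the exponential by \<open>t\<^sub>j\<close>, so it contracts \<open>\<phi>\<close> with \<open>t\<^sub>j\<close>.\<close>

lemma pderiv_Phi:
  "pderiv_var 1 (Phi z) = - 2 * log_term (unit_exp 1) z + log_term (unit_exp 2) z + log_term (unit_exp 4) z"
  "pderiv_var 2 (Phi z) = log_term (unit_exp 1) z - log_term (unit_exp 2) z + log_term (unit_exp 3) z - log_term (unit_exp 5) z"
  "pderiv_var 3 (Phi z) = log_term (unit_exp 2) z - 2 * log_term (unit_exp 3) z + log_term (unit_exp 6) z"
  "pderiv_var 4 (Phi z) = log_term (unit_exp 1) z"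
  "pderiv_var 5 (Phi z) = - log_term (unit_exp 2) z"
  "pderiv_var 6 (Phi z) = log_term (unit_exp 3) z"
proof -
  have neg: "pderiv_var j (- p) = - pderiv_var j p" for p j
    using pderiv_var_Const_mult[of j "-1" p] by (simp add: Const_uminus)
  have sub: "pderiv_var j (p - q) = pderiv_var j p - pderiv_var j q" for p q j
    using pderiv_var_add[of j p "- q"] by (simp add: neg)
  have two: "pderiv_var j (2 * p) = 2 * pderiv_var j p" for p j
    using pderiv_var_Const_mult[of j 2 p] by (simp add: Const_numeral)
  note s = Phi_def sub neg two pderiv_var_add pderiv_log_term_pair
  show "pderiv_var 1 (Phi z) = - 2 * log_term (unit_exp 1) z + log_term (unit_exp 2) z + log_term (unit_exp 4) z"
    "pderiv_var 2 (Phi z) = log_term (unit_exp 1) z - log_term (unit_exp 2) z + log_term (unit_exp 3) z - log_term (unit_exp 5) z"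
    "pderiv_var 3 (Phi z) = log_term (unit_exp 2) z - 2 * log_term (unit_exp 3) z + log_term (unit_exp 6) z"
    "pderiv_var 4 (Phi z) = log_term (unit_exp 1) z"
    "pderiv_var 5 (Phi z) = - log_term (unit_exp 2) z"
    "pderiv_var 6 (Phi z) = log_term (unit_exp 3) z"
    by (simp_all add: s)
qed

text \<open>If one of \<open>z\<^sub>1\<close>, \<open>z\<^sub>2\<close>, \<open>z\<^sub>3\<close> is negative, then the Gamma series at \<open>x\<^sup>z\<close> lies in \<open>M\<close>, so only the
  terms \<open>t\<^sub>1\<close>, \<open>t\<^sub>2\<close>, \<open>t\<^sub>3\<close> remain in the derivatives.  Their coefficients vanish because \<open>\<phi>\<close> kills \<open>U M\<close>.\<close>

lemma Phi_euler:
  assumes z: "z 1 < 0 \<or> z 2 < 0 \<or> z 3 < 0" and i: "i \<in> {1, 2, 3}"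
  shows "(\<Sum>j=1..6. Const (of_int (veronese i j)) * pderiv_var j (Phi z)) = 0"
proof -
  have t: "log_term (unit_exp i) z = 0" if i: "i \<in> {4, 5, 6}" for i
  proof -
    obtain k where k: "k \<in> {1, 2, 3}" "z k < 0" using z by blast
    have "unit_exp i k = 0" using i k(1) by (auto simp: unit_exp_def)
    then have "log_coeff k (z k) (unit_exp i k) = 0" using log_coeff_negative[of k "z k"] k by auto
    moreover have "k \<in> {1..6}" using k(1) by auto
    ultimately show ?thesis unfolding log_term_def by (intro prod_zero) auto
  qed
  have "log_term (unit_exp 4) z = 0" "log_term (unit_exp 5) z = 0" "log_term (unit_exp 6) z = 0"
    using t by simp_all
  then show ?thesis
    using i by (elim insertE emptyE) (simp_all add: sum_6 veronese_values pderiv_Phi Const_numeral algebra_simps)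
qed

lemma euler_act:
  "weyl_act 6 exponent6 (euler_op 6 A \<beta> i) f u =
     (\<Sum>j=1..6. Const (of_int (A i j)) * (Const (exponent6 j + of_int (u j)) * f u + pderiv_var j (f u)))
     - Const (\<beta> i) * f u"
proof -
  have e: "euler_op 6 A \<beta> i = (\<Sum>j=1..6. single (single j 1, single j 1) (of_int (A i j))) + single (0, 0) (- \<beta> i)"
    by (simp add: euler_op_def single_uminus)
  have "x_act (single j 1) (dmono_act 6 exponent6 (single j 1) f) u =
      Const (exponent6 j + of_int (u j)) * f u + pderiv_var j (f u)" if "j \<in> {1..6}" for j
  proof -
    have d: "dmono_act 6 exponent6 (single j 1) f = d_act exponent6 j f"
      using dmono_act_Suc[OF that, of exponent6 0 f] by (simp add: dmono_act_zero)
    let ?u = "\<lambda>i. u i - int (lookup (single j 1) i)"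
    have "?u(j := ?u j + 1) = u" by (rule ext) (simp add: lookup_single when_def)
    moreover have "?u j + 1 = u j" by simp
    ultimately show ?thesis unfolding d x_act_def d_act_apply by simp
  qed
  then have "(\<Sum>j=1..6. weyl_act 6 exponent6 (single (single j 1, single j 1) (of_int (A i j))) f u) =
      (\<Sum>j=1..6. Const (of_int (A i j)) * (Const (exponent6 j + of_int (u j)) * f u + pderiv_var j (f u)))"
    by (intro sum.cong refl) (simp add: weyl_act_single)
  moreover have "weyl_act 6 exponent6 (single (0, 0) (- \<beta> i)) f u = - Const (\<beta> i) * f u"
    by (simp add: weyl_act_single x_act_def dmono_act_zero Const_uminus)
  ultimately show ?thesis unfolding e weyl_act_add weyl_act_sum by simp
qed

lemma euler_annihilates:
  assumes i: "i \<in> {1..3}"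
  shows "weyl_act 6 exponent6 (euler_op 6 veronese beta6 i) log_solution = (\<lambda>_. 0)"
proof
  fix u
  show "weyl_act 6 exponent6 (euler_op 6 veronese beta6 i) log_solution u = 0"
  proof (cases "in_family u")
    case False
    then show ?thesis unfolding euler_act by (simp add: log_solution_def Phi_series_def)
  next
    case True
    let ?f = "Phi (int_exponent u)"
    have f: "log_solution u = ?f" using True by (simp add: log_solution_def Phi_series_def)
    have "nsupp 6 (shift exponent6 u) \<in> family6" using True by (simp add: in_family_def)
    then have "1 \<in> nsupp 6 (shift exponent6 u) \<or> 2 \<in> nsupp 6 (shift exponent6 u) \<or> 3 \<in> nsupp 6 (shift exponent6 u)"
      unfolding family6_def by (elim insertE emptyE) simp_all
    then have z: "int_exponent u 1 < 0 \<or> int_exponent u 2 < 0 \<or> int_exponent u 3 < 0"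
      unfolding mem_nsupp_int_exponent by blast
    have i3: "i \<in> {1, 2, 3}" using i unfolding atLeastAtMost_3 .
    have "(\<Sum>j=1..6. veronese i j * u j) = 0"
      using True i by (simp add: in_family_def toric_lattice_def)
    then have "(of_int (\<Sum>j=1..6. veronese i j * u j) :: complex) = 0" by (simp only: of_int_0)
    then have L: "(\<Sum>j=1..6. of_int (veronese i j) * (exponent6 j + of_int (u j))) = beta6 i"
      by (simp add: beta6_def distrib_left sum.distrib)
    have "(\<Sum>j=1..6. Const (of_int (veronese i j)) * (Const (exponent6 j + of_int (u j)) * ?f + pderiv_var j ?f)) =
        Const (\<Sum>j=1..6. of_int (veronese i j) * (exponent6 j + of_int (u j))) * ?f
        + (\<Sum>j=1..6. Const (of_int (veronese i j)) * pderiv_var j ?f)"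
    proof -
      have c: "Const (sum g S) = (\<Sum>j\<in>S. Const (g j))" for g and S :: "nat set"
        by (induction S rule: infinite_finite_induct) (simp_all add: Const_add)
      show ?thesis
        unfolding c by (simp add: distrib_left[of "Const _"] sum.distrib sum_distrib_right Const_mult mult.assoc)
    qed
    then show ?thesis unfolding euler_act f L Phi_euler[OF z i3] by simp
  qed
qed

lemma hypergeometric_annihilates:
  assumes "P \<in> hypergeometric_ideal 6 3 veronese beta6"
  shows "weyl_act 6 exponent6 P log_solution = (\<lambda>_. 0)"
  using assms unfolding hypergeometric_ideal_def
  by (rule left_ideal_annihilates[rotated]) (auto simp: toric_annihilates euler_annihilates)

lemma log_coeff_polys: "k \<in> {1..6} \<Longrightarrow> log_coeff k z q \<in> polys 6"
  unfolding log_coeff_def by (auto intro!: polys_add polys_mult polys_Const polys_Var)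

lemma Phi_polys: "Phi z \<in> polys 6"
proof -
  have t: "log_term e z \<in> polys 6" for e unfolding log_term_def by (intro polys_prod log_coeff_polys)
  show ?thesis
    unfolding Phi_def by (intro polys_add polys_diff polys_mult t polys_uminus numeral_polys)
qed

lemma log_solution_0: "log_solution (\<lambda>_. 0) = Var 2 - 2 * Var 3 + Var 6"
proof -
  let ?z = "int_exponent (\<lambda>_. 0)"
  have in0: "in_family (\<lambda>_. 0)"
  proof -
    have "shift exponent6 (\<lambda>_. 0) = exponent6" by (rule ext) (simp add: shift_def)
    then show ?thesis by (simp add: in_family_def toric_lattice_0 supp_0 family6_def)
  qed
  have z: "?z k = (if k = 3 \<or> k = 5 then -1 else 0)" for k by (simp add: int_exponent_def)
  have g: "gamma_coord k (?z k) = (if k = 3 then fps_X else 1)" for k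
    by (simp add: gamma_coord_def z gamma_reduced_def gamma_fps_def One_nat_def)
  have l: "log_coeff k (?z k) 0 = (if k = 3 then 0 else 1)" "log_coeff k (?z k) 1 = (if k = 3 then 1 else Var k)"
    "log_coeff 3 (?z 3) 2 = Var 3" for k
    by (simp_all add: log_coeff_def g fps_X_nth)
  have t0: "log_term (pair_exp i j) ?z = 0" if "i \<noteq> 3" "j \<noteq> 3" for i j
    by (rule log_term_zero[of 3]) (use that z in auto)
  have p6: "(\<Prod>k=1..6. h k) = h 1 * h 2 * h 3 * h 4 * h 5 * h 6" for h :: "nat \<Rightarrow> cpoly"
    unfolding atLeastAtMost_6 by (simp add: mult.assoc)
  have "log_term (pair_exp 3 3) ?z = Var 3" "log_term (pair_exp 2 3) ?z = Var 2" "log_term (pair_exp 3 6) ?z = Var 6"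
    unfolding log_term_def p6 by (simp_all add: pair_exp_def l)
  then have "Phi ?z = Var 2 - 2 * Var 3 + Var 6"
    unfolding Phi_def by (simp add: t0)
  then show ?thesis using in0 by (simp add: log_solution_def Phi_series_def)
qed

lemma log_solution_ambient:
  "Var 2 - 2 * Var 3 + Var 6 \<in> ambient_space 6 3 veronese beta6 exponent6 family6"
  unfolding ambient_space_def
proof (rule CollectI, rule exI[of _ log_solution], intro conjI allI ballI impI)
  show "Var 2 - 2 * Var 3 + Var 6 = log_solution (\<lambda>_. 0)" by (simp only: log_solution_0)
  fix u
  show "log_solution u \<in> polys 6" by (simp add: log_solution_def Phi_series_def Phi_polys polys_0)
  show "u \<in> lattice6" "nsupp 6 (shift exponent6 u) \<in> family6" if "log_solution u \<noteq> 0"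
    using that by (auto simp: log_solution_def Phi_series_def in_family_def split: if_splits)
qed (rule hypergeometric_annihilates)

lemma lookup_log_form: "lookup (Var 2 - 2 * Var 3 + Var 6) m =
    (if m = single 2 1 then 1 else 0) - 2 * (if m = single 3 1 then 1 else 0) + (if m = single 6 1 then 1 else 0)"
  using lookup_Const_mult[of 2 "Var 3" m]
  by (simp add: lookup_add lookup_minus Var_def lookup_single when_def Const_numeral eq_commute)

lemma leading_form_log: "leading_form (Var 2 - 2 * Var 3 + Var 6) = Var 2 - 2 * Var 3 + Var 6"
proof (rule poly_mapping_eqI)
  fix m
  have d: "mono_deg m = 1" if "m \<in> keys (Var 2 - 2 * Var 3 + Var 6)" for m
    using that unfolding in_keys_iff lookup_log_form by (auto split: if_splits)
  show "lookup (leading_form (Var 2 - 2 * Var 3 + Var 6)) m = lookup (Var 2 - 2 * Var 3 + Var 6) m"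
  proof (cases "m \<in> keys (Var 2 - 2 * Var 3 + Var 6)")
    case True
    then show ?thesis unfolding leading_form_def lookup_init_form by (simp add: d)
  next
    case False
    then show ?thesis unfolding leading_form_def lookup_init_form by (simp add: in_keys_iff)
  qed
qed

section \<open>The intrinsic coefficient space\<close>

lemma mfps_mult_one: "mfps_mult f (lookup 1) = f" for f :: "mono \<Rightarrow> complex"
proof
  fix m :: mono
  have fin: "finite {(a, b). a + b = m}"
  proof (rule finite_subset)
    show "{(a, b). a + b = m} \<subseteq> {k. mono_dvd k m} \<times> {k. mono_dvd k m}"
      by (auto simp: mono_dvd_def lookup_add)
  qed (simp add: finite_mono_dvd)
  have "mfps_mult f (lookup 1) m = (\<Sum>(a, b)\<in>{(m, 0 :: mono)}. f a * lookup 1 b)"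
    unfolding mfps_mult_def by (rule sum.mono_neutral_right) (auto simp: fin lookup_one when_def split: if_splits)
  then show "mfps_mult f (lookup 1) m = f m" by simp
qed

definition homog :: "nat \<Rightarrow> cpoly \<Rightarrow> bool" where
  "homog d f \<longleftrightarrow> (\<forall>m\<in>keys f. mono_deg m = d)"

lemma homog_mult: "homog d f \<Longrightarrow> homog e g \<Longrightarrow> homog (d + e) (f * g)"
  unfolding homog_def
proof
  fix m assume h: "\<forall>m\<in>keys f. mono_deg m = d" "\<forall>m\<in>keys g. mono_deg m = e" "m \<in> keys (f * g)"
  obtain a b where "m = a + b" "a \<in> keys f" "b \<in> keys g" using keys_mult[of f g] h(3) by blast
  then show "mono_deg m = d + e" using h by (simp add: mono_deg_add)
qed

lemma homog_1: "homog 0 1" by (simp add: homog_def)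
lemma homog_Const: "homog 0 (Const c)" by (simp add: homog_def Const_def)

lemma homog_power: "homog d f \<Longrightarrow> homog (k * d) (f ^ k)"
  by (induction k) (simp_all add: homog_1 homog_mult)

lemma homog_prod: "(\<And>i. i \<in> I \<Longrightarrow> homog (d i) (f i)) \<Longrightarrow> finite I \<Longrightarrow> homog (\<Sum>i\<in>I. d i) (\<Prod>i\<in>I. f i)"
  by (induction I rule: infinite_finite_induct) (simp_all add: homog_1 homog_mult)

lemma homog_sum: "(\<And>i. i \<in> I \<Longrightarrow> homog d (f i)) \<Longrightarrow> homog d (\<Sum>i\<in>I. f i)"
proof (induction I rule: infinite_finite_induct)
  case (insert i I)
  then show ?case using keys_add[of "f i" "sum f I"] unfolding homog_def by auto
qed (simp_all add: homog_def)

context basis_matrix6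
begin

text \<open>The part of \<open>x\<^bsup>Bs\<^esup>\<close> that is linear in \<open>log x\<close> is \<open>\<Sum>\<^sub>j \<ell>\<^sub>j log x\<^sub>j\<close>.\<close>

lemma log_coefficient_xBs: "lookup (xBs_series 6 3 B b) (single 6 1) = lookup (l 6) b"
proof (cases "b \<in> monomials 3 \<and> mono_deg b = 1")
  case True
  then have b3: "b \<in> monomials 3" and d: "mono_deg b = 1" by auto
  have "b \<noteq> 0" using d by auto
  then obtain k q where k: "k \<in> {1..3}" "q \<in> monomials 3" "b = single k 1 + q"
    using monomial_split[OF b3] by blast
  then have "q = 0" using d by (simp add: mono_deg_add mono_deg_eq_0)
  then have b: "b = single k 1" using k(3) by simp
  let ?L = "\<lambda>k. \<Sum>j=1..6. Const (of_int (B j k)) * Var j"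
  have "xBs_series 6 3 B b = (\<Prod>k'=1..3. if k' = k then ?L k else 1)"
    unfolding xBs_series_def if_P[OF b3]
    by (intro prod.cong refl) (simp add: b lookup_single when_def Const_1)
  also have "\<dots> = ?L k" using k(1) by simp
  finally have "lookup (xBs_series 6 3 B b) (single 6 1) =
      (\<Sum>j=1..6. of_int (B j k) * lookup (Var j) (single 6 1))"
    by (simp add: lookup_sum lookup_Const_mult)
  also have "\<dots> = (\<Sum>j::nat=1..6. if j = 6 then of_int (B 6 k) else 0)"
  proof (intro sum.cong refl)
    fix j
    have "lookup (Var j) (single 6 1) = (if j = 6 then 1 else 0)"
    proof (cases "j = 6")
      case False
      have "single j 1 \<noteq> single 6 (1::nat)"
      proof
        assume "single j 1 = single 6 (1::nat)"
        then have "lookup (single j (1::nat)) 6 = lookup (single 6 1) 6" by simp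
        then show False using False by (simp add: lookup_single when_def)
      qed
      then show ?thesis using False by (simp add: Var_def lookup_single when_def)
    qed (simp add: Var_def)
    then show "of_int (B j k) * lookup (Var j) (single 6 1) = (if j = 6 then of_int (B 6 k) else (0::complex))"
      by simp
  qed
  also have "\<dots> = of_int (B 6 k)" by simp
  finally show ?thesis unfolding b lookup_l_single[OF k(1)] .
next
  case False
  have "b \<notin> keys (l 6)" using False l_deg[of b 6] l_polys[of 6] by (auto simp: polys_def)
  then have r: "lookup (l 6) b = 0" by (simp add: in_keys_iff)
  have "lookup (xBs_series 6 3 B b) (single 6 1) = 0"
  proof (cases "b \<in> monomials 3")
    case True
    have V: "homog 1 (Var j)" for j by (simp add: homog_def Var_def)
    have L: "homog 1 (\<Sum>j=1..6. Const (of_int (B j k)) * Var j)" for k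
      by (rule homog_sum) (use homog_mult[OF homog_Const V] in simp)
    have "homog (\<Sum>k=1..3. 0 + lookup b k * 1) (xBs_series 6 3 B b)"
      unfolding xBs_series_def using True
      by (simp only: if_True) (intro homog_prod homog_mult homog_Const homog_power L finite_atLeastAtMost)
    moreover have "(\<Sum>k=1..3. lookup b k) = mono_deg b"
      by (rule mono_deg_superset[symmetric]) (use True in \<open>auto simp: monomials_def\<close>)
    ultimately have "homog (mono_deg b) (xBs_series 6 3 B b)" by simp
    then have "single 6 1 \<notin> keys (xBs_series 6 3 B b)" using False True by (auto simp: homog_def)
    then show ?thesis by (simp add: in_keys_iff)
  qed (simp add: xBs_series_def)
  then show ?thesis using r by simp
qed

lemma falling_zero: "falling n z (\<lambda>_. 0) = 1"
  by (simp add: falling_def)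

lemma a_series_0: "a_series 6 3 B exponent6 {3} (\<lambda>_. 0) = lookup (l 3)"
proof -
  have p: "lookup (pos_part 6 (\<lambda>_. 0)) = (\<lambda>_. 0)" "lookup (neg_part 6 (\<lambda>_. 0)) = (\<lambda>_. 0)"
    by (rule ext, simp add: lookup_pos_part lookup_neg_part)+
  show ?thesis
    unfolding a_series_def p falling_zero mfps_mult_one ell_prod_single mult_1_right
    by (rule the_equality) (auto intro: lookup_polys_carrier l_polys)
qed

text \<open>The coefficient of \<open>log x\<^sub>6\<close> in the intrinsic series at \<open>x\<^sup>v\<close> is the pairing of \<open>q\<close> with \<open>\<ell>\<^sub>3\<ell>\<^sub>6\<close>,
  an element of \<open>H\<close>, whereas it is 1 in the logarithmic form at hand.\<close>

lemma log_form_not_intrinsic: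
  "Var 2 - 2 * Var 3 + Var 6 \<notin> intrinsic_space 6 lattice6 3 B exponent6 family6"
proof
  assume "Var 2 - 2 * Var 3 + Var 6 \<in> intrinsic_space 6 lattice6 3 B exponent6 family6"
  then obtain q where q: "q \<in> perp 3 H"
    and eq: "Var 2 - 2 * Var 3 + Var 6 = intrinsic_series 6 lattice6 3 B exponent6 family6 q (\<lambda>_. 0)"
    unfolding intrinsic_space_def by blast
  have "shift exponent6 (\<lambda>_. 0) = exponent6" by (rule ext) (simp add: shift_def)
  then have n: "(\<lambda>_. 0) \<in> lattice6 \<and> nsupp 6 (shift exponent6 (\<lambda>_. 0)) \<in> family6"
    by (simp add: toric_lattice_0 supp_0 family6_def)
  have c: "lookup (mfps_mult (\<lambda>k. Const (lookup (l 3) k)) (xBs_series 6 3 B) m) (single 6 1) = lookup (l 3 * l 6) m" for m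
  proof -
    have "lookup (mfps_mult (\<lambda>k. Const (lookup (l 3) k)) (xBs_series 6 3 B) m) (single 6 1) =
        (\<Sum>(a, b)\<in>{(a, b). a + b = m}. lookup (l 3) a * lookup (l 6) b)"
      unfolding mfps_mult_def lookup_sum
      by (intro sum.cong refl) (auto simp: lookup_Const_mult log_coefficient_xBs)
    then show ?thesis unfolding mfps_mult_lookup[symmetric] mfps_mult_def .
  qed
  have "l 3 * l 6 \<in> H" using l6_l3_in_H by (simp add: mult.commute)
  then have "(\<Sum>m\<in>keys q. lookup q m * mono_fact m * lookup (l 3 * l 6) m) = 0"
    using q by (simp add: perp_def)
  moreover have "lookup (intrinsic_series 6 lattice6 3 B exponent6 family6 q (\<lambda>_. 0)) (single 6 1) =
      (\<Sum>m\<in>keys q. lookup q m * mono_fact m * lookup (l 3 * l 6) m)"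
    unfolding intrinsic_series_def e_set6 a_series_0 using n
    by (simp add: lookup_sum lookup_Const_mult c)
  moreover have "lookup (Var 2 - 2 * Var 3 + Var 6) (single 6 1) = 1"
  proof -
    have "(single 6 1 :: mono) \<noteq> single 2 1" "(single 6 1 :: mono) \<noteq> single 3 1"
      by (auto dest!: arg_cong[where f = "\<lambda>m. lookup m 6"] simp: lookup_single when_def)
    then show ?thesis unfolding lookup_log_form by simp
  qed
  ultimately show False unfolding eq by simp
qed

end

theorem theorem5p7:
  shows "\<exists>(n::nat) (d::nat) (A::nat \<Rightarrow> nat \<Rightarrow> int) (\<beta>::nat \<Rightarrow> complex) (w::nat \<Rightarrow> real)
      (v::nat \<Rightarrow> complex) (N::nat set set) (G::cpoly set).
    let L = toric_lattice n d A; Nv = distinguished_nsupps n L w v;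
        C = groebner_semigroup n L G
    in
      column_rank d A {1..n} = d \<and> homogeneous_matrix n d A \<and> n = d + 3 \<and>
      generic_direction n d A \<beta> w \<and>
      is_reduced_groebner_basis n w (toric_ideal n d A) G \<and>
      fake_exponent n d A \<beta> w v \<and>
      negative_support_family n L w v N \<and> ordered_family n L v N \<and>
      matroid_connected {1..n} (column_rank d A) 3 \<and>
      (\<exists>S. is_Z_basis L S \<and> C = nat_span S) \<and>
      normal_semigroup C \<and> free_semigroup C \<and> unimodular_cone L (real_cone C) \<and>
      is_polynomial_ring_quotient n (sr_ideal n N) \<and>
      (\<forall>B. is_basis_matrix L 3 B \<longrightarrow> obstruction_hilb n L 3 B v N = fps_X) \<and>
      (\<forall>j\<in>{1..n}. v j \<in> {-1, 0}) \<and>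
      (\<forall>u\<in>L. u \<noteq> (\<lambda>_. 0) \<longrightarrow> (\<Sum>j=1..n. w j * of_int (u j)) \<noteq> 0) \<and>
      \<not> ordered_family n L v Nv \<and>
      M_ideal n Nv = M_ideal n N \<and> P_ideal n L v Nv = P_ideal n L v N \<and>
      e_monomial n v Nv = e_monomial n v N \<and>
      obstruction_module n d A v Nv = obstruction_module n d A v N \<and>
      (\<exists>p \<in> ambient_space n d A \<beta> v N.
         leading_form p = Var 2 - 2 * Var 3 + Var 6 \<and>
         (\<forall>B. is_basis_matrix L 3 B \<longrightarrow> p \<notin> intrinsic_space n L 3 B v N))"
proof -
  have basis: "\<exists>S. is_Z_basis lattice6 S \<and> orthant = nat_span S"
    using lattice6_basis nat_span_basis by metis
  have hilb: "\<forall>B. is_basis_matrix lattice6 3 B \<longrightarrow>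
      obstruction_hilb 6 lattice6 3 B exponent6 family6 = fps_X"
    using basis_matrix6.obstruction_hilb6 basis_matrix6.intro by blast
  have binary: "\<forall>j\<in>{1..6}. exponent6 j \<in> {-1, 0}" by (simp add: exponent6_def)
  have log_form: "\<exists>p \<in> ambient_space 6 3 veronese beta6 exponent6 family6.
         leading_form p = Var 2 - 2 * Var 3 + Var 6 \<and>
         (\<forall>B. is_basis_matrix lattice6 3 B \<longrightarrow> p \<notin> intrinsic_space 6 lattice6 3 B exponent6 family6)"
    using log_solution_ambient leading_form_log basis_matrix6.log_form_not_intrinsic basis_matrix6.intro
    by blast
  show ?thesis
    unfolding Let_def
    by (rule exI[of _ 6], rule exI[of _ 3], rule exI[of _ veronese], rule exI[of _ beta6],
        rule exI[of _ weight6], rule exI[of _ exponent6], rule exI[of _ family6], rule exI[of _ gb6],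
        unfold groebner_semigroup6,
        intro conjI ballI impI veronese_rank homogeneous_veronese generic_direction6 gb6_reduced
          fake_exponent6 family6_negative_support family6_ordered veronese_three_connected
          basis hilb log_form orthant_normal orthant_free orthant_unimodular sr_ring6 weight6_nonzero
          distinguished6_not_ordered ideals_distinguished6 e_monomial_distinguished6
          obstruction_module_distinguished6)
       (use binary in auto)
qed

end
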